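(* Let $\omega\in S^2$ be regular with respect to $D$. Assume that $D$ has a conical singularity from direction $\omega$, with $D\cap\{x\in\mathbb R^3: h_D(\omega)-\delta<x\cdot\omega<h_D(\omega)\}=D_{(p(\omega),\omega)}(\delta,Q)$, that $F_{\rho,D}$ is active at $p(\omega)$, and that the direction $\vartheta\in S(\omega)$ satisfies $C_{(p(\omega),\omega)}(\delta,Q,\vartheta)\neq0$. Then there exists $\tau_0>0$ such that $|I_{\omega,\vartheta}(\tau)|>0$ for all $\tau\ge\tau_0$, and the following three formulae hold: $$\lim_{\tau\to\infty}\frac{\log|I_{\omega,\vartheta}(\tau)|}{\tau}=h_D(\omega);$$ $$\lim_{\tau\to\infty}\frac{I'_{\omega,\vartheta}(\tau)}{I_{\omega,\vartheta}(\tau)}=h_D(\omega)+i\,p(\omega)\cdot\vartheta;$$ $$\lim_{\tau\to\infty}e^{-\tau t}|I_{\omega,\vartheta}(\tau)|=\begin{cases}0,&\text{if } t\ge h_D(\omega),\\ \infty,&\text{if } t<h_D(\omega).\end{cases}$$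
   Context: Setting. $\Omega\subset\mathbb R^3$ is a bounded domain with $C^2$ boundary and outward unit normal $\nu$; $k\ge 0$. $D$ is a nonempty open set with $\overline D\subset\Omega$, $\rho\in L^2(D)$ is complex-valued, and $F=F_{\rho,D}$ equals $\rho$ on $D$ and $0$ on $\Omega\setminus D$. $u\in H^1(\Omega)$ (complex-valued) is an arbitrary weak solution of $\Delta u+k^2u=F$ in $\Omega$ (no boundary condition is prescribed). The normal derivative $\partial u/\partial\nu\in H^{-1/2}(\partial\Omega)$ is defined weakly by $\langle \partial u/\partial\nu,g|_{\partial\Omega}\rangle=\int_\Omega(\nabla u\cdot\nabla g-k^2ug+Fg)\,dx$ for $g\in H^1(\Omega)$, and boundary integrals containing it are understood as this pairing. Dot products are extended bilinearly (no conjugation) to complex vectors. For $\omega\in S^2$, $S(\omega)=\{\vartheta\in S^2:\omega\cdot\vartheta=0\}$. For $\vartheta\in S(\omega)$, $\tau>0$, put $v=e^{x\cdot(\tau\omega+i\sqrt{\tau^2+k^2}\,\vartheta)}$, $v_\tau=\partial_\tau v=\{x\cdot(\omega+i\frac{\tau}{\sqrt{\tau^2+k^2}}\vartheta)\}v$, and $$I_{\omega,\vartheta}(\tau)=\int_{\partial\Omega}\Bigl(\frac{\partial u}{\partial\nu}v-\frac{\partial v}{\partial\nu}u\Bigr)dS,\qquad I'_{\omega,\vartheta}(\tau)=\int_{\partial\Omega}\Bigl(\frac{\partial u}{\partial\nu}v_\tau-\frac{\partial v_\tau}{\partial\nu}u\Bigr)dS.$$ $h_D(\omega)=\sup_{x\in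 D}x\cdot\omega$. $\omega$ is regular with respect to $D$ if $\{x\in\overline D: x\cdot\omega=h_D(\omega)\}$ is a single point, denoted $p(\omega)$. For $p\in\mathbb R^3$, $\omega\in S^2$, $\delta>0$ and a nonempty bounded relatively open subset $Q$ of the plane $x\cdot\omega=p\cdot\omega-\delta$, let $D_{(p,\omega)}(\delta,Q)=\bigcup_{0<s<\delta}\{p+\frac{s}{\delta}(z-p): z\in Q\}$. For $\vartheta\in S(\omega)$, $$C_{(p,\omega)}(\delta,Q,\vartheta)=2s\int_{Q_s}\frac{dS_z}{\{s-i(z-p)\cdot\vartheta\}^3},\qquad Q_s=D_{(p,\omega)}(\delta,Q)\cap\{x: x\cdot\omega=p\cdot\omega-s\},$$ which does not depend on $s\in\,]0,\delta[$. If $\omega$ is regular with respect to $D$, $D$ has a conical singularity from direction $\omega$ if there exist $\delta>0$ and a nonempty bounded relatively open subset $Q$ of the plane $x\cdot\omega=h_D(\omega)-\delta$ such that $D\cap\{x: h_D(\omega)-\delta<x\cdot\omega<h_D(\omega)\}=D_{(p(\omega),\omega)}(\delta,Q)$. $F_{\rho,D}$ is active at a point $p\in\partial D$ if there exist an open ball $B_\eta(p)$ centered at $p$ with radius $\eta>0$, $0<\alpha\le1$ and a (complex-valued) $\tilde\rho\in C^{0,\alpha}(\overline{B_\eta(p)})$ such that $\rho=\tilde\rho$ almost everywhere on $B_\eta(p)\cap D$ and $\tilde\rho(p)\ne0$. *)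

theory Defs
  imports "HOL-Analysis.Analysis"
begin

section \<open>Functions of class C1 and C2, complex vectors\<close>

text \<open>Both notions are meant for open sets \<open>S\<close>.\<close>

definition C1_on :: "'a::real_normed_vector set \<Rightarrow> ('a \<Rightarrow> 'b::real_normed_vector) \<Rightarrow> bool" where
  "C1_on S f \<longleftrightarrow>
     (\<exists>f' :: 'a \<Rightarrow> 'a \<Rightarrow>\<^sub>L 'b.
        (\<forall>x\<in>S. (f has_derivative blinfun_apply (f' x)) (at x)) \<and> continuous_on S f')"

definition C2_on :: "'a::real_normed_vector set \<Rightarrow> ('a \<Rightarrow> 'b::real_normed_vector) \<Rightarrow> bool" where
  "C2_on S f \<longleftrightarrow>
     (\<exists>f' :: 'a \<Rightarrow> 'a \<Rightarrow>\<^sub>L 'b.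
        (\<forall>x\<in>S. (f has_derivative blinfun_apply (f' x)) (at x)) \<and> C1_on S f')"

definition partial_deriv :: "'n::finite \<Rightarrow> (real^'n \<Rightarrow> 'b::real_normed_vector) \<Rightarrow> real^'n \<Rightarrow> 'b" where
  "partial_deriv i f x = frechet_derivative f (at x) (axis i 1)"

definition cgrad :: "(real^3 \<Rightarrow> complex) \<Rightarrow> real^3 \<Rightarrow> complex^3" where
  "cgrad f x = (\<chi> i. partial_deriv i f x)"

definition cvec :: "real^3 \<Rightarrow> complex^3" where
  "cvec x = (\<chi> i. complex_of_real (x $ i))"

text \<open>The bilinear dot product; the library's inner product on \<open>complex^3\<close> is a different
  (real-valued) form.\<close>

definition cdot :: "complex^3 \<Rightarrow> complex^3 \<Rightarrow> complex" (infixl \<open>\<cdot>\<^sub>c\<close> 70) where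
  "a \<cdot>\<^sub>c b = (\<Sum>i\<in>UNIV. a $ i * b $ i)"


section \<open>Bounded domains with C2 boundary\<close>

text \<open>Near each boundary point, after an orthogonal change of coordinates \<open>T\<close>, the set \<open>\<Omega>\<close> is the
  region strictly above the graph of a C2 function.\<close>

definition C2_boundary :: "(real^3) set \<Rightarrow> bool" where
  "C2_boundary \<Omega> \<longleftrightarrow>
     (\<forall>p\<in>frontier \<Omega>. \<exists>(T :: real^3 \<Rightarrow> real^3) r (\<gamma> :: real^2 \<Rightarrow> real).
        orthogonal_transformation T \<and> r > 0 \<and> C2_on UNIV \<gamma> \<and>
        \<Omega> \<inter> ball p r = {x \<in> ball p r. \<gamma> (vector [T x $ 1, T x $ 2]) < T x $ 3})"

definition bounded_C2_domain :: "(real^3) set \<Rightarrow> bool" where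
  "bounded_C2_domain \<Omega> \<longleftrightarrow>
     open \<Omega> \<and> connected \<Omega> \<and> \<Omega> \<noteq> {} \<and> bounded \<Omega> \<and> C2_boundary \<Omega>"

text \<open>A unit vector orthogonal to every velocity vector of a curve in the boundary through \<open>x\<close>,
  and pointing out of \<open>\<Omega>\<close>.\<close>

definition is_outward_normal :: "(real^3) set \<Rightarrow> real^3 \<Rightarrow> real^3 \<Rightarrow> bool" where
  "is_outward_normal \<Omega> x n \<longleftrightarrow>
     norm n = 1 \<and>
     (\<forall>(c :: real \<Rightarrow> real^3) c'.
        c 0 = x \<and> range c \<subseteq> frontier \<Omega> \<and> (c has_vector_derivative c') (at 0) \<longrightarrow> c' \<bullet> n = 0) \<and>
     (\<forall>\<^sub>F t in at_right 0. x - t *\<^sub>R n \<in> \<Omega> \<and> x + t *\<^sub>R n \<notin> closure \<Omega>)"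

definition outward_normal :: "(real^3) set \<Rightarrow> real^3 \<Rightarrow> real^3" where
  "outward_normal \<Omega> x = (THE n. is_outward_normal \<Omega> x n)"


section \<open>Surface measure\<close>

text \<open>A regular parametrized patch \<open>X\<close> of a surface \<open>S\<close> carries the measure with area element
  \<open>|\<partial>\<^sub>1X \<times> \<partial>\<^sub>2X| dy\<close>, transported to \<open>\<real>\<^sup>3\<close>. On an embedded surface these measures agree where patches
  overlap, so the supremum in the complete lattice of measures glues them to the surface measure
  of \<open>S\<close>, a measure on the Borel sets of \<open>\<real>\<^sup>3\<close> concentrated on \<open>S\<close>.\<close>

definition area_element :: "(real^2 \<Rightarrow> real^3) \<Rightarrow> real^2 \<Rightarrow> real" where
  "area_element X y = norm (cross3 (partial_deriv 1 X y) (partial_deriv 2 X y))"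

definition surface_patch :: "(real^3) set \<Rightarrow> (real^2) set \<Rightarrow> (real^2 \<Rightarrow> real^3) \<Rightarrow> bool" where
  "surface_patch S U X \<longleftrightarrow>
     open U \<and> C1_on U X \<and> inj_on X U \<and> X ` U \<subseteq> S \<and> (\<forall>y\<in>U. area_element X y \<noteq> 0)"

definition patch_measure :: "(real^2) set \<Rightarrow> (real^2 \<Rightarrow> real^3) \<Rightarrow> (real^3) measure" where
  "patch_measure U X =
     distr (density (restrict_space lborel U) (\<lambda>y. ennreal (area_element X y))) borel X"

definition surface_measure :: "(real^3) set \<Rightarrow> (real^3) measure" where
  "surface_measure S = (SUP (U, X) \<in> {(U, X). surface_patch S U X}. patch_measure U X)"


section \<open>Square integrable functions, the Sobolev space H1, traces\<close>

definition L2_fun :: "'a measure \<Rightarrow> ('a \<Rightarrow> 'b::{banach, second_countable_topology}) \<Rightarrow> bool" where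
  "L2_fun M f \<longleftrightarrow> f \<in> borel_measurable M \<and> integrable M (\<lambda>x. (norm (f x))\<^sup>2)"

definition L2_tendsto ::
  "'a measure \<Rightarrow> (nat \<Rightarrow> 'a \<Rightarrow> 'b::{banach, second_countable_topology}) \<Rightarrow> ('a \<Rightarrow> 'b) \<Rightarrow> bool" where
  "L2_tendsto M f g \<longleftrightarrow>
     (\<lambda>n. \<integral>\<^sup>+x. ennreal ((norm (f n x - g x))\<^sup>2) \<partial>M) \<longlonglongrightarrow> 0"

definition test_function :: "(real^3) set \<Rightarrow> (real^3 \<Rightarrow> complex) \<Rightarrow> bool" where
  "test_function \<Omega> \<phi> \<longleftrightarrow>
     C1_on UNIV \<phi> \<and> compact (closure {x. \<phi> x \<noteq> 0}) \<and> closure {x. \<phi> x \<noteq> 0} \<subseteq> \<Omega>"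

definition has_weak_gradient ::
  "(real^3) set \<Rightarrow> (real^3 \<Rightarrow> complex) \<Rightarrow> (real^3 \<Rightarrow> complex^3) \<Rightarrow> bool" where
  "has_weak_gradient \<Omega> u G \<longleftrightarrow>
     (\<forall>\<phi>. test_function \<Omega> \<phi> \<longrightarrow>
        (\<forall>i. (LINT x|lebesgue_on \<Omega>. u x * partial_deriv i \<phi> x) =
             - (LINT x|lebesgue_on \<Omega>. G x $ i * \<phi> x)))"

text \<open>Elements of function spaces are represented by functions on all of \<open>\<real>\<^sup>3\<close>, whose values off
  \<open>\<Omega>\<close> are irrelevant.\<close>

definition H1 :: "(real^3) set \<Rightarrow> (real^3 \<Rightarrow> complex) set" where
  "H1 \<Omega> = {u. L2_fun (lebesgue_on \<Omega>) u \<and>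
               (\<exists>G. L2_fun (lebesgue_on \<Omega>) G \<and> has_weak_gradient \<Omega> u G)}"

definition weak_grad :: "(real^3) set \<Rightarrow> (real^3 \<Rightarrow> complex) \<Rightarrow> real^3 \<Rightarrow> complex^3" where
  "weak_grad \<Omega> u = (SOME G. L2_fun (lebesgue_on \<Omega>) G \<and> has_weak_gradient \<Omega> u G)"

text \<open>The trace is the continuous extension to \<open>H1 \<Omega>\<close> of the restriction of C1 functions to the
  boundary, with values in L2 of the boundary; it is determined almost everywhere with respect to
  the surface measure.\<close>

definition is_trace :: "(real^3) set \<Rightarrow> (real^3 \<Rightarrow> complex) \<Rightarrow> (real^3 \<Rightarrow> complex) \<Rightarrow> bool" where
  "is_trace \<Omega> u g \<longleftrightarrow>
     L2_fun (surface_measure (frontier \<Omega>)) g \<and>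
     (\<exists>\<phi> :: nat \<Rightarrow> real^3 \<Rightarrow> complex.
        (\<forall>n. C1_on UNIV (\<phi> n)) \<and>
        L2_tendsto (lebesgue_on \<Omega>) \<phi> u \<and>
        L2_tendsto (lebesgue_on \<Omega>) (\<lambda>n. cgrad (\<phi> n)) (weak_grad \<Omega> u) \<and>
        L2_tendsto (surface_measure (frontier \<Omega>)) \<phi> g)"

definition boundary_trace :: "(real^3) set \<Rightarrow> (real^3 \<Rightarrow> complex) \<Rightarrow> real^3 \<Rightarrow> complex" where
  "boundary_trace \<Omega> u = (SOME g. is_trace \<Omega> u g)"


section \<open>The source problem and the indicator functions\<close>

definition source :: "(real^3 \<Rightarrow> complex) \<Rightarrow> (real^3) set \<Rightarrow> real^3 \<Rightarrow> complex" where
  "source \<rho> D x = (if x \<in> D then \<rho> x else 0)"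

text \<open>The form \<open>\<integral>\<^sub>\<Omega> (\<nabla>u \<cdot> \<nabla>g - k\<^sup>2 u g + F g) dx\<close>: weak solutions annihilate test functions, and for
  general \<open>g\<close> in \<open>H1 \<Omega>\<close> its value is the pairing of \<open>\<partial>u/\<partial>\<nu>\<close> with the trace of \<open>g\<close>.\<close>

definition normal_deriv_pairing ::
  "(real^3) set \<Rightarrow> real \<Rightarrow> (real^3 \<Rightarrow> complex) \<Rightarrow> (real^3 \<Rightarrow> complex) \<Rightarrow> (real^3 \<Rightarrow> complex) \<Rightarrow> complex" where
  "normal_deriv_pairing \<Omega> k F u g =
     (LINT x|lebesgue_on \<Omega>.
        weak_grad \<Omega> u x \<cdot>\<^sub>c weak_grad \<Omega> g x - (complex_of_real k)\<^sup>2 * u x * g x + F x * g x)"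

definition weak_solution ::
  "(real^3) set \<Rightarrow> real \<Rightarrow> (real^3 \<Rightarrow> complex) \<Rightarrow> (real^3 \<Rightarrow> complex) \<Rightarrow> bool" where
  "weak_solution \<Omega> k F u \<longleftrightarrow>
     u \<in> H1 \<Omega> \<and>
     (\<forall>\<phi>. test_function \<Omega> \<phi> \<longrightarrow>
        (LINT x|lebesgue_on \<Omega>.
           weak_grad \<Omega> u x \<cdot>\<^sub>c cgrad \<phi> x - (complex_of_real k)\<^sup>2 * u x * \<phi> x + F x * \<phi> x) = 0)"

definition normal_deriv :: "(real^3) set \<Rightarrow> (real^3 \<Rightarrow> complex) \<Rightarrow> real^3 \<Rightarrow> complex" where
  "normal_deriv \<Omega> w x = cgrad w x \<cdot>\<^sub>c cvec (outward_normal \<Omega> x)"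

text \<open>\<open>\<integral> (\<partial>u/\<partial>\<nu> w - \<partial>w/\<partial>\<nu> u) dS\<close> over the boundary, for \<open>w\<close> smooth near the closure of \<open>\<Omega>\<close>.\<close>

definition boundary_form ::
  "(real^3) set \<Rightarrow> real \<Rightarrow> (real^3 \<Rightarrow> complex) \<Rightarrow> (real^3 \<Rightarrow> complex) \<Rightarrow> (real^3 \<Rightarrow> complex) \<Rightarrow> complex" where
  "boundary_form \<Omega> k F u w =
     normal_deriv_pairing \<Omega> k F u w -
     (LINT x:frontier \<Omega>|surface_measure (frontier \<Omega>). normal_deriv \<Omega> w x * boundary_trace \<Omega> u x)"

definition orth_dirs :: "real^3 \<Rightarrow> (real^3) set" where
  "orth_dirs \<omega> = {\<theta> \<in> sphere 0 1. \<omega> \<bullet> \<theta> = 0}"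

definition cgo :: "real \<Rightarrow> real^3 \<Rightarrow> real^3 \<Rightarrow> real \<Rightarrow> real^3 \<Rightarrow> complex" where
  "cgo k \<omega> \<theta> \<tau> x =
     exp (cvec x \<cdot>\<^sub>c (complex_of_real \<tau> *s cvec \<omega> +
            (\<i> * complex_of_real (sqrt (\<tau>\<^sup>2 + k\<^sup>2))) *s cvec \<theta>))"

text \<open>The derivative of \<open>cgo k \<omega> \<theta> \<tau> x\<close> with respect to \<open>\<tau>\<close>.\<close>

definition cgo_deriv :: "real \<Rightarrow> real^3 \<Rightarrow> real^3 \<Rightarrow> real \<Rightarrow> real^3 \<Rightarrow> complex" where
  "cgo_deriv k \<omega> \<theta> \<tau> x =
     (cvec x \<cdot>\<^sub>c (cvec \<omega> + (\<i> * complex_of_real (\<tau> / sqrt (\<tau>\<^sup>2 + k\<^sup>2))) *s cvec \<theta>)) *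
     cgo k \<omega> \<theta> \<tau> x"

definition indicator_I ::
  "(real^3) set \<Rightarrow> real \<Rightarrow> (real^3 \<Rightarrow> complex) \<Rightarrow> (real^3 \<Rightarrow> complex) \<Rightarrow> real^3 \<Rightarrow> real^3 \<Rightarrow> real \<Rightarrow> complex" where
  "indicator_I \<Omega> k F u \<omega> \<theta> \<tau> = boundary_form \<Omega> k F u (cgo k \<omega> \<theta> \<tau>)"

definition indicator_I' ::
  "(real^3) set \<Rightarrow> real \<Rightarrow> (real^3 \<Rightarrow> complex) \<Rightarrow> (real^3 \<Rightarrow> complex) \<Rightarrow> real^3 \<Rightarrow> real^3 \<Rightarrow> real \<Rightarrow> complex" where
  "indicator_I' \<Omega> k F u \<omega> \<theta> \<tau> = boundary_form \<Omega> k F u (cgo_deriv k \<omega> \<theta> \<tau>)"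


section \<open>Geometry of the support of the source\<close>

definition support_fun :: "(real^3) set \<Rightarrow> real^3 \<Rightarrow> real" where
  "support_fun D \<omega> = (SUP x\<in>D. x \<bullet> \<omega>)"

definition regular_direction :: "(real^3) set \<Rightarrow> real^3 \<Rightarrow> bool" where
  "regular_direction D \<omega> \<longleftrightarrow> (\<exists>!x. x \<in> closure D \<and> x \<bullet> \<omega> = support_fun D \<omega>)"

definition contact_point :: "(real^3) set \<Rightarrow> real^3 \<Rightarrow> real^3" where
  "contact_point D \<omega> = (THE x. x \<in> closure D \<and> x \<bullet> \<omega> = support_fun D \<omega>)"

definition cone_set :: "real^3 \<Rightarrow> real \<Rightarrow> (real^3) set \<Rightarrow> (real^3) set" where
  "cone_set p \<delta> Q = (\<Union>s\<in>{0<..<\<delta>}. {p + (s / \<delta>) *\<^sub>R (z - p) | z. z \<in> Q})"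

text \<open>\<open>D\<close> has a conical singularity from direction \<open>\<omega>\<close>, realized by \<open>\<delta>\<close> and \<open>Q\<close>.\<close>

definition conical_singularity :: "(real^3) set \<Rightarrow> real^3 \<Rightarrow> real \<Rightarrow> (real^3) set \<Rightarrow> bool" where
  "conical_singularity D \<omega> \<delta> Q \<longleftrightarrow>
     \<delta> > 0 \<and> Q \<noteq> {} \<and> bounded Q \<and>
     openin (top_of_set {x. x \<bullet> \<omega> = support_fun D \<omega> - \<delta>}) Q \<and>
     D \<inter> {x. support_fun D \<omega> - \<delta> < x \<bullet> \<omega> \<and> x \<bullet> \<omega> < support_fun D \<omega>} =
       cone_set (contact_point D \<omega>) \<delta> Q"

definition cone_slice_integral ::
  "real^3 \<Rightarrow> real^3 \<Rightarrow> real \<Rightarrow> (real^3) set \<Rightarrow> real^3 \<Rightarrow> real \<Rightarrow> complex" where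
  "cone_slice_integral p \<omega> \<delta> Q \<theta> s =
     2 * complex_of_real s *
     (LINT z:cone_set p \<delta> Q \<inter> {x. x \<bullet> \<omega> = p \<bullet> \<omega> - s}|surface_measure {x. x \<bullet> \<omega> = p \<bullet> \<omega> - s}.
        1 / (complex_of_real s - \<i> * complex_of_real ((z - p) \<bullet> \<theta>)) ^ 3)"

text \<open>By scaling, the slice integral takes the same value for every \<open>s\<close> between \<open>0\<close> and \<open>\<delta>\<close>.\<close>

definition cone_const ::
  "real^3 \<Rightarrow> real^3 \<Rightarrow> real \<Rightarrow> (real^3) set \<Rightarrow> real^3 \<Rightarrow> complex" where
  "cone_const p \<omega> \<delta> Q \<theta> = (THE c. \<forall>s\<in>{0<..<\<delta>}. cone_slice_integral p \<omega> \<delta> Q \<theta> s = c)"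

definition active_at :: "(real^3 \<Rightarrow> complex) \<Rightarrow> (real^3) set \<Rightarrow> real^3 \<Rightarrow> bool" where
  "active_at \<rho> D p \<longleftrightarrow>
     p \<in> frontier D \<and>
     (\<exists>\<eta>>0. \<exists>\<alpha>. 0 < \<alpha> \<and> \<alpha> \<le> 1 \<and>
        (\<exists>\<rho>' :: real^3 \<Rightarrow> complex.
           (\<exists>C. \<forall>x\<in>cball p \<eta>. \<forall>y\<in>cball p \<eta>. norm (\<rho>' x - \<rho>' y) \<le> C * norm (x - y) powr \<alpha>) \<and>
           (AE x in lebesgue. x \<in> ball p \<eta> \<inter> D \<longrightarrow> \<rho> x = \<rho>' x) \<and>
           \<rho>' p \<noteq> 0))"

end

theory Submission
  imports Defs "HOL-Real_Asymp.Real_Asymp"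
begin

text \<open>
  The oscillating exponentials solve the Helmholtz equation, so Green's formula turns \<open>I\<close> into the
  volume integral of \<open>\<rho> v\<close> over \<open>D\<close>, and \<open>I'\<close> into that of \<open>\<rho> v\<^sub>\<tau>\<close>. Only the part of \<open>D\<close> near the
  contact point \<open>p\<close> matters, the rest being smaller by a factor \<open>exp (- \<tau> d)\<close>. Near \<open>p\<close> the set \<open>D\<close> is
  a cone \<open>p + K\<close>, and the substitution \<open>x = p + y / \<tau>\<close> shows that \<open>\<tau>\<^sup>3 I / v p\<close> tends to \<open>\<rho> p\<close> times
  the integral of \<open>exp (y \<bullet> \<omega> + \<i> y \<bullet> \<theta>)\<close> over \<open>K\<close>. Integrating over the slices of \<open>K\<close> identifies
  that integral with the constant of the cone; all three formulas follow.

  Green's formula for \<open>u\<close> in \<open>H1\<close> is obtained from the divergence theorem by density: \<open>u\<close> is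
  approximated by \<open>C1\<close> functions, whose boundary values converge by the trace inequality.
\<close>

section \<open>Functions of class C1\<close>

text \<open>Three objects of the statement are given by a choice or a supremum, and they shape the
  proof. The weak gradient and the trace come from \<open>SOME\<close>, so facts about them rest on
  uniqueness almost everywhere of weak gradients and on existence of traces. The surface measure is
  a supremum over all parametrized patches; it becomes computable once it is identified with the
  area measure of a graph. The approximation has to hold up to the boundary, since the trace
  inequality consumes gradients on all of \<Omega>. The exponent 3 is the dimension: the
  substitution scales volume by \<open>\<tau> ^ 3\<close>. The phase has frequency
  \<open>sqrt (\<tau>\<^sup>2 + k\<^sup>2)\<close> instead of \<tau>; their quotient tends to 1, and
  the modulus of the rescaled exponential is free of \<tau>, so domination on the cone is uniform.
  For \<open>I'\<close> the same asymptotics are applied to the density multiplied by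
  \<open>x \<bullet> a\<close>, with \<open>a\<close> equal to \<omega> and to \<theta>. A nonzero
  density at the contact point and a nonzero cone constant make the leading coefficient nonzero,
  which permits logarithms and quotients.\<close>

lemma C1_onI:
  fixes f :: "'a::euclidean_space \<Rightarrow> 'b::real_normed_vector"
  assumes "\<And>x. x \<in> S \<Longrightarrow> (f has_derivative f' x) (at x)"
    and "\<And>i. i \<in> Basis \<Longrightarrow> continuous_on S (\<lambda>x. f' x i)"
  shows "C1_on S f"
  unfolding C1_on_def
proof (intro exI[where x="\<lambda>x. Blinfun (f' x)"] conjI ballI)
  have ap: "blinfun_apply (Blinfun (f' x)) = f' x" if "x \<in> S" for x
    using assms(1)[OF that] by (simp add: bounded_linear_Blinfun_apply has_derivative_bounded_linear)
  show "(f has_derivative blinfun_apply (Blinfun (f' x))) (at x)" if "x \<in> S" for x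
    using assms(1)[OF that] ap[OF that] by simp
  \<comment> \<open>In finite dimension, continuity in the operator norm can be tested on the basis
    vectors, so applications need only continuity of directional derivatives.\<close>
  show "continuous_on S (\<lambda>x. Blinfun (f' x))"
  proof (rule continuous_on_blinfun_componentwise)
    fix i :: 'a assume "i \<in> Basis"
    with assms(2) show "continuous_on S (\<lambda>x. blinfun_apply (Blinfun (f' x)) i)"
      using ap by (simp cong: continuous_on_cong)
  qed
qed

lemma C1_on_has_derivative:
  "C1_on S f \<Longrightarrow> x \<in> S \<Longrightarrow> (f has_derivative frechet_derivative f (at x)) (at x)"
  unfolding C1_on_def by (metis frechet_derivative_at)

lemma C1_on_continuous_derivative:
  assumes "C1_on S f"
  shows "continuous_on S (\<lambda>x. frechet_derivative f (at x) h)"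
proof -
  obtain f' where f': "\<And>x. x \<in> S \<Longrightarrow> (f has_derivative blinfun_apply (f' x)) (at x)"
    and c: "continuous_on S f'"
    using assms unfolding C1_on_def by auto
  have "continuous_on S (\<lambda>x. blinfun_apply (f' x) h)"
    by (intro continuous_intros c)
  moreover have "blinfun_apply (f' x) h = frechet_derivative f (at x) h" if "x \<in> S" for x
    using frechet_derivative_at[OF f'[OF that]] by simp
  ultimately show ?thesis
    by (simp cong: continuous_on_cong)
qed

lemma C1_on_subset: "C1_on S f \<Longrightarrow> T \<subseteq> S \<Longrightarrow> C1_on T f"
  unfolding C1_on_def using continuous_on_subset by blast

lemma C1_on_continuous: "C1_on S f \<Longrightarrow> continuous_on S f"
  unfolding C1_on_def
  by (meson continuous_at_imp_continuous_on has_derivative_continuous)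

lemma C1_on_linear:
  assumes "bounded_linear f"
  shows "C1_on S f"
  unfolding C1_on_def
  by (rule exI[where x="\<lambda>_. Blinfun f"])
    (auto simp: bounded_linear_Blinfun_apply[OF assms] intro!: bounded_linear_imp_has_derivative assms)

lemma C1_on_const: "C1_on S (\<lambda>x. c)"
  unfolding C1_on_def by (rule exI[where x="\<lambda>_. 0"]) (auto simp: zero_blinfun.rep_eq)

lemma C1_on_add:
  assumes "C1_on S f" "C1_on S g"
  shows "C1_on S (\<lambda>x. f x + g x)"
proof -
  obtain f' g' where
    "\<And>x. x \<in> S \<Longrightarrow> (f has_derivative blinfun_apply (f' x)) (at x)" "continuous_on S f'"
    "\<And>x. x \<in> S \<Longrightarrow> (g has_derivative blinfun_apply (g' x)) (at x)" "continuous_on S g'"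
    using assms unfolding C1_on_def by blast
  then show ?thesis
    unfolding C1_on_def
    by (intro exI[where x="\<lambda>x. f' x + g' x"])
      (auto simp: plus_blinfun.rep_eq intro!: derivative_intros continuous_intros)
qed

lemma C1_on_sum: "(\<And>i. i \<in> I \<Longrightarrow> C1_on S (f i)) \<Longrightarrow> C1_on S (\<lambda>x. \<Sum>i\<in>I. f i x)"
proof (induction I rule: infinite_finite_induct)
  case (insert i I)
  then show ?case
    using C1_on_add[of S "f i" "\<lambda>x. \<Sum>i\<in>I. f i x"] by simp
qed (simp_all add: C1_on_const)

lemma C1_on_compose:
  assumes "C1_on S f" "C1_on T g" "f ` S \<subseteq> T"
  shows "C1_on S (\<lambda>x. g (f x))"
proof -
  obtain f' g' where f: "\<And>x. x \<in> S \<Longrightarrow> (f has_derivative blinfun_apply (f' x)) (at x)" "continuous_on S f'"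
    and g: "\<And>x. x \<in> T \<Longrightarrow> (g has_derivative blinfun_apply (g' x)) (at x)" "continuous_on T g'"
    using assms unfolding C1_on_def by blast
  have "((\<lambda>x. g (f x)) has_derivative blinfun_apply (g' (f x) o\<^sub>L f' x)) (at x)" if "x \<in> S" for x
    using has_derivative_compose[OF f(1)[OF that] g(1)[of "f x"]] that assms(3)
    by (auto simp: o_def blinfun_compose.rep_eq)
  moreover have "continuous_on S (\<lambda>x. g' (f x) o\<^sub>L f' x)"
    by (intro bounded_bilinear.continuous_on[OF bounded_bilinear_blinfun_compose] f(2)
        continuous_on_compose2[OF g(2) C1_on_continuous[OF assms(1)]] assms(3))
  ultimately show ?thesis
    unfolding C1_on_def by (intro exI[where x="\<lambda>x. g' (f x) o\<^sub>L f' x"]) auto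
qed

lemma C1_on_compose_UNIV: "C1_on UNIV g \<Longrightarrow> C1_on S f \<Longrightarrow> C1_on S (\<lambda>x. g (f x))"
  by (rule C1_on_compose) auto

lemma C1_on_linear_compose: "bounded_linear g \<Longrightarrow> C1_on S f \<Longrightarrow> C1_on S (\<lambda>x. g (f x))"
  by (rule C1_on_compose_UNIV) (rule C1_on_linear)

lemma C1_on_bilinear:
  fixes f :: "'a::euclidean_space \<Rightarrow> 'b::real_normed_vector"
  assumes "bounded_bilinear pr" "C1_on S f" "C1_on S g"
  shows "C1_on S (\<lambda>x. pr (f x) (g x))"
proof (rule C1_onI)
  interpret bounded_bilinear pr by fact
  show "((\<lambda>x. pr (f x) (g x)) has_derivative
      (\<lambda>h. pr (f x) (frechet_derivative g (at x) h) + pr (frechet_derivative f (at x) h) (g x))) (at x)"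
    if "x \<in> S" for x
    by (rule FDERIV[OF C1_on_has_derivative C1_on_has_derivative]) (use assms that in auto)
  show "continuous_on S (\<lambda>x. pr (f x) (frechet_derivative g (at x) i)
      + pr (frechet_derivative f (at x) i) (g x))" for i
    by (intro continuous_on_add continuous_on C1_on_continuous C1_on_continuous_derivative assms)
qed

lemmas C1_on_mult = C1_on_bilinear[OF bounded_bilinear_mult]
lemmas C1_on_inner = C1_on_bilinear[OF bounded_bilinear_inner]
lemmas C1_on_of_real = C1_on_linear_compose[OF bounded_linear_of_real]

lemma C1_on_diff:
  "C1_on S f \<Longrightarrow> C1_on S g \<Longrightarrow> C1_on S (\<lambda>x. f x - g x)"
  using C1_on_add[of S f "\<lambda>x. - g x"] C1_on_linear_compose[OF bounded_linear_minus[OF bounded_linear_ident]]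
  by fastforce

lemma C1_on_inverse:
  fixes f :: "'a::euclidean_space \<Rightarrow> real"
  assumes "C1_on S f" "\<And>x. x \<in> S \<Longrightarrow> f x \<noteq> 0"
  shows "C1_on S (\<lambda>x. inverse (f x))"
proof (rule C1_onI)
  show "((\<lambda>x. inverse (f x)) has_derivative
      (\<lambda>h. - (inverse (f x) * frechet_derivative f (at x) h * inverse (f x)))) (at x)" if "x \<in> S" for x
    by (rule Deriv.has_derivative_inverse[OF assms(2)[OF that] C1_on_has_derivative[OF assms(1) that]])
  show "continuous_on S (\<lambda>x. - (inverse (f x) * frechet_derivative f (at x) i * inverse (f x)))" for i
    by (intro continuous_intros C1_on_continuous C1_on_continuous_derivative assms ballI)
qed

lemma frechet_derivative_mult:
  fixes f g :: "'a::euclidean_space \<Rightarrow> 'b::real_normed_algebra"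
  assumes "C1_on UNIV f" "C1_on UNIV g"
  shows "frechet_derivative (\<lambda>x. f x * g x) (at x) h =
    f x * frechet_derivative g (at x) h + frechet_derivative f (at x) h * g x"
  by (rule fun_cong[OF frechet_derivative_at[symmetric]])
    (intro has_derivative_mult C1_on_has_derivative[OF assms(1)] C1_on_has_derivative[OF assms(2)] UNIV_I)

lemma frechet_derivative_eq_0_outside:
  assumes "\<And>y. y \<notin> K \<Longrightarrow> f y = 0" "closed K" "x \<notin> K"
  shows "frechet_derivative f (at x) h = 0"
proof -
  have "(f has_derivative (\<lambda>h. 0)) (at x)"
    by (rule has_derivative_transform_within_open[OF has_derivative_const[of 0], of "- K"])
      (use assms in auto)
  then show ?thesis
    by (metis frechet_derivative_at)
qed

section \<open>Bump functions and partitions of unity of class C1\<close>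

lemma square_pos_part_has_derivative:
  "((\<lambda>t::real. (max 0 t)\<^sup>2) has_real_derivative 2 * max 0 t) (at t)"
proof -
  consider "t < 0" | "t > 0" | "t = 0" by linarith
  then show ?thesis
  proof cases
    case 1
    have "((\<lambda>t::real. (max 0 t)\<^sup>2) has_real_derivative 0) (at t)"
      by (rule has_field_derivative_transform_within_open[of "\<lambda>_. 0" _ _ "{..<0}"]) (use 1 in auto)
    with 1 show ?thesis by simp
  next
    case 2
    have "((\<lambda>t::real. (max 0 t)\<^sup>2) has_real_derivative 2 * t) (at t)"
      by (rule has_field_derivative_transform_within_open[of "\<lambda>t. t\<^sup>2" _ _ "{0<..}"])
        (use 2 in \<open>auto intro!: derivative_eq_intros\<close>)
    with 2 show ?thesis by simp
  next
    case 3
    \<comment> \<open>At the kink the difference quotient is bounded by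
      \<open>\<bar>h\<bar>\<close>, which is why squaring makes the positive part
      differentiable.\<close>
    have "((\<lambda>h::real. (max 0 h)\<^sup>2 / h) \<longlongrightarrow> 0) (at 0)"
    proof (rule Lim_null_comparison)
      show "\<forall>\<^sub>F h in at 0. norm ((max 0 h)\<^sup>2 / h) \<le> \<bar>h::real\<bar>"
        by (rule always_eventually) (auto simp: power2_eq_square max_def)
      show "((\<lambda>h::real. \<bar>h\<bar>) \<longlongrightarrow> 0) (at 0)"
        by (rule tendsto_eq_intros | simp)+
    qed
    with 3 show ?thesis by (simp add: DERIV_def)
  qed
qed

lemma C1_on_square_pos_part:
  fixes f :: "'a::euclidean_space \<Rightarrow> real"
  assumes "C1_on S f"
  shows "C1_on S (\<lambda>x. (max 0 (f x))\<^sup>2)"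
proof -
  have "C1_on UNIV (\<lambda>t::real. (max 0 t)\<^sup>2)"
    by (rule C1_onI[where f'="\<lambda>t h. 2 * max 0 t * h"])
      (auto intro!: continuous_intros square_pos_part_has_derivative[unfolded has_field_derivative_def])
  then show ?thesis
    using assms by (rule C1_on_compose_UNIV)
qed

text \<open>Test functions are only required to be C1, so a piecewise polynomial in the squared
  distance serves as cutoff. The inner product is used instead of the norm because it is smooth at
  the centre.\<close>

definition bump :: "'a::euclidean_space \<Rightarrow> real \<Rightarrow> 'a \<Rightarrow> real" where
  "bump p r x = (max 0 (r\<^sup>2 - (x - p) \<bullet> (x - p)))\<^sup>2"

lemma C1_on_bump: "C1_on S (bump p r)"
  unfolding bump_def[abs_def]
  by (intro C1_on_square_pos_part C1_on_diff C1_on_inner C1_on_const C1_on_linear bounded_linear_ident)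

lemma bump_nonneg: "0 \<le> bump p r x"
  by (simp add: bump_def)

lemma bump_pos_iff:
  assumes "r > 0"
  shows "0 < bump p r x \<longleftrightarrow> x \<in> ball p r"
proof -
  have "norm (x - p) < r \<longleftrightarrow> (norm (x - p))\<^sup>2 < r\<^sup>2"
    using assms by (simp add: abs_less_iff norm_minus_commute power_strict_mono)
      (smt (verit) norm_ge_zero power2_le_imp_le power_strict_mono zero_less_numeral)
  then show ?thesis
    unfolding bump_def power2_norm_eq_inner[symmetric]
    by (auto simp: dist_norm norm_minus_commute max_def)
qed

lemma bump_eq_0: "r > 0 \<Longrightarrow> x \<notin> ball p r \<Longrightarrow> bump p r x = 0"
  using bump_nonneg[of p r x] bump_pos_iff[of r p x] by linarith

text \<open>Finitely many bumps cover the compact set and are divided by their sum. The radii are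
  prescribed because they will come from local charts.\<close>

lemma C1_partition_of_unity:
  fixes K :: "'a::euclidean_space set"
  assumes "compact K" "\<And>p. p \<in> K \<Longrightarrow> r p > 0"
  obtains C \<psi> where "finite C" "C \<subseteq> K" "\<And>c. C1_on UNIV (\<psi> c)" "\<And>c x. 0 \<le> \<psi> c x"
    "\<And>c x. c \<in> C \<Longrightarrow> x \<notin> ball c (r c) \<Longrightarrow> \<psi> c x = (0::real)"
    "\<And>x. x \<in> K \<Longrightarrow> (\<Sum>c\<in>C. \<psi> c x) = 1"
proof -
  have "K \<subseteq> (\<Union>p\<in>K. ball p (r p))"
    using assms(2) by auto
  then obtain C where C: "C \<subseteq> K" "finite C" "K \<subseteq> (\<Union>p\<in>C. ball p (r p))"
    by (rule compactE_image[OF assms(1), rotated]) auto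
  define B where "B x = (\<Sum>c\<in>C. bump c (r c) x)" for x
  have B0: "B x \<ge> 0" for x
    unfolding B_def by (intro sum_nonneg bump_nonneg)
  have B1: "C1_on UNIV B"
    unfolding B_def[abs_def] by (rule C1_on_sum) (rule C1_on_bump)
  have Bpos: "B x > 0" if "x \<in> K" for x
  proof -
    from subsetD[OF C(3) that] obtain c where "c \<in> C" "x \<in> ball c (r c)"
      by blast
    then show ?thesis
      unfolding B_def using C assms(2) bump_pos_iff[of "r c" c x]
      by (intro sum_pos2[where i=c]) (auto intro: bump_nonneg)
  qed
  obtain b where b: "b > 0" "\<And>x. x \<in> K \<Longrightarrow> b \<le> B x"
  proof (cases "K = {}")
    case False
    have "continuous_on K B"
      by (rule continuous_on_subset[OF C1_on_continuous[OF B1]]) simp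
    from continuous_attains_inf[OF assms(1) False this]
    obtain x0 where "x0 \<in> K" "\<And>x. x \<in> K \<Longrightarrow> B x0 \<le> B x"
      by blast
    with Bpos that[of "B x0"] show ?thesis by auto
  qed (use that[of 1] in auto)
  \<comment> \<open>\<open>B\<close> may vanish away from \<open>K\<close>, so it cannot be the
    denominator. \<open>M\<close> is of class C1, agrees with \<open>B\<close> on \<open>K\<close>,
    where \<open>b \<le> B x\<close>, and stays positive where \<open>B\<close> is zero.\<close>
  define M where "M x = B x + (max 0 (b - B x))\<^sup>2" for x
  have M0: "M x > 0" for x
  proof (cases "B x = 0")
    case True
    then show ?thesis using b by (simp add: M_def max_def)
  next
    case False
    then show ?thesis using B0[of x] by (simp add: M_def add_pos_nonneg)
  qed
  have MB: "M x = B x" if "x \<in> K" for x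
    using b(2)[OF that] by (simp add: M_def)
  show ?thesis
  proof (rule that[of C "\<lambda>c x. bump c (r c) x * inverse (M x)"])
    show "C1_on UNIV (\<lambda>x. bump c (r c) x * inverse (M x))" for c
    proof (rule C1_on_mult[OF C1_on_bump C1_on_inverse])
      show "C1_on UNIV M"
        unfolding M_def[abs_def]
        by (rule C1_on_add[OF B1 C1_on_square_pos_part[OF C1_on_diff[OF C1_on_const B1]]])
      show "M x \<noteq> 0" for x
        using M0[of x] by simp
    qed
    show "0 \<le> bump c (r c) x * inverse (M x)" for c x
      using M0[of x] bump_nonneg[of c "r c" x] by simp
    show "bump c (r c) x * inverse (M x) = 0" if "c \<in> C" "x \<notin> ball c (r c)" for c x
      using that bump_eq_0 assms(2) C(1) by force
    show "(\<Sum>c\<in>C. bump c (r c) x * inverse (M x)) = 1" if "x \<in> K" for x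
      using MB[OF that] Bpos[OF that] unfolding sum_distrib_right[symmetric] B_def by simp
  qed (use C in auto)
qed

section \<open>Integrals of functions with bounded support, translations and derivatives\<close>

lemma integrable_continuous_bounded_support:
  fixes f :: "'a::euclidean_space \<Rightarrow> 'b::{banach,second_countable_topology}"
  assumes "continuous_on UNIV f" "\<And>x. f x \<noteq> 0 \<Longrightarrow> norm x \<le> R"
  shows "integrable lborel f"
proof -
  have "integrable lborel (\<lambda>x. indicator (cball 0 R) x *\<^sub>R f x)"
    by (intro borel_integrable_compact continuous_on_subset[OF assms(1)]) auto
  moreover have "(\<lambda>x. indicator (cball 0 R) x *\<^sub>R f x) = f"
    using assms(2) by (force simp: indicator_def)
  ultimately show ?thesis by simp
qed

lemma lborel_integrable_translation:
  fixes f :: "'a::euclidean_space \<Rightarrow> 'b::{banach,second_countable_topology}"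
  assumes "integrable lborel f"
  shows "integrable lborel (\<lambda>x. f (a + x))" "(\<integral>x. f (a + x) \<partial>lborel) = integral\<^sup>L lborel f"
proof -
  have [measurable]: "f \<in> borel_measurable borel"
    using assms borel_measurable_integrable by auto
  show "integrable lborel (\<lambda>x. f (a + x))"
    by (rule integrable_distr[where M'=borel]) (use assms in \<open>simp_all add: lborel_distr_plus\<close>)
  have "integral\<^sup>L (distr lborel borel ((+) a)) f = (\<integral>x. f (a + x) \<partial>lborel)"
    by (rule integral_distr) simp_all
  then show "(\<integral>x. f (a + x) \<partial>lborel) = integral\<^sup>L lborel f"
    by (simp add: lborel_distr_plus)
qed

lemma C1_difference_bound:
  fixes f :: "'a::euclidean_space \<Rightarrow> 'b::real_normed_vector"
  assumes "C1_on UNIV f" "\<And>y. norm (frechet_derivative f (at y) e) \<le> M"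
  shows "norm (f (x + t *\<^sub>R e) - f x) \<le> \<bar>t\<bar> * M"
proof -
  have d: "((\<lambda>s. f (x + s *\<^sub>R e)) has_derivative (\<lambda>h. h *\<^sub>R frechet_derivative f (at (x + s *\<^sub>R e)) e)) (at s)" for s
  proof -
    have "((\<lambda>s. f (x + s *\<^sub>R e)) has_derivative (\<lambda>h. frechet_derivative f (at (x + s *\<^sub>R e)) (h *\<^sub>R e))) (at s)"
      by (rule has_derivative_compose[of "\<lambda>s. x + s *\<^sub>R e" "\<lambda>h. h *\<^sub>R e"])
        (auto intro!: derivative_eq_intros C1_on_has_derivative[OF assms(1)])
    moreover have "linear (frechet_derivative f (at (x + s *\<^sub>R e)))"
      using C1_on_has_derivative[OF assms(1)] by (intro has_derivative_linear) auto
    ultimately show ?thesis by (simp add: linear_cmul)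
  qed
  have "norm (f (x + t *\<^sub>R e) - f (x + 0 *\<^sub>R e)) \<le> M * norm (t - 0)"
  proof (rule differentiable_bound[of UNIV _ "\<lambda>s h. h *\<^sub>R frechet_derivative f (at (x + s *\<^sub>R e)) e"])
    show "onorm (\<lambda>h. h *\<^sub>R frechet_derivative f (at (x + s *\<^sub>R e)) e) \<le> M" for s :: real
      using assms(2)[of "x + s *\<^sub>R e"]
      by (intro onorm_le) (simp add: mult.commute[of M] mult_left_mono)
  qed (use d in auto)
  then show ?thesis by (simp add: mult.commute)
qed

lemma derivative_difference_quotient:
  assumes "(f has_derivative f') (at x)"
  shows "(\<lambda>n. (f (x + (1 / real (Suc n)) *\<^sub>R e) - f x) /\<^sub>R (1 / real (Suc n))) \<longlonglongrightarrow> f' e"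
proof -
  have "((\<lambda>s::real. f (x + s *\<^sub>R e)) has_derivative (\<lambda>h. f' (h *\<^sub>R e))) (at 0)"
    by (rule has_derivative_compose[of "\<lambda>s. x + s *\<^sub>R e" "\<lambda>h. h *\<^sub>R e"])
      (use assms in \<open>auto intro!: derivative_eq_intros\<close>)
  then have "((\<lambda>s::real. f (x + s *\<^sub>R e)) has_vector_derivative f' e) (at 0)"
    using has_derivative_linear[OF assms] by (simp add: has_vector_derivative_def linear_cmul)
  then have "((\<lambda>h. norm (f (x + h *\<^sub>R e) - f x - h *\<^sub>R f' e) / norm h) \<longlongrightarrow> 0) (at 0)"
    by (simp add: has_vector_derivative_def has_derivative_iff_norm)
  then have "((\<lambda>h. norm ((f (x + h *\<^sub>R e) - f x) /\<^sub>R h - f' e)) \<longlongrightarrow> 0) (at 0)"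
  proof (rule Lim_transform_eventually)
    show "\<forall>\<^sub>F h in at 0. norm (f (x + h *\<^sub>R e) - f x - h *\<^sub>R f' e) / norm h =
        norm ((f (x + h *\<^sub>R e) - f x) /\<^sub>R h - f' e)"
    proof (rule eventually_at_filter[THEN iffD2, OF always_eventually], intro allI impI)
      fix h :: real assume "h \<noteq> 0"
      then have "(f (x + h *\<^sub>R e) - f x) /\<^sub>R h - f' e = (f (x + h *\<^sub>R e) - f x - h *\<^sub>R f' e) /\<^sub>R h"
        by (simp add: scaleR_diff_right)
      then show "norm (f (x + h *\<^sub>R e) - f x - h *\<^sub>R f' e) / norm h =
        norm ((f (x + h *\<^sub>R e) - f x) /\<^sub>R h - f' e)"
        by (simp add: divide_inverse mult.commute)
    qed
  qed
  then have "((\<lambda>h. (f (x + h *\<^sub>R e) - f x) /\<^sub>R h) \<longlongrightarrow> f' e) (at 0)"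
    by (simp add: tendsto_norm_zero_iff LIM_zero_iff)
  moreover have "filterlim (\<lambda>n. 1 / real (Suc n)) (at 0) sequentially"
    unfolding filterlim_at using LIMSEQ_Suc[OF lim_1_over_n] by (auto simp: field_simps)
  ultimately show ?thesis
    by (rule filterlim_compose)
qed

text \<open>Translation invariance gives every difference quotient the integral 0, and dominated
  convergence passes to the derivative. With a product as \<open>f\<close> this becomes integration
  by parts without boundary terms.\<close>

lemma integral_derivative_eq_0:
  fixes f :: "'a::euclidean_space \<Rightarrow> 'b::{banach,second_countable_topology}"
  assumes f: "C1_on UNIV f" and R: "\<And>x. f x \<noteq> 0 \<Longrightarrow> norm x \<le> R"
  shows "integrable lborel (\<lambda>x. frechet_derivative f (at x) e)"
    "(\<integral>x. frechet_derivative f (at x) e \<partial>lborel) = 0"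
proof -
  let ?f' = "\<lambda>x. frechet_derivative f (at x) e"
  have c: "continuous_on UNIV f" "continuous_on UNIV ?f'"
    using f by (auto intro: C1_on_continuous C1_on_continuous_derivative)
  have f'R: "norm x \<le> R" if "?f' x \<noteq> 0" for x
  proof (rule ccontr)
    assume "\<not> norm x \<le> R"
    then have "?f' x = 0"
      by (intro frechet_derivative_eq_0_outside[of "cball 0 R"]) (use R in auto)
    with that show False by simp
  qed
  show int': "integrable lborel ?f'"
    using c(2) f'R by (rule integrable_continuous_bounded_support)
  have int: "integrable lborel f"
    using c(1) R by (rule integrable_continuous_bounded_support)
  have "bounded (?f' ` cball 0 R)"
    by (intro compact_imp_bounded compact_continuous_image continuous_on_subset[OF c(2)]) auto
  then obtain M where M: "M > 0" "\<And>x. norm x \<le> R \<Longrightarrow> norm (?f' x) \<le> M"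
    unfolding bounded_pos by auto
  then have M': "norm (?f' x) \<le> M" for x
    using f'R[of x] by (cases "?f' x = 0") auto
  define t where "t n = 1 / real (Suc n)" for n
  have t: "0 < t n" "t n \<le> 1" for n
    by (auto simp: t_def)
  let ?q = "\<lambda>n x. (f (x + t n *\<^sub>R e) - f x) /\<^sub>R t n"
  have "(\<lambda>n. integral\<^sup>L lborel (?q n)) \<longlonglongrightarrow> integral\<^sup>L lborel ?f'"
  \<comment> \<open>Step sizes are at most 1, so all quotients vanish outside the ball enlarged by
    \<open>norm e\<close>; the mean value inequality bounds them by \<open>M\<close>.\<close>
  proof (rule integral_dominated_convergence[where w="\<lambda>x. M * indicator (cball 0 (R + norm e)) x"])
    show "?f' \<in> borel_measurable lborel" "?q n \<in> borel_measurable lborel" for n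
      using c by (auto intro!: borel_measurable_continuous_onI continuous_intros
          continuous_on_compose2[OF c(1)])
    have "integrable lborel (indicator (cball (0::'a) (R + norm e)) :: _ \<Rightarrow> real)"
      using emeasure_lborel_cball_finite[of "0::'a" "R + norm e"] by (intro integrable_real_indicator) auto
    then show "integrable lborel (\<lambda>x. M * indicator (cball (0::'a) (R + norm e)) x)"
      by simp
    show "AE x in lborel. (\<lambda>n. ?q n x) \<longlonglongrightarrow> ?f' x"
      using derivative_difference_quotient[OF C1_on_has_derivative[OF f]]
      by (intro AE_I2) (auto simp: t_def)
    show "AE x in lborel. norm (?q n x) \<le> M * indicator (cball 0 (R + norm e)) x" for n
    proof (rule AE_I2)
      fix x
      show "norm (?q n x) \<le> M * indicator (cball 0 (R + norm e)) x"
      proof (cases "norm x \<le> R + norm e")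
        case True
        then show ?thesis
          using C1_difference_bound[OF f M', of x "t n"] t[of n] by (simp add: divide_simps mult.commute)
      next
        case False
        have "norm x \<le> norm (x + t n *\<^sub>R e) + norm e"
        proof -
          have "norm x \<le> norm (x + t n *\<^sub>R e) + norm (t n *\<^sub>R e)"
            using norm_triangle_ineq4[of "x + t n *\<^sub>R e" "t n *\<^sub>R e"] by simp
          also have "norm (t n *\<^sub>R e) \<le> norm e"
            using t[of n] by (simp add: mult_left_le_one_le)
          finally show ?thesis by simp
        qed
        with False have "f (x + t n *\<^sub>R e) = 0" "f x = 0"
          using R[of x] R[of "x + t n *\<^sub>R e"] norm_ge_zero[of e] by linarith+
        then show ?thesis using M by simp
      qed
    qed
  qed
  moreover have "integral\<^sup>L lborel (?q n) = 0" for n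
    using lborel_integrable_translation[OF int, of "t n *\<^sub>R e"] int
    by (simp add: add.commute Bochner_Integration.integral_diff)
  ultimately show "integral\<^sup>L lborel ?f' = 0"
    using LIMSEQ_unique[OF _ tendsto_const] by (simp only:)
qed

section \<open>Mollification in L2\<close>

text \<open>The form taken by density arguments: the null sequence \<open>b\<close> belongs to an
  approximant chosen for the given \<open>e\<close>, and \<open>c\<close> is the approximation
  error, which does not depend on \<open>n\<close>.\<close>

lemma tendsto_zero_approximation:
  fixes a :: "nat \<Rightarrow> real"
  assumes "\<And>e. e > 0 \<Longrightarrow> \<exists>b c. b \<longlonglongrightarrow> 0 \<and> c \<le> e \<and> (\<forall>n. \<bar>a n\<bar> \<le> b n + c)"
  shows "a \<longlonglongrightarrow> 0"
proof (rule LIMSEQ_I)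
  fix r :: real assume "r > 0"
  then obtain b c where b: "b \<longlonglongrightarrow> 0" "c \<le> r / 2" "\<And>n. \<bar>a n\<bar> \<le> b n + c"
    using assms[of "r / 2"] by auto
  obtain N where "\<And>n. n \<ge> N \<Longrightarrow> \<bar>b n\<bar> < r / 2"
    using LIMSEQ_D[OF b(1), of "r / 2"] \<open>r > 0\<close> by auto
  then have "norm (a n - 0) < r" if "n \<ge> N" for n
    using that b(2) b(3)[of n] by fastforce
  then show "\<exists>no. \<forall>n\<ge>no. norm (a n - 0) < r" by blast
qed

text \<open>The factor 2 counts the error \<open>f - g\<close> once at \<open>x\<close> and once at
  \<open>h + x\<close>; both have the same integral by translation invariance.\<close>

lemma translation_L1_approx:
  fixes f g :: "'a::euclidean_space \<Rightarrow> 'b::{banach,second_countable_topology}"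
  assumes f: "integrable lborel f" and g: "integrable lborel g"
  shows "(\<integral>x. norm (f (h + x) - f x) \<partial>lborel) \<le>
    (\<integral>x. norm (g (h + x) - g x) \<partial>lborel) + 2 * (\<integral>x. norm (f x - g x) \<partial>lborel)"
proof -
  note i = lborel_integrable_translation(1)
  have d: "integrable lborel (\<lambda>x. norm (f x - g x))"
    using f g by auto
  have "(\<integral>x. norm (f (h + x) - f x) \<partial>lborel) \<le>
    (\<integral>x. norm (g (h + x) - g x) + norm (f (h + x) - g (h + x)) + norm (f x - g x) \<partial>lborel)"
  proof (rule integral_mono)
    fix x
    have "f (h + x) - f x = (g (h + x) - g x) + (f (h + x) - g (h + x)) - (f x - g x)" by simp
    then show "norm (f (h + x) - f x) \<le> norm (g (h + x) - g x) + norm (f (h + x) - g (h + x)) + norm (f x - g x)"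
      by (metis (no_types, lifting) norm_triangle_ineq norm_triangle_ineq4 order_trans add_right_mono)
  qed (use i[OF f] i[OF g] f g in auto)
  also have "\<dots> = (\<integral>x. norm (g (h + x) - g x) \<partial>lborel)
      + (\<integral>x. norm (f (h + x) - g (h + x)) \<partial>lborel) + (\<integral>x. norm (f x - g x) \<partial>lborel)"
    using i[OF f] i[OF g] f g by simp
  also have "(\<integral>x. norm (f (h + x) - g (h + x)) \<partial>lborel) = (\<integral>x. norm (f x - g x) \<partial>lborel)"
    using lborel_integrable_translation(2)[OF d] by simp
  finally show ?thesis by simp
qed

text \<open>The indicator of an open set is lower semicontinuous, so pointwise convergence is
  available only for the part where \<open>x\<close> lies in \<open>U\<close> and
  \<open>h n + x\<close> does not. Since a set and its translate have the same measure, this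
  one-sided part is exactly half of the whole.\<close>

lemma translation_L1_open:
  fixes U :: "'a::euclidean_space set"
  assumes U: "open U" "emeasure lborel U < \<infinity>" and h: "h \<longlonglongrightarrow> 0"
  shows "(\<lambda>n. \<integral>x. \<bar>indicator U (h n + x) - indicator U x :: real\<bar> \<partial>lborel) \<longlonglongrightarrow> 0"
proof -
  let ?i = "indicator U :: 'a \<Rightarrow> real"
  have i: "integrable lborel ?i"
    using U by (intro integrable_real_indicator) auto
  note it = lborel_integrable_translation[OF i]
  have "(\<lambda>n. \<integral>x. max 0 (?i x - ?i (h n + x)) \<partial>lborel) \<longlonglongrightarrow> (\<integral>x. 0 \<partial>(lborel :: 'a measure))"
  proof (rule integral_dominated_convergence[OF _ _ i])
    show "AE x in lborel. (\<lambda>n. max 0 (?i x - ?i (h n + x))) \<longlonglongrightarrow> 0"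
    proof (rule AE_I2)
      fix x
      show "(\<lambda>n. max 0 (?i x - ?i (h n + x))) \<longlonglongrightarrow> 0"
      proof (cases "x \<in> U")
        case True
        have "(\<lambda>n. h n + x) \<longlonglongrightarrow> 0 + x"
          by (intro tendsto_intros h)
        then have "\<forall>\<^sub>F n in sequentially. h n + x \<in> U"
          using U(1) True by (auto dest: topological_tendstoD)
        then show ?thesis
          by (intro tendsto_eventually) (auto elim!: eventually_mono simp: indicator_def)
      next
        case False
        then have "max 0 (?i x - ?i (h n + x)) = 0" for n
          by (simp add: indicator_def)
        then show ?thesis by simp
      qed
    qed
    show "(\<lambda>x. max 0 (?i x - ?i (h n + x))) \<in> borel_measurable lborel" for n
      using borel_measurable_integrable[OF i] borel_measurable_integrable[OF it(1)] by measurable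
  qed (auto simp: indicator_def max_def)
  then have "(\<lambda>n. 2 * (\<integral>x. max 0 (?i x - ?i (h n + x)) \<partial>lborel)) \<longlonglongrightarrow> 0"
    by (auto intro: tendsto_eq_intros)
  moreover have "(\<integral>x. \<bar>?i (h n + x) - ?i x\<bar> \<partial>lborel) = 2 * (\<integral>x. max 0 (?i x - ?i (h n + x)) \<partial>lborel)" for n
  proof -
    have m: "integrable lborel (\<lambda>x. max 0 (?i x - ?i (h n + x)))"
      using i it(1) by (intro integrable_max integrable_zero Bochner_Integration.integrable_diff)
    have "(\<integral>x. \<bar>?i (h n + x) - ?i x\<bar> \<partial>lborel) =
        (\<integral>x. 2 * max 0 (?i x - ?i (h n + x)) + (?i (h n + x) - ?i x) \<partial>lborel)"
      by (rule Bochner_Integration.integral_cong) (auto simp: indicator_def max_def)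
    also have "\<dots> = 2 * (\<integral>x. max 0 (?i x - ?i (h n + x)) \<partial>lborel) + ((\<integral>x. ?i (h n + x) \<partial>lborel) - integral\<^sup>L lborel ?i)"
      using m i it(1)[of "h n"] by (simp add: Bochner_Integration.integral_add Bochner_Integration.integral_diff)
    finally show ?thesis using it(2) by simp
  qed
  ultimately show ?thesis by simp
qed

text \<open>Induction over integrable functions: open sets approximate a measurable set from
  outside, sums follow from the triangle inequality, and limits from dominated convergence.\<close>

lemma translation_L1_continuous:
  fixes f :: "'a::euclidean_space \<Rightarrow> 'b::{banach,second_countable_topology}"
  assumes f: "integrable lborel f" and h: "h \<longlonglongrightarrow> 0"
  shows "(\<lambda>n. \<integral>x. norm (f (h n + x) - f x) \<partial>lborel) \<longlonglongrightarrow> 0"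
  using f
proof (induction rule: integrable_induct)
  case (base A c)
  have A: "A \<in> sets lebesgue"
    using base(1) sets_completionI_sets by auto
  let ?T = "\<lambda>A n. \<integral>x. \<bar>indicator A (h n + x) - indicator A x :: real\<bar> \<partial>lborel"
  have "?T A \<longlonglongrightarrow> 0"
  proof (rule tendsto_zero_approximation)
    fix e :: real assume "e > 0"
    then obtain U where U: "open U" "A \<subseteq> U" "U - A \<in> lmeasurable" "emeasure lebesgue (U - A) < ennreal (e / 2)"
      using sets_lebesgue_outer_open[OF A, of "e / 2"] by auto
    have UA: "U - A \<in> sets borel" and A': "A \<in> sets borel"
      using U(1) base(1) by auto
    then have le: "emeasure lborel (U - A) < ennreal (e / 2)"
      using U(4) by simp
    have "emeasure lborel U \<le> emeasure lborel (U - A) + emeasure lborel A"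
      using UA A' U(2) by (subst plus_emeasure) (auto simp: Un_absorb2)
    also have "\<dots> < \<infinity>"
      using le base(2) by (auto simp: ennreal_add_less_top intro: less_trans)
    finally have Ufin: "emeasure lborel U < \<infinity>" .
    have eq: "norm (indicator A x - indicator U x :: real) = indicator (U - A) x" for x :: 'a
      using U(2) by (auto simp: indicator_def)
    have "?T A n \<le> ?T U n + 2 * (\<integral>x. norm (indicator A x - indicator U x :: real) \<partial>lborel)" for n
      unfolding real_norm_def[symmetric]
      by (rule translation_L1_approx) (use Ufin U(1) A' base(2) in \<open>auto intro!: integrable_real_indicator\<close>)
    also have "(\<integral>x. norm (indicator A x - indicator U x :: real) \<partial>lborel) = measure lborel (U - A)"
      unfolding eq using UA by simp
    finally have *: "?T A n \<le> ?T U n + 2 * measure lborel (U - A)" for n .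
    have "measure lborel (U - A) \<le> e / 2"
      using le \<open>e > 0\<close> unfolding measure_def by (intro enn2real_leI) auto
    with * translation_L1_open[OF U(1) Ufin h]
    show "\<exists>b c. b \<longlonglongrightarrow> 0 \<and> c \<le> e \<and> (\<forall>n. \<bar>?T A n\<bar> \<le> b n + c)"
      by (intro exI[where x="?T U"] exI[where x="2 * measure lborel (U - A)"]) auto
  qed
  then have "(\<lambda>n. ?T A n * norm c) \<longlonglongrightarrow> 0"
    by (auto intro: tendsto_eq_intros)
  then show ?case
    by (simp flip: scaleR_diff_left)
next
  case (add f g)
  note i = lborel_integrable_translation(1)
  let ?T = "\<lambda>f n. \<integral>x. norm (f (h n + x) - f x) \<partial>lborel"
  show ?case
  proof (rule tendsto_sandwich[OF _ _ tendsto_const])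
    show "(\<lambda>n. ?T f n + ?T g n) \<longlonglongrightarrow> 0"
      using tendsto_add[OF add(3,4)] by simp
    show "\<forall>\<^sub>F n in sequentially. ?T (\<lambda>x. f x + g x) n \<le> ?T f n + ?T g n"
    proof (intro always_eventually allI)
      fix n
      have "?T (\<lambda>x. f x + g x) n \<le> (\<integral>x. norm (f (h n + x) - f x) + norm (g (h n + x) - g x) \<partial>lborel)"
      proof (rule integral_mono)
        show "norm (f (h n + x) + g (h n + x) - (f x + g x)) \<le> norm (f (h n + x) - f x) + norm (g (h n + x) - g x)" for x
          by (simp add: add_diff_add norm_triangle_ineq)
      qed (use i[OF add(1)] i[OF add(2)] add(1,2) in auto)
      also have "\<dots> = ?T f n + ?T g n"
        using i[OF add(1)] i[OF add(2)] add(1,2) by simp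
      finally show "?T (\<lambda>x. f x + g x) n \<le> ?T f n + ?T g n" .
    qed
  qed auto
next
  case (lim f s)
  let ?T = "\<lambda>f n. \<integral>x. norm (f (h n + x) - f x) \<partial>lborel"
  have "(\<lambda>i. \<integral>x. norm (f x - s i x) \<partial>lborel) \<longlonglongrightarrow> (\<integral>x. 0 \<partial>(lborel :: 'a measure))"
  \<comment> \<open>The approximants of the induction satisfy
    \<open>norm (s i x) \<le> 2 * norm (f x)\<close>, hence the factor 3.\<close>
  proof (rule integral_dominated_convergence[where w="\<lambda>x. 3 * norm (f x)"])
    show "AE x in lborel. (\<lambda>i. norm (f x - s i x)) \<longlonglongrightarrow> 0"
    proof (rule AE_I2)
      fix x :: 'a
      have "(\<lambda>i. f x - s i x) \<longlonglongrightarrow> f x - f x"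
        by (intro tendsto_intros lim) auto
      then show "(\<lambda>i. norm (f x - s i x)) \<longlonglongrightarrow> 0"
        by (simp add: tendsto_norm_zero)
    qed
    show "AE x in lborel. norm (norm (f x - s i x)) \<le> 3 * norm (f x)" for i
    proof (rule AE_I2)
      fix x :: 'a
      have "norm (f x - s i x) \<le> norm (f x) + norm (s i x)"
        by (rule norm_triangle_ineq4)
      also have "norm (s i x) \<le> 2 * norm (f x)"
        using lim(3)[of x i] by simp
      finally show "norm (norm (f x - s i x)) \<le> 3 * norm (f x)" by simp
    qed
  qed (use lim(1,4) in auto)
  then have l: "(\<lambda>i. \<integral>x. norm (f x - s i x) \<partial>lborel) \<longlonglongrightarrow> 0"
    by simp
  show ?case
  proof (rule tendsto_zero_approximation)
    fix e :: real assume "e > 0"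
    then obtain i where i: "\<bar>\<integral>x. norm (f x - s i x) \<partial>lborel\<bar> < e / 2"
      using LIMSEQ_D[OF l, of "e / 2"] by auto
    with lim(5)[of i] translation_L1_approx[OF lim(4) lim(1)[of i]]
    show "\<exists>b c. b \<longlonglongrightarrow> 0 \<and> c \<le> e \<and> (\<forall>n. \<bar>?T f n\<bar> \<le> b n + c)"
      by (intro exI[where x="?T (s i)"] exI[where x="2 * (\<integral>x. norm (f x - s i x) \<partial>lborel)"]) auto
  qed
qed

lemma norm_add3_square_le:
  "(norm (a + b + c))\<^sup>2 \<le> 3 * ((norm a)\<^sup>2 + (norm b)\<^sup>2 + (norm c)\<^sup>2)"
proof -
  have "(norm (a + b + c))\<^sup>2 \<le> (norm a + norm b + norm c)\<^sup>2"
    by (intro power_mono order_trans[OF norm_triangle_ineq add_right_mono] norm_triangle_ineq norm_ge_zero)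
  also have "\<dots> \<le> 3 * ((norm a)\<^sup>2 + (norm b)\<^sup>2 + (norm c)\<^sup>2)"
    using sum_squares_bound[of "norm a" "norm b"] sum_squares_bound[of "norm a" "norm c"]
      sum_squares_bound[of "norm b" "norm c"]
    by (simp add: power2_eq_square algebra_simps)
  finally show ?thesis .
qed

lemma norm_diff_square_le: "(norm (a - b))\<^sup>2 \<le> 2 * ((norm a)\<^sup>2 + (norm b)\<^sup>2)"
proof -
  have "(norm (a - b))\<^sup>2 \<le> (norm a + norm b)\<^sup>2"
    by (intro power_mono norm_triangle_ineq4 norm_ge_zero)
  also have "\<dots> \<le> 2 * ((norm a)\<^sup>2 + (norm b)\<^sup>2)"
    using sum_squares_bound[of "norm a" "norm b"] by (simp add: power2_eq_square algebra_simps)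
  finally show ?thesis .
qed

lemma integrable_norm_diff_square:
  fixes f g :: "'a \<Rightarrow> 'b::{banach,second_countable_topology}"
  assumes "f \<in> borel_measurable M" "g \<in> borel_measurable M"
    "integrable M (\<lambda>x. (norm (f x))\<^sup>2)" "integrable M (\<lambda>x. (norm (g x))\<^sup>2)"
  shows "integrable M (\<lambda>x. (norm (f x - g x))\<^sup>2)"
  by (rule Bochner_Integration.integrable_bound[where f="\<lambda>x. 2 * ((norm (f x))\<^sup>2 + (norm (g x))\<^sup>2)"])
    (use assms norm_diff_square_le in auto)

text \<open>Truncation at height \<open>m\<close> reduces L2 to L1: for two values bounded by
  \<open>m\<close>, the square of the norm of their difference is at most \<open>2 * m\<close> times
  that norm. The part cut off is small in L2 by dominated convergence.\<close>

lemma translation_L2_continuous_sequence: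
  fixes f :: "'a::euclidean_space \<Rightarrow> 'b::{banach,second_countable_topology}"
  assumes f: "integrable lborel f" and f2: "integrable lborel (\<lambda>x. (norm (f x))\<^sup>2)" and h: "h \<longlonglongrightarrow> 0"
  shows "(\<lambda>n. \<integral>x. (norm (f (h n + x) - f x))\<^sup>2 \<partial>lborel) \<longlonglongrightarrow> 0"
proof (rule tendsto_zero_approximation)
  fix e :: real assume e: "e > 0"
  have [measurable]: "f \<in> borel_measurable borel"
    using f borel_measurable_integrable by auto
  define g where "g m x = indicator {x. norm (f x) \<le> real m} x *\<^sub>R f x" for m x
  have [measurable]: "g m \<in> borel_measurable borel" for m
    unfolding g_def[abs_def] by measurable
  have gle: "norm (g m x) \<le> norm (f x)" "norm (g m x) \<le> real m" for m x
    by (auto simp: g_def indicator_def)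
  have dle: "norm (f x - g m x) \<le> norm (f x)" for m x
    by (auto simp: g_def indicator_def)
  have gi: "integrable lborel (g m)" for m
    by (rule Bochner_Integration.integrable_bound[OF f]) (use gle in auto)
  have di: "integrable lborel (\<lambda>x. (norm (f x - g m x))\<^sup>2)" for m
    by (rule Bochner_Integration.integrable_bound[OF f2]) (use dle in \<open>auto simp: power_mono\<close>)
  have "(\<lambda>m. \<integral>x. (norm (f x - g m x))\<^sup>2 \<partial>lborel) \<longlonglongrightarrow> (\<integral>x. 0 \<partial>(lborel :: 'a measure))"
  proof (rule integral_dominated_convergence[OF _ _ f2])
    show "AE x in lborel. (\<lambda>m. (norm (f x - g m x))\<^sup>2) \<longlonglongrightarrow> 0"
    proof (intro AE_I2 tendsto_eventually)
      fix x
      show "\<forall>\<^sub>F m in sequentially. (norm (f x - g m x))\<^sup>2 = 0"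
        using eventually_ge_at_top[of "nat \<lceil>norm (f x)\<rceil>"]
        by eventually_elim (auto simp: g_def indicator_def of_nat_ceiling nat_le_iff ceiling_le_iff not_le)
    qed
  qed (use dle in \<open>auto simp: power_mono\<close>)
  then have l: "(\<lambda>m. \<integral>x. (norm (f x - g m x))\<^sup>2 \<partial>lborel) \<longlonglongrightarrow> 0"
    by simp
  \<comment> \<open>The tail appears at \<open>x\<close> and at \<open>h n + x\<close>, each time
    with the factor 3 from squaring a sum of three terms; hence \<open>e / 6\<close>.\<close>
  then obtain m where m: "(\<integral>x. (norm (f x - g m x))\<^sup>2 \<partial>lborel) < e / 6"
    using LIMSEQ_D[OF l, of "e / 6"] e by force
  let ?b = "\<lambda>n. 6 * real m * (\<integral>x. norm (g m (h n + x) - g m x) \<partial>lborel)"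
  have "?b \<longlonglongrightarrow> 0"
    by (rule tendsto_mult_right_zero) (rule translation_L1_continuous[OF gi h])
  moreover have "\<bar>\<integral>x. (norm (f (h n + x) - f x))\<^sup>2 \<partial>lborel\<bar> \<le> ?b n + 6 * (\<integral>x. (norm (f x - g m x))\<^sup>2 \<partial>lborel)" for n
  proof -
    note gt = lborel_integrable_translation(1)[OF gi[of m], of "h n"]
    note dt = lborel_integrable_translation[OF di[of m], of "h n"]
    note ft = lborel_integrable_translation(1)[OF f2, of "h n"]
    have "(\<integral>x. (norm (f (h n + x) - f x))\<^sup>2 \<partial>lborel) \<le>
      (\<integral>x. 6 * real m * norm (g m (h n + x) - g m x) + (3 * (norm (f (h n + x) - g m (h n + x)))\<^sup>2
         + 3 * (norm (f x - g m x))\<^sup>2) \<partial>lborel)"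
    proof (rule integral_mono)
      show "integrable lborel (\<lambda>x. (norm (f (h n + x) - f x))\<^sup>2)"
        using ft f2 by (intro integrable_norm_diff_square) auto
      fix x
      have "f (h n + x) - f x = (g m (h n + x) - g m x) + (f (h n + x) - g m (h n + x)) + (g m x - f x)"
        by simp
      then have "(norm (f (h n + x) - f x))\<^sup>2 \<le> 3 * ((norm (g m (h n + x) - g m x))\<^sup>2
          + (norm (f (h n + x) - g m (h n + x)))\<^sup>2 + (norm (g m x - f x))\<^sup>2)"
        using norm_add3_square_le by metis
      moreover have "(norm (g m (h n + x) - g m x))\<^sup>2 \<le> 2 * real m * norm (g m (h n + x) - g m x)"
      proof -
        have "norm (g m (h n + x) - g m x) \<le> 2 * real m"
          using norm_triangle_ineq4[of "g m (h n + x)" "g m x"] gle(2)[of m "h n + x"] gle(2)[of m x] by linarith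
        then show ?thesis
          unfolding power2_eq_square by (rule mult_right_mono) simp
      qed
      ultimately show "(norm (f (h n + x) - f x))\<^sup>2 \<le> 6 * real m * norm (g m (h n + x) - g m x)
          + (3 * (norm (f (h n + x) - g m (h n + x)))\<^sup>2 + 3 * (norm (f x - g m x))\<^sup>2)"
        by (simp add: norm_minus_commute[of "g m x"])
    qed (use gi gt di dt in auto)
    also have "\<dots> = ?b n + (3 * (\<integral>x. (norm (f (h n + x) - g m (h n + x)))\<^sup>2 \<partial>lborel)
        + 3 * (\<integral>x. (norm (f x - g m x))\<^sup>2 \<partial>lborel))"
      using gi gt di dt by (simp add: Bochner_Integration.integral_add)
    finally show ?thesis
      using dt(2) by simp
  qed
  ultimately show "\<exists>b c. b \<longlonglongrightarrow> 0 \<and> c \<le> e \<and> (\<forall>n. \<bar>\<integral>x. (norm (f (h n + x) - f x))\<^sup>2 \<partial>lborel\<bar> \<le> b n + c)"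
    using m by (intro exI[where x="?b"] exI[where x="6 * (\<integral>x. (norm (f x - g m x))\<^sup>2 \<partial>lborel)"]) auto
qed

lemma translation_L2_continuous:
  fixes f :: "'a::euclidean_space \<Rightarrow> 'b::{banach,second_countable_topology}"
  assumes f: "integrable lborel f" and f2: "integrable lborel (\<lambda>x. (norm (f x))\<^sup>2)" and e: "e > 0"
  obtains d where "d > 0" "\<And>h. norm h < d \<Longrightarrow> (\<integral>x. (norm (f (h + x) - f x))\<^sup>2 \<partial>lborel) < e"
proof -
  have "\<forall>\<^sub>F h in nhds 0. (\<integral>x. (norm (f (h + x) - f x))\<^sup>2 \<partial>lborel) < e"
    unfolding eventually_nhds_iff_sequentially
    using order_tendstoD(2)[OF translation_L2_continuous_sequence[OF f f2] e] by simp
  then show ?thesis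
    using that unfolding eventually_nhds_metric by (auto simp: dist_norm)
qed

text \<open>The kernel is taken at \<open>y - x\<close>, reflected with respect to the usual
  convolution: a kernel concentrated near a vector \<open>a\<close> makes \<open>conv k f x\<close>
  an average of \<open>f\<close> near \<open>x + a\<close>. Derivatives in \<open>x\<close>
  therefore produce a minus sign.\<close>

definition conv :: "('a::euclidean_space \<Rightarrow> real) \<Rightarrow> ('a \<Rightarrow> 'b::{banach,second_countable_topology}) \<Rightarrow> 'a \<Rightarrow> 'b" where
  "conv k f x = (\<integral>y. k (y - x) *\<^sub>R f y \<partial>lborel)"

lemma integrable_kernel_scaleR:
  fixes f :: "'a::euclidean_space \<Rightarrow> 'b::{banach,second_countable_topology}"
  assumes "integrable lborel f" "k \<in> borel_measurable borel" "\<And>z. \<bar>k z\<bar> \<le> B"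
  shows "integrable lborel (\<lambda>y. k (y - x) *\<^sub>R f y)"
proof (rule Bochner_Integration.integrable_bound[where f="\<lambda>y. B *\<^sub>R f y"])
  show "AE y in lborel. norm (k (y - x) *\<^sub>R f y) \<le> norm (B *\<^sub>R f y)"
    using assms(3) by (auto intro!: AE_I2 mult_right_mono order_trans[OF _ abs_ge_self])
  have [measurable]: "f \<in> borel_measurable borel" "k \<in> borel_measurable borel"
    using assms borel_measurable_integrable by auto
  show "(\<lambda>y. k (y - x) *\<^sub>R f y) \<in> borel_measurable lborel" by simp
qed (use assms(1) in auto)

text \<open>Jensen's inequality for the probability density \<open>k\<close>, obtained by
  Cauchy-Schwarz after writing \<open>k\<close> as the product of two square roots; one of the
  resulting factors is the integral of \<open>k\<close>, which is 1.\<close>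

lemma conv_square_error_le:
  fixes f :: "'a::euclidean_space \<Rightarrow> 'b::{banach,second_countable_topology}"
  assumes f: "integrable lborel f" and k: "k \<in> borel_measurable borel" "\<And>z. \<bar>k z\<bar> \<le> B" "\<And>z. 0 \<le> k z"
    "integrable lborel k" "integral\<^sup>L lborel k = 1"
  shows "ennreal ((norm (conv k f x - f x))\<^sup>2) \<le> (\<integral>\<^sup>+z. ennreal (k z) * ennreal ((norm (f (z + x) - f x))\<^sup>2) \<partial>lborel)"
proof -
  have [measurable]: "f \<in> borel_measurable borel" "k \<in> borel_measurable borel"
    using f k borel_measurable_integrable by auto
  note i = integrable_kernel_scaleR[OF f k(1,2), of x]
  note it = lborel_integrable_translation[OF i, of x]
  have "conv k f x - f x = (\<integral>z. k z *\<^sub>R f (z + x) \<partial>lborel) - (\<integral>z. k z *\<^sub>R f x \<partial>lborel)"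
    using it(2) k(4,5) by (simp add: conv_def add.commute)
  also have "\<dots> = (\<integral>z. k z *\<^sub>R (f (z + x) - f x) \<partial>lborel)"
    unfolding scaleR_diff_right
    by (rule Bochner_Integration.integral_diff[symmetric]) (use it(1) k(4) in \<open>auto simp: add.commute\<close>)
  finally have eq: "conv k f x - f x = (\<integral>z. k z *\<^sub>R (f (z + x) - f x) \<partial>lborel)" .
  have int: "integrable lborel (\<lambda>z. k z *\<^sub>R (f (z + x) - f x))"
    unfolding scaleR_diff_right
    by (rule Bochner_Integration.integrable_diff) (use it(1) k(4) in \<open>auto simp: add.commute\<close>)
  let ?F = "\<lambda>z. ennreal (sqrt (k z))" and ?G = "\<lambda>z. ennreal (sqrt (k z) * norm (f (z + x) - f x))"
  have "ennreal (norm (conv k f x - f x)) \<le> (\<integral>\<^sup>+z. ?F z * ?G z \<partial>lborel)"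
  proof -
    have "ennreal (norm (conv k f x - f x)) \<le> (\<integral>\<^sup>+z. ennreal (norm (k z *\<^sub>R (f (z + x) - f x))) \<partial>lborel)"
      unfolding eq by (rule integral_norm_bound_ennreal[OF int])
    also have "\<dots> = (\<integral>\<^sup>+z. ?F z * ?G z \<partial>lborel)"
      using k(3) by (intro nn_integral_cong)
        (auto simp: ennreal_mult[symmetric] mult.assoc[symmetric] real_sqrt_mult_self simp del: ennreal_mult')
    finally show ?thesis .
  qed
  then have "(ennreal (norm (conv k f x - f x)))\<^sup>2 \<le> (\<integral>\<^sup>+z. ?F z * ?G z \<partial>lborel)\<^sup>2"
    by (rule power_mono) simp
  also have "\<dots> \<le> (\<integral>\<^sup>+z. (?F z)\<^sup>2 \<partial>lborel) * (\<integral>\<^sup>+z. (?G z)\<^sup>2 \<partial>lborel)"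
    by (rule Cauchy_Schwarz_nn_integral) auto
  also have "(\<integral>\<^sup>+z. (?F z)\<^sup>2 \<partial>lborel) = (\<integral>\<^sup>+z. ennreal (k z) \<partial>lborel)"
    using k(3) by (simp add: ennreal_power)
  also have "\<dots> = 1"
    using k by (simp add: nn_integral_eq_integral)
  also have "(\<integral>\<^sup>+z. (?G z)\<^sup>2 \<partial>lborel) = (\<integral>\<^sup>+z. ennreal (k z) * ennreal ((norm (f (z + x) - f x))\<^sup>2) \<partial>lborel)"
    using k(3) by (simp add: ennreal_power power_mult_distrib ennreal_mult)
  finally show ?thesis
    by (simp add: ennreal_power)
qed

text \<open>Fubini turns the error into an average of translation errors over the support of the
  kernel. The radius \<open>d\<close> depends on \<open>f\<close> and \<open>e\<close> alone, and
  the kernel may sit anywhere in the ball of radius \<open>d\<close>, not only symmetrically around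
  0.\<close>

lemma conv_L2_error:
  fixes f :: "'a::euclidean_space \<Rightarrow> 'b::{banach,second_countable_topology}"
  assumes f: "integrable lborel f" and f2: "integrable lborel (\<lambda>x. (norm (f x))\<^sup>2)" and e: "e > 0"
  obtains d where "d > 0"
    "\<And>k B. \<lbrakk>k \<in> borel_measurable borel; \<And>z. \<bar>k z\<bar> \<le> B; \<And>z. 0 \<le> k z;
       integrable lborel k; integral\<^sup>L lborel k = 1; \<And>z. k z \<noteq> 0 \<Longrightarrow> norm z < d\<rbrakk>
     \<Longrightarrow> (\<integral>\<^sup>+x. ennreal ((norm (conv k f x - f x))\<^sup>2) \<partial>lborel) \<le> ennreal e"
proof -
  obtain d where d: "d > 0" "\<And>h. norm h < d \<Longrightarrow> (\<integral>x. (norm (f (h + x) - f x))\<^sup>2 \<partial>lborel) < e"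
    using translation_L2_continuous[OF f f2 e] by blast
  have [measurable]: "f \<in> borel_measurable borel"
    using f borel_measurable_integrable by auto
  show ?thesis
  proof (rule that[OF d(1)])
    fix k :: "'a \<Rightarrow> real" and B
    assume k: "k \<in> borel_measurable borel" "\<And>z. \<bar>k z\<bar> \<le> B" "\<And>z. 0 \<le> k z"
       "integrable lborel k" "integral\<^sup>L lborel k = 1" and kd: "\<And>z. k z \<noteq> 0 \<Longrightarrow> norm z < d"
    note k(1)[measurable]
    have "(\<integral>\<^sup>+x. ennreal ((norm (conv k f x - f x))\<^sup>2) \<partial>lborel) \<le>
        (\<integral>\<^sup>+x. \<integral>\<^sup>+z. ennreal (k z) * ennreal ((norm (f (z + x) - f x))\<^sup>2) \<partial>lborel \<partial>lborel)"
      by (intro nn_integral_mono conv_square_error_le[OF f k])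
    also have "\<dots> = (\<integral>\<^sup>+z. \<integral>\<^sup>+x. ennreal (k z) * ennreal ((norm (f (z + x) - f x))\<^sup>2) \<partial>lborel \<partial>lborel)"
      by (rule lborel_pair.Fubini') measurable
    also have "\<dots> \<le> (\<integral>\<^sup>+z. ennreal (k z) * ennreal e \<partial>lborel)"
    proof (rule nn_integral_mono)
      fix z
      show "(\<integral>\<^sup>+x. ennreal (k z) * ennreal ((norm (f (z + x) - f x))\<^sup>2) \<partial>lborel) \<le> ennreal (k z) * ennreal e"
      proof (cases "k z = 0")
        case False
        have "integrable lborel (\<lambda>x. (norm (f (z + x) - f x))\<^sup>2)"
          using lborel_integrable_translation(1)[OF f2] f2 by (intro integrable_norm_diff_square) auto
        then have "(\<integral>\<^sup>+x. ennreal ((norm (f (z + x) - f x))\<^sup>2) \<partial>lborel) =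
            ennreal (\<integral>x. (norm (f (z + x) - f x))\<^sup>2 \<partial>lborel)"
          by (intro nn_integral_eq_integral) auto
        also have "\<dots> \<le> ennreal e"
          using d(2)[OF kd[OF False]] by (intro ennreal_leI) simp
        finally show ?thesis
          by (simp add: nn_integral_cmult mult_left_mono)
      qed simp
    qed
    also have "\<dots> = ennreal e"
      using k by (simp add: nn_integral_multc nn_integral_eq_integral)
    finally show "(\<integral>\<^sup>+x. ennreal ((norm (conv k f x - f x))\<^sup>2) \<partial>lborel) \<le> ennreal e" .
  qed
qed

lemma uniformly_continuous_bounded_support:
  fixes F :: "'a::euclidean_space \<Rightarrow> 'b::real_normed_vector"
  assumes "continuous_on UNIV F" "\<And>x. F x \<noteq> 0 \<Longrightarrow> norm x \<le> R" "e > 0"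
  obtains d where "d > 0" "\<And>x y. norm (x - y) < d \<Longrightarrow> norm (F x - F y) < e"
proof -
  have "uniformly_continuous_on (cball 0 (R + 1)) F"
    by (intro compact_uniformly_continuous continuous_on_subset[OF assms(1)]) auto
  then obtain d where d: "d > 0" "\<And>x y. x \<in> cball 0 (R + 1) \<Longrightarrow> y \<in> cball 0 (R + 1) \<Longrightarrow> dist y x < d \<Longrightarrow> dist (F y) (F x) < e"
    unfolding uniformly_continuous_on_def using assms(3) by meson
  show ?thesis
  proof (rule that[of "min d 1"])
    fix x y :: 'a assume xy: "norm (x - y) < min d 1"
    show "norm (F x - F y) < e"
    proof (cases "norm x \<le> R \<or> norm y \<le> R")
      case True
      have "norm x \<le> norm y + norm (x - y)" "norm y \<le> norm x + norm (x - y)"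
        using norm_triangle_sub[of x y] norm_triangle_sub[of y x] by (auto simp: norm_minus_commute)
      with True xy have "x \<in> cball 0 (R + 1)" "y \<in> cball 0 (R + 1)" by auto
      with d(2)[of y x] xy show ?thesis by (simp add: dist_norm)
    next
      case False
      with assms(2)[of x] assms(2)[of y] have "F x = 0" "F y = 0" by auto
      with assms(3) show ?thesis by simp
    qed
  qed (use d in auto)
qed

text \<open>Differentiation under the integral sign. The derivative of \<open>k\<close> is uniformly
  continuous, so the linearization error of \<open>k\<close> is small uniformly in the integration
  variable, and integration against \<open>f\<close> preserves this.\<close>

lemma
  fixes f :: "'a::euclidean_space \<Rightarrow> 'b::{banach,second_countable_topology}"
  assumes f: "integrable lborel f" and k: "C1_on UNIV k" and R: "\<And>z. k z \<noteq> 0 \<Longrightarrow> norm z \<le> R"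
  shows C1_on_conv: "C1_on UNIV (conv k f)"
    and frechet_derivative_conv: "frechet_derivative (conv k f) (at x) h =
      - (\<integral>y. frechet_derivative k (at (y - x)) h *\<^sub>R f y \<partial>lborel)"
proof -
  obtain k' where k': "\<And>z. (k has_derivative blinfun_apply (k' z)) (at z)" "continuous_on UNIV k'"
    using k unfolding C1_on_def by auto
  have fk: "frechet_derivative k (at z) = blinfun_apply (k' z)" for z
    using frechet_derivative_at[OF k'(1)] by simp
  have R': "norm z \<le> R" if "k' z \<noteq> 0" for z
  proof (rule ccontr)
    assume "\<not> norm z \<le> R"
    then have "frechet_derivative k (at z) h = 0" for h
      by (intro frechet_derivative_eq_0_outside[of "cball 0 R"]) (use R in auto)
    with fk have "k' z = 0"
      by (intro blinfun_eqI) auto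
    with that show False by simp
  qed
  have bounded_on: "\<exists>B. \<forall>z. norm (g z) \<le> B" if "continuous_on UNIV g" "\<And>z. g z \<noteq> 0 \<Longrightarrow> norm z \<le> R"
    for g :: "'a \<Rightarrow> 'c::real_normed_vector"
  proof -
    have "bounded (g ` cball 0 R)"
      by (intro compact_imp_bounded compact_continuous_image continuous_on_subset[OF that(1)]) auto
    then obtain B where "B > 0" "\<And>z. norm z \<le> R \<Longrightarrow> norm (g z) \<le> B"
      unfolding bounded_pos by auto
    then have "norm (g z) \<le> B" for z
      using that(2)[of z] by (cases "g z = 0") auto
    then show ?thesis by blast
  qed
  obtain B where B: "\<And>z. norm (k' z) \<le> B"
    using bounded_on[OF k'(2) R'] by blast
  obtain B0 where B0: "\<And>z. \<bar>k z\<bar> \<le> B0"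
    using bounded_on[OF C1_on_continuous[OF k] R] by auto
  have kb: "k \<in> borel_measurable borel"
    by (intro borel_measurable_continuous_onI C1_on_continuous[OF k])
  have ik: "integrable lborel (\<lambda>y. k (y - x) *\<^sub>R f y)" for x
    by (rule integrable_kernel_scaleR[OF f kb B0])
  have k'b: "(\<lambda>z. blinfun_apply (k' z) h) \<in> borel_measurable borel" for h
    by (intro borel_measurable_continuous_onI continuous_intros k')
  have ik': "integrable lborel (\<lambda>y. blinfun_apply (k' (y - x)) h *\<^sub>R f y)" for x h
  proof (rule integrable_kernel_scaleR[OF f k'b])
    show "\<bar>blinfun_apply (k' z) h\<bar> \<le> B * norm h" for z
      using norm_blinfun[of "k' z" h] mult_right_mono[OF B[of z] norm_ge_zero[of h]] by simp
  qed
  define g' where "g' x h = - (\<integral>y. blinfun_apply (k' (y - x)) h *\<^sub>R f y \<partial>lborel)" for x h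
  define N where "N = (\<integral>y. norm (f y) \<partial>lborel)"
  have N0: "N \<ge> 0" unfolding N_def by simp
  \<comment> \<open>Both the differentiability and the continuity estimate have this form: a uniform
    bound on the kernel factor times the L1 norm \<open>N\<close> of \<open>f\<close>.\<close>
  have key: "norm (\<integral>y. F y *\<^sub>R f y \<partial>lborel) \<le> b * N"
    if "integrable lborel (\<lambda>y. F y *\<^sub>R f y)" "\<And>y. \<bar>F y\<bar> \<le> b" for F :: "'a \<Rightarrow> real" and b
  proof -
    have "norm (\<integral>y. F y *\<^sub>R f y \<partial>lborel) \<le> (\<integral>y. norm (F y *\<^sub>R f y) \<partial>lborel)"
      by (rule integral_norm_bound)
    also have "\<dots> \<le> (\<integral>y. b * norm (f y) \<partial>lborel)"
    proof (rule integral_mono[OF integrable_norm[OF that(1)]])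
      show "norm (F y *\<^sub>R f y) \<le> b * norm (f y)" for y
        using that(2)[of y] by (simp add: mult_right_mono)
    qed (use f in auto)
    finally show ?thesis by (simp add: N_def)
  qed
  have lin: "bounded_linear (g' x)" for x
  proof
    show "g' x (a + b) = g' x a + g' x b" for a b
      unfolding g'_def using ik' by (simp add: blinfun.add_right scaleR_add_left)
    show "g' x (r *\<^sub>R b) = r *\<^sub>R g' x b" for r b
      unfolding g'_def by (simp add: blinfun.scaleR_right flip: scaleR_scaleR integral_scaleR_right)
    show "\<exists>K. \<forall>h. norm (g' x h) \<le> norm h * K"
    proof (intro exI allI)
      fix h
      have "norm (g' x h) \<le> (norm h * B) * N"
        unfolding g'_def norm_minus_cancel
      proof (rule key[OF ik'])
        show "\<bar>blinfun_apply (k' (y - x)) h\<bar> \<le> norm h * B" for y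
          using norm_blinfun[of "k' (y - x)" h] mult_right_mono[OF B[of "y - x"] norm_ge_zero[of h]]
          by (simp add: mult.commute)
      qed
      then show "norm (g' x h) \<le> norm h * (B * N)" by (simp add: mult.assoc)
    qed
  qed
  have unif: "\<exists>d>0. \<forall>x y. norm (x - y) < d \<longrightarrow> norm (k' x - k' y) \<le> e" if e: "e > 0" for e
  proof -
    obtain d where "d > 0" "\<And>x y. norm (x - y) < d \<Longrightarrow> norm (k' x - k' y) < e"
      using uniformly_continuous_bounded_support[OF k'(2) R' e] by blast
    then show ?thesis by (intro exI[of _ d]) (auto intro: less_imp_le)
  qed
  have der: "(conv k f has_derivative g' x) (at x)" for x
    unfolding has_derivative_at_alt
  proof (intro conjI lin allI impI)
    fix e :: real assume "e > 0"
    \<comment> \<open>The summand 1 covers the case \<open>N = 0\<close>.\<close>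
    define e' where "e' = e / (N + 1)"
    have e': "e' > 0" "e' * N \<le> e"
    proof -
      show "e' > 0" using \<open>e > 0\<close> N0 by (simp add: e'_def)
      show "e' * N \<le> e"
        using \<open>e > 0\<close> N0 by (simp add: e'_def pos_divide_le_eq mult_left_mono)
    qed
    obtain d where d: "d > 0" "\<And>x y. norm (x - y) < d \<Longrightarrow> norm (k' x - k' y) \<le> e'"
      using unif[OF e'(1)] by blast
    have "norm (conv k f y - conv k f x - g' x (y - x)) \<le> e * norm (y - x)" if y: "norm (y - x) < d" for y
    proof -
      let ?F = "\<lambda>z. k (z - y) - k (z - x) - blinfun_apply (k' (z - x)) (x - y)"
      have intF: "integrable lborel (\<lambda>z. ?F z *\<^sub>R f z)"
        unfolding scaleR_diff_left by (intro Bochner_Integration.integrable_diff ik ik')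
      have "conv k f y - conv k f x - g' x (y - x) = (\<integral>z. ?F z *\<^sub>R f z \<partial>lborel)"
      proof -
        have "g' x (y - x) = (\<integral>z. blinfun_apply (k' (z - x)) (x - y) *\<^sub>R f z \<partial>lborel)"
        proof -
          have "blinfun_apply (k' (z - x)) (x - y) = - blinfun_apply (k' (z - x)) (y - x)" for z
            by (simp flip: blinfun.minus_right)
          then show ?thesis unfolding g'_def by simp
        qed
        then show ?thesis
          unfolding conv_def scaleR_diff_left using ik ik' by simp
      qed
      also have "norm \<dots> \<le> (e' * norm (y - x)) * N"
      proof (rule key[OF intF])
        fix z
        have "norm (k (z - y) - k (z - x) - blinfun_apply (k' (z - x)) ((z - y) - (z - x))) \<le> norm ((z - y) - (z - x)) * e'"
        proof (rule differentiable_bound_linearization[where S="ball (z - x) d"])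
          show "z - x + t *\<^sub>R (z - y - (z - x)) \<in> ball (z - x) d" if "t \<in> {0..1}" for t
          proof -
            have "norm (t *\<^sub>R (x - y)) \<le> norm (y - x)"
              using that by (simp add: norm_minus_commute mult_left_le_one_le)
            then show ?thesis using y by (simp add: dist_norm)
          qed
          show "(k has_derivative blinfun_apply (k' w)) (at w within ball (z - x) d)" for w
            using k'(1) by (rule has_derivative_at_withinI)
          show "onorm (blinfun_apply (k' w) - blinfun_apply (k' (z - x))) \<le> e'" if "w \<in> ball (z - x) d" for w
            using d(2)[of w "z - x"] that unfolding norm_blinfun.rep_eq
            by (simp add: minus_blinfun.rep_eq dist_norm norm_minus_commute fun_diff_def)
        qed (use d in auto)
        then show "\<bar>?F z\<bar> \<le> e' * norm (y - x)"
          by (simp add: norm_minus_commute mult.commute)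
      qed
      also have "\<dots> \<le> e * norm (y - x)"
        using mult_right_mono[OF e'(2), of "norm (y - x)"] by (simp add: ac_simps)
      finally show ?thesis .
    qed
    then show "\<exists>d>0. \<forall>y. norm (y - x) < d \<longrightarrow> norm (conv k f y - conv k f x - g' x (y - x)) \<le> e * norm (y - x)"
      using d(1) by blast
  qed
  have "continuous_on UNIV (\<lambda>x. g' x h)" for h
    unfolding continuous_on_iff
  proof (intro ballI allI impI)
    fix x and e :: real assume "e > 0"
    define e' where "e' = e / (2 * (norm h * N + 1))"
    have e': "e' > 0" "e' * norm h * N < e"
    proof -
      have p: "norm h * N \<ge> 0" using N0 by simp
      then show "e' > 0" using \<open>e > 0\<close> by (simp add: e'_def)
      have "e' * (norm h * N) < e"
        using p \<open>e > 0\<close> mult_pos_pos[of e "norm h * N + 1"] by (simp add: e'_def field_simps) 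
      then show "e' * norm h * N < e" by (simp add: mult.assoc)
    qed
    obtain d where d: "d > 0" "\<And>x y. norm (x - y) < d \<Longrightarrow> norm (k' x - k' y) \<le> e'"
      using unif[OF e'(1)] by blast
    have "dist (g' y h) (g' x h) < e" if y: "dist y x < d" for y
    proof -
      let ?F = "\<lambda>z. blinfun_apply (k' (z - x)) h - blinfun_apply (k' (z - y)) h"
      have "g' y h - g' x h = (\<integral>z. ?F z *\<^sub>R f z \<partial>lborel)"
        unfolding g'_def scaleR_diff_left using ik' by simp
      also have "norm \<dots> \<le> (e' * norm h) * N"
      proof (rule key)
        show "integrable lborel (\<lambda>z. ?F z *\<^sub>R f z)"
          unfolding scaleR_diff_left by (intro Bochner_Integration.integrable_diff ik')
        show "\<bar>?F z\<bar> \<le> e' * norm h" for z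
          using norm_blinfun[of "k' (z - x) - k' (z - y)" h] y
            mult_right_mono[OF d(2)[of "z - x" "z - y"] norm_ge_zero[of h]]
          by (simp add: blinfun.diff_left dist_norm)
      qed
      finally show ?thesis using e'(2) by (simp add: dist_norm)
    qed
    then show "\<exists>d>0. \<forall>y\<in>UNIV. dist y x < d \<longrightarrow> dist (g' y h) (g' x h) < e"
      using d(1) by blast
  qed
  then show "C1_on UNIV (conv k f)"
    using der by (intro C1_onI)
  show "frechet_derivative (conv k f) (at x) h = - (\<integral>y. frechet_derivative k (at (y - x)) h *\<^sub>R f y \<partial>lborel)"
    using frechet_derivative_at[OF der[of x]] by (simp add: g'_def fk fun_eq_iff)
qed

text \<open>The centre \<open>c\<close> is left free because mollification up to the boundary needs
  kernels centred at a vector pointing into the domain.\<close>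

definition mollifier :: "'a::euclidean_space \<Rightarrow> real \<Rightarrow> 'a \<Rightarrow> real" where
  "mollifier c s x = bump c s x * inverse (integral\<^sup>L lborel (bump c s))"

lemma
  fixes c :: "'a::euclidean_space"
  assumes s: "s > 0"
  shows C1_on_mollifier: "C1_on S (mollifier c s)"
    and mollifier_nonneg: "0 \<le> mollifier c s x"
    and mollifier_eq_0: "x \<notin> ball c s \<Longrightarrow> mollifier c s x = 0"
    and integral_mollifier: "integral\<^sup>L lborel (mollifier c s) = 1"
proof -
  have R: "norm x \<le> norm c + s" if "bump c s x \<noteq> 0" for x
    using that bump_eq_0[OF s, of x c] norm_triangle_ineq2[of x c] by (force simp: dist_norm norm_minus_commute)
  have int: "integrable lborel (bump c s)"
    by (rule integrable_continuous_bounded_support[OF C1_on_continuous[OF C1_on_bump] R])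
  \<comment> \<open>A bump with zero integral would vanish almost everywhere, making an open ball
    negligible.\<close>
  have pos: "integral\<^sup>L lborel (bump c s) > 0"
  proof (rule ccontr)
    assume "\<not> ?thesis"
    then have "integral\<^sup>L lborel (bump c s) = 0"
      using Bochner_Integration.integral_nonneg[of lborel "bump c s"] bump_nonneg by (meson antisym not_less)
    then have "AE x in lborel. bump c s x = 0"
      using int bump_nonneg by (subst (asm) integral_nonneg_eq_0_iff_AE) auto
    then have "AE x in lborel. x \<notin> ball c s"
      by eventually_elim (use bump_pos_iff[OF s] in \<open>metis less_irrefl\<close>)
    then have "ball c s \<in> null_sets lborel"
      by (subst AE_iff_null_sets) auto
    then have "negligible (ball c s)"
      by (simp add: negligible_iff_null_sets null_sets_completionI)
    then show False
      using s open_not_negligible[of "ball c s"] by simp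
  qed
  show "C1_on S (mollifier c s)"
    unfolding mollifier_def[abs_def] by (intro C1_on_mult C1_on_bump C1_on_const)
  show "0 \<le> mollifier c s x"
    unfolding mollifier_def using pos bump_nonneg[of c s x] by simp
  show "x \<notin> ball c s \<Longrightarrow> mollifier c s x = 0"
    unfolding mollifier_def using bump_eq_0[OF s, of x c] by simp
  show "integral\<^sup>L lborel (mollifier c s) = 1"
    unfolding mollifier_def[abs_def] using int pos by simp_all
qed

section \<open>Borel representatives and convergence in L2\<close>

lemma integral_lebesgue_on_eq_lborel:
  fixes F :: "'a::euclidean_space \<Rightarrow> 'b::{banach,second_countable_topology}"
  assumes "F \<in> borel_measurable borel" "\<Omega> \<in> sets borel"
  shows "integral\<^sup>L (lebesgue_on \<Omega>) F = (\<integral>x. indicator \<Omega> x *\<^sub>R F x \<partial>lborel)"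
proof -
  have "\<Omega> \<inter> space lebesgue \<in> sets lebesgue"
    using assms(2) by auto
  then have "integral\<^sup>L (lebesgue_on \<Omega>) F = (\<integral>x. indicator \<Omega> x *\<^sub>R F x \<partial>lebesgue)"
    by (rule integral_restrict_space)
  also have "\<dots> = (\<integral>x. indicator \<Omega> x *\<^sub>R F x \<partial>lborel)"
    by (rule integral_completion) (use assms in measurable)
  finally show ?thesis .
qed

lemma nn_integral_lebesgue_on_eq_lborel:
  fixes F :: "'a::euclidean_space \<Rightarrow> ennreal"
  assumes "\<Omega> \<in> sets borel"
  shows "integral\<^sup>N (lebesgue_on \<Omega>) F = (\<integral>\<^sup>+x. F x * indicator \<Omega> x \<partial>lborel)"
proof -
  have "\<Omega> \<inter> space lebesgue \<in> sets lebesgue"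
    using assms by auto
  then show ?thesis
    by (simp add: nn_integral_restrict_space nn_integral_completion)
qed

lemma borel_measurable_lebesgue_on:
  "F \<in> borel_measurable borel \<Longrightarrow> F \<in> borel_measurable (lebesgue_on \<Omega>)"
  by (rule measurable_restrict_space1) (simp add: measurable_completion)

lemma AE_lborel_imp_lebesgue_on:
  assumes "AE x in lborel. x \<in> \<Omega> \<longrightarrow> P x" "\<Omega> \<in> sets borel"
  shows "AE x in lebesgue_on \<Omega>. P x"
proof -
  have "\<Omega> \<inter> space lebesgue \<in> sets lebesgue"
    using assms(2) by auto
  with AE_completion[OF assms(1)] show ?thesis
    by (simp add: AE_restrict_space_iff)
qed

lemma complex_lebesgue_ex_borel:
  fixes f :: "'a::euclidean_space \<Rightarrow> complex"
  assumes "f \<in> borel_measurable lebesgue"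
  obtains g where "g \<in> borel_measurable borel" "AE x in lebesgue. f x = g x"
proof -
  have "(\<lambda>x. Re (f x)) \<in> borel_measurable lebesgue" "(\<lambda>x. Im (f x)) \<in> borel_measurable lebesgue"
    using assms by measurable
  from this[THEN completion_ex_borel_measurable_real] obtain g1 g2
    where g: "g1 \<in> borel_measurable lborel" "AE x in lborel. Re (f x) = g1 x"
      "g2 \<in> borel_measurable lborel" "AE x in lborel. Im (f x) = g2 x"
    by blast
  have "AE x in lborel. f x = Complex (g1 x) (g2 x)"
    using g(2,4) by eventually_elim (simp add: complex_eq_iff)
  moreover have "(\<lambda>x. Complex (g1 x) (g2 x)) \<in> borel_measurable borel"
    using g(1,3) by (simp add: borel_measurable_complex_iff)
  ultimately show ?thesis
    using that AE_completion by blast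
qed

text \<open>Convolution and Fubini are carried out for \<open>lborel\<close>, while the function
  spaces are defined with the completed measure on \<Omega>. A Borel representative extended by zero
  connects the two.\<close>

lemma L2_lebesgue_on_ex_borel:
  fixes f :: "'a::euclidean_space \<Rightarrow> complex"
  assumes \<Omega>: "\<Omega> \<in> sets borel" "bounded \<Omega>" and f: "L2_fun (lebesgue_on \<Omega>) f"
  obtains g where "g \<in> borel_measurable borel" "\<And>x. x \<notin> \<Omega> \<Longrightarrow> g x = 0"
    "AE x in lebesgue_on \<Omega>. f x = g x" "integrable lborel g" "integrable lborel (\<lambda>x. (norm (g x))\<^sup>2)"
proof -
  have \<Omega>': "\<Omega> \<inter> space lebesgue \<in> sets lebesgue"
    using \<Omega>(1) by auto
  have fm: "f \<in> borel_measurable (lebesgue_on \<Omega>)" and f2: "integrable (lebesgue_on \<Omega>) (\<lambda>x. (norm (f x))\<^sup>2)"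
    using f by (auto simp: L2_fun_def)
  have "(\<lambda>x. indicator \<Omega> x *\<^sub>R f x) \<in> borel_measurable lebesgue"
    using fm \<Omega>' by (simp add: borel_measurable_restrict_space_iff)
  then obtain g0 where g0: "g0 \<in> borel_measurable borel" "AE x in lebesgue. indicator \<Omega> x *\<^sub>R f x = g0 x"
    using complex_lebesgue_ex_borel by blast
  define g where "g x = indicator \<Omega> x *\<^sub>R g0 x" for x
  have gm: "g \<in> borel_measurable borel"
    unfolding g_def[abs_def] using g0(1) \<Omega>(1) by measurable
  have ae: "AE x in lebesgue_on \<Omega>. f x = g x"
    using g0(2) \<Omega>' by (auto simp: AE_restrict_space_iff g_def elim!: eventually_mono)
  have "integrable (lebesgue_on \<Omega>) (\<lambda>x. (norm (g x))\<^sup>2)"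
  proof (rule integrable_cong_AE_imp[OF f2])
    show "AE x in lebesgue_on \<Omega>. (norm (f x))\<^sup>2 = (norm (g x))\<^sup>2"
      using ae by eventually_elim simp
    show "(\<lambda>x. (norm (g x))\<^sup>2) \<in> borel_measurable (lebesgue_on \<Omega>)"
      by (rule borel_measurable_lebesgue_on) (use gm in measurable)
  qed
  then have "integrable lebesgue (\<lambda>x. indicator \<Omega> x *\<^sub>R (norm (g x))\<^sup>2)"
    using \<Omega>' by (simp add: integrable_restrict_space)
  moreover have "(\<lambda>x. indicator \<Omega> x *\<^sub>R (norm (g x))\<^sup>2) = (\<lambda>x. (norm (g x))\<^sup>2)"
    by (auto simp: g_def indicator_def)
  ultimately have g2: "integrable lborel (\<lambda>x. (norm (g x))\<^sup>2)"
    using gm by (simp add: integrable_completion)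
  have "integrable lborel (indicator \<Omega> :: 'a \<Rightarrow> real)"
    using \<Omega>(1) emeasure_bounded_finite[OF \<Omega>(2)] by (intro integrable_real_indicator) auto
  \<comment> \<open>On a bounded set the inequality \<open>t \<le> 1 + t\<^sup>2\<close> puts square
    integrable functions into L1.\<close>
  then have "integrable lborel (\<lambda>x. indicator \<Omega> x + (norm (g x))\<^sup>2)"
    using g2 by simp
  then have "integrable lborel g"
  proof (rule Bochner_Integration.integrable_bound)
    show "AE x in lborel. norm (g x) \<le> norm (indicator \<Omega> x + (norm (g x))\<^sup>2)"
    proof (rule AE_I2)
      fix x
      have "norm (g x) \<le> 1 + (norm (g x))\<^sup>2"
        using sum_squares_bound[of "norm (g x)" 1, simplified] norm_ge_zero[of "g x"] by linarith
      then show "norm (g x) \<le> norm (indicator \<Omega> x + (norm (g x))\<^sup>2)"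
        by (cases "x \<in> \<Omega>") (auto simp: g_def)
    qed
  qed (use gm in auto)
  then show ?thesis
    using gm ae g2 by (intro that) (auto simp: g_def)
qed

lemma L2_tendsto_add:
  fixes f f' :: "nat \<Rightarrow> 'a \<Rightarrow> 'b::{banach, second_countable_topology}"
  assumes "L2_tendsto M f g" "L2_tendsto M f' g'"
    and [measurable]: "\<And>n. f n \<in> borel_measurable M" "\<And>n. f' n \<in> borel_measurable M"
      "g \<in> borel_measurable M" "g' \<in> borel_measurable M"
  shows "L2_tendsto M (\<lambda>n x. f n x + f' n x) (\<lambda>x. g x + g' x)"
proof -
  let ?F = "\<lambda>n. \<integral>\<^sup>+x. ennreal ((norm (f n x - g x))\<^sup>2) \<partial>M"
  let ?F' = "\<lambda>n. \<integral>\<^sup>+x. ennreal ((norm (f' n x - g' x))\<^sup>2) \<partial>M"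
  have "(\<lambda>n. 2 * (?F n + ?F' n)) \<longlonglongrightarrow> 2 * (0 + 0)"
    using assms(1,2) unfolding L2_tendsto_def by (intro tendsto_add ennreal_tendsto_cmult) auto
  then have lim: "(\<lambda>n. 2 * (?F n + ?F' n)) \<longlonglongrightarrow> 0" by simp
  show ?thesis
    unfolding L2_tendsto_def
  proof (rule tendsto_sandwich[OF _ _ tendsto_const lim])
    show "\<forall>\<^sub>F n in sequentially. (\<integral>\<^sup>+x. ennreal ((norm (f n x + f' n x - (g x + g' x)))\<^sup>2) \<partial>M) \<le> 2 * (?F n + ?F' n)"
    proof (intro always_eventually allI)
      fix n
      have "(\<integral>\<^sup>+x. ennreal ((norm (f n x + f' n x - (g x + g' x)))\<^sup>2) \<partial>M) \<le>
        (\<integral>\<^sup>+x. 2 * (ennreal ((norm (f n x - g x))\<^sup>2) + ennreal ((norm (f' n x - g' x))\<^sup>2)) \<partial>M)"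
      proof (rule nn_integral_mono)
        fix x
        have "(norm (f n x + f' n x - (g x + g' x)))\<^sup>2 \<le> 2 * ((norm (f n x - g x))\<^sup>2 + (norm (f' n x - g' x))\<^sup>2)"
          using norm_diff_square_le[of "f n x - g x" "- (f' n x - g' x)"]
          by (simp add: algebra_simps norm_minus_commute[of "g' x"])
        then have "ennreal ((norm (f n x + f' n x - (g x + g' x)))\<^sup>2) \<le>
            ennreal (2 * ((norm (f n x - g x))\<^sup>2 + (norm (f' n x - g' x))\<^sup>2))"
          by (rule ennreal_leI)
        then show "ennreal ((norm (f n x + f' n x - (g x + g' x)))\<^sup>2) \<le>
            2 * (ennreal ((norm (f n x - g x))\<^sup>2) + ennreal ((norm (f' n x - g' x))\<^sup>2))"
          by (simp add: ennreal_mult)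
      qed
      also have "\<dots> = 2 * (?F n + ?F' n)"
        by (simp add: nn_integral_cmult nn_integral_add)
      finally show "(\<integral>\<^sup>+x. ennreal ((norm (f n x + f' n x - (g x + g' x)))\<^sup>2) \<partial>M) \<le> 2 * (?F n + ?F' n)" .
    qed
  qed simp
qed

lemma L2_tendsto_sum:
  fixes f :: "'i \<Rightarrow> nat \<Rightarrow> 'a \<Rightarrow> 'b::{banach, second_countable_topology}"
  assumes "finite I" "\<And>i. i \<in> I \<Longrightarrow> L2_tendsto M (f i) (g i)"
    and "\<And>i n. i \<in> I \<Longrightarrow> f i n \<in> borel_measurable M" "\<And>i. i \<in> I \<Longrightarrow> g i \<in> borel_measurable M"
  shows "L2_tendsto M (\<lambda>n x. \<Sum>i\<in>I. f i n x) (\<lambda>x. \<Sum>i\<in>I. g i x)"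
  using assms
proof (induction I rule: finite_induct)
  case empty
  then show ?case by (simp add: L2_tendsto_def)
next
  case (insert i I)
  have "L2_tendsto M (\<lambda>n x. f i n x + (\<Sum>i\<in>I. f i n x)) (\<lambda>x. g i x + (\<Sum>i\<in>I. g i x))"
    by (intro L2_tendsto_add borel_measurable_sum insert) (use insert in auto)
  with insert(1,2) show ?case by simp
qed

text \<open>Only the norm of the error matters, so sequence and limit may be replaced together, and
  only from some index on. The gradients of the approximants will have the desired form only for
  large indices.\<close>

lemma L2_tendsto_cong_AE:
  assumes "L2_tendsto M f g" "\<forall>\<^sub>F n in sequentially. AE x in M. norm (f n x - g x) = norm (f' n x - g' x)"
  shows "L2_tendsto M f' g'"
  unfolding L2_tendsto_def
proof (rule Lim_transform_eventually[OF assms(1)[unfolded L2_tendsto_def]])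
  show "\<forall>\<^sub>F n in sequentially. (\<integral>\<^sup>+x. ennreal ((norm (f n x - g x))\<^sup>2) \<partial>M) = (\<integral>\<^sup>+x. ennreal ((norm (f' n x - g' x))\<^sup>2) \<partial>M)"
    using assms(2) by eventually_elim (auto intro!: nn_integral_cong_AE elim!: eventually_mono)
qed

lemma L2_tendsto_lebesgue_on:
  fixes f :: "nat \<Rightarrow> 'a::euclidean_space \<Rightarrow> 'b::{banach, second_countable_topology}"
  assumes "L2_tendsto lborel f g" "\<Omega> \<in> sets borel"
  shows "L2_tendsto (lebesgue_on \<Omega>) f g"
  unfolding L2_tendsto_def
  by (rule tendsto_sandwich[OF _ _ tendsto_const assms(1)[unfolded L2_tendsto_def]])
    (auto simp: nn_integral_lebesgue_on_eq_lborel[OF assms(2)] indicator_def intro!: always_eventually nn_integral_mono)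

lemma norm_vec_square: "(norm (x :: 'a::real_normed_vector^'n))\<^sup>2 = (\<Sum>i\<in>UNIV. (norm (x $ i))\<^sup>2)"
  by (simp add: norm_vec_def L2_set_def sum_nonneg)

lemma L2_tendsto_vec:
  fixes f :: "nat \<Rightarrow> 'a \<Rightarrow> 'b::euclidean_space^'n"
  assumes "\<And>i. L2_tendsto M (\<lambda>n x. f n x $ i) (\<lambda>x. g x $ i)"
    and "\<And>n i. (\<lambda>x. f n x $ i) \<in> borel_measurable M" "\<And>i. (\<lambda>x. g x $ i) \<in> borel_measurable M"
  shows "L2_tendsto M f g"
proof -
  have "(\<integral>\<^sup>+x. ennreal ((norm (f n x - g x))\<^sup>2) \<partial>M) =
      (\<Sum>i\<in>UNIV. \<integral>\<^sup>+x. ennreal ((norm (f n x $ i - g x $ i))\<^sup>2) \<partial>M)" for n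
    using assms(2,3) by (subst nn_integral_sum[symmetric]) (simp_all add: norm_vec_square sum_nonneg)
  moreover have "(\<lambda>n. \<Sum>i\<in>UNIV. \<integral>\<^sup>+x. ennreal ((norm (f n x $ i - g x $ i))\<^sup>2) \<partial>M) \<longlonglongrightarrow> (\<Sum>i\<in>(UNIV :: 'n set). 0)"
    using assms(1) unfolding L2_tendsto_def by (intro tendsto_sum)
  ultimately show ?thesis
    by (simp add: L2_tendsto_def)
qed

lemma ennreal_tendsto_0I:
  fixes X :: "nat \<Rightarrow> ennreal"
  assumes "\<And>e. e > 0 \<Longrightarrow> \<forall>\<^sub>F n in sequentially. X n \<le> ennreal e"
  shows "X \<longlonglongrightarrow> 0"
proof (rule order_tendstoI)
  fix a :: ennreal assume "0 < a"
  then obtain e where "e > 0" "ennreal e < a"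
  proof (cases a)
    case (real r)
    with \<open>0 < a\<close> show ?thesis by (intro that[of "r / 2"]) (auto simp: ennreal_less_iff)
  qed (use that[of 1] in auto)
  with assms[of e] show "\<forall>\<^sub>F n in sequentially. X n < a"
    by (auto elim!: eventually_mono)
qed simp

lemma bounded_continuous_bounded_support:
  fixes g :: "'a::euclidean_space \<Rightarrow> 'b::real_normed_vector"
  assumes "continuous_on UNIV g" "\<And>z. g z \<noteq> 0 \<Longrightarrow> norm z \<le> R"
  obtains B where "\<And>z. norm (g z) \<le> B"
proof -
  have "bounded (g ` cball 0 R)"
    by (intro compact_imp_bounded compact_continuous_image continuous_on_subset[OF assms(1)]) auto
  then obtain B where "B > 0" "\<And>z. norm z \<le> R \<Longrightarrow> norm (g z) \<le> B"
    unfolding bounded_pos by auto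
  then have "norm (g z) \<le> B" for z
    using assms(2)[of z] by (cases "g z = 0") auto
  then show ?thesis using that by blast
qed

lemma integrable_scaleR_bounded_support:
  fixes f :: "'a::euclidean_space \<Rightarrow> 'b::{banach,second_countable_topology}"
  assumes "integrable lborel f" "continuous_on UNIV k" "\<And>z. k z \<noteq> 0 \<Longrightarrow> norm z \<le> R"
  shows "integrable lborel (\<lambda>y. k y *\<^sub>R f y)"
proof -
  obtain B where "\<And>z. norm (k z) \<le> B"
    using bounded_continuous_bounded_support[OF assms(2,3)] by blast
  then show ?thesis
    using integrable_kernel_scaleR[OF assms(1) borel_measurable_continuous_onI[OF assms(2)], of B 0] by simp
qed

section \<open>Density of C1 functions in H1\<close>

lemma conv_L2_tendsto:
  fixes f :: "'a::euclidean_space \<Rightarrow> 'b::{banach,second_countable_topology}"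
  assumes f: "integrable lborel f" "integrable lborel (\<lambda>x. (norm (f x))\<^sup>2)"
    and k: "\<And>n. continuous_on UNIV (k n)" "\<And>n z. 0 \<le> k n z"
      "\<And>n. integral\<^sup>L lborel (k n) = 1" "\<And>n z. k n z \<noteq> 0 \<Longrightarrow> norm z < r n" "r \<longlonglongrightarrow> 0"
  shows "L2_tendsto lborel (\<lambda>n. conv (k n) f) f"
  unfolding L2_tendsto_def
proof (rule ennreal_tendsto_0I)
  fix e :: real assume e: "e > 0"
  obtain d where "d > 0" and d: "\<And>k B. \<lbrakk>k \<in> borel_measurable borel; \<And>z. \<bar>k z\<bar> \<le> B; \<And>z. 0 \<le> k z;
       integrable lborel k; integral\<^sup>L lborel k = 1; \<And>z. k z \<noteq> 0 \<Longrightarrow> norm z < d\<rbrakk>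
     \<Longrightarrow> (\<integral>\<^sup>+x. ennreal ((norm (conv k f x - f x))\<^sup>2) \<partial>lborel) \<le> ennreal e"
    using conv_L2_error[OF f e] by blast
  have "\<forall>\<^sub>F n in sequentially. r n < d"
    using order_tendstoD(2)[OF k(5) \<open>d > 0\<close>] .
  then show "\<forall>\<^sub>F n in sequentially. (\<integral>\<^sup>+x. ennreal ((norm (conv (k n) f x - f x))\<^sup>2) \<partial>lborel) \<le> ennreal e"
  proof eventually_elim
    case (elim n)
    obtain B where B: "\<And>z. norm (k n z) \<le> B"
      using bounded_continuous_bounded_support[OF k(1), of n "r n"] k(4)[of n] by (meson less_imp_le)
    show ?case
    proof (rule d[of _ B])
      show "integrable lborel (k n)"
        using k(4)[of n] by (intro integrable_continuous_bounded_support[OF k(1), of n "r n"] less_imp_le)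
      show "norm z < d" if "k n z \<noteq> 0" for z
        using k(4)[OF that] elim by simp
    qed (use B k in \<open>auto intro: borel_measurable_continuous_onI\<close>)
  qed
qed

lemma frechet_derivative_translate:
  assumes "C1_on UNIV k"
  shows "frechet_derivative (\<lambda>y. k (y - x)) (at y) = frechet_derivative k (at (y - x))"
proof -
  have "((\<lambda>y. y - x) has_derivative (\<lambda>h. h)) (at y)"
    by (auto intro!: derivative_eq_intros)
  from has_derivative_compose[OF this C1_on_has_derivative[OF assms UNIV_I]]
  show ?thesis
    by (rule frechet_derivative_at[symmetric])
qed

text \<open>The derivative falls on the kernel. Testing the weak derivative with the kernel
  localized by \<psi> moves it to \<open>u\<close>, and the product rule leaves the extra term with
  the derivative of \<psi>. The assumption \<open>test\<close> says that at the point
  \<open>x\<close> the localized kernel stays inside \<Omega>.\<close>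

lemma conv_weak_derivative:
  fixes u g :: "real^3 \<Rightarrow> complex"
  assumes wg: "\<And>\<phi>. test_function \<Omega> \<phi> \<Longrightarrow> (\<integral>y. u y * partial_deriv i \<phi> y \<partial>lborel) = - (\<integral>y. g y * \<phi> y \<partial>lborel)"
    and u: "integrable lborel u" and g: "integrable lborel g"
    and \<psi>: "C1_on UNIV \<psi>" "\<And>z. \<psi> z \<noteq> 0 \<Longrightarrow> norm z \<le> R"
    and k: "C1_on UNIV k" "\<And>z. k z \<noteq> 0 \<Longrightarrow> norm z \<le> R'"
    and test: "test_function \<Omega> (\<lambda>y. complex_of_real (\<psi> y * k (y - x)))"
  shows "frechet_derivative (conv k (\<lambda>y. \<psi> y *\<^sub>R u y)) (at x) (axis i 1) =
    conv k (\<lambda>y. \<psi> y *\<^sub>R g y + frechet_derivative \<psi> (at y) (axis i 1) *\<^sub>R u y) x"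
proof -
  let ?e = "axis i 1 :: real^3"
  let ?D\<psi> = "\<lambda>y. frechet_derivative \<psi> (at y) ?e" and ?Dk = "\<lambda>y. frechet_derivative k (at (y - x)) ?e"
  have kx: "C1_on UNIV (\<lambda>y. k (y - x))"
    using C1_on_compose_UNIV[OF k(1), of UNIV "\<lambda>y. y - x"]
      C1_on_diff[OF C1_on_linear[OF bounded_linear_ident] C1_on_const] by blast
  have c: "continuous_on UNIV \<psi>" "continuous_on UNIV ?D\<psi>" "continuous_on UNIV (\<lambda>y. k (y - x))" "continuous_on UNIV ?Dk"
    using C1_on_continuous[OF \<psi>(1)] C1_on_continuous_derivative[OF \<psi>(1)] C1_on_continuous[OF kx]
      C1_on_continuous_derivative[OF kx, of ?e] by (auto simp: frechet_derivative_translate[OF k(1)])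
  have D\<psi>R: "norm z \<le> R" if "?D\<psi> z \<noteq> 0" for z
  proof (rule ccontr)
    assume "\<not> norm z \<le> R"
    then have "?D\<psi> z = 0"
      by (intro frechet_derivative_eq_0_outside[of "cball 0 R"]) (use \<psi>(2) in auto)
    with that show False by simp
  qed
  have \<psi>u: "integrable lborel (\<lambda>y. \<psi> y *\<^sub>R u y)"
    by (rule integrable_scaleR_bounded_support[OF u c(1) \<psi>(2)])
  have D: "partial_deriv i (\<lambda>y. complex_of_real (\<psi> y * k (y - x))) y =
      complex_of_real (\<psi> y * ?Dk y + ?D\<psi> y * k (y - x))" for y
  proof -
    have "((\<lambda>y. complex_of_real (\<psi> y * k (y - x))) has_derivative
      (\<lambda>h. complex_of_real (\<psi> y * frechet_derivative k (at (y - x)) h + frechet_derivative \<psi> (at y) h * k (y - x)))) (at y)"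
      using C1_on_has_derivative[OF kx, of y]
      by (intro bounded_linear.has_derivative[OF bounded_linear_of_real] has_derivative_mult
          C1_on_has_derivative[OF \<psi>(1)]) (auto simp: frechet_derivative_translate[OF k(1)])
    from fun_cong[OF frechet_derivative_at[OF this], of ?e] show ?thesis
      unfolding partial_deriv_def by (rule sym)
  qed
  have i1: "integrable lborel (\<lambda>y. (\<psi> y * ?Dk y) *\<^sub>R u y)"
  proof (rule integrable_scaleR_bounded_support[OF u continuous_on_mult[OF c(1,4)]])
    show "norm z \<le> R" if "\<psi> z * frechet_derivative k (at (z - x)) ?e \<noteq> 0" for z
      by (rule \<psi>(2)) (use that in simp)
  qed
  have i2: "integrable lborel (\<lambda>y. (?D\<psi> y * k (y - x)) *\<^sub>R u y)"
  proof (rule integrable_scaleR_bounded_support[OF u continuous_on_mult[OF c(2,3)]])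
    show "norm z \<le> R" if "?D\<psi> z * k (z - x) \<noteq> 0" for z
      by (rule D\<psi>R) (use that in simp)
  qed
  have i3: "integrable lborel (\<lambda>y. (\<psi> y * k (y - x)) *\<^sub>R g y)"
  proof (rule integrable_scaleR_bounded_support[OF g continuous_on_mult[OF c(1,3)]])
    show "norm z \<le> R" if "\<psi> z * k (z - x) \<noteq> 0" for z
      by (rule \<psi>(2)) (use that in simp)
  qed
  have alg: "- A = C + B" if "A + B = - C" for A B C :: complex
    using that by (simp add: complex_eq_iff)
  have "(\<integral>y. (\<psi> y * ?Dk y) *\<^sub>R u y + (?D\<psi> y * k (y - x)) *\<^sub>R u y \<partial>lborel) = - (\<integral>y. (\<psi> y * k (y - x)) *\<^sub>R g y \<partial>lborel)"
    using wg[OF test] unfolding D by (simp add: scaleR_conv_of_real algebra_simps)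
  then have "- (\<integral>y. (\<psi> y * ?Dk y) *\<^sub>R u y \<partial>lborel) =
      (\<integral>y. (\<psi> y * k (y - x)) *\<^sub>R g y \<partial>lborel) + (\<integral>y. (?D\<psi> y * k (y - x)) *\<^sub>R u y \<partial>lborel)"
    unfolding Bochner_Integration.integral_add[OF i1 i2] by (rule alg)
  also have "\<dots> = (\<integral>y. k (y - x) *\<^sub>R (\<psi> y *\<^sub>R g y + ?D\<psi> y *\<^sub>R u y) \<partial>lborel)"
    using i2 i3 by (simp add: scaleR_add_right mult.commute)
  finally show ?thesis
    by (subst frechet_derivative_conv[OF \<psi>u k, rotated]) (simp_all add: conv_def mult.commute)
qed

definition borel_representative :: "'a::euclidean_space set \<Rightarrow> ('a \<Rightarrow> complex) \<Rightarrow> ('a \<Rightarrow> complex) \<Rightarrow> bool" where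
  "borel_representative \<Omega> f g \<longleftrightarrow> g \<in> borel_measurable borel \<and> (\<forall>x. x \<notin> \<Omega> \<longrightarrow> g x = 0) \<and>
    (AE x in lebesgue_on \<Omega>. f x = g x) \<and> integrable lborel g \<and> integrable lborel (\<lambda>x. (norm (g x))\<^sup>2)"

lemma borel_representative_exists:
  assumes "\<Omega> \<in> sets borel" "bounded \<Omega>" "L2_fun (lebesgue_on \<Omega>) f"
  shows "\<exists>g. borel_representative \<Omega> f g"
  unfolding borel_representative_def using L2_lebesgue_on_ex_borel[OF assms] by (smt (verit, best))

lemma C1_on_translate:
  assumes "C1_on UNIV k"
  shows "C1_on UNIV (\<lambda>y. k (y - x))"
  using C1_on_compose_UNIV[OF assms, of UNIV "\<lambda>y. y - x"]
    C1_on_diff[OF C1_on_linear[OF bounded_linear_ident] C1_on_const] by blast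

lemma test_function_of_real:
  fixes \<phi> :: "real^3 \<Rightarrow> real"
  assumes "C1_on UNIV \<phi>" "\<And>y. \<phi> y \<noteq> 0 \<Longrightarrow> y \<in> K" "compact K" "K \<subseteq> \<Omega>"
  shows "test_function \<Omega> (\<lambda>y. complex_of_real (\<phi> y))"
proof -
  have sub: "closure {x. complex_of_real (\<phi> x) \<noteq> 0} \<subseteq> K"
    using assms(2,3) by (intro closure_minimal compact_imp_closed) auto
  moreover have "compact (closure {x. complex_of_real (\<phi> x) \<noteq> 0})"
    using compact_Int_closed[OF assms(3) closed_closure] sub by (metis inf.absorb2)
  ultimately show ?thesis
    unfolding test_function_def using assms by (auto intro: C1_on_of_real)
qed

lemma
  assumes t: "test_function \<Omega> \<phi>"
  shows test_function_C1: "C1_on UNIV \<phi>"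
    and test_function_outside: "x \<notin> \<Omega> \<Longrightarrow> \<phi> x = 0"
    and test_function_derivative_outside: "x \<notin> \<Omega> \<Longrightarrow> partial_deriv i \<phi> x = 0"
    and test_function_bounded_support: "\<exists>R. \<forall>x. \<phi> x \<noteq> 0 \<longrightarrow> norm x \<le> R"
proof -
  define K where "K = closure {x. \<phi> x \<noteq> 0}"
  have K: "compact K" "K \<subseteq> \<Omega>"
    using t by (auto simp: test_function_def K_def)
  have K0: "\<phi> y = 0" if "y \<notin> K" for y
    using that closure_subset[of "{x. \<phi> x \<noteq> 0}"] unfolding K_def by auto
  show "C1_on UNIV \<phi>" using t by (simp add: test_function_def)
  show "\<phi> x = 0" if "x \<notin> \<Omega>"
    by (rule K0) (use that K in auto)
  show "partial_deriv i \<phi> x = 0" if "x \<notin> \<Omega>"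
    unfolding partial_deriv_def
    by (rule frechet_derivative_eq_0_outside[OF K0 compact_imp_closed[OF K(1)]]) (use that K in auto)
  from compact_imp_bounded[OF K(1)] obtain R where R: "\<And>x. x \<in> K \<Longrightarrow> norm x \<le> R"
    unfolding bounded_iff by auto
  have "norm x \<le> R" if "\<phi> x \<noteq> 0" for x
    using K0[of x] R[of x] that by auto
  then show "\<exists>R. \<forall>x. \<phi> x \<noteq> 0 \<longrightarrow> norm x \<le> R" by auto
qed

lemma partial_deriv_continuous: "C1_on UNIV \<phi> \<Longrightarrow> continuous_on UNIV (partial_deriv i \<phi>)"
  unfolding partial_deriv_def[abs_def] by (rule C1_on_continuous_derivative)

lemma integral_lebesgue_on_test:
  fixes u v f :: "real^3 \<Rightarrow> complex"
  assumes \<Omega>: "\<Omega> \<in> sets borel" and u: "u \<in> borel_measurable (lebesgue_on \<Omega>)" "u' \<in> borel_measurable borel"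
    and ae: "AE x in lebesgue_on \<Omega>. u x = u' x" and u'0: "\<And>x. x \<notin> \<Omega> \<Longrightarrow> u' x = 0"
    and f: "f \<in> borel_measurable borel"
  shows "(LINT x|lebesgue_on \<Omega>. u x * f x) = (\<integral>x. u' x * f x \<partial>lborel)"
proof -
  have "(LINT x|lebesgue_on \<Omega>. u x * f x) = (LINT x|lebesgue_on \<Omega>. u' x * f x)"
  proof (rule integral_cong_AE)
    show "AE x in lebesgue_on \<Omega>. u x * f x = u' x * f x"
      using ae by eventually_elim simp
    have "u' \<in> borel_measurable (lebesgue_on \<Omega>)" "f \<in> borel_measurable (lebesgue_on \<Omega>)"
      using u(2) f by (simp_all add: borel_measurable_lebesgue_on)
    then show "(\<lambda>x. u x * f x) \<in> borel_measurable (lebesgue_on \<Omega>)"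
      "(\<lambda>x. u' x * f x) \<in> borel_measurable (lebesgue_on \<Omega>)"
      using u(1) by (simp_all add: borel_measurable_times)
  qed
  also have "\<dots> = (\<integral>x. indicator \<Omega> x *\<^sub>R (u' x * f x) \<partial>lborel)"
    by (rule integral_lebesgue_on_eq_lborel) (use u f \<Omega> in measurable)
  also have "\<dots> = (\<integral>x. u' x * f x \<partial>lborel)"
    by (rule Bochner_Integration.integral_cong) (auto simp: u'0 indicator_def)
  finally show ?thesis .
qed

lemma L2_fun_component:
  fixes G :: "'a \<Rightarrow> 'b::euclidean_space^'n"
  assumes "L2_fun M G"
  shows "L2_fun M (\<lambda>x. G x $ i)"
proof -
  have m: "(\<lambda>x. G x $ i) \<in> borel_measurable M"
    using assms unfolding L2_fun_def
    by (intro borel_measurable_continuous_on[where f="\<lambda>v. v $ i"] continuous_intros) auto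
  moreover have "integrable M (\<lambda>x. (norm (G x $ i))\<^sup>2)"
    by (rule Bochner_Integration.integrable_bound[where f="\<lambda>x. (norm (G x))\<^sup>2"])
      (use assms m in \<open>auto simp: L2_fun_def intro!: AE_I2 power_mono Finite_Cartesian_Product.norm_nth_le\<close>)
  ultimately show ?thesis by (simp add: L2_fun_def)
qed

lemma weak_gradient_representative:
  fixes u :: "real^3 \<Rightarrow> complex"
  assumes \<Omega>: "\<Omega> \<in> sets borel" "bounded \<Omega>" and u: "L2_fun (lebesgue_on \<Omega>) u"
    and G: "L2_fun (lebesgue_on \<Omega>) G" "has_weak_gradient \<Omega> u G"
    and u': "u' \<in> borel_measurable borel" "\<And>x. x \<notin> \<Omega> \<Longrightarrow> u' x = 0" "AE x in lebesgue_on \<Omega>. u x = u' x"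
    and g: "g \<in> borel_measurable borel" "\<And>x. x \<notin> \<Omega> \<Longrightarrow> g x = 0" "AE x in lebesgue_on \<Omega>. G x $ i = g x"
    and \<phi>: "test_function \<Omega> \<phi>"
  shows "(\<integral>y. u' y * partial_deriv i \<phi> y \<partial>lborel) = - (\<integral>y. g y * \<phi> y \<partial>lborel)"
proof -
  have m: "\<phi> \<in> borel_measurable borel" "partial_deriv i \<phi> \<in> borel_measurable borel"
    using test_function_C1[OF \<phi>]
    by (auto intro!: borel_measurable_continuous_onI C1_on_continuous partial_deriv_continuous)
  have "(LINT x|lebesgue_on \<Omega>. u x * partial_deriv i \<phi> x) = - (LINT x|lebesgue_on \<Omega>. G x $ i * \<phi> x)"
    using G(2) \<phi> by (auto simp: has_weak_gradient_def)
  moreover have "(LINT x|lebesgue_on \<Omega>. u x * partial_deriv i \<phi> x) = (\<integral>y. u' y * partial_deriv i \<phi> y \<partial>lborel)"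
    by (rule integral_lebesgue_on_test[OF \<Omega>(1) _ u'(1,3,2) m(2)]) (use u in \<open>auto simp: L2_fun_def\<close>)
  moreover have "(LINT x|lebesgue_on \<Omega>. G x $ i * \<phi> x) = (\<integral>y. g y * \<phi> y \<partial>lborel)"
    by (rule integral_lebesgue_on_test[OF \<Omega>(1) _ g(1,3,2) m(1)])
      (use L2_fun_component[OF G(1)] in \<open>auto simp: L2_fun_def\<close>)
  ultimately show ?thesis by simp
qed

text \<open>A point \<open>y\<close> of the support is \<open>x + t *\<^sub>R z\<close> with
  \<open>z\<close> in the ball of directions of the cone. As \<psi> lives in the ball of half the
  radius and the displacement is shorter than the other half, \<open>x\<close> and \<open>y\<close>
  both lie where the cone condition applies, so \<open>y\<close> is in \<Omega>.\<close>

lemma mollifier_test_function: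
  assumes r: "r > 0" "\<rho> > 0" and \<psi>: "C1_on UNIV \<psi>" "\<And>y. y \<notin> ball c (r / 2) \<Longrightarrow> \<psi> y = 0"
    and cone: "\<And>x z t. x \<in> \<Omega> \<inter> ball c r \<Longrightarrow> z \<in> cball a \<rho> \<Longrightarrow> t > 0 \<Longrightarrow> x + t *\<^sub>R z \<in> ball c r \<Longrightarrow> x + t *\<^sub>R z \<in> \<Omega>"
    and t: "t > 0" "t * (norm a + \<rho>) < r / 2" and x: "x \<in> \<Omega>"
  shows "test_function \<Omega> (\<lambda>y. complex_of_real (\<psi> y * mollifier (t *\<^sub>R a) (t * \<rho>) (y - x)))"
proof (rule test_function_of_real)
  let ?K = "cball c (r / 2) \<inter> cball (x + t *\<^sub>R a) (t * \<rho>)"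
  have "C1_on UNIV (\<lambda>y. mollifier (t *\<^sub>R a) (t * \<rho>) (y - x))"
    by (rule C1_on_translate[OF C1_on_mollifier]) (use t r in simp)
  then show "C1_on UNIV (\<lambda>y. \<psi> y * mollifier (t *\<^sub>R a) (t * \<rho>) (y - x))"
    by (rule C1_on_mult[OF \<psi>(1)])
  show "y \<in> ?K" if "\<psi> y * mollifier (t *\<^sub>R a) (t * \<rho>) (y - x) \<noteq> 0" for y
  proof -
    have "y \<in> ball c (r / 2)" using that \<psi>(2)[of y] by fastforce
    moreover have "y - x \<in> ball (t *\<^sub>R a) (t * \<rho>)"
      using that mollifier_eq_0[of "t * \<rho>" "y - x" "t *\<^sub>R a"] t r by fastforce
    ultimately show ?thesis
      by (auto simp: dist_norm algebra_simps)
  qed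
  show "compact ?K" by (simp add: compact_Int)
  show "?K \<subseteq> \<Omega>"
  proof
    fix y assume y: "y \<in> ?K"
    define z where "z = (y - x) /\<^sub>R t"
    have yz: "y = x + t *\<^sub>R z" using t by (simp add: z_def)
    have "norm (t *\<^sub>R (a - z)) \<le> t * \<rho>"
      using y by (simp add: yz dist_norm algebra_simps)
    then have z: "z \<in> cball a \<rho>" using t by (simp add: dist_norm)
    have "norm (y - x) = t * norm z" using t by (simp add: yz)
    also have "\<dots> \<le> t * (norm a + \<rho>)"
      using z t norm_triangle_ineq2[of z a] by (intro mult_left_mono) (auto simp: dist_norm norm_minus_commute)
    finally have "dist x y < r / 2" using t by (simp add: dist_norm norm_minus_commute)
    moreover have "dist c y \<le> r / 2" using y by simp
    ultimately have "dist c x < r" using dist_triangle[of c x y] by (simp add: dist_commute)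
    with x y r show "y \<in> \<Omega>"
      using cone[of x z t] z t unfolding yz by auto
  qed
qed

lemma norm_less_of_mollifier_neq_0:
  assumes "t > 0" "\<rho> > 0" "mollifier (t *\<^sub>R a) (t * \<rho>) z \<noteq> 0"
  shows "norm z < t * (norm a + \<rho>)"
proof -
  have "z \<in> ball (t *\<^sub>R a) (t * \<rho>)"
    using mollifier_eq_0[of "t * \<rho>" z "t *\<^sub>R a"] assms by fastforce
  then show ?thesis
    using norm_triangle_ineq2[of z "t *\<^sub>R a"] assms(1) by (simp add: dist_norm norm_minus_commute algebra_simps)
qed

text \<open>Shifting the mollifiers in the direction of the cone makes them sample \<open>u\<close> inside \<open>\<Omega>\<close> only.\<close>

theorem C1_dense_in_H1:
  fixes u :: "real^3 \<Rightarrow> complex"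
  assumes \<Omega>: "open \<Omega>" "bounded \<Omega>" and cone: "\<And>p. p \<in> closure \<Omega> \<Longrightarrow>
      \<exists>r>0. \<exists>a. \<exists>\<rho>>0. \<forall>x\<in>\<Omega> \<inter> ball p r. \<forall>z\<in>cball a \<rho>. \<forall>t>0. x + t *\<^sub>R z \<in> ball p r \<longrightarrow> x + t *\<^sub>R z \<in> \<Omega>"
    and u: "L2_fun (lebesgue_on \<Omega>) u" and G: "L2_fun (lebesgue_on \<Omega>) G" "has_weak_gradient \<Omega> u G"
  obtains \<phi> where "\<And>n. C1_on UNIV (\<phi> n)" "L2_tendsto (lebesgue_on \<Omega>) \<phi> u"
    "L2_tendsto (lebesgue_on \<Omega>) (\<lambda>n. cgrad (\<phi> n)) G"
proof -
  have \<Omega>b: "\<Omega> \<in> sets borel" using \<Omega> by auto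
  obtain u' where "borel_representative \<Omega> u u'"
    using borel_representative_exists[OF \<Omega>b \<Omega>(2) u] by blast
  then have u': "u' \<in> borel_measurable borel" "\<And>x. x \<notin> \<Omega> \<Longrightarrow> u' x = 0"
    "AE x in lebesgue_on \<Omega>. u x = u' x" "integrable lborel u'" "integrable lborel (\<lambda>x. (norm (u' x))\<^sup>2)"
    by (auto simp: borel_representative_def)
  have "\<forall>i. \<exists>g. borel_representative \<Omega> (\<lambda>x. G x $ i) g"
    using borel_representative_exists[OF \<Omega>b \<Omega>(2) L2_fun_component[OF G(1)]] by blast
  from choice[OF this] obtain g where "\<And>i. borel_representative \<Omega> (\<lambda>x. G x $ i) (g i)"
    by blast
  then have g: "\<And>i. g i \<in> borel_measurable borel" "\<And>i x. x \<notin> \<Omega> \<Longrightarrow> g i x = 0"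
    "\<And>i. AE x in lebesgue_on \<Omega>. G x $ i = g i x" "\<And>i. integrable lborel (g i)"
    "\<And>i. integrable lborel (\<lambda>x. (norm (g i x))\<^sup>2)"
    by (auto simp: borel_representative_def)
  have wg: "(\<integral>y. u' y * partial_deriv i \<phi> y \<partial>lborel) = - (\<integral>y. g i y * \<phi> y \<partial>lborel)"
    if "test_function \<Omega> \<phi>" for \<phi> i
    by (rule weak_gradient_representative[OF \<Omega>b \<Omega>(2) u G u'(1,2,3) g(1,2,3) that])
  define conic where "conic p r a \<rho> \<longleftrightarrow> r > 0 \<and> \<rho> > 0 \<and>
    (\<forall>x\<in>\<Omega> \<inter> ball p r. \<forall>z\<in>cball a \<rho>. \<forall>t>0. x + t *\<^sub>R z \<in> ball p r \<longrightarrow> x + t *\<^sub>R z \<in> \<Omega>)"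
    for p r and a :: "real^3" and \<rho> :: real
  have "\<forall>p\<in>closure \<Omega>. \<exists>r a \<rho>. conic p r a \<rho>"
    unfolding conic_def using cone by blast
  then obtain r a \<rho> where cn: "\<And>p. p \<in> closure \<Omega> \<Longrightarrow> conic p (r p) (a p) (\<rho> p)"
    by metis
  then have r: "\<And>p. p \<in> closure \<Omega> \<Longrightarrow> r p > 0" "\<And>p. p \<in> closure \<Omega> \<Longrightarrow> \<rho> p > 0"
    unfolding conic_def by blast+
  have ra: "x + t *\<^sub>R z \<in> \<Omega>" if "p \<in> closure \<Omega>" "x \<in> \<Omega> \<inter> ball p (r p)" "z \<in> cball (a p) (\<rho> p)" "t > 0"
      "x + t *\<^sub>R z \<in> ball p (r p)" for p x z t
    using cn[OF that(1)] that unfolding conic_def by blast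
  have "compact (closure \<Omega>)"
    using \<Omega> by (simp add: compact_eq_bounded_closed bounded_closure)
  then obtain C \<psi> where C: "finite C" "C \<subseteq> closure \<Omega>" and \<psi>: "\<And>c. C1_on UNIV (\<psi> c)" "\<And>c x. 0 \<le> \<psi> c x"
    "\<And>c x. c \<in> C \<Longrightarrow> x \<notin> ball c (r c / 2) \<Longrightarrow> \<psi> c x = (0::real)"
    and \<psi>1: "\<And>x. x \<in> closure \<Omega> \<Longrightarrow> (\<Sum>c\<in>C. \<psi> c x) = 1"
    using r(1) by (elim C1_partition_of_unity[of "closure \<Omega>" "\<lambda>c. r c / 2"]) auto
  have \<psi>R: "norm z \<le> norm c + r c" if "c \<in> C" "\<psi> c z \<noteq> 0" for c z
  proof -
    have "z \<in> ball c (r c / 2)" using \<psi>(3) that by blast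
    moreover have "r c > 0" using r(1) C that by blast
    ultimately show ?thesis
      using norm_triangle_ineq2[of z c] by (simp add: dist_norm norm_minus_commute)
  qed
  define t where "t n = 1 / real (Suc n)" for n
  have t: "t n > 0" for n by (simp add: t_def)
  have tlim: "t \<longlonglongrightarrow> 0" unfolding t_def[abs_def] by (rule LIMSEQ_Suc[OF lim_1_over_n])
  define k where "k c n = mollifier (t n *\<^sub>R a c) (t n * \<rho> c)" for c n
  have tr: "t n * \<rho> c > 0" if "c \<in> C" for c n using t r(2) C that by auto
  have kC1: "C1_on UNIV (k c n)" if "c \<in> C" for c n
    unfolding k_def by (rule C1_on_mollifier[OF tr[OF that]])
  have kR: "norm z < t n * (norm (a c) + \<rho> c)" if "c \<in> C" "k c n z \<noteq> 0" for c n z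
    using norm_less_of_mollifier_neq_0[OF t[of n], of "\<rho> c" "a c" z] r(2)[of c] C that unfolding k_def by auto
  have ktend: "L2_tendsto lborel (\<lambda>n. conv (k c n) f) f"
    if "c \<in> C" "integrable lborel f" "integrable lborel (\<lambda>x. (norm (f x))\<^sup>2)" for c and f :: "real^3 \<Rightarrow> complex"
  proof (rule conv_L2_tendsto[OF that(2,3), where r="\<lambda>n. t n * (norm (a c) + \<rho> c)"])
    show "(\<lambda>n. t n * (norm (a c) + \<rho> c)) \<longlonglongrightarrow> 0"
      by (rule tendsto_mult_left_zero[OF tlim])
  qed (use that kC1 kR mollifier_nonneg[OF tr] integral_mollifier[OF tr] in \<open>auto simp: k_def intro!: C1_on_continuous\<close>)
  have prod: "integrable lborel (\<lambda>x. F x *\<^sub>R f x)" "integrable lborel (\<lambda>x. (norm (F x *\<^sub>R f x))\<^sup>2)"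
    if "integrable lborel f" "integrable lborel (\<lambda>x. (norm (f x))\<^sup>2)" "continuous_on UNIV F" "\<And>z. F z \<noteq> 0 \<Longrightarrow> norm z \<le> R"
    for f :: "real^3 \<Rightarrow> complex" and F R
  proof -
    show "integrable lborel (\<lambda>x. F x *\<^sub>R f x)"
      by (rule integrable_scaleR_bounded_support[OF that(1,3,4)])
    have "integrable lborel (\<lambda>x. (F x)\<^sup>2 *\<^sub>R (norm (f x))\<^sup>2)"
      by (rule integrable_scaleR_bounded_support[OF that(2), of _ R]) (use that(3,4) in \<open>auto intro!: continuous_intros\<close>)
    then show "integrable lborel (\<lambda>x. (norm (F x *\<^sub>R f x))\<^sup>2)"
      by (simp add: power_mult_distrib)
  qed
  let ?e = "\<lambda>i. axis i 1 :: real^3"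
  define D where "D c i y = frechet_derivative (\<psi> c) (at y) (?e i)" for c i y
  have Dc: "continuous_on UNIV (D c i)" for c i
    unfolding D_def[abs_def] by (rule C1_on_continuous_derivative[OF \<psi>(1)])
  have DR: "norm z \<le> norm c + r c" if "c \<in> C" "D c i z \<noteq> 0" for c i z
  proof (rule ccontr)
    assume "\<not> norm z \<le> norm c + r c"
    then have "D c i z = 0"
      unfolding D_def by (intro frechet_derivative_eq_0_outside[of "cball 0 (norm c + r c)"]) (use \<psi>R that in auto)
    with that show False by simp
  qed
  \<comment> \<open>\<open>V\<close> is a localized piece of \<open>u\<close>, and \<open>W\<close>
    its weak partial derivative according to the product rule.\<close>
  define V where "V c y = \<psi> c y *\<^sub>R u' y" for c y
  define W where "W c i y = \<psi> c y *\<^sub>R g i y + D c i y *\<^sub>R u' y" for c i y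
  have V: "integrable lborel (V c)" "integrable lborel (\<lambda>x. (norm (V c x))\<^sup>2)" if "c \<in> C" for c
    unfolding V_def[abs_def] using prod[OF u'(4,5) C1_on_continuous[OF \<psi>(1)] \<psi>R[OF that]] by auto
  have W: "integrable lborel (W c i)" "integrable lborel (\<lambda>x. (norm (W c i x))\<^sup>2)" if "c \<in> C" for c i
  proof -
    note p1 = prod[OF g(4)[of i] g(5)[of i] C1_on_continuous[OF \<psi>(1)] \<psi>R[OF that]]
    note p2 = prod[OF u'(4,5) Dc[of c i] DR[OF that]]
    show "integrable lborel (W c i)"
      unfolding W_def[abs_def] by (rule Bochner_Integration.integrable_add[OF p1(1) p2(1)])
    have "integrable lborel (\<lambda>x. (norm (\<psi> c x *\<^sub>R g i x - (- (D c i x *\<^sub>R u' x))))\<^sup>2)"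
      by (rule integrable_norm_diff_square) (use p1 p2 in auto)
    then show "integrable lborel (\<lambda>x. (norm (W c i x))\<^sup>2)"
      by (simp add: W_def)
  qed
  define \<phi> where "\<phi> n x = (\<Sum>c\<in>C. conv (k c n) (V c) x)" for n x
  have cC1: "C1_on UNIV (conv (k c n) f)" if "c \<in> C" "integrable lborel f" for c n and f :: "real^3 \<Rightarrow> complex"
    by (rule C1_on_conv[OF that(2) kC1[OF that(1)] less_imp_le[OF kR[OF that(1)]]])
  have \<phi>C1: "C1_on UNIV (\<phi> n)" for n
    unfolding \<phi>_def[abs_def] by (intro C1_on_sum cC1 V)
  have cb: "conv (k c n) f \<in> borel_measurable borel" if "c \<in> C" "integrable lborel f" for c n and f :: "real^3 \<Rightarrow> complex"
    by (intro borel_measurable_continuous_onI C1_on_continuous cC1 that)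
  have sumV: "(\<Sum>c\<in>C. V c x) = u' x" for x
    using \<psi>1[of x] u'(2)[of x] closure_subset[of \<Omega>] by (cases "x \<in> \<Omega>") (auto simp: V_def simp flip: scaleR_sum_left)
  \<comment> \<open>Inside \<Omega> the partition adds up to the constant 1, so its derivatives
    cancel and the pieces \<open>W\<close> add up to the weak derivative of \<open>u\<close>
    alone.\<close>
  have sumD: "(\<Sum>c\<in>C. D c i x) = 0" if "x \<in> \<Omega>" for x i
  proof -
    have "((\<lambda>x. \<Sum>c\<in>C. \<psi> c x) has_derivative (\<lambda>h. \<Sum>c\<in>C. frechet_derivative (\<psi> c) (at x) h)) (at x)"
      by (intro has_derivative_sum C1_on_has_derivative[OF \<psi>(1)] UNIV_I)
    moreover have "((\<lambda>x. \<Sum>c\<in>C. \<psi> c x) has_derivative (\<lambda>h. 0)) (at x)"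
      by (rule has_derivative_transform_within_open[OF has_derivative_const[of 1] \<Omega>(1) that])
        (use \<psi>1 closure_subset in auto)
    ultimately show ?thesis
      unfolding D_def using has_derivative_unique by (metis (no_types))
  qed
  have sumW: "(\<Sum>c\<in>C. W c i x) = g i x" if "x \<in> \<Omega>" for x i
    using \<psi>1[of x] sumD[OF that, of i] closure_subset[of \<Omega>] that
    by (auto simp: W_def sum.distrib simp flip: scaleR_sum_left)
  have "L2_tendsto lborel \<phi> (\<lambda>x. \<Sum>c\<in>C. V c x)"
    unfolding \<phi>_def[abs_def] by (intro L2_tendsto_sum C ktend V) (use cb V in auto)
  then have "L2_tendsto (lebesgue_on \<Omega>) \<phi> u'"
    unfolding sumV by (rule L2_tendsto_lebesgue_on[OF _ \<Omega>b])
  then have "L2_tendsto (lebesgue_on \<Omega>) \<phi> u"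
    by (rule L2_tendsto_cong_AE) (use u'(3) in \<open>auto intro!: always_eventually elim!: eventually_mono\<close>)
  moreover have "L2_tendsto (lebesgue_on \<Omega>) (\<lambda>n. cgrad (\<phi> n)) G"
  proof (rule L2_tendsto_vec)
    fix i
    have "L2_tendsto lborel (\<lambda>n x. \<Sum>c\<in>C. conv (k c n) (W c i) x) (\<lambda>x. \<Sum>c\<in>C. W c i x)"
      by (intro L2_tendsto_sum C ktend W) (use cb W in auto)
    then have "L2_tendsto (lebesgue_on \<Omega>) (\<lambda>n x. \<Sum>c\<in>C. conv (k c n) (W c i) x) (\<lambda>x. \<Sum>c\<in>C. W c i x)"
      by (rule L2_tendsto_lebesgue_on[OF _ \<Omega>b])
    then show "L2_tendsto (lebesgue_on \<Omega>) (\<lambda>n x. cgrad (\<phi> n) x $ i) (\<lambda>x. G x $ i)"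
    proof (rule L2_tendsto_cong_AE)
      \<comment> \<open>For small steps the shifted kernels, cut off by \<psi>, are test functions
        in \<Omega>; since there are finitely many balls, one threshold serves all of them.\<close>
      have "\<forall>\<^sub>F n in sequentially. \<forall>c\<in>C. t n * (norm (a c) + \<rho> c) < r c / 2"
      proof (intro eventually_ball_finite C ballI)
        fix c assume "c \<in> C"
        then have "r c / 2 > 0" using r(1) C by auto
        then show "\<forall>\<^sub>F n in sequentially. t n * (norm (a c) + \<rho> c) < r c / 2"
          using order_tendstoD(2)[OF tendsto_mult_left_zero[OF tlim]] by blast
      qed
      then show "\<forall>\<^sub>F n in sequentially. AE x in lebesgue_on \<Omega>.
          norm ((\<Sum>c\<in>C. conv (k c n) (W c i) x) - (\<Sum>c\<in>C. W c i x)) = norm (cgrad (\<phi> n) x $ i - G x $ i)"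
      proof eventually_elim
        case (elim n)
        have der: "cgrad (\<phi> n) x $ i = (\<Sum>c\<in>C. conv (k c n) (W c i) x)" if x: "x \<in> \<Omega>" for x
        proof -
          have "(\<phi> n has_derivative (\<lambda>h. \<Sum>c\<in>C. frechet_derivative (conv (k c n) (V c)) (at x) h)) (at x)"
            unfolding \<phi>_def[abs_def] by (intro has_derivative_sum C1_on_has_derivative[OF cC1] V UNIV_I)
          from fun_cong[OF frechet_derivative_at[OF this], of "?e i"]
          have "cgrad (\<phi> n) x $ i = (\<Sum>c\<in>C. frechet_derivative (conv (k c n) (V c)) (at x) (?e i))"
            by (simp add: cgrad_def partial_deriv_def)
          also have "\<dots> = (\<Sum>c\<in>C. conv (k c n) (W c i) x)"
          proof (rule sum.cong[OF refl])
            fix c assume c: "c \<in> C"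
            have c': "c \<in> closure \<Omega>" using C c by auto
            have "test_function \<Omega> (\<lambda>y. complex_of_real (\<psi> c y * k c n (y - x)))"
              unfolding k_def
              by (rule mollifier_test_function[OF r(1)[OF c'] r(2)[OF c'] \<psi>(1) \<psi>(3)[OF c] ra[OF c'] t _ x])
                (use elim c in auto)
            from conv_weak_derivative[OF wg u'(4) g(4) \<psi>(1) \<psi>R[OF c] kC1[OF c] less_imp_le[OF kR[OF c]] this]
            show "frechet_derivative (conv (k c n) (V c)) (at x) (?e i) = conv (k c n) (W c i) x"
              unfolding V_def[abs_def] W_def[abs_def] D_def .
          qed
          finally show ?thesis .
        qed
        have "AE x in lebesgue_on \<Omega>. x \<in> \<Omega>"
          using AE_space[of "lebesgue_on \<Omega>"] by (simp add: space_restrict_space)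
        with g(3)[of i] show ?case
          by eventually_elim (simp add: der sumW)
      qed
    qed
    show "(\<lambda>x. cgrad (\<phi> n) x $ i) \<in> borel_measurable (lebesgue_on \<Omega>)" for n
      using partial_deriv_continuous[OF \<phi>C1]
      by (auto simp: cgrad_def intro!: borel_measurable_lebesgue_on borel_measurable_continuous_onI)
    show "(\<lambda>x. G x $ i) \<in> borel_measurable (lebesgue_on \<Omega>)"
      using L2_fun_component[OF G(1)] by (simp add: L2_fun_def)
  qed
  ultimately show ?thesis using that \<phi>C1 by blast
qed

section \<open>Weak gradients\<close>

lemma L2_fun_continuous:
  fixes f :: "'a::euclidean_space \<Rightarrow> 'b::{banach,second_countable_topology}"
  assumes f: "continuous_on UNIV f" and \<Omega>: "\<Omega> \<in> sets borel" "bounded \<Omega>"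
  shows "L2_fun (lebesgue_on \<Omega>) f"
proof -
  have \<Omega>': "\<Omega> \<inter> space lebesgue \<in> sets lebesgue"
    using \<Omega>(1) by auto
  have fm: "f \<in> borel_measurable borel"
    by (rule borel_measurable_continuous_onI[OF f])
  have "integrable lborel (\<lambda>x. indicator (closure \<Omega>) x *\<^sub>R (norm (f x))\<^sup>2)"
    using \<Omega>(2) by (intro borel_integrable_compact continuous_intros continuous_on_subset[OF f])
      (auto simp: compact_eq_bounded_closed bounded_closure)
  then have "integrable lborel (\<lambda>x. indicator \<Omega> x *\<^sub>R (norm (f x))\<^sup>2)"
    by (rule Bochner_Integration.integrable_bound)
      (use fm \<Omega>(1) closure_subset[of \<Omega>] in \<open>auto intro!: AE_I2 simp: indicator_def\<close>)
  then have "integrable lebesgue (\<lambda>x. indicator \<Omega> x *\<^sub>R (norm (f x))\<^sup>2)"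
    using fm \<Omega>(1) by (subst integrable_completion) auto
  then have "integrable (lebesgue_on \<Omega>) (\<lambda>x. (norm (f x))\<^sup>2)"
    using \<Omega>' by (simp add: integrable_restrict_space)
  then show ?thesis
    using borel_measurable_lebesgue_on[OF fm] by (simp add: L2_fun_def)
qed

lemma cgrad_continuous: "C1_on UNIV w \<Longrightarrow> continuous_on UNIV (cgrad w)"
  unfolding cgrad_def[abs_def] by (intro continuous_on_vec_lambda partial_deriv_continuous)

text \<open>The derivative of the compactly supported product \<open>w * \<phi>\<close> has integral
  0; the integrands vanish outside \<Omega> together with \<phi> and its derivatives.\<close>

lemma C1_has_weak_gradient:
  assumes w: "C1_on UNIV w" and \<Omega>: "\<Omega> \<in> sets borel"
  shows "has_weak_gradient \<Omega> w (cgrad w)"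
  unfolding has_weak_gradient_def
proof (intro allI impI)
  fix \<phi> i assume t: "test_function \<Omega> \<phi>"
  note \<phi> = test_function_C1[OF t]
  obtain R where R: "\<And>x. \<phi> x \<noteq> 0 \<Longrightarrow> norm x \<le> R"
    using test_function_bounded_support[OF t] by auto
  have R': "norm x \<le> R" if "partial_deriv i \<phi> x \<noteq> 0" for x
  proof (rule ccontr)
    assume "\<not> norm x \<le> R"
    then have "partial_deriv i \<phi> x = 0"
      unfolding partial_deriv_def by (intro frechet_derivative_eq_0_outside[of "cball 0 R"]) (use R in auto)
    with that show False by simp
  qed
  have c: "continuous_on UNIV (\<lambda>x. w x * partial_deriv i \<phi> x)" "continuous_on UNIV (\<lambda>x. cgrad w x $ i * \<phi> x)"
    using C1_on_continuous[OF w] C1_on_continuous[OF \<phi>] partial_deriv_continuous[OF w] partial_deriv_continuous[OF \<phi>]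
    by (auto simp: cgrad_def intro!: continuous_intros)
  have i1: "integrable lborel (\<lambda>x. w x * partial_deriv i \<phi> x)"
    by (rule integrable_continuous_bounded_support[OF c(1), of R]) (use R' in auto)
  have i2: "integrable lborel (\<lambda>x. cgrad w x $ i * \<phi> x)"
    by (rule integrable_continuous_bounded_support[OF c(2), of R]) (use R in auto)
  have "(\<integral>x. w x * partial_deriv i \<phi> x + cgrad w x $ i * \<phi> x \<partial>lborel) = 0"
  proof -
    have "(\<integral>x. frechet_derivative (\<lambda>x. w x * \<phi> x) (at x) (axis i 1) \<partial>lborel) = 0"
      by (rule integral_derivative_eq_0(2)[of _ R]) (use C1_on_mult[OF w \<phi>] R in auto)
    then show ?thesis
      unfolding frechet_derivative_mult[OF w \<phi>] by (simp add: partial_deriv_def cgrad_def)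
  qed
  then have "(\<integral>x. w x * partial_deriv i \<phi> x \<partial>lborel) = - (\<integral>x. cgrad w x $ i * \<phi> x \<partial>lborel)"
    unfolding Bochner_Integration.integral_add[OF i1 i2] by (simp add: add_eq_0_iff2)
  moreover have "(LINT x|lebesgue_on \<Omega>. w x * partial_deriv i \<phi> x) = (\<integral>x. w x * partial_deriv i \<phi> x \<partial>lborel)"
    by (subst integral_lebesgue_on_eq_lborel[OF borel_measurable_continuous_onI[OF c(1)] \<Omega>])
      (auto intro!: Bochner_Integration.integral_cong simp: indicator_def test_function_derivative_outside[OF t])
  moreover have "(LINT x|lebesgue_on \<Omega>. cgrad w x $ i * \<phi> x) = (\<integral>x. cgrad w x $ i * \<phi> x \<partial>lborel)"
    by (subst integral_lebesgue_on_eq_lborel[OF borel_measurable_continuous_onI[OF c(2)] \<Omega>])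
      (auto intro!: Bochner_Integration.integral_cong simp: indicator_def test_function_outside[OF t])
  ultimately show "(LINT x|lebesgue_on \<Omega>. w x * partial_deriv i \<phi> x) = - (LINT x|lebesgue_on \<Omega>. cgrad w x $ i * \<phi> x)"
    by simp
qed

lemma C1_in_H1:
  assumes "C1_on UNIV w" "\<Omega> \<in> sets borel" "bounded \<Omega>"
  shows "w \<in> H1 \<Omega>"
  unfolding H1_def
  using C1_has_weak_gradient[OF assms(1,2)] L2_fun_continuous[OF C1_on_continuous[OF assms(1)] assms(2,3)]
    L2_fun_continuous[OF cgrad_continuous[OF assms(1)] assms(2,3)] by blast

lemma
  assumes "u \<in> H1 \<Omega>"
  shows L2_weak_grad: "L2_fun (lebesgue_on \<Omega>) (weak_grad \<Omega> u)"
    and has_weak_gradient_weak_grad: "has_weak_gradient \<Omega> u (weak_grad \<Omega> u)"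
proof -
  have "\<exists>G. L2_fun (lebesgue_on \<Omega>) G \<and> has_weak_gradient \<Omega> u G"
    using assms by (auto simp: H1_def)
  from someI_ex[OF this] show "L2_fun (lebesgue_on \<Omega>) (weak_grad \<Omega> u)" "has_weak_gradient \<Omega> u (weak_grad \<Omega> u)"
    unfolding weak_grad_def by blast+
qed

text \<open>The fundamental lemma of the calculus of variations. Mollifications of \<open>g\<close>
  vanish at points far enough from the complement of \<Omega>, because the kernel is a test function
  there; they converge to \<open>g\<close> in L2, so \<open>g\<close> vanishes almost everywhere at
  these points.\<close>

lemma AE_eq_0_of_test_integrals:
  fixes g :: "real^3 \<Rightarrow> complex"
  assumes \<Omega>: "open \<Omega>" and g: "integrable lborel g" "integrable lborel (\<lambda>x. (norm (g x))\<^sup>2)"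
    and z: "\<And>\<phi>. test_function \<Omega> \<phi> \<Longrightarrow> (\<integral>y. g y * \<phi> y \<partial>lborel) = 0"
  shows "AE x in lborel. x \<in> \<Omega> \<longrightarrow> g x = 0"
proof -
  have [measurable]: "g \<in> borel_measurable borel"
    using borel_measurable_integrable[OF g(1)] by simp
  define t where "t n = 1 / real (Suc n)" for n
  have t: "t n > 0" for n by (simp add: t_def)
  have tlim: "t \<longlonglongrightarrow> 0" unfolding t_def[abs_def] by (rule LIMSEQ_Suc[OF lim_1_over_n])
  define k where "k n = mollifier (0 :: real^3) (t n)" for n
  have k0: "norm z < t n" if "k n z \<noteq> 0" for n z
    using mollifier_eq_0[OF t[of n], of z 0] that by (fastforce simp: k_def dist_norm)
  have kC1: "C1_on UNIV (k n)" for n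
    unfolding k_def by (rule C1_on_mollifier[OF t])
  have conv: "L2_tendsto lborel (\<lambda>n. conv (k n) g) g"
    by (rule conv_L2_tendsto[OF g _ _ _ k0 tlim])
      (use t C1_on_continuous[OF kC1] in \<open>auto simp: k_def mollifier_nonneg integral_mollifier\<close>)
  \<comment> \<open>These sets are closed, hence Borel, and exhaust \<Omega> because \<Omega> is
    open.\<close>
  define \<Omega>' where "\<Omega>' m = {x. ball x (t m) \<subseteq> \<Omega>}" for m
  have \<Omega>'c: "closed (\<Omega>' m)" for m
  proof -
    have "\<Omega>' m = (\<Inter>y\<in>- \<Omega>. {x. t m \<le> dist x y})"
      by (auto simp: \<Omega>'_def subset_eq not_less)
        (use not_less in blast)
    then show ?thesis
      by (simp add: closed_INT closed_Collect_le continuous_on_dist)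
  qed
  have conv0: "conv (k n) g x = 0" if "m < n" "x \<in> \<Omega>' m" for m n x
  proof -
    have "t n < t m" using that(1) by (simp add: t_def frac_less2)
    then have "cball x (t n) \<subseteq> \<Omega>" using that(2) by (auto simp: \<Omega>'_def)
    then have "test_function \<Omega> (\<lambda>y. complex_of_real (k n (y - x)))"
      by (intro test_function_of_real[OF C1_on_translate[OF kC1], of _ _ "cball x (t n)"])
        (auto dest!: k0 simp: dist_norm norm_minus_commute)
    from z[OF this] show ?thesis
      by (simp add: conv_def scaleR_conv_of_real mult.commute)
  qed
  have "AE x in lborel. x \<in> \<Omega>' m \<longrightarrow> g x = 0" for m
  proof -
    let ?J = "\<integral>\<^sup>+x. ennreal ((norm (g x))\<^sup>2) * indicator (\<Omega>' m) x \<partial>lborel"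
    have "\<forall>\<^sub>F n in sequentially. ?J \<le> (\<integral>\<^sup>+x. ennreal ((norm (conv (k n) g x - g x))\<^sup>2) \<partial>lborel)"
      using eventually_gt_at_top[of m]
      by eventually_elim (auto intro!: nn_integral_mono simp: indicator_def conv0)
    from tendsto_lowerbound[OF conv[unfolded L2_tendsto_def] this] have "?J = 0"
      by simp
    moreover have "(\<lambda>x. ennreal ((norm (g x))\<^sup>2) * indicator (\<Omega>' m) x) \<in> borel_measurable lborel"
      using borel_closed[OF \<Omega>'c] by measurable
    ultimately have "AE x in lborel. ennreal ((norm (g x))\<^sup>2) * indicator (\<Omega>' m) x = 0"
      by (simp add: nn_integral_0_iff_AE)
    then show ?thesis
      by eventually_elim (auto simp: indicator_def)
  qed
  then have "AE x in lborel. \<forall>m. x \<in> \<Omega>' m \<longrightarrow> g x = 0"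
    unfolding AE_all_countable by blast
  then show ?thesis
  proof eventually_elim
    case (elim x)
    show ?case
    proof
      assume "x \<in> \<Omega>"
      then obtain e where e: "e > 0" "ball x e \<subseteq> \<Omega>"
        using \<Omega> open_contains_ball by blast
      have "\<forall>\<^sub>F m in sequentially. t m < e"
        by (rule order_tendstoD(2)[OF tlim e(1)])
      then obtain m where "t m < e"
        by (auto simp: eventually_sequentially)
      with e(2) have "x \<in> \<Omega>' m" by (auto simp: \<Omega>'_def)
      with elim show "g x = 0" by blast
    qed
  qed
qed

text \<open>\<open>weak_grad\<close> is chosen by \<open>SOME\<close>; uniqueness almost everywhere
  is what identifies the chosen gradient of a C1 function with the classical one.\<close>

lemma weak_gradient_unique:
  assumes \<Omega>: "open \<Omega>" "bounded \<Omega>" and u: "L2_fun (lebesgue_on \<Omega>) u"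
    and G: "L2_fun (lebesgue_on \<Omega>) G" "has_weak_gradient \<Omega> u G"
    and G': "L2_fun (lebesgue_on \<Omega>) G'" "has_weak_gradient \<Omega> u G'"
  shows "AE x in lebesgue_on \<Omega>. G x = G' x"
proof -
  have \<Omega>b: "\<Omega> \<in> sets borel" using \<Omega> by auto
  have "AE x in lebesgue_on \<Omega>. G x $ i = G' x $ i" for i
  proof -
    obtain u' where "borel_representative \<Omega> u u'"
      using borel_representative_exists[OF \<Omega>b \<Omega>(2) u] by blast
    then have u': "u' \<in> borel_measurable borel" "\<And>x. x \<notin> \<Omega> \<Longrightarrow> u' x = 0" "AE x in lebesgue_on \<Omega>. u x = u' x"
      by (auto simp: borel_representative_def)
    obtain g where "borel_representative \<Omega> (\<lambda>x. G x $ i) g"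
      using borel_representative_exists[OF \<Omega>b \<Omega>(2) L2_fun_component[OF G(1)]] by blast
    then have g: "g \<in> borel_measurable borel" "\<And>x. x \<notin> \<Omega> \<Longrightarrow> g x = 0" "AE x in lebesgue_on \<Omega>. G x $ i = g x"
      "integrable lborel g" "integrable lborel (\<lambda>x. (norm (g x))\<^sup>2)"
      by (auto simp: borel_representative_def)
    obtain g' where "borel_representative \<Omega> (\<lambda>x. G' x $ i) g'"
      using borel_representative_exists[OF \<Omega>b \<Omega>(2) L2_fun_component[OF G'(1)]] by blast
    then have g': "g' \<in> borel_measurable borel" "\<And>x. x \<notin> \<Omega> \<Longrightarrow> g' x = 0" "AE x in lebesgue_on \<Omega>. G' x $ i = g' x"
      "integrable lborel g'" "integrable lborel (\<lambda>x. (norm (g' x))\<^sup>2)"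
      by (auto simp: borel_representative_def)
    have "AE x in lborel. x \<in> \<Omega> \<longrightarrow> g x - g' x = 0"
    proof (rule AE_eq_0_of_test_integrals[OF \<Omega>(1)])
      show "integrable lborel (\<lambda>x. g x - g' x)" using g g' by simp
      show "integrable lborel (\<lambda>x. (norm (g x - g' x))\<^sup>2)"
        using g g' by (intro integrable_norm_diff_square) auto
      fix \<phi> assume t: "test_function \<Omega> \<phi>"
      obtain R where R: "\<And>x. \<phi> x \<noteq> 0 \<Longrightarrow> norm x \<le> R"
        using test_function_bounded_support[OF t] by auto
      obtain B where B: "\<And>x. norm (\<phi> x) \<le> B"
        using bounded_continuous_bounded_support[OF C1_on_continuous[OF test_function_C1[OF t]] R] by blast
      have \<phi>m: "\<phi> \<in> borel_measurable borel"
        by (rule borel_measurable_continuous_onI[OF C1_on_continuous[OF test_function_C1[OF t]]])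
      have int: "integrable lborel (\<lambda>y. f y * \<phi> y)" if "integrable lborel f" for f :: "real^3 \<Rightarrow> complex"
      proof (rule Bochner_Integration.integrable_bound[where f="\<lambda>y. B * norm (f y)"])
        show "AE x in lborel. norm (f x * \<phi> x) \<le> norm (B * norm (f x))"
          using B order_trans[OF norm_ge_zero B]
          by (intro AE_I2) (simp add: norm_mult mult.commute mult_right_mono abs_mult)
      qed (use that \<phi>m borel_measurable_integrable[OF that] in auto)
      have "(\<integral>y. g y * \<phi> y \<partial>lborel) = (\<integral>y. g' y * \<phi> y \<partial>lborel)"
        using weak_gradient_representative[OF \<Omega>b \<Omega>(2) u G u' g(1,2,3) t]
          weak_gradient_representative[OF \<Omega>b \<Omega>(2) u G' u' g'(1,2,3) t] by simp
      then show "(\<integral>y. (g y - g' y) * \<phi> y \<partial>lborel) = 0"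
        using int[OF g(4)] int[OF g'(4)] by (simp add: left_diff_distrib)
    qed
    then have "AE x in lebesgue_on \<Omega>. g x - g' x = 0"
      by (rule AE_lborel_imp_lebesgue_on[OF _ \<Omega>b])
    with g(3) g'(3) show ?thesis
      by eventually_elim simp
  qed
  then have "AE x in lebesgue_on \<Omega>. \<forall>i\<in>UNIV. G x $ i = G' x $ i"
    by (intro AE_finite_allI) auto
  then show ?thesis
    by eventually_elim (simp add: vec_eq_iff)
qed

lemma weak_grad_C1:
  assumes "C1_on UNIV w" "open \<Omega>" "bounded \<Omega>"
  shows "AE x in lebesgue_on \<Omega>. weak_grad \<Omega> w x = cgrad w x"
proof -
  have \<Omega>b: "\<Omega> \<in> sets borel" using assms by auto
  note w = C1_in_H1[OF assms(1) \<Omega>b assms(3)]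
  show ?thesis
    by (rule weak_gradient_unique[OF assms(2,3) L2_fun_continuous[OF C1_on_continuous[OF assms(1)] \<Omega>b assms(3)]
        L2_weak_grad[OF w] has_weak_gradient_weak_grad[OF w]
        L2_fun_continuous[OF cgrad_continuous[OF assms(1)] \<Omega>b assms(3)] C1_has_weak_gradient[OF assms(1) \<Omega>b]])
qed

lemma integrable_of_L2_finite:
  fixes f :: "'a \<Rightarrow> 'b::{banach,second_countable_topology}"
  assumes "finite_measure M" "L2_fun M f"
  shows "integrable M f"
proof (rule Bochner_Integration.integrable_bound[where f="\<lambda>x. 1 + (norm (f x))\<^sup>2"])
  interpret finite_measure M by fact
  show "integrable M (\<lambda>x. 1 + (norm (f x))\<^sup>2)"
    using assms(2) by (auto simp: L2_fun_def)
  show "AE x in M. norm (f x) \<le> norm (1 + (norm (f x))\<^sup>2)"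
  proof (rule AE_I2)
    fix x
    have "norm (f x) \<le> 1 + (norm (f x))\<^sup>2"
      using sum_squares_bound[of "norm (f x)" 1, simplified] norm_ge_zero[of "f x"] by linarith
    then show "norm (f x) \<le> norm (1 + (norm (f x))\<^sup>2)" by simp
  qed
qed (use assms in \<open>auto simp: L2_fun_def\<close>)

lemma integrable_mult_bounded:
  fixes f b :: "'a \<Rightarrow> complex"
  assumes "integrable M f" "b \<in> borel_measurable M" "AE x in M. norm (b x) \<le> B"
  shows "integrable M (\<lambda>x. f x * b x)"
proof (rule Bochner_Integration.integrable_bound[where f="\<lambda>x. B * norm (f x)"])
  show "AE x in M. norm (f x * b x) \<le> norm (B * norm (f x))"
    using assms(3)
  proof eventually_elim
    case (elim x)
    then have "norm (b x) \<le> \<bar>B\<bar>" by simp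
    then have "norm (b x) * norm (f x) \<le> \<bar>B\<bar> * norm (f x)"
      by (rule mult_right_mono) simp
    then show ?case by (simp add: norm_mult abs_mult mult.commute)
  qed
qed (use assms borel_measurable_integrable[OF assms(1)] in auto)

text \<open>The weighted inequality \<open>t \<le> d + t\<^sup>2 / d\<close> takes the place of
  Cauchy-Schwarz; finiteness of the measure controls the constant part.\<close>

lemma L2_tendsto_integral:
  fixes f :: "nat \<Rightarrow> 'a \<Rightarrow> complex"
  assumes M: "finite_measure M" and lim: "L2_tendsto M f g"
    and f: "\<And>n. integrable M (f n)" and g: "integrable M g"
    and b: "b \<in> borel_measurable M" "AE x in M. norm (b x) \<le> B"
  shows "(\<lambda>n. \<integral>x. f n x * b x \<partial>M) \<longlonglongrightarrow> (\<integral>x. g x * b x \<partial>M)"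
proof -
  interpret finite_measure M by fact
  let ?m = "measure M (space M)"
  have [measurable]: "f n \<in> borel_measurable M" "g \<in> borel_measurable M" for n
    using f g borel_measurable_integrable by auto
  have "(\<lambda>n. ennreal (norm ((\<integral>x. f n x * b x \<partial>M) - (\<integral>x. g x * b x \<partial>M)))) \<longlonglongrightarrow> 0"
  proof (rule ennreal_tendsto_0I)
    fix e :: real assume e: "e > 0"
    define B' where "B' = \<bar>B\<bar> + 1"
    \<comment> \<open>With this \<open>d\<close> the constant part contributes at most
      \<open>e / 2\<close>. The L2 error is then required to stay below
      \<open>d * e / (2 * B')\<close>, which makes the other part at most
      \<open>e / 2\<close>.\<close>
    define d where "d = e / (2 * B' * (?m + 1))"
    have B': "B' > 0" by (simp add: B'_def)
    have d: "d > 0" using e B' by (simp add: d_def add_nonneg_pos)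
    have dm: "B' * d * ?m \<le> e / 2"
    proof -
      have "B' * d * (?m + 1) = e / 2"
        using B' by (simp add: d_def field_simps add_nonneg_eq_0_iff) 
      moreover have "B' * d * ?m \<le> B' * d * (?m + 1)"
        using B' d by (intro mult_left_mono) auto
      ultimately show ?thesis by simp
    qed
    have "\<forall>\<^sub>F n in sequentially. (\<integral>\<^sup>+x. ennreal ((norm (f n x - g x))\<^sup>2) \<partial>M) < ennreal (d * e / (2 * B'))"
      using d e B' by (intro order_tendstoD(2)[OF lim[unfolded L2_tendsto_def]]) simp
    then show "\<forall>\<^sub>F n in sequentially. ennreal (norm ((\<integral>x. f n x * b x \<partial>M) - (\<integral>x. g x * b x \<partial>M))) \<le> ennreal e"
    proof eventually_elim
      case (elim n)
      have int: "integrable M (\<lambda>x. (f n x - g x) * b x)"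
        by (rule integrable_mult_bounded[OF Bochner_Integration.integrable_diff[OF f g] b])
      have "(\<integral>x. f n x * b x \<partial>M) - (\<integral>x. g x * b x \<partial>M) = (\<integral>x. (f n x - g x) * b x \<partial>M)"
        using integrable_mult_bounded[OF f b] integrable_mult_bounded[OF g b] by (simp add: left_diff_distrib)
      then have "ennreal (norm ((\<integral>x. f n x * b x \<partial>M) - (\<integral>x. g x * b x \<partial>M))) \<le> (\<integral>\<^sup>+x. ennreal (norm ((f n x - g x) * b x)) \<partial>M)"
        using integral_norm_bound_ennreal[OF int] by simp
      also have "\<dots> \<le> (\<integral>\<^sup>+x. ennreal (B' * d) + ennreal (B' / d) * ennreal ((norm (f n x - g x))\<^sup>2) \<partial>M)"
      proof (rule nn_integral_mono_AE)
        show "AE x in M. ennreal (norm ((f n x - g x) * b x)) \<le> ennreal (B' * d) + ennreal (B' / d) * ennreal ((norm (f n x - g x))\<^sup>2)"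
          using b(2)
        proof eventually_elim
          case (elim x)
          let ?y = "norm (f n x - g x)"
          have "?y * d \<le> d\<^sup>2 + ?y\<^sup>2"
          proof -
            have "2 * (?y * d) \<le> ?y\<^sup>2 + d\<^sup>2"
              using sum_squares_bound[of ?y d] by (simp add: mult.assoc)
            moreover have "0 \<le> ?y * d" using d by simp
            ultimately show ?thesis by linarith
          qed
          then have y: "?y \<le> d + ?y\<^sup>2 / d"
            using d by (simp add: field_simps power2_eq_square)
          have "norm ((f n x - g x) * b x) \<le> ?y * B'"
            unfolding norm_mult using elim by (intro mult_left_mono) (auto simp: B'_def)
          also have "\<dots> \<le> (d + ?y\<^sup>2 / d) * B'"
            using y B' by (intro mult_right_mono) auto
          finally have "norm ((f n x - g x) * b x) \<le> B' * d + (B' / d) * ?y\<^sup>2"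
            by (simp add: algebra_simps)
          then show ?case
            using B' d by (simp flip: ennreal_plus ennreal_mult add: ennreal_leI)
        qed
      qed
      also have "\<dots> = ennreal (B' * d) * emeasure M (space M) + ennreal (B' / d) * (\<integral>\<^sup>+x. ennreal ((norm (f n x - g x))\<^sup>2) \<partial>M)"
        by (simp add: nn_integral_add nn_integral_cmult)
      also have "\<dots> \<le> ennreal (e / 2) + ennreal (B' / d) * ennreal (d * e / (2 * B'))"
      proof (rule add_mono)
        show "ennreal (B' * d) * emeasure M (space M) \<le> ennreal (e / 2)"
          unfolding emeasure_eq_measure using dm B' d by (simp flip: ennreal_mult add: ennreal_leI)
        show "ennreal (B' / d) * (\<integral>\<^sup>+x. ennreal ((norm (f n x - g x))\<^sup>2) \<partial>M) \<le> ennreal (B' / d) * ennreal (d * e / (2 * B'))"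
          using elim by (intro mult_left_mono) auto
      qed
      also have "\<dots> = ennreal e"
        using B' d e by (simp flip: ennreal_mult ennreal_plus add: field_simps)
      finally show ?case .
    qed
  qed
  then have "(\<lambda>n. norm ((\<integral>x. f n x * b x \<partial>M) - (\<integral>x. g x * b x \<partial>M))) \<longlonglongrightarrow> 0"
    by (subst (asm) ennreal_0[symmetric], subst (asm) tendsto_ennreal_iff) auto
  then show ?thesis
    by (simp add: tendsto_norm_zero_iff LIM_zero_iff)
qed

section \<open>Surface measure of a graph\<close>

text \<open>It is an inequality because the image of \<open>g\<close> may be smaller than
  \<open>T\<close>. Its purpose is to compare the area of an arbitrary patch with that of the graph
  on which the patch lies.\<close>

lemma nn_integral_change_of_variables_le:
  fixes g :: "real^'m::{finite,wellorder} \<Rightarrow> real^'m::_" and f :: "real^'m::_ \<Rightarrow> real"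
  assumes S: "S \<in> sets lebesgue" and g: "\<And>x. x \<in> S \<Longrightarrow> (g has_derivative g' x) (at x within S)"
    and inj: "inj_on g S" and f0: "\<And>y. 0 \<le> f y" and f: "set_integrable lebesgue T f" and T: "g ` S \<subseteq> T"
  shows "(\<integral>\<^sup>+x. ennreal (\<bar>det (matrix (g' x))\<bar> * f (g x)) * indicator S x \<partial>lebesgue) \<le>
    (\<integral>\<^sup>+y. ennreal (f y) * indicator T y \<partial>lebesgue)"
proof -
  \<comment> \<open>The change of variables theorem for absolute integrals concerns vector values,
    so scalars are passed to it as elements of \<open>real^1\<close>.\<close>
  define F where "F y = (vec (f y) :: real^1)" for y
  have ai: "(\<lambda>y. vec (h y) :: real^1) absolutely_integrable_on A \<longleftrightarrow> h absolutely_integrable_on A"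
    for h :: "real^'m::_ \<Rightarrow> real" and A
    by (subst absolutely_integrable_componentwise_iff) (simp add: Basis_vec_def inner_axis)
  have comp: "integral A (\<lambda>y. vec (h y) :: real^1) \<bullet> axis 1 1 = integral A h"
    if "h absolutely_integrable_on A" for h :: "real^'m::_ \<Rightarrow> real" and A
  proof -
    have "(\<lambda>y. vec (h y) :: real^1) integrable_on A"
      using that ai set_lebesgue_integral_eq_integral(1) by blast
    from integral_component_eq[OF this, of "axis 1 1"] show ?thesis
      by (simp add: inner_axis)
  qed
  have "g differentiable_on S"
    using g by (auto simp: differentiable_on_def differentiable_def)
  then have gS: "g ` S \<in> sets lebesgue"
    by (intro differentiable_image_in_sets_lebesgue S) auto
  have fS: "f absolutely_integrable_on (g ` S)"
    by (rule set_integrable_subset[OF f gS T])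
  let ?G = "\<lambda>x. \<bar>det (matrix (g' x))\<bar> * f (g x)"
  have "(\<lambda>x. \<bar>det (matrix (g' x))\<bar> *\<^sub>R F (g x)) absolutely_integrable_on S \<and>
           integral S (\<lambda>x. \<bar>det (matrix (g' x))\<bar> *\<^sub>R F (g x)) = integral (g ` S) F"
    using has_absolute_integral_change_of_variables[OF S g inj, of F "integral (g ` S) F"] fS
    unfolding F_def ai by blast
  moreover have "(\<lambda>x. \<bar>det (matrix (g' x))\<bar> *\<^sub>R F (g x)) = (\<lambda>x. vec (?G x))"
    by (simp add: F_def vec_eq_iff fun_eq_iff)
  ultimately have G: "?G absolutely_integrable_on S" "integral S (\<lambda>x. vec (?G x) :: real^1) = integral (g ` S) F"
    by (simp_all add: ai)
  then have eq: "integral S ?G = integral (g ` S) f"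
    using comp[OF G(1)] comp[OF fS] by (simp add: F_def[abs_def])
  have nn: "(\<integral>\<^sup>+x. ennreal (h x) * indicator A x \<partial>lebesgue) = ennreal (integral A h)"
    if "h absolutely_integrable_on A" "\<And>x. 0 \<le> h x" for h :: "real^'m::_ \<Rightarrow> real" and A
  proof -
    have "(\<integral>\<^sup>+x. ennreal (h x) * indicator A x \<partial>lebesgue) = (\<integral>\<^sup>+x. ennreal (indicator A x *\<^sub>R h x) \<partial>lebesgue)"
      by (intro nn_integral_cong) (simp add: indicator_def)
    also have "\<dots> = ennreal (\<integral>x. indicator A x *\<^sub>R h x \<partial>lebesgue)"
      using that by (intro nn_integral_eq_integral) (auto simp: set_integrable_def)
    also have "(\<integral>x. indicator A x *\<^sub>R h x \<partial>lebesgue) = integral A h"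
      using set_lebesgue_integral_eq_integral(2)[OF that(1)] by (simp add: set_lebesgue_integral_def)
    finally show ?thesis .
  qed
  have "(\<integral>\<^sup>+x. ennreal (?G x) * indicator S x \<partial>lebesgue) = (\<integral>\<^sup>+y. ennreal (f y) * indicator (g ` S) y \<partial>lebesgue)"
    using nn[OF G(1)] nn[OF fS] f0 eq by simp
  also have "\<dots> \<le> (\<integral>\<^sup>+y. ennreal (f y) * indicator T y \<partial>lebesgue)"
    using T by (intro nn_integral_mono mult_left_mono) (auto simp: indicator_def)
  finally show ?thesis .
qed

section \<open>Orthogonal coordinates that split space into a plane and a line\<close>

definition vec3 :: "(real^2) \<times> real \<Rightarrow> real^3" where
  "vec3 z = vector [fst z $ 1, fst z $ 2, snd z]"

lemma vec3_nth [simp]: "vec3 z $ 1 = fst z $ 1" "vec3 z $ 2 = fst z $ 2" "vec3 z $ 3 = snd z"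
  by (simp_all add: vec3_def)

lemma linear_vec3: "linear vec3"
  by (rule linearI) (simp_all add: vec_eq_iff forall_3)

lemma norm_vec3: "norm (vec3 z) = norm z"
proof -
  have "(norm (vec3 z))\<^sup>2 = (norm (fst z))\<^sup>2 + (snd z)\<^sup>2"
    by (simp only: norm_vec_square sum_2 sum_3 vec3_nth real_norm_def power2_abs)
  then have "(norm (vec3 z))\<^sup>2 = (norm z)\<^sup>2"
    by (simp add: norm_prod_def)
  then show ?thesis by (rule power2_eq_imp_eq) simp_all
qed

lemma vec3_eq_iff: "vec3 z = x \<longleftrightarrow> z = (vector [x $ 1, x $ 2], x $ 3)"
  by (cases z) (auto simp: vec_eq_iff forall_2 forall_3)

text \<open>Lebesgue measure is determined by its values on boxes, and boxes of
  \<open>real^3\<close> correspond to products of boxes. This gives access to Fubini along the third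
  coordinate.\<close>

lemma distr_vec3: "distr lborel borel vec3 = lborel"
proof (rule lborel_eqI[symmetric])
  fix l u :: "real^3" assume le: "\<And>b. b \<in> Basis \<Longrightarrow> l \<bullet> b \<le> u \<bullet> b"
  let ?v = "\<lambda>x :: real^3. vector [x $ 1, x $ 2] :: real^2"
  have lu: "l $ i \<le> u $ i" for i
    using le[of "axis i 1"] by (simp add: axis_in_Basis_iff inner_axis)
  have [measurable]: "vec3 \<in> borel_measurable borel"
    using linear_vec3 by (intro borel_measurable_continuous_onI linear_continuous_on)
      (simp add: linear_conv_bounded_linear)
  have "vec3 -` box l u \<inter> space lborel = box (?v l) (?v u) \<times> box (l $ 3) (u $ 3)"
    by (auto simp: mem_box_cart forall_2 forall_3)
  then have "emeasure (distr lborel borel vec3) (box l u) =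
      emeasure (lborel \<Otimes>\<^sub>M lborel) (box (?v l) (?v u) \<times> box (l $ 3) (u $ 3))"
    by (simp add: emeasure_distr lborel_prod)
  also have "\<dots> = emeasure lborel (box (?v l) (?v u)) * emeasure lborel (box (l $ 3) (u $ 3))"
    by (rule lborel.emeasure_pair_measure_Times) auto
  also have "emeasure lborel (box (?v l) (?v u)) = ennreal ((u $ 1 - l $ 1) * (u $ 2 - l $ 2))"
  proof -
    have le2: "\<And>b. b \<in> Basis \<Longrightarrow> ?v l \<bullet> b \<le> ?v u \<bullet> b"
      using lu by (auto simp: Basis_vec_def inner_axis UNIV_2)
    have "(\<Prod>b\<in>Basis. (?v u - ?v l) \<bullet> b) = (\<Prod>i\<in>(UNIV :: 2 set). (?v u - ?v l) $ i)"
      by (rule prod.reindex_cong[of "\<lambda>i. axis i 1"])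
        (auto simp: inj_on_def axis_eq_axis Basis_vec_def inner_axis)
    then show ?thesis
      using emeasure_lborel_box[OF le2] by (simp add: UNIV_2)
  qed
  also have "ennreal ((u $ 1 - l $ 1) * (u $ 2 - l $ 2)) * emeasure lborel (box (l $ 3) (u $ 3)) =
      ennreal ((u $ 1 - l $ 1) * (u $ 2 - l $ 2) * (u $ 3 - l $ 3))"
    using lu by (simp add: box_real ennreal_mult)
  also have "(u $ 1 - l $ 1) * (u $ 2 - l $ 2) * (u $ 3 - l $ 3) = (\<Prod>b\<in>Basis. (u - l) \<bullet> b)"
  proof -
    have "(\<Prod>b\<in>Basis. (u - l) \<bullet> b) = (\<Prod>i\<in>(UNIV :: 3 set). (u - l) $ i)"
      by (rule prod.reindex_cong[of "\<lambda>i. axis i 1"])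
        (auto simp: inj_on_def axis_eq_axis Basis_vec_def inner_axis)
    also have "\<dots> = (u $ 1 - l $ 1) * (u $ 2 - l $ 2) * (u $ 3 - l $ 3)"
      unfolding UNIV_3 by simp
    finally show ?thesis by simp
  qed
  finally show "emeasure (distr lborel borel vec3) (box l u) = ennreal (\<Prod>b\<in>Basis. (u - l) \<bullet> b)" .
qed simp

lemma distr_orthogonal_transformation:
  fixes T :: "real^'n::{finite,wellorder} \<Rightarrow> real^'n::_"
  assumes T: "orthogonal_transformation T"
  shows "distr lborel borel T = lborel"
proof (rule lborel_eqI[symmetric])
  fix l u :: "real^'n::_" assume le: "\<And>b. b \<in> Basis \<Longrightarrow> l \<bullet> b \<le> u \<bullet> b"
  have [measurable]: "T \<in> borel_measurable borel"
    using orthogonal_transformation_linear[OF T] by (intro borel_measurable_continuous_onI linear_continuous_on)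
      (simp add: linear_conv_bounded_linear)
  have "T -` box l u = inv T ` box l u"
    using orthogonal_transformation_bij[OF T] by (simp add: bij_vimage_eq_inv_image)
  then have "emeasure (distr lborel borel T) (box l u) = emeasure lborel (inv T ` box l u)"
    by (simp add: emeasure_distr)
  also have "\<dots> = emeasure lebesgue (inv T ` box l u)"
  proof -
    have "T -` box l u \<in> sets borel"
      using measurable_sets[of T borel borel "box l u"] by simp
    then show ?thesis using \<open>T -` box l u = inv T ` box l u\<close> by simp
  qed
  also have "\<dots> = emeasure lebesgue (box l u)"
    using measurable_orthogonal_image[OF orthogonal_transformation_inv[OF T], of "box l u"]
      measure_orthogonal_image[OF orthogonal_transformation_inv[OF T], of "box l u"]
    by (simp add: emeasure_eq_measure2 fmeasurableD2)
  also have "\<dots> = ennreal (\<Prod>b\<in>Basis. (u - l) \<bullet> b)"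
    using emeasure_lborel_box[OF le] by simp
  finally show "emeasure (distr lborel borel T) (box l u) = ennreal (\<Prod>b\<in>Basis. (u - l) \<bullet> b)" .
qed simp

text \<open>\<Phi> and \<Psi> are inverse isometries between space and plane times height, with
  heights measured by the third coordinate of \<open>T\<close>. The locale serves twice: for charts
  of the boundary and for the slices of the cone at the contact point.\<close>

locale frame =
  fixes T :: "real^3 \<Rightarrow> real^3"
  assumes T: "orthogonal_transformation T"
begin

definition \<Phi> :: "(real^2) \<times> real \<Rightarrow> real^3" where "\<Phi> z = inv T (vec3 z)"
definition \<Psi> :: "real^3 \<Rightarrow> (real^2) \<times> real" where "\<Psi> x = (vector [T x $ 1, T x $ 2], T x $ 3)"

lemma invT: "orthogonal_transformation (inv T)" "T (inv T x) = x" "inv T (T x) = x"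
  using orthogonal_transformation_inv[OF T] orthogonal_transformation_surj[OF T] orthogonal_transformation_inj[OF T]
  by (simp_all add: surj_f_inv_f)

lemma \<Psi>_\<Phi> [simp]: "\<Psi> (\<Phi> z) = z"
  unfolding \<Psi>_def \<Phi>_def invT using vec3_eq_iff[of z "vec3 z"] by simp

lemma \<Phi>_\<Psi> [simp]: "\<Phi> (\<Psi> x) = x"
proof -
  have "vec3 (\<Psi> x) = T x"
    by (simp add: vec3_eq_iff \<Psi>_def)
  then show ?thesis by (simp add: \<Phi>_def invT)
qed

lemma linear_\<Phi>: "linear \<Phi>"
  unfolding \<Phi>_def[abs_def]
  using linear_compose[OF linear_vec3 orthogonal_transformation_linear[OF invT(1)]] by (simp add: o_def)

lemma norm_\<Phi>: "norm (\<Phi> z) = norm z"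
  by (simp add: \<Phi>_def orthogonal_transformation_norm[OF invT(1)] norm_vec3)

lemma bounded_linear_\<Phi>: "bounded_linear \<Phi>"
  using linear_\<Phi> by (simp add: linear_conv_bounded_linear)

lemmas \<Phi>_simps = linear_add[OF linear_\<Phi>] linear_diff[OF linear_\<Phi>] linear_cmul[OF linear_\<Phi>]

lemma inner_\<Phi>: "\<Phi> z \<bullet> \<Phi> z' = z \<bullet> z'"
  using norm_\<Phi>[of "z + z'"] by (simp add: dot_norm norm_\<Phi> flip: \<Phi>_simps)

lemma linear_\<Psi>: "linear \<Psi>"
proof (rule linearI)
  show "\<Psi> (x + y) = \<Psi> x + \<Psi> y" for x y
    using \<Psi>_\<Phi>[of "\<Psi> x + \<Psi> y"] by (simp add: \<Phi>_simps)
  show "\<Psi> (r *\<^sub>R x) = r *\<^sub>R \<Psi> x" for r x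
    using \<Psi>_\<Phi>[of "r *\<^sub>R \<Psi> x"] by (simp add: \<Phi>_simps)
qed

lemma bounded_linear_\<Psi>: "bounded_linear \<Psi>"
  using linear_\<Psi> by (simp add: linear_conv_bounded_linear)

lemma norm_\<Psi>: "norm (\<Psi> x) = norm x"
  using norm_\<Phi>[of "\<Psi> x"] by simp

lemma inner_\<Psi>: "\<Psi> z \<bullet> \<Psi> z' = z \<bullet> z'"
  using inner_\<Phi>[of "\<Psi> z" "\<Psi> z'"] by simp

lemma continuous_\<Phi>: "continuous_on S \<Phi>" and continuous_\<Psi>: "continuous_on S' \<Psi>"
  by (simp_all add: linear_continuous_on bounded_linear_\<Phi> bounded_linear_\<Psi>)

lemma \<Phi>_measurable [measurable]: "\<Phi> \<in> borel_measurable borel"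
  by (simp add: borel_measurable_continuous_onI continuous_\<Phi>)

lemma distr_\<Phi>: "distr lborel borel \<Phi> = lborel"
proof -
  have m: "inv T \<in> borel_measurable borel" "vec3 \<in> borel_measurable borel"
    using orthogonal_transformation_linear[OF invT(1)] linear_vec3
    by (simp_all add: borel_measurable_continuous_onI linear_continuous_on linear_conv_bounded_linear)
  have "distr lborel borel \<Phi> = distr (distr lborel borel vec3) borel (inv T)"
    using m by (simp add: distr_distr o_def \<Phi>_def[abs_def])
  then show ?thesis
    by (simp add: distr_vec3 distr_orthogonal_transformation[OF invT(1)])
qed

lemma
  fixes f :: "real^3 \<Rightarrow> 'b::{banach,second_countable_topology}"
  assumes "integrable lborel f"
  shows integrable_\<Phi>: "integrable lborel (\<lambda>z. f (\<Phi> z))"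
    and integral_\<Phi>: "integral\<^sup>L lborel f = (\<integral>z. f (\<Phi> z) \<partial>lborel)"
proof -
  have [measurable]: "f \<in> borel_measurable borel"
    using borel_measurable_integrable[OF assms] by simp
  show "integrable lborel (\<lambda>z. f (\<Phi> z))"
    by (rule integrable_distr[where M'=borel]) (use assms in \<open>simp_all add: distr_\<Phi>\<close>)
  have "integral\<^sup>L (distr lborel borel \<Phi>) f = (\<integral>z. f (\<Phi> z) \<partial>lborel)"
    by (rule integral_distr) simp_all
  then show "integral\<^sup>L lborel f = (\<integral>z. f (\<Phi> z) \<partial>lborel)"
    by (simp add: distr_\<Phi>)
qed

end

section \<open>Area elements and the surface measure as a supremum\<close>

lemma linear_real2:
  fixes L :: "real^2 \<Rightarrow> 'a::real_vector"
  assumes "linear L"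
  shows "L h = h $ 1 *\<^sub>R L (axis 1 1) + h $ 2 *\<^sub>R L (axis 2 1)"
proof -
  have "h = h $ 1 *\<^sub>R axis 1 1 + h $ 2 *\<^sub>R axis 2 1"
    using basis_expansion[of h] by (simp add: sum_2 scalar_mult_eq_scaleR)
  then have "L h = L (h $ 1 *\<^sub>R axis 1 1 + h $ 2 *\<^sub>R axis 2 1)"
    by (rule arg_cong)
  then show ?thesis
    by (simp only: linear_add[OF assms] linear_cmul[OF assms])
qed

text \<open>Expanding both arguments in the images of the basis leaves the determinant of
  \<open>a\<close> and \<open>b\<close>: the factor by which a reparametrization changes the area
  element.\<close>

lemma cross3_linear_image:
  fixes L :: "real^2 \<Rightarrow> real^3"
  assumes "linear L"
  shows "norm (cross3 (L a) (L b)) = \<bar>a $ 1 * b $ 2 - a $ 2 * b $ 1\<bar> * norm (cross3 (L (axis 1 1)) (L (axis 2 1)))"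
proof -
  let ?x = "L (axis 1 1)" and ?y = "L (axis 2 1)"
  have "cross3 (L a) (L b) = (a $ 1 * b $ 2 - a $ 2 * b $ 1) *\<^sub>R cross3 ?x ?y"
    by (subst linear_real2[OF assms, of a], subst linear_real2[OF assms, of b])
      (simp add: cross_add_left cross_add_right cross_mult_left cross_mult_right cross_skew[of ?y ?x] algebra_simps)
  then show ?thesis by simp
qed

text \<open>It makes the family of patches nonempty, so that the supremum of measures lives on the
  Borel sets.\<close>

lemma surface_patch_empty: "surface_patch S {} X"
  by (simp add: surface_patch_def C1_on_def)

lemma sets_patch_measure [simp]: "sets (patch_measure U X) = sets borel"
  by (simp add: patch_measure_def)

lemma sets_surface_measure [simp, measurable_cong]: "sets (surface_measure S) = sets borel"
  unfolding surface_measure_def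
proof (rule sets_SUP[where N=borel])
  show "{(U, X). surface_patch S U X} \<noteq> {}"
    using surface_patch_empty by blast
qed (simp split: prod.split)

lemma space_surface_measure [simp]: "space (surface_measure S) = UNIV"
  using sets_eq_imp_space_eq[OF sets_surface_measure] by simp

lemma patch_measure_le_surface_measure:
  assumes "surface_patch S U X"
  shows "emeasure (patch_measure U X) A \<le> emeasure (surface_measure S) A"
proof (rule le_measureD3)
  show "patch_measure U X \<le> surface_measure S"
    unfolding surface_measure_def by (rule SUP_upper2[of "(U, X)"]) (use assms in simp_all)
qed simp

text \<open>The order of measures on the same sets is setwise, so the least upper bound property
  becomes this comparison. With \<open>patch_measure_le_surface_measure\<close> it is all that is
  used about the values of the supremum.\<close>

lemma surface_measure_le:
  assumes "sets N = sets borel"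
    and "\<And>U X A. surface_patch S U X \<Longrightarrow> A \<in> sets borel \<Longrightarrow> emeasure (patch_measure U X) A \<le> emeasure N A"
  shows "emeasure (surface_measure S) A \<le> emeasure N A"
proof (rule le_measureD3)
  show "surface_measure S \<le> N"
    unfolding surface_measure_def
  proof (intro SUP_least, clarify)
    fix U X assume "surface_patch S U X"
    then show "patch_measure U X \<le> N"
      by (intro le_measure[THEN iffD2]) (simp_all add: assms)
  qed
qed (use assms in simp)

lemma area_element_continuous:
  assumes "C1_on U X"
  shows "continuous_on U (area_element X)"
  unfolding area_element_def[abs_def] partial_deriv_def[abs_def]
  by (intro continuous_on_norm continuous_on_cross C1_on_continuous_derivative assms)

lemma emeasure_patch_measure:
  assumes X: "surface_patch S U X" and A: "A \<in> sets borel"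
  shows "emeasure (patch_measure U X) A = (\<integral>\<^sup>+y. ennreal (area_element X y) * indicator (U \<inter> X -` A) y \<partial>lborel)"
proof -
  have U: "open U" "C1_on U X" using X by (auto simp: surface_patch_def)
  have "sets (restrict_space lborel U) = sets (restrict_space borel U)"
    by (rule sets_restrict_space_cong) simp
  note mc = measurable_cong_sets[OF this refl]
  have Xm: "X \<in> borel_measurable (restrict_space lborel U)"
    unfolding mc by (rule borel_measurable_continuous_on_restrict[OF C1_on_continuous[OF U(2)]])
  have "area_element X \<in> borel_measurable (restrict_space lborel U)"
    unfolding mc by (rule borel_measurable_continuous_on_restrict[OF area_element_continuous[OF U(2)]])
  then have am: "(\<lambda>y. ennreal (area_element X y)) \<in> borel_measurable (restrict_space lborel U)"
    by measurable
  have XA: "X -` A \<inter> space (restrict_space lborel U) \<in> sets (restrict_space lborel U)"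
    by (rule measurable_sets[OF Xm A])
  have "emeasure (patch_measure U X) A =
      (\<integral>\<^sup>+y. ennreal (area_element X y) * indicator (X -` A \<inter> space (restrict_space lborel U)) y \<partial>restrict_space lborel U)"
    unfolding patch_measure_def
    by (subst emeasure_distr) (use Xm am A XA in \<open>simp_all add: emeasure_density measurable_density_eq1\<close>)
  also have "\<dots> = (\<integral>\<^sup>+y. ennreal (area_element X y) * indicator (X -` A \<inter> space (restrict_space lborel U)) y * indicator U y \<partial>lborel)"
    using U(1) by (subst nn_integral_restrict_space) auto
  also have "\<dots> = (\<integral>\<^sup>+y. ennreal (area_element X y) * indicator (U \<inter> X -` A) y \<partial>lborel)"
    by (intro nn_integral_cong) (auto simp: indicator_def space_restrict_space)
  finally show ?thesis .
qed

text \<open>Every patch maps into \<open>S\<close>, so the restriction of the surface measure to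
  \<open>S\<close> still dominates all patch measures, and by minimality it dominates the surface
  measure itself.\<close>

lemma emeasure_surface_measure_Int:
  assumes S: "S \<in> sets borel" and A: "A \<in> sets borel"
  shows "emeasure (surface_measure S) A = emeasure (surface_measure S) (A \<inter> S)"
proof (rule antisym)
  let ?N = "density (surface_measure S) (indicator S)"
  have N: "emeasure ?N B = emeasure (surface_measure S) (B \<inter> S)" if "B \<in> sets borel" for B :: "(real^3) set"
  proof -
    have "emeasure ?N B = (\<integral>\<^sup>+x. indicator S x * indicator B x \<partial>surface_measure S)"
      using that S by (intro emeasure_density) auto
    also have "\<dots> = (\<integral>\<^sup>+x. indicator (B \<inter> S) x \<partial>surface_measure S)"
      by (intro nn_integral_cong) (auto simp: indicator_def)
    finally show ?thesis
      using that S by simp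
  qed
  have "emeasure (surface_measure S) A \<le> emeasure ?N A"
  proof (rule surface_measure_le)
    fix U X and B :: "(real^3) set" assume X: "surface_patch S U X" and B: "B \<in> sets borel"
    then have "X ` U \<subseteq> S" by (auto simp: surface_patch_def)
    then have "U \<inter> X -` B = U \<inter> X -` (B \<inter> S)" by auto
    then have "emeasure (patch_measure U X) B = emeasure (patch_measure U X) (B \<inter> S)"
      using B S by (simp add: emeasure_patch_measure[OF X])
    also have "\<dots> \<le> emeasure (surface_measure S) (B \<inter> S)"
      by (rule patch_measure_le_surface_measure[OF X])
    finally show "emeasure (patch_measure U X) B \<le> emeasure ?N B"
      using N[OF B] by simp
  qed simp
  then show "emeasure (surface_measure S) A \<le> emeasure (surface_measure S) (A \<inter> S)"
    using N[OF A] by simp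
  show "emeasure (surface_measure S) (A \<inter> S) \<le> emeasure (surface_measure S) A"
    using A by (intro emeasure_mono) auto
qed

lemma AE_frontier: "AE x in surface_measure (frontier \<Omega>). x \<in> frontier \<Omega>"
proof (rule AE_I')
  have "emeasure (surface_measure (frontier \<Omega>)) (- frontier \<Omega>) = 0"
    using emeasure_surface_measure_Int[of "frontier \<Omega>" "- frontier \<Omega>"] by simp
  then show "- frontier \<Omega> \<in> null_sets (surface_measure (frontier \<Omega>))"
    by (simp add: null_setsI)
qed auto

section \<open>Graphs of C1 functions and their area\<close>

locale graph = frame +
  fixes \<gamma> :: "real^2 \<Rightarrow> real"
  assumes \<gamma>: "C1_on UNIV \<gamma>"
begin

abbreviation D\<gamma> :: "real^2 \<Rightarrow> real^2 \<Rightarrow> real" where "D\<gamma> y \<equiv> frechet_derivative \<gamma> (at y)"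

definition G :: "real^2 \<Rightarrow> real^3" where "G y = \<Phi> (y, \<gamma> y)"
definition grad\<gamma> :: "real^2 \<Rightarrow> real^2" where "grad\<gamma> y = vector [D\<gamma> y (axis 1 1), D\<gamma> y (axis 2 1)]"
definition area :: "real^2 \<Rightarrow> real" where "area y = sqrt (1 + (norm (grad\<gamma> y))\<^sup>2)"
text \<open>The domain lies above the graph, so the outward direction has the last component
  \<open>- 1\<close>.\<close>

definition normal :: "real^2 \<Rightarrow> real^3" where "normal y = \<Phi> (grad\<gamma> y, - 1) /\<^sub>R area y"

lemma \<gamma>_has_derivative: "(\<gamma> has_derivative D\<gamma> y) (at y)"
  by (rule C1_on_has_derivative[OF \<gamma> UNIV_I])

lemma linear_D\<gamma>: "linear (D\<gamma> y)"
  by (rule has_derivative_linear[OF \<gamma>_has_derivative])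

lemma D\<gamma>_eq: "D\<gamma> y h = grad\<gamma> y \<bullet> h"
  by (subst linear_real2[OF linear_D\<gamma>]) (simp add: grad\<gamma>_def inner_vec_def sum_2 mult.commute)

lemma continuous_D\<gamma>: "continuous_on S (\<lambda>y. D\<gamma> y h)"
  by (rule continuous_on_subset[OF C1_on_continuous_derivative[OF \<gamma>]]) simp

lemma continuous_\<gamma>: "continuous_on S \<gamma>"
  by (rule continuous_on_subset[OF C1_on_continuous[OF \<gamma>]]) simp

lemma continuous_grad\<gamma>: "continuous_on S grad\<gamma>"
proof -
  have "grad\<gamma> = (\<lambda>y. D\<gamma> y (axis 1 1) *\<^sub>R axis 1 1 + D\<gamma> y (axis 2 1) *\<^sub>R axis 2 1)"
  proof
    fix y
    show "grad\<gamma> y = D\<gamma> y (axis 1 1) *\<^sub>R axis 1 1 + D\<gamma> y (axis 2 1) *\<^sub>R axis 2 1"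
      using basis_expansion[of "grad\<gamma> y"] by (simp add: sum_2 scalar_mult_eq_scaleR grad\<gamma>_def)
  qed
  then show ?thesis
    by (simp only:) (intro continuous_intros continuous_D\<gamma>)
qed

lemma area_ge_1: "area y \<ge> 1"
  by (simp add: area_def)

lemma area_pos: "area y > 0"
  using area_ge_1[of y] by linarith

lemma continuous_area: "continuous_on S area"
  unfolding area_def[abs_def] by (intro continuous_intros continuous_grad\<gamma>)

lemma area_measurable [measurable]: "area \<in> borel_measurable borel"
  by (intro borel_measurable_continuous_onI continuous_area)

lemma C1_pair: "C1_on UNIV (\<lambda>y. (y, \<gamma> y))"
proof -
  have 1: "bounded_linear (\<lambda>y :: real^2. (y, 0 :: real))"
    by (intro bounded_linear_Pair bounded_linear_ident bounded_linear_zero)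
  have 2: "bounded_linear (\<lambda>s :: real. (0 :: real^2, s))"
    by (intro bounded_linear_Pair bounded_linear_ident bounded_linear_zero)
  have "C1_on UNIV (\<lambda>y. (y, 0) + (0, \<gamma> y))"
    by (rule C1_on_add[OF C1_on_linear[OF 1] C1_on_linear_compose[OF 2 \<gamma>]])
  then show ?thesis by simp
qed

lemma C1_G: "C1_on UNIV G"
  unfolding G_def[abs_def] by (rule C1_on_linear_compose[OF bounded_linear_\<Phi> C1_pair])

lemma G_has_derivative: "(G has_derivative (\<lambda>h. \<Phi> (h, D\<gamma> y h))) (at y)"
  unfolding G_def[abs_def]
  by (intro bounded_linear.has_derivative[OF bounded_linear_\<Phi>] has_derivative_Pair has_derivative_ident \<gamma>_has_derivative)

lemma continuous_G: "continuous_on S G"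
  by (rule continuous_on_subset[OF C1_on_continuous[OF C1_G]]) simp

lemma G_measurable [measurable]: "G \<in> borel_measurable borel"
  by (intro borel_measurable_continuous_onI continuous_G)

lemma linear_DG: "linear (\<lambda>h. \<Phi> (h, D\<gamma> y h))"
  by (rule has_derivative_linear[OF G_has_derivative])

lemma \<Psi>_G [simp]: "\<Psi> (G y) = (y, \<gamma> y)"
  by (simp add: G_def)

text \<open>Lagrange's identity for the two tangent vectors, whose inner products are those of
  \<open>(1, 0, p)\<close> and \<open>(0, 1, q)\<close>, with \<open>p\<close> and \<open>q\<close>
  the partial derivatives of \<gamma>.\<close>

lemma norm_cross_DG: "norm (cross3 (\<Phi> (axis 1 1, D\<gamma> y (axis 1 1))) (\<Phi> (axis 2 1, D\<gamma> y (axis 2 1)))) = area y"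
proof -
  let ?a = "\<Phi> (axis 1 1, D\<gamma> y (axis 1 1))" and ?b = "\<Phi> (axis 2 1, D\<gamma> y (axis 2 1))"
  let ?p = "D\<gamma> y (axis 1 1)" and ?q = "D\<gamma> y (axis 2 1)"
  have ab: "?a \<bullet> ?b = ?p * ?q" "(norm ?a)\<^sup>2 = 1 + ?p\<^sup>2" "(norm ?b)\<^sup>2 = 1 + ?q\<^sup>2"
    by (simp_all add: inner_\<Phi> norm_\<Phi> norm_Pair inner_axis_axis power2_eq_square)
  have "(norm (cross3 ?a ?b))\<^sup>2 = (norm ?a)\<^sup>2 * (norm ?b)\<^sup>2 - (?a \<bullet> ?b)\<^sup>2"
    using norm_cross_dot[of ?a ?b] by (simp add: power_mult_distrib)
  also have "\<dots> = 1 + (norm (grad\<gamma> y))\<^sup>2"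
  proof -
    have "(norm (grad\<gamma> y))\<^sup>2 = ?p\<^sup>2 + ?q\<^sup>2"
      by (simp add: norm_vec_square sum_2 grad\<gamma>_def)
    then show ?thesis
      unfolding ab by (simp add: power2_eq_square algebra_simps)
  qed
  finally show ?thesis
    unfolding area_def by (metis norm_ge_zero real_sqrt_abs abs_of_nonneg)
qed

lemma area_element_G: "area_element G y = area y"
proof -
  have "frechet_derivative G (at y) = (\<lambda>h. \<Phi> (h, D\<gamma> y h))"
    by (rule frechet_derivative_at[OF G_has_derivative, symmetric])
  then show ?thesis
    by (simp add: area_element_def partial_deriv_def norm_cross_DG)
qed

lemma inj_G: "inj_on G S"
  by (rule inj_onI) (metis \<Psi>_G fst_conv)

lemma normal_inner_tangent: "\<Phi> (h, D\<gamma> y h) \<bullet> normal y = 0"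
  by (simp add: normal_def inner_\<Phi> D\<gamma>_eq inner_commute)

lemma norm_normal: "norm (normal y) = 1"
proof -
  have "norm (\<Phi> (grad\<gamma> y, - 1)) = area y"
    by (simp add: norm_\<Phi> norm_Pair area_def add.commute)
  then show ?thesis using area_pos[of y] by (simp add: normal_def)
qed

lemma \<Phi>_inner_normal: "\<Phi> (e, \<sigma>) \<bullet> normal y = (D\<gamma> y e - \<sigma>) / area y"
  by (simp add: normal_def inner_\<Phi> D\<gamma>_eq inner_commute divide_inverse mult.commute)

text \<open>A patch of the graph is \<open>G\<close> composed with the projection \<open>h\<close>
  of the patch to the plane, and the chain rule gives the factor. Since \<open>U\<close> and
  \<open>B\<close> are open, the factorization holds in a neighbourhood of \<open>y\<close> and can
  be differentiated.\<close>

lemma patch_derivative: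
  assumes X: "C1_on U X" "open U" "open B" and onG: "\<And>y. y \<in> U \<Longrightarrow> X y \<in> B \<Longrightarrow> snd (\<Psi> (X y)) = \<gamma> (fst (\<Psi> (X y)))"
    and y: "y \<in> U" "X y \<in> B"
  defines "h \<equiv> (\<lambda>y. fst (\<Psi> (X y)))"
  shows "X y = G (h y)" "(h has_derivative (\<lambda>v. fst (\<Psi> (frechet_derivative X (at y) v)))) (at y)"
    "area_element X y = \<bar>det (matrix (\<lambda>v. fst (\<Psi> (frechet_derivative X (at y) v))))\<bar> * area (h y)"
proof -
  let ?h' = "\<lambda>v. fst (\<Psi> (frechet_derivative X (at y) v))"
  have XG: "X z = G (h z)" if "z \<in> U" "X z \<in> B" for z
  proof -
    have "\<Psi> (X z) = (h z, \<gamma> (h z))"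
      using onG[OF that] by (simp add: h_def prod_eq_iff)
    then have "\<Phi> (\<Psi> (X z)) = G (h z)"
      by (simp add: G_def)
    then show ?thesis by simp
  qed
  then show "X y = G (h y)" using y by blast
  have dX: "(X has_derivative frechet_derivative X (at y)) (at y)"
    by (rule C1_on_has_derivative[OF X(1) y(1)])
  show dh: "(h has_derivative ?h') (at y)"
    unfolding h_def
    by (intro has_derivative_fst bounded_linear.has_derivative[OF bounded_linear_\<Psi>] dX)
  have "open (U \<inter> X -` B)"
    by (rule continuous_open_preimage[OF C1_on_continuous[OF X(1)] X(2,3)])
  then have "((\<lambda>z. G (h z)) has_derivative frechet_derivative X (at y)) (at y)"
    by (rule has_derivative_transform_within_open[OF dX]) (use y XG in auto)
  moreover have "((\<lambda>z. G (h z)) has_derivative (\<lambda>v. \<Phi> (?h' v, D\<gamma> (h y) (?h' v)))) (at y)"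
    by (rule has_derivative_compose[OF dh G_has_derivative])
  ultimately have eq: "frechet_derivative X (at y) = (\<lambda>v. \<Phi> (?h' v, D\<gamma> (h y) (?h' v)))"
    by (rule has_derivative_unique)
  have "area_element X y = norm (cross3 (\<Phi> (?h' (axis 1 1), D\<gamma> (h y) (?h' (axis 1 1)))) (\<Phi> (?h' (axis 2 1), D\<gamma> (h y) (?h' (axis 2 1)))))"
    unfolding area_element_def partial_deriv_def using fun_cong[OF eq] by metis
  also have "\<dots> = \<bar>?h' (axis 1 1) $ 1 * ?h' (axis 2 1) $ 2 - ?h' (axis 1 1) $ 2 * ?h' (axis 2 1) $ 1\<bar> * area (h y)"
    using cross3_linear_image[OF linear_DG[of "h y"], of "?h' (axis 1 1)" "?h' (axis 2 1)"]
    by (simp only: norm_cross_DG)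
  also have "?h' (axis 1 1) $ 1 * ?h' (axis 2 1) $ 2 - ?h' (axis 1 1) $ 2 * ?h' (axis 2 1) $ 1 = det (matrix ?h')"
    by (simp add: det_2 matrix_def)
  finally show "area_element X y = \<bar>det (matrix ?h')\<bar> * area (h y)" .
qed

definition graph_measure :: "(real^3) measure" where
  "graph_measure = distr (density lborel (\<lambda>y. ennreal (area y))) borel G"

lemma sets_graph_measure [simp, measurable_cong]: "sets graph_measure = sets borel"
  by (simp add: graph_measure_def)

lemma emeasure_graph_measure:
  assumes "A \<in> sets borel"
  shows "emeasure graph_measure A = (\<integral>\<^sup>+y. ennreal (area y) * indicator (G -` A) y \<partial>lborel)"
proof -
  have "G -` A \<in> sets borel"
    using measurable_sets[OF G_measurable assms] by simp
  then show ?thesis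
    unfolding graph_measure_def using assms by (simp add: emeasure_distr emeasure_density)
qed

text \<open>In the coordinates of the plane the patch becomes a map \<open>h\<close> to which the
  change of variables inequality applies. It is injective because \<open>X\<close> is and a point of
  the graph is determined by its projection.\<close>

lemma patch_measure_le_graph_measure:
  assumes X: "surface_patch S U X" and B: "open B" and onG: "\<And>x. x \<in> S \<Longrightarrow> x \<in> B \<Longrightarrow> snd (\<Psi> x) = \<gamma> (fst (\<Psi> x))"
    and A: "A \<in> sets borel" "A \<subseteq> B"
  shows "emeasure (patch_measure U X) A \<le> emeasure graph_measure A"
\<comment> \<open>An infinite right side leaves nothing to prove; a finite one supplies the
  integrability demanded by the change of variables.\<close>
proof (cases "emeasure graph_measure A = \<infinity>")
  case False
  have U: "open U" "C1_on U X" "inj_on X U" "X ` U \<subseteq> S"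
    using X by (auto simp: surface_patch_def)
  have onU: "snd (\<Psi> (X y)) = \<gamma> (fst (\<Psi> (X y)))" if "y \<in> U" "X y \<in> B" for y
    using onG[of "X y"] that U(4) by auto
  define h where "h y = fst (\<Psi> (X y))" for y
  define h' where "h' y v = fst (\<Psi> (frechet_derivative X (at y) v))" for y v
  have pd: "X y = G (h y)" "(h has_derivative h' y) (at y)"
    "area_element X y = \<bar>det (matrix (h' y))\<bar> * area (h y)" if "y \<in> U" "X y \<in> B" for y
    unfolding h_def[abs_def] h'_def[abs_def]
    using patch_derivative[OF U(2,1) B _ that] onU by simp_all
  define V where "V = U \<inter> X -` A"
  have VB: "y \<in> U" "X y \<in> B" if "y \<in> V" for y
    using that A(2) by (auto simp: V_def)
  have Vb: "V \<in> sets borel"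
  proof -
    have "V \<in> sets (restrict_space borel U)"
      using measurable_sets[OF borel_measurable_continuous_on_restrict[OF C1_on_continuous[OF U(2)]] A(1)]
      by (simp add: V_def space_restrict_space Int_commute)
    then show ?thesis using U(1) by (auto simp: sets_restrict_space_iff)
  qed
  have GA: "G -` A \<in> sets borel"
    using measurable_sets[OF G_measurable A(1)] by simp
  have fin: "(\<integral>\<^sup>+y. ennreal (area y) * indicator (G -` A) y \<partial>lborel) < \<infinity>"
    using False emeasure_graph_measure[OF A(1)] by (simp add: less_top)
  have "integrable lborel (\<lambda>y. indicator (G -` A) y *\<^sub>R area y)"
  proof (rule integrableI_nonneg)
    show "(\<integral>\<^sup>+y. ennreal (indicator (G -` A) y *\<^sub>R area y) \<partial>lborel) < \<infinity>"
      using fin by (rule le_less_trans[rotated]) (auto intro!: nn_integral_mono simp: indicator_def)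
    show "(\<lambda>y. indicator (G -` A) y *\<^sub>R area y) \<in> borel_measurable lborel"
      using GA by (intro borel_measurable_scaleR borel_measurable_indicator) auto
  qed (use less_imp_le[OF area_pos] in \<open>auto simp: indicator_def\<close>)
  then have aint: "set_integrable lebesgue (G -` A) area"
    unfolding set_integrable_def using GA by (simp add: integrable_completion)
  have hV: "h ` V \<subseteq> G -` A"
  proof
    fix z assume "z \<in> h ` V"
    then obtain y where "y \<in> V" "z = h y" by blast
    then show "z \<in> G -` A"
      using pd(1)[OF VB] by (simp add: V_def)
  qed
  have "emeasure (patch_measure U X) A = (\<integral>\<^sup>+y. ennreal (area_element X y) * indicator V y \<partial>lborel)"
    unfolding V_def by (rule emeasure_patch_measure[OF X A(1)])
  also have "\<dots> = (\<integral>\<^sup>+y. ennreal (\<bar>det (matrix (h' y))\<bar> * area (h y)) * indicator V y \<partial>lebesgue)"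
  proof -
    have "area_element X y = \<bar>det (matrix (h' y))\<bar> * area (h y)" if "y \<in> V" for y
      by (rule pd(3)[OF VB[OF that]])
    then show ?thesis
      unfolding nn_integral_completion by (intro nn_integral_cong) (simp add: indicator_def)
  qed
  also have "\<dots> \<le> (\<integral>\<^sup>+y. ennreal (area y) * indicator (G -` A) y \<partial>lebesgue)"
  proof (rule nn_integral_change_of_variables_le[OF _ _ _ _ aint hV])
    show "V \<in> sets lebesgue" using Vb by simp
    show "(h has_derivative h' y) (at y within V)" if "y \<in> V" for y
      using pd(2)[OF VB[OF that]] by (rule has_derivative_at_withinI)
    show "inj_on h V"
    proof (rule inj_onI)
      fix y z assume yz: "y \<in> V" "z \<in> V" "h y = h z"
      then have "X y = X z"
        using pd(1)[OF VB[OF yz(1)]] pd(1)[OF VB[OF yz(2)]] yz(3) by simp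
      then show "y = z" using U(3) VB(1) yz by (meson inj_onD)
    qed
  qed (rule less_imp_le[OF area_pos])
  also have "\<dots> = emeasure graph_measure A"
    unfolding nn_integral_completion using emeasure_graph_measure[OF A(1)] by simp
  finally show ?thesis .
qed simp

text \<open>The graph measure inside \<open>B\<close>, continued by \<open>surface_measure S\<close> outside, dominates every patch
  measure; the supremum is therefore at most the graph measure on subsets of \<open>B\<close>. The parametrization
  of the graph is itself a patch, which gives the other inequality.\<close>

lemma emeasure_surface_measure_graph:
  assumes B: "open B" and S: "\<And>x. x \<in> B \<Longrightarrow> x \<in> S \<longleftrightarrow> snd (\<Psi> x) = \<gamma> (fst (\<Psi> x))"
    and A: "A \<in> sets borel" "A \<subseteq> B"
  shows "emeasure (surface_measure S) A = emeasure graph_measure A"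
proof (rule antisym)
  let ?\<mu> = "surface_measure S"
  let ?m = "\<lambda>E. emeasure graph_measure (E \<inter> B) + emeasure ?\<mu> (E - B)"
  let ?N = "measure_of UNIV (sets borel) ?m"
  have Bb: "B \<in> sets borel" using B by auto
  have N: "emeasure ?N E = ?m E" if "E \<in> sets borel" for E
  proof (rule emeasure_measure_of_sigma[OF _ _ _ that])
    show "sigma_algebra UNIV (sets (borel :: (real^3) measure))"
      using sets.sigma_algebra_axioms[of "borel :: (real^3) measure"] by simp
    show "positive (sets borel) ?m" by (simp add: positive_def)
    show "countably_additive (sets borel) ?m"
    proof (rule countably_additiveI)
      fix F :: "nat \<Rightarrow> (real^3) set" assume F: "range F \<subseteq> sets borel" "disjoint_family F" "(\<Union>i. F i) \<in> sets borel"
      have "(\<Sum>i. ?m (F i)) = (\<Sum>i. emeasure graph_measure (F i \<inter> B)) + (\<Sum>i. emeasure ?\<mu> (F i - B))"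
        by (rule suminf_add[symmetric]) auto
      also have "(\<Sum>i. emeasure graph_measure (F i \<inter> B)) = emeasure graph_measure (\<Union>i. F i \<inter> B)"
        using F Bb by (intro suminf_emeasure) (auto simp: disjoint_family_on_def)
      also have "(\<Sum>i. emeasure ?\<mu> (F i - B)) = emeasure ?\<mu> (\<Union>i. F i - B)"
        using F Bb by (intro suminf_emeasure) (auto simp: disjoint_family_on_def)
      moreover have "(\<Union>i. F i \<inter> B) = (\<Union>i. F i) \<inter> B" "(\<Union>i. F i - B) = (\<Union>i. F i) - B"
        by auto
      ultimately show "(\<Sum>i. ?m (F i)) = ?m (\<Union>i. F i)"
        by simp
    qed
  qed
  have "emeasure ?\<mu> A \<le> emeasure ?N A"
  proof (rule surface_measure_le)
    have "sigma_sets UNIV (sets borel) = sets (borel :: (real^3) measure)"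
      using sets.sigma_sets_eq[of "borel :: (real^3) measure"] by (simp only: space_borel)
    then show "sets ?N = sets borel"
      by (subst sets_measure_of) auto
    fix U X and E :: "(real^3) set" assume X: "surface_patch S U X" and E: "E \<in> sets borel"
    have "emeasure (patch_measure U X) E = emeasure (patch_measure U X) (E \<inter> B) + emeasure (patch_measure U X) (E - B)"
      using E Bb by (subst plus_emeasure) (auto intro!: arg_cong[where f="emeasure _"])
    also have "\<dots> \<le> ?m E"
      using E Bb S by (intro add_mono patch_measure_le_graph_measure[OF X B] patch_measure_le_surface_measure[OF X]) auto
    finally show "emeasure (patch_measure U X) E \<le> emeasure ?N E"
      using N[OF E] by simp
  qed
  also have "emeasure ?N A = emeasure graph_measure A"
    using N[OF A(1)] A(2) by (simp add: Int_absorb2 Diff_eq_empty_iff[THEN iffD2])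
  finally show "emeasure ?\<mu> A \<le> emeasure graph_measure A" .
  have "open (G -` B)"
    by (rule open_vimage[OF B continuous_G])
  then have patch: "surface_patch S (G -` B) G"
    unfolding surface_patch_def using C1_on_subset[OF C1_G] inj_G S area_pos
    by (auto simp: area_element_G less_le)
  have "emeasure graph_measure A = emeasure (patch_measure (G -` B) G) A"
    unfolding emeasure_patch_measure[OF patch A(1)] emeasure_graph_measure[OF A(1)] area_element_G
    using A(2) by (intro nn_integral_cong) (auto simp: indicator_def)
  also have "\<dots> \<le> emeasure ?\<mu> A"
    by (rule patch_measure_le_surface_measure[OF patch])
  finally show "emeasure graph_measure A \<le> emeasure ?\<mu> A" .
qed

text \<open>The two measures are known to agree on Borel subsets of \<open>B\<close>, so the passage
  to integrals goes through densities with the indicator of \<open>B\<close>; a function vanishing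
  outside \<open>B\<close> does not see the difference.\<close>

lemma
  fixes f :: "real^3 \<Rightarrow> 'b::{banach,second_countable_topology}"
  assumes B: "open B" and S: "\<And>x. x \<in> B \<Longrightarrow> x \<in> S \<longleftrightarrow> snd (\<Psi> x) = \<gamma> (fst (\<Psi> x))"
    and f: "f \<in> borel_measurable borel" "\<And>x. x \<notin> B \<Longrightarrow> f x = 0"
  shows integral_surface_measure_graph: "integral\<^sup>L (surface_measure S) f = (\<integral>y. area y *\<^sub>R f (G y) \<partial>lborel)"
    and integrable_surface_measure_graph: "integrable (surface_measure S) f \<longleftrightarrow> integrable lborel (\<lambda>y. area y *\<^sub>R f (G y))"
proof -
  have Bb: "B \<in> sets borel" using B by auto
  have "density (surface_measure S) (\<lambda>x. ennreal (indicator B x)) = density graph_measure (\<lambda>x. ennreal (indicator B x))"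
  proof (rule measure_eqI)
    fix A assume "A \<in> sets (density (surface_measure S) (\<lambda>x. ennreal (indicator B x)))"
    then have A: "A \<in> sets borel" by simp
    have "(\<integral>\<^sup>+x. ennreal (indicator B x) * indicator A x \<partial>M) = emeasure M (A \<inter> B)" if "sets M = sets borel" for M
    proof -
      have "(\<integral>\<^sup>+x. ennreal (indicator B x) * indicator A x \<partial>M) = (\<integral>\<^sup>+x. indicator (A \<inter> B) x \<partial>M)"
        by (intro nn_integral_cong) (auto simp: indicator_def)
      then show ?thesis using A Bb that by simp
    qed
    then show "emeasure (density (surface_measure S) (\<lambda>x. ennreal (indicator B x))) A =
        emeasure (density graph_measure (\<lambda>x. ennreal (indicator B x))) A"
      using A Bb emeasure_surface_measure_graph[OF B S, of "A \<inter> B"]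
      by (simp add: emeasure_density)
  qed simp
  note eq = this
  have fB: "indicator B x *\<^sub>R f x = f x" for x
    using f(2)[of x] by (simp add: indicator_def)
  have 1: "integral\<^sup>L M f = integral\<^sup>L (density M (\<lambda>x. ennreal (indicator B x))) f"
    "integrable M f \<longleftrightarrow> integrable (density M (\<lambda>x. ennreal (indicator B x))) f"
    if "sets M = sets borel" for M
  proof -
    have m: "f \<in> borel_measurable M" "(indicator B :: _ \<Rightarrow> real) \<in> borel_measurable M"
      using f(1) Bb that by (simp_all add: measurable_cong_sets[OF that refl])
    show "integral\<^sup>L M f = integral\<^sup>L (density M (\<lambda>x. ennreal (indicator B x))) f"
      using integral_density[OF m] by (simp add: fB)
    show "integrable M f \<longleftrightarrow> integrable (density M (\<lambda>x. ennreal (indicator B x))) f"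
      using integrable_density[OF m] by (simp add: fB)
  qed
  have m: "(\<lambda>y. f (G y)) \<in> borel_measurable lborel" "area \<in> borel_measurable lborel"
    "G \<in> measurable (density lborel (\<lambda>y. ennreal (area y))) borel"
    using f(1) by auto
  have a0: "AE y in lborel. 0 \<le> area y" using less_imp_le[OF area_pos] by simp
  have 2: "integral\<^sup>L graph_measure f = (\<integral>y. area y *\<^sub>R f (G y) \<partial>lborel)"
    unfolding graph_measure_def
    by (subst integral_distr[OF m(3) f(1)]) (rule integral_density[OF m(1,2) a0])
  have 3: "integrable graph_measure f \<longleftrightarrow> integrable lborel (\<lambda>y. area y *\<^sub>R f (G y))"
    unfolding graph_measure_def
    by (subst integrable_distr_eq[OF m(3) f(1)]) (rule integrable_density[OF m(1,2) a0])
  show "integral\<^sup>L (surface_measure S) f = (\<integral>y. area y *\<^sub>R f (G y) \<partial>lborel)"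
    using 1(1)[of "surface_measure S"] 1(1)[of graph_measure] eq 2 by simp
  show "integrable (surface_measure S) f \<longleftrightarrow> integrable lborel (\<lambda>y. area y *\<^sub>R f (G y))"
    using 1(2)[of "surface_measure S"] 1(2)[of graph_measure] eq 3 by simp
qed

end

section \<open>The divergence theorem\<close>

lemma integral_halfline_derivative:
  fixes g :: "real \<Rightarrow> 'b::euclidean_space"
  assumes g: "\<And>s. (g has_vector_derivative g' s) (at s)" "continuous_on UNIV g'"
    and B: "\<And>s. s > B \<Longrightarrow> g s = 0" "\<And>s. s > B \<Longrightarrow> g' s = 0"
  shows "(\<integral>s. indicator {0<..} s *\<^sub>R g' s \<partial>lborel) = - g 0"
proof -
  define b where "b = \<bar>B\<bar> + 1"
  have b: "0 \<le> b" "B < b" by (auto simp: b_def)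
  have [measurable]: "g' \<in> borel_measurable borel"
    by (rule borel_measurable_continuous_onI[OF g(2)])
  have "(\<integral>s. indicator {0<..} s *\<^sub>R g' s \<partial>lborel) = (\<integral>s. indicator {0..b} s *\<^sub>R g' s \<partial>lborel)"
  proof (rule integral_cong_AE)
    show "AE s in lborel. indicator {0<..} s *\<^sub>R g' s = indicator {0..b} s *\<^sub>R g' s"
      using AE_lborel_singleton[of 0]
    proof eventually_elim
      case (elim s)
      have "g' s = 0" if "s > b" using B(2)[of s] b that by simp
      with elim show ?case by (auto simp: indicator_def)
    qed
  qed auto
  also have "\<dots> = g b - g 0"
    by (rule integral_FTC_atLeastAtMost[OF b(1)])
      (use g in \<open>auto intro: has_vector_derivative_at_within continuous_on_subset\<close>)
  finally show ?thesis
    using B(1)[OF b(2)] by simp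
qed

lemma lborel_prod_iterated:
  fixes f :: "'a::euclidean_space \<times> 'b::euclidean_space \<Rightarrow> 'c::{banach,second_countable_topology}"
  assumes f: "integrable lborel f"
  shows "integral\<^sup>L lborel f = (\<integral>x. \<integral>y. f (x, y) \<partial>lborel \<partial>lborel)"
    and "integral\<^sup>L lborel f = (\<integral>y. \<integral>x. f (x, y) \<partial>lborel \<partial>lborel)"
    and "integrable lborel (\<lambda>x. \<integral>y. f (x, y) \<partial>lborel)"
    and "AE x in lborel. integrable lborel (\<lambda>y. f (x, y))"
proof -
  have f': "integrable (lborel \<Otimes>\<^sub>M lborel) (case_prod (\<lambda>x y. f (x, y)))"
    using f by (simp add: lborel_prod)
  show "integral\<^sup>L lborel f = (\<integral>x. \<integral>y. f (x, y) \<partial>lborel \<partial>lborel)"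
    using lborel_pair.integral_fst[OF f'] by (simp add: lborel_prod)
  show "integral\<^sup>L lborel f = (\<integral>y. \<integral>x. f (x, y) \<partial>lborel \<partial>lborel)"
    using lborel_pair.integral_snd[OF f'] by (simp add: lborel_prod)
  show "integrable lborel (\<lambda>x. \<integral>y. f (x, y) \<partial>lborel)"
    by (rule lborel_pair.integrable_fst[OF f'])
  show "AE x in lborel. integrable lborel (\<lambda>y. f (x, y))"
    by (rule lborel_pair.AE_integrable_fst[OF f'])
qed

lemma integrable_indicator_scaleR:
  fixes f :: "'a::euclidean_space \<Rightarrow> 'b::{banach,second_countable_topology}"
  assumes "integrable lborel f" "A \<in> sets borel"
  shows "integrable lborel (\<lambda>x. indicator A x *\<^sub>R f x)"
  by (rule Bochner_Integration.integrable_bound[OF assms(1)])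
    (use assms borel_measurable_integrable[OF assms(1)] in \<open>auto simp: indicator_def intro!: AE_I2\<close>)

context graph
begin

definition epigraph :: "(real^3) set" where
  "epigraph = {x. \<gamma> (fst (\<Psi> x)) < snd (\<Psi> x)}"

lemma \<Phi>_in_epigraph: "\<Phi> (y, s) \<in> epigraph \<longleftrightarrow> \<gamma> y < s"
  by (simp add: epigraph_def)

lemma open_epigraph: "open epigraph"
  unfolding epigraph_def
  by (intro open_Collect_less continuous_on_compose2[OF continuous_\<gamma>[of UNIV]] continuous_intros continuous_\<Psi>) auto

text \<open>After the boundary is flattened, horizontal derivatives integrate to zero over every
  horizontal slice, and the vertical one is integrated by the fundamental theorem, leaving the value
  on the graph. The gradient of \<gamma> enters only as a coefficient and is not
  differentiated.\<close>

lemma divergence_epigraph: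
  fixes f :: "real^3 \<Rightarrow> complex"
  assumes f: "C1_on UNIV f" and R: "\<And>x. f x \<noteq> 0 \<Longrightarrow> norm x \<le> R"
  shows "(\<integral>x. indicator epigraph x *\<^sub>R frechet_derivative f (at x) e \<partial>lborel) =
    (\<integral>y. area y *\<^sub>R ((e \<bullet> normal y) *\<^sub>R f (G y)) \<partial>lborel)"
proof -
  obtain a \<sigma> where e: "e = \<Phi> (a, \<sigma>)"
    by (metis \<Phi>_\<Psi> surj_pair)
  \<comment> \<open>A shear adding the height of the graph. It maps the half space of positive
    heights onto the epigraph and is a translation on each vertical line, so no Jacobian
    appears.\<close>
  define \<Sigma> where "\<Sigma> z = \<Phi> (fst z, snd z + \<gamma> (fst z))" for z
  define F where "F z = f (\<Sigma> z)" for z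
  have lin: "bounded_linear (\<lambda>s :: real. (0 :: real^2, s))"
    by (intro bounded_linear_Pair bounded_linear_ident bounded_linear_zero)
  have "C1_on UNIV (\<lambda>z. \<Phi> (z + (0, \<gamma> (fst z))))"
    by (intro C1_on_linear_compose[OF bounded_linear_\<Phi>] C1_on_add C1_on_linear bounded_linear_ident
        C1_on_linear_compose[OF lin] C1_on_compose_UNIV[OF \<gamma>] bounded_linear_fst)
  moreover have "\<Sigma> = (\<lambda>z. \<Phi> (z + (0, \<gamma> (fst z))))"
    by (simp add: \<Sigma>_def fun_eq_iff plus_prod_def)
  ultimately have C\<Sigma>: "C1_on UNIV \<Sigma>" by simp
  have CF: "C1_on UNIV F"
    unfolding F_def[abs_def] by (rule C1_on_compose_UNIV[OF f C\<Sigma>])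
  have dF: "frechet_derivative F (at z) (v, t) = frechet_derivative f (at (\<Sigma> z)) (\<Phi> (v, t + D\<gamma> (fst z) v))" for z v t
  proof -
    have "(\<Sigma> has_derivative (\<lambda>h. \<Phi> (fst h, snd h + D\<gamma> (fst z) (fst h)))) (at z)"
      unfolding \<Sigma>_def[abs_def]
      by (intro bounded_linear.has_derivative[OF bounded_linear_\<Phi>] has_derivative_Pair has_derivative_add
          has_derivative_fst has_derivative_snd has_derivative_ident
          has_derivative_compose[OF has_derivative_fst[OF has_derivative_ident] \<gamma>_has_derivative])
    from has_derivative_compose[OF this C1_on_has_derivative[OF f UNIV_I]]
    have "(F has_derivative (\<lambda>h. frechet_derivative f (at (\<Sigma> z)) (\<Phi> (fst h, snd h + D\<gamma> (fst z) (fst h))))) (at z)"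
      by (simp add: F_def[abs_def])
    from fun_cong[OF frechet_derivative_at[OF this], of "(v, t)"] show ?thesis by simp
  qed
  obtain M where M: "\<And>y. norm y \<le> R \<Longrightarrow> \<bar>\<gamma> y\<bar> \<le> M"
  proof -
    have "bounded (\<gamma> ` cball 0 R)"
      by (intro compact_imp_bounded compact_continuous_image continuous_\<gamma>) auto
    then obtain b where "\<forall>x\<in>cball 0 R. \<bar>\<gamma> x\<bar> \<le> b"
      unfolding bounded_iff by auto
    then show ?thesis by (intro that[of b]) simp
  qed
  \<comment> \<open>On the support, \<open>norm y \<le> R\<close> and
    \<open>\<bar>s + \<gamma> y\<bar> \<le> R\<close>, so \<open>\<bar>s\<bar>\<close> is at most
    \<open>R + M\<close> and the norm of the pair at most \<open>2 * R + M\<close>.\<close>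
  define R' where "R' = 2 * R + M"
  have FR: "norm z \<le> R'" "\<bar>snd z\<bar> \<le> R'" if "F z \<noteq> 0" for z
  proof -
    obtain y s where z: "z = (y, s)" by (cases z)
    have "norm (y, s + \<gamma> y) \<le> R"
      using R[of "\<Sigma> z"] that by (simp add: F_def \<Sigma>_def norm_\<Phi> z)
    then have "norm y \<le> R" "\<bar>s + \<gamma> y\<bar> \<le> R"
      using norm_fst_le[of y "s + \<gamma> y"] norm_snd_le[of "s + \<gamma> y" y] by (auto intro: order_trans)
    with M[of y] norm_ge_zero[of y] show "norm z \<le> R'" "\<bar>snd z\<bar> \<le> R'"
      using norm_Pair_le[of y s] unfolding R'_def z by (simp_all add: abs_le_iff) linarith+
  qed
  have dFR: "norm z \<le> R'" if "frechet_derivative F (at z) v \<noteq> 0" for z v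
  proof (rule ccontr)
    assume "\<not> norm z \<le> R'"
    then have "frechet_derivative F (at z) v = 0"
      by (intro frechet_derivative_eq_0_outside[of "cball 0 R'"]) (use FR in auto)
    with that show False by simp
  qed
  have dfR: "norm x \<le> R" if "frechet_derivative f (at x) v \<noteq> 0" for x v
  proof (rule ccontr)
    assume "\<not> norm x \<le> R"
    then have "frechet_derivative f (at x) v = 0"
      by (intro frechet_derivative_eq_0_outside[of "cball 0 R"]) (use R in auto)
    with that show False by simp
  qed
  have cdF: "continuous_on UNIV (\<lambda>z. frechet_derivative F (at z) v)" for v
    by (rule C1_on_continuous_derivative[OF CF])
  have idF: "integrable lborel (\<lambda>z. frechet_derivative F (at z) v)" for v
    by (rule integrable_continuous_bounded_support[OF cdF dFR])
  have idf: "integrable lborel (\<lambda>x. frechet_derivative f (at x) e)"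
    by (rule integrable_continuous_bounded_support[OF C1_on_continuous_derivative[OF f] dfR])
  have Eb: "epigraph \<in> sets borel" using open_epigraph by auto
  have Hb: "UNIV \<times> {0<..} \<in> sets (borel :: ((real^2) \<times> real) measure)"
    by (intro borel_open open_Times) auto
  note iH = integrable_indicator_scaleR[OF idf Eb]
  let ?c = "\<lambda>y. \<sigma> - D\<gamma> y a"
  let ?A = "\<lambda>y s. indicator {0<..} s *\<^sub>R frechet_derivative F (at (y, s)) (a, 0)"
  let ?B = "\<lambda>y s. indicator {0<..} s *\<^sub>R frechet_derivative F (at (y, s)) (0, 1)"
  \<comment> \<open>The shear turns a horizontal move \<open>a\<close> into a move along the graph;
    its difference to \<open>e\<close> is vertical with coefficient \<open>?c\<close>. This
    coefficient does not depend on the height and equals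
    \<open>- area y * (e \<bullet> normal y)\<close>.\<close>
  have split: "frechet_derivative f (at (\<Sigma> z)) e =
      frechet_derivative F (at z) (a, 0) + ?c (fst z) *\<^sub>R frechet_derivative F (at z) (0, 1)" for z
  proof -
    have "linear (frechet_derivative F (at z))"
      by (rule has_derivative_linear[OF C1_on_has_derivative[OF CF UNIV_I]])
    then have "frechet_derivative F (at z) (a, 0) + ?c (fst z) *\<^sub>R frechet_derivative F (at z) (0, 1) =
        frechet_derivative F (at z) ((a, 0) + ?c (fst z) *\<^sub>R (0, 1))"
      by (simp only: linear_add linear_cmul)
    also have "\<dots> = frechet_derivative F (at z) (a, ?c (fst z))" by simp
    finally show ?thesis by (simp add: dF e)
  qed
  have i1: "integrable lborel (\<lambda>z. indicator (UNIV \<times> {0<..}) z *\<^sub>R frechet_derivative F (at z) (a, 0))"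
    by (rule integrable_indicator_scaleR[OF idF Hb])
  have "integrable lborel (\<lambda>z. ?c (fst z) *\<^sub>R frechet_derivative F (at z) (0, 1))"
  proof (rule integrable_continuous_bounded_support[where R=R'])
    show "continuous_on UNIV (\<lambda>z :: (real^2) \<times> real. ?c (fst z) *\<^sub>R frechet_derivative F (at z) (0, 1))"
      by (intro continuous_intros cdF continuous_on_compose2[OF continuous_D\<gamma>[of UNIV]]) auto
  qed (use dFR in auto)
  then have i2: "integrable lborel (\<lambda>z. indicator (UNIV \<times> {0<..}) z *\<^sub>R (?c (fst z) *\<^sub>R frechet_derivative F (at z) (0, 1)))"
    by (rule integrable_indicator_scaleR[OF _ Hb])
  have ind: "indicator (UNIV \<times> {0<..}) (y, s) = (indicator {0<..} s :: real)" for y :: "real^2" and s :: real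
    by (simp add: indicator_def)
  have "(\<integral>x. indicator epigraph x *\<^sub>R frechet_derivative f (at x) e \<partial>lborel) =
      (\<integral>y. \<integral>s. indicator epigraph (\<Phi> (y, s)) *\<^sub>R frechet_derivative f (at (\<Phi> (y, s))) e \<partial>lborel \<partial>lborel)"
    unfolding integral_\<Phi>[OF iH] by (rule lborel_prod_iterated(1)[OF integrable_\<Phi>[OF iH]])
  also have "\<dots> = (\<integral>y. \<integral>s. indicator {0<..} s *\<^sub>R frechet_derivative f (at (\<Sigma> (y, s))) e \<partial>lborel \<partial>lborel)"
  proof (rule Bochner_Integration.integral_cong[OF refl])
    fix y
    have "(\<integral>s. indicator epigraph (\<Phi> (y, s)) *\<^sub>R frechet_derivative f (at (\<Phi> (y, s))) e \<partial>lborel) =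
      (\<integral>s. indicator epigraph (\<Phi> (y, \<gamma> y + s)) *\<^sub>R frechet_derivative f (at (\<Phi> (y, \<gamma> y + s))) e \<partial>lborel)"
      using lborel_integral_real_affine[of 1 "\<lambda>s. indicator epigraph (\<Phi> (y, s)) *\<^sub>R frechet_derivative f (at (\<Phi> (y, s))) e" "\<gamma> y"]
      by simp
    also have "\<dots> = (\<integral>s. indicator {0<..} s *\<^sub>R frechet_derivative f (at (\<Sigma> (y, s))) e \<partial>lborel)"
      by (intro Bochner_Integration.integral_cong) (auto simp: indicator_def \<Phi>_in_epigraph \<Sigma>_def add.commute)
    finally show "(\<integral>s. indicator epigraph (\<Phi> (y, s)) *\<^sub>R frechet_derivative f (at (\<Phi> (y, s))) e \<partial>lborel) =
      (\<integral>s. indicator {0<..} s *\<^sub>R frechet_derivative f (at (\<Sigma> (y, s))) e \<partial>lborel)" .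
  qed
  also have "\<dots> = (\<integral>y. \<integral>s. indicator (UNIV \<times> {0<..}) (y, s) *\<^sub>R frechet_derivative F (at (y, s)) (a, 0) +
      indicator (UNIV \<times> {0<..}) (y, s) *\<^sub>R (?c y *\<^sub>R frechet_derivative F (at (y, s)) (0, 1)) \<partial>lborel \<partial>lborel)"
    unfolding split ind by (simp add: scaleR_add_right)
  also have "\<dots> = (\<integral>z. indicator (UNIV \<times> {0<..}) z *\<^sub>R frechet_derivative F (at z) (a, 0) +
      indicator (UNIV \<times> {0<..}) z *\<^sub>R (?c (fst z) *\<^sub>R frechet_derivative F (at z) (0, 1)) \<partial>lborel)"
    by (subst lborel_prod_iterated(1)[OF Bochner_Integration.integrable_add[OF i1 i2]]) simp
  also have "\<dots> = (\<integral>z. indicator (UNIV \<times> {0<..}) z *\<^sub>R frechet_derivative F (at z) (a, 0) \<partial>lborel) +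
      (\<integral>z. indicator (UNIV \<times> {0<..}) z *\<^sub>R (?c (fst z) *\<^sub>R frechet_derivative F (at z) (0, 1)) \<partial>lborel)"
    by (rule Bochner_Integration.integral_add[OF i1 i2])
  also have "(\<integral>z. indicator (UNIV \<times> {0<..}) z *\<^sub>R frechet_derivative F (at z) (a, 0) \<partial>lborel) = 0"
  proof -
    have "(\<integral>y. frechet_derivative F (at (y, s)) (a, 0) \<partial>lborel) = 0" for s
    proof -
      have lin1: "bounded_linear (\<lambda>y :: real^2. (y, 0 :: real))"
        by (intro bounded_linear_Pair bounded_linear_ident bounded_linear_zero)
      have "C1_on UNIV (\<lambda>y :: real^2. (y, 0) + (0, s))"
        by (intro C1_on_add C1_on_const C1_on_linear lin1)
      then have "C1_on UNIV (\<lambda>y. (y :: real^2, s))" by simp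
      then have C: "C1_on UNIV (\<lambda>y. F (y, s))"
        by (rule C1_on_compose_UNIV[OF CF])
      have "frechet_derivative (\<lambda>y. F (y, s)) (at y) a = frechet_derivative F (at (y, s)) (a, 0)" for y
      proof -
        have "((\<lambda>y. F (y, s)) has_derivative (\<lambda>h. frechet_derivative F (at (y, s)) (h, 0))) (at y)"
          by (rule has_derivative_compose[OF has_derivative_Pair[OF has_derivative_ident has_derivative_const]
                C1_on_has_derivative[OF CF UNIV_I]])
        from fun_cong[OF frechet_derivative_at[OF this], of a] show ?thesis
          by simp
      qed
      moreover have "norm y \<le> R'" if "F (y, s) \<noteq> 0" for y
        using FR(1)[OF that] norm_fst_le[of y s] by simp
      ultimately show ?thesis
        using integral_derivative_eq_0(2)[OF C, of R' a] by simp
    qed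
    then show ?thesis
      by (subst lborel_prod_iterated(2)[OF i1]) (simp add: ind)
  qed
  also have "(\<integral>z. indicator (UNIV \<times> {0<..}) z *\<^sub>R (?c (fst z) *\<^sub>R frechet_derivative F (at z) (0, 1)) \<partial>lborel) =
      (\<integral>y. - (?c y *\<^sub>R f (G y)) \<partial>lborel)"
  proof (subst lborel_prod_iterated(1)[OF i2], rule Bochner_Integration.integral_cong[OF refl])
    fix y :: "real^2"
    have "((\<lambda>s. F (y, s)) has_vector_derivative frechet_derivative F (at (y, s)) (0, 1)) (at s)" for s
    proof -
      have "((\<lambda>s. F (y, s)) has_derivative (\<lambda>h. frechet_derivative F (at (y, s)) (0, h))) (at s)"
        by (rule has_derivative_compose[OF has_derivative_Pair[OF has_derivative_const has_derivative_ident]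
              C1_on_has_derivative[OF CF UNIV_I]])
      moreover have "(\<lambda>h. frechet_derivative F (at (y, s)) (0, h)) = (\<lambda>h. h *\<^sub>R frechet_derivative F (at (y, s)) (0, 1))"
      proof
        fix h
        have "linear (frechet_derivative F (at (y, s)))"
          by (rule has_derivative_linear[OF C1_on_has_derivative[OF CF UNIV_I]])
        from linear_cmul[OF this, of h "(0, 1)"]
        show "frechet_derivative F (at (y, s)) (0, h) = h *\<^sub>R frechet_derivative F (at (y, s)) (0, 1)"
          by simp
      qed
      ultimately show ?thesis
        by (simp only: has_vector_derivative_def)
    qed
    then have "(\<integral>s. indicator {0<..} s *\<^sub>R frechet_derivative F (at (y, s)) (0, 1) \<partial>lborel) = - F (y, 0)"
    proof (rule integral_halfline_derivative[where B=R'])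
      show "continuous_on UNIV (\<lambda>s. frechet_derivative F (at (y, s)) (0, 1))"
        by (intro continuous_on_compose2[OF cdF] continuous_intros) auto
      show "F (y, s) = 0" if "s > R'" for s
        using FR(2)[of "(y, s)"] that by fastforce
      show "frechet_derivative F (at (y, s)) (0, 1) = 0" if "s > R'" for s
        using dFR[of "(y, s)" "(0, 1)"] norm_snd_le[of s y] that by fastforce
    qed
    moreover have "F (y, 0) = f (G y)"
      by (simp add: F_def \<Sigma>_def G_def)
    moreover have "(\<integral>s. indicator {0<..} s *\<^sub>R (?c y *\<^sub>R frechet_derivative F (at (y, s)) (0, 1)) \<partial>lborel) =
        ?c y *\<^sub>R (\<integral>s. indicator {0<..} s *\<^sub>R frechet_derivative F (at (y, s)) (0, 1) \<partial>lborel)"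
      by (subst integral_scaleR_right[symmetric]) (simp add: mult.commute)
    ultimately show "(\<integral>s. indicator (UNIV \<times> {0<..}) (y, s) *\<^sub>R (?c (fst (y, s)) *\<^sub>R frechet_derivative F (at (y, s)) (0, 1)) \<partial>lborel) =
        - (?c y *\<^sub>R f (G y))"
      by (simp add: ind)
  qed
  also have "0 + (\<integral>y. - (?c y *\<^sub>R f (G y)) \<partial>lborel) = (\<integral>y. area y *\<^sub>R ((e \<bullet> normal y) *\<^sub>R f (G y)) \<partial>lborel)"
  proof -
    have "- (?c y *\<^sub>R f (G y)) = area y *\<^sub>R ((e \<bullet> normal y) *\<^sub>R f (G y))" for y
      using area_pos[of y] by (simp add: e \<Phi>_inner_normal flip: scaleR_minus_left)
    then show ?thesis by simp
  qed
  finally show ?thesis .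
qed

end

section \<open>Boundary charts and the outward normal\<close>

lemma isCont_near:
  assumes "isCont f a" "open S" "f a \<in> S"
  obtains d where "d > 0" "\<And>t. dist t a < d \<Longrightarrow> f t \<in> S"
proof -
  have "(f \<longlongrightarrow> f a) (nhds a)"
    using assms(1) unfolding isCont_def tendsto_at_iff_tendsto_nhds .
  from topological_tendstoD[OF this assms(2,3)] show ?thesis
    unfolding eventually_nhds_metric using that by blast
qed

text \<open>The function \<open>q\<close> is the height above the graph, so that \<open>\<Omega>\<close> is \<open>{q > 0}\<close> near \<open>p\<close>.\<close>

locale boundary_chart = graph +
  fixes \<Omega> :: "(real^3) set" and p :: "real^3" and r :: real
  assumes \<Omega>: "open \<Omega>" and r: "r > 0" and chart: "\<Omega> \<inter> ball p r = epigraph \<inter> ball p r"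
begin

definition q :: "real^3 \<Rightarrow> real" where "q x = snd (\<Psi> x) - \<gamma> (fst (\<Psi> x))"

lemma continuous_q: "continuous_on S q"
  unfolding q_def[abs_def]
  by (intro continuous_intros continuous_\<Psi> continuous_on_compose2[OF continuous_\<gamma>[of UNIV]]) auto

lemma in_\<Omega>_iff: "x \<in> ball p r \<Longrightarrow> x \<in> \<Omega> \<longleftrightarrow> q x > 0"
  using chart by (auto simp: epigraph_def q_def set_eq_iff)

lemma q_\<Phi>: "q (\<Phi> (y, s)) = s - \<gamma> y"
  by (simp add: q_def)

lemma q_eq_0_iff: "q x = 0 \<longleftrightarrow> x = G (fst (\<Psi> x))"
proof
  assume "q x = 0"
  then have "\<Psi> x = (fst (\<Psi> x), \<gamma> (fst (\<Psi> x)))" by (simp add: q_def prod_eq_iff)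
  then show "x = G (fst (\<Psi> x))" unfolding G_def by (metis \<Phi>_\<Psi>)
next
  assume *: "x = G (fst (\<Psi> x))"
  show "q x = 0" by (subst *) (simp add: G_def q_\<Phi>)
qed

lemma not_in_closure: 
  assumes "x \<in> ball p r" "q x < 0"
  shows "x \<notin> closure \<Omega>"
proof -
  have o: "open (ball p r \<inter> q -` {..<0})"
    by (intro open_Int open_ball open_vimage[OF open_lessThan continuous_q])
  moreover have "ball p r \<inter> q -` {..<0} \<inter> \<Omega> = {}"
    using in_\<Omega>_iff by force
  ultimately have "ball p r \<inter> q -` {..<0} \<inter> closure \<Omega> = {}"
    using open_Int_closure_eq_empty by blast
  then show ?thesis using assms by auto
qed

text \<open>Points with \<open>q < 0\<close> have a neighbourhood free of points of \<Omega>, and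
  points with \<open>q = 0\<close> are limits of points moved upwards, which lie in
  \<Omega>.\<close>

lemma frontier_iff:
  assumes x: "x \<in> ball p r"
  shows "x \<in> frontier \<Omega> \<longleftrightarrow> q x = 0"
proof
  assume "x \<in> frontier \<Omega>"
  then have "x \<in> closure \<Omega>" "x \<notin> \<Omega>"
    using \<Omega> by (auto simp: frontier_def interior_open)
  then show "q x = 0"
    using not_in_closure[OF x] in_\<Omega>_iff[OF x] by force
next
  assume q0: "q x = 0"
  have "x \<in> closure \<Omega>"
    unfolding closure_approachable
  proof (intro allI impI)
    fix e :: real assume "e > 0"
    obtain d where d: "d > 0" "ball x d \<subseteq> ball p r"
      by (rule openE[OF open_ball x])
    define t where "t = min e d / 2"
    have t: "0 < t" "t < e" "t < d" using \<open>e > 0\<close> d by (auto simp: t_def)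
    have n: "dist (x + t *\<^sub>R \<Phi> (0, 1)) x = t"
      using t by (simp add: dist_norm norm_\<Phi> norm_Pair)
    have "q (x + t *\<^sub>R \<Phi> (0, 1)) = q x + t"
      unfolding q_def by (simp add: linear_add[OF linear_\<Psi>] linear_cmul[OF linear_\<Psi>])
    moreover have "x + t *\<^sub>R \<Phi> (0, 1) \<in> ball p r"
      by (rule subsetD[OF d(2)]) (use n t in \<open>simp add: dist_commute\<close>)
    ultimately have "x + t *\<^sub>R \<Phi> (0, 1) \<in> \<Omega>"
      using in_\<Omega>_iff q0 t by auto
    with n t show "\<exists>y\<in>\<Omega>. dist y x < e"
      by (intro bexI[of _ "x + t *\<^sub>R \<Phi> (0, 1)"]) auto
  qed
  moreover have "x \<notin> \<Omega>" using in_\<Omega>_iff[OF x] q0 by simp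
  ultimately show "x \<in> frontier \<Omega>"
    using \<Omega> by (simp add: frontier_def interior_open)
qed

lemma q_line_derivative:
  "((\<lambda>t. q (x + t *\<^sub>R v)) has_real_derivative (snd (\<Psi> v) - D\<gamma> (fst (\<Psi> x)) (fst (\<Psi> v)))) (at 0)"
proof -
  have "((\<lambda>t. \<Psi> (x + t *\<^sub>R v)) has_derivative (\<lambda>h. \<Psi> (h *\<^sub>R v))) (at 0)"
    by (intro bounded_linear.has_derivative[OF bounded_linear_\<Psi>]) (auto intro!: derivative_eq_intros)
  moreover have "\<Psi> (h *\<^sub>R v) = h *\<^sub>R \<Psi> v" for h
    by (rule linear_cmul[OF linear_\<Psi>])
  ultimately have d: "((\<lambda>t. \<Psi> (x + t *\<^sub>R v)) has_derivative (\<lambda>h. h *\<^sub>R \<Psi> v)) (at 0)" by simp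
  have g: "(\<gamma> has_derivative D\<gamma> (fst (\<Psi> x))) (at (fst (\<Psi> (x + 0 *\<^sub>R v))))"
    using \<gamma>_has_derivative by simp
  have "((\<lambda>t. q (x + t *\<^sub>R v)) has_derivative
      (\<lambda>h. snd (h *\<^sub>R \<Psi> v) - D\<gamma> (fst (\<Psi> x)) (fst (h *\<^sub>R \<Psi> v)))) (at 0)"
    unfolding q_def
    by (rule has_derivative_diff[OF has_derivative_snd[OF d] has_derivative_compose[OF has_derivative_fst[OF d] g]])
  moreover have "snd (h *\<^sub>R \<Psi> v) - D\<gamma> (fst (\<Psi> x)) (fst (h *\<^sub>R \<Psi> v)) =
      (snd (\<Psi> v) - D\<gamma> (fst (\<Psi> x)) (fst (\<Psi> v))) * h" for h
    by (simp add: linear_cmul[OF linear_D\<gamma>] algebra_simps)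
  ultimately show ?thesis by (simp add: has_field_derivative_def)
qed

lemma eventually_line:
  assumes "x \<in> ball p r"
  shows "\<forall>\<^sub>F t in at_right 0. x + t *\<^sub>R v \<in> ball p r"
proof -
  have "((\<lambda>t. x + t *\<^sub>R v) \<longlongrightarrow> x + 0 *\<^sub>R v) (at_right 0)"
    by (intro tendsto_intros)
  with assms show ?thesis
    using topological_tendstoD[OF _ open_ball] by force
qed

text \<open>Along \<open>n\<close> the function \<open>q\<close> has the derivative
  \<open>- area\<close>, which is negative, so \<open>q\<close> is positive just before the boundary
  point and negative just after it.\<close>

lemma eventually_normal_side:
  assumes x: "x \<in> ball p r" "q x = 0"
  defines "n \<equiv> normal (fst (\<Psi> x))"
  shows "\<forall>\<^sub>F t in at_right 0. x - t *\<^sub>R n \<in> \<Omega>" "\<forall>\<^sub>F t in at_right 0. x + t *\<^sub>R n \<notin> closure \<Omega>"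
proof -
  let ?y = "fst (\<Psi> x)"
  have "snd (\<Psi> n) - D\<gamma> ?y (fst (\<Psi> n)) = - area ?y"
  proof -
    have "\<Psi> n = (grad\<gamma> ?y /\<^sub>R area ?y, - 1 / area ?y)"
      unfolding n_def normal_def by (simp add: linear_cmul[OF linear_\<Psi>] divide_inverse)
    then have "snd (\<Psi> n) - D\<gamma> ?y (fst (\<Psi> n)) = - (1 + (norm (grad\<gamma> ?y))\<^sup>2) / area ?y"
      by (simp add: D\<gamma>_eq power2_norm_eq_inner divide_inverse algebra_simps)
    also have "1 + (norm (grad\<gamma> ?y))\<^sup>2 = area ?y * area ?y"
      by (simp add: area_def)
    finally show ?thesis using area_pos[of ?y] by simp
  qed
  then have d: "((\<lambda>t. q (x + t *\<^sub>R n)) has_real_derivative - area ?y) (at 0)"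
    using q_line_derivative[of x n] by simp
  have neg: "- area ?y < 0" using area_pos[of ?y] by simp
  obtain d1 where d1: "d1 > 0" "\<And>h. h > 0 \<Longrightarrow> h < d1 \<Longrightarrow> q (x + (0 + h) *\<^sub>R n) < q (x + 0 *\<^sub>R n)"
    using DERIV_neg_dec_right[OF d neg] by blast
  obtain d2 where d2: "d2 > 0" "\<And>h. h > 0 \<Longrightarrow> h < d2 \<Longrightarrow> q (x + 0 *\<^sub>R n) < q (x + (0 - h) *\<^sub>R n)"
    using DERIV_neg_dec_left[OF d neg] by blast
  have "\<forall>\<^sub>F t in at_right (0::real). 0 < t \<and> t < d1" "\<forall>\<^sub>F t in at_right (0::real). 0 < t \<and> t < d2"
    using d1(1) d2(1) by (auto simp: eventually_at_right_field)
  note ev = this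
  show "\<forall>\<^sub>F t in at_right 0. x - t *\<^sub>R n \<in> \<Omega>"
    using ev(2) eventually_line[OF x(1), of "- n"]
  proof eventually_elim
    case (elim t)
    then show ?case using d2(2)[of t] x(2) in_\<Omega>_iff[of "x - t *\<^sub>R n"] by simp
  qed
  show "\<forall>\<^sub>F t in at_right 0. x + t *\<^sub>R n \<notin> closure \<Omega>"
    using ev(1) eventually_line[OF x(1), of n]
  proof eventually_elim
    case (elim t)
    then show ?case using d1(2)[of t] x(2) not_in_closure[of "x + t *\<^sub>R n"] by simp
  qed
qed

text \<open>The curve satisfies \<open>q = 0\<close> near time 0; differentiating this equation puts
  its velocity into the tangent plane of the graph.\<close>

lemma curve_velocity:
  assumes x: "x \<in> ball p r" and c: "c 0 = x" "range c \<subseteq> frontier \<Omega>" "(c has_vector_derivative c') (at 0)"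
  shows "c' \<bullet> normal (fst (\<Psi> x)) = 0"
proof -
  let ?y = "fst (\<Psi> x)"
  have cd: "(c has_derivative (\<lambda>h. h *\<^sub>R c')) (at 0)"
    using c(3) by (simp add: has_vector_derivative_def)
  have d: "((\<lambda>t. \<Psi> (c t)) has_derivative (\<lambda>h. \<Psi> (h *\<^sub>R c'))) (at 0)"
    by (rule bounded_linear.has_derivative[OF bounded_linear_\<Psi> cd])
  have g: "(\<gamma> has_derivative D\<gamma> ?y) (at (fst (\<Psi> (c 0))))"
    using \<gamma>_has_derivative c(1) by simp
  have d1: "((\<lambda>t. snd (\<Psi> (c t))) has_derivative (\<lambda>h. snd (\<Psi> (h *\<^sub>R c')))) (at 0)"
    by (rule has_derivative_snd[OF d])
  have d2: "((\<lambda>t. \<gamma> (fst (\<Psi> (c t)))) has_derivative (\<lambda>h. D\<gamma> ?y (fst (\<Psi> (h *\<^sub>R c'))))) (at 0)"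
    by (rule has_derivative_compose[OF has_derivative_fst[OF d] g])
  have "isCont c 0" by (rule has_derivative_continuous[OF cd])
  then obtain d0 where d0: "d0 > 0" "\<And>t. dist t 0 < d0 \<Longrightarrow> c t \<in> ball p r"
    by (rule isCont_near[OF _ open_ball]) (use x c(1) in auto)
  have "((\<lambda>t. snd (\<Psi> (c t))) has_derivative (\<lambda>h. D\<gamma> ?y (fst (\<Psi> (h *\<^sub>R c'))))) (at 0)"
  proof (rule has_derivative_transform_within[OF d2 d0(1)])
    fix t :: real assume "dist t 0 < d0"
    then have "q (c t) = 0" using d0(2) c(2) frontier_iff by blast
    then show "\<gamma> (fst (\<Psi> (c t))) = snd (\<Psi> (c t))" by (simp add: q_def)
  qed simp
  from fun_cong[OF has_derivative_unique[OF d1 this], of 1]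
  have "\<Psi> c' = (fst (\<Psi> c'), D\<gamma> ?y (fst (\<Psi> c')))" by (simp add: prod_eq_iff)
  then have "c' = \<Phi> (fst (\<Psi> c'), D\<gamma> ?y (fst (\<Psi> c')))"
    by (metis \<Phi>_\<Psi>)
  then show ?thesis using normal_inner_tangent by metis
qed

text \<open>The curves in the definition of the normal must stay in the boundary for all times,
  whereas the chart controls only a ball around the point; the parameter is therefore confined to a
  bounded range.\<close>

lemma tangent_curve:
  assumes x: "x \<in> ball p r" "q x = 0"
  obtains c where "c 0 = x" "range c \<subseteq> frontier \<Omega>" "(c has_vector_derivative \<Phi> (v, D\<gamma> (fst (\<Psi> x)) v)) (at 0)"
proof -
  let ?y = "fst (\<Psi> x)"
  have xG: "x = G ?y" using x q_eq_0_iff by blast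
  have "isCont (\<lambda>s. ?y + s *\<^sub>R v) 0"
    by (intro continuous_intros)
  then have "isCont (\<lambda>s. G (?y + s *\<^sub>R v)) 0"
    by (rule isCont_o2) (rule has_derivative_continuous[OF G_has_derivative])
  moreover have "G (?y + 0 *\<^sub>R v) \<in> ball p r" using x(1) xG by simp
  ultimately obtain d0 where d0: "d0 > 0" "\<And>s. dist s 0 < d0 \<Longrightarrow> G (?y + s *\<^sub>R v) \<in> ball p r"
    using isCont_near[OF _ open_ball] by blast
  define d where "d = d0 / 2"
  have d: "d > 0" "d < d0" using d0 by (auto simp: d_def)
  \<comment> \<open>Bounded by \<open>d\<close> for all times, zero at 0 with derivative 1 there:
    the curve stays in the chart and its velocity at time 0 is unchanged.\<close>
  define \<phi> where "\<phi> t = d * sin (t / d)" for t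
  have \<phi>: "\<phi> 0 = 0" "\<bar>\<phi> t\<bar> \<le> d" for t
    using d abs_sin_le_one[of "t / d"] by (auto simp: \<phi>_def abs_mult mult_left_le)
  have "(\<phi> has_real_derivative 1) (at 0)"
    unfolding \<phi>_def[abs_def] using d by (auto intro!: derivative_eq_intros)
  moreover have "(*) (1 :: real) = (\<lambda>h. h)"
    by (simp add: fun_eq_iff)
  ultimately have d\<phi>: "(\<phi> has_derivative (\<lambda>h. h)) (at 0)"
    by (simp only: has_field_derivative_def)
  define c where "c t = G (?y + \<phi> t *\<^sub>R v)" for t
  have "((\<lambda>t. ?y + \<phi> t *\<^sub>R v) has_derivative (\<lambda>h. h *\<^sub>R v)) (at 0)"
    using has_derivative_add[OF has_derivative_const has_derivative_scaleR_left[OF d\<phi>]] by simp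
  moreover have "(G has_derivative (\<lambda>h. \<Phi> (h, D\<gamma> ?y h))) (at (?y + \<phi> 0 *\<^sub>R v))"
    using G_has_derivative \<phi>(1) by simp
  ultimately have "(c has_derivative (\<lambda>h. \<Phi> (h *\<^sub>R v, D\<gamma> ?y (h *\<^sub>R v)))) (at 0)"
    unfolding c_def[abs_def] by (rule has_derivative_compose)
  moreover have "\<Phi> (h *\<^sub>R v, D\<gamma> ?y (h *\<^sub>R v)) = h *\<^sub>R \<Phi> (v, D\<gamma> ?y v)" for h
    by (rule linear_cmul[OF linear_DG])
  ultimately have "(c has_vector_derivative \<Phi> (v, D\<gamma> ?y v)) (at 0)"
    by (simp add: has_vector_derivative_def)
  moreover have "c 0 = x" using xG \<phi>(1) by (simp add: c_def)
  moreover have "c t \<in> frontier \<Omega>" for t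
  proof -
    have "c t \<in> ball p r"
      unfolding c_def using \<phi>(2)[of t] d by (intro d0(2)) simp
    moreover have "q (c t) = 0" by (simp add: c_def G_def q_\<Phi>)
    ultimately show ?thesis using frontier_iff by blast
  qed
  ultimately show ?thesis using that by blast
qed

text \<open>Orthogonality to the velocities of \<open>tangent_curve\<close> leaves only multiples of
  \<open>normal\<close>, unit length leaves two signs, and the wrong sign would point into \<Omega>.
  The definite description needs this uniqueness.\<close>

lemma outward_normal_eq:
  assumes x: "x \<in> frontier \<Omega>" "x \<in> ball p r"
  shows "outward_normal \<Omega> x = normal (fst (\<Psi> x))"
  unfolding outward_normal_def
proof (rule the_equality)
  let ?y = "fst (\<Psi> x)"
  have q0: "q x = 0" using frontier_iff x by blast
  show "is_outward_normal \<Omega> x (normal ?y)"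
    unfolding is_outward_normal_def
  proof (intro conjI norm_normal allI impI)
    show "c' \<bullet> normal ?y = 0" if "c 0 = x \<and> range c \<subseteq> frontier \<Omega> \<and> (c has_vector_derivative c') (at 0)" for c c'
      using curve_velocity[OF x(2)] that by blast
    show "\<forall>\<^sub>F t in at_right 0. x - t *\<^sub>R normal ?y \<in> \<Omega> \<and> x + t *\<^sub>R normal ?y \<notin> closure \<Omega>"
      using eventually_normal_side[OF x(2) q0] by (simp add: eventually_conj_iff)
  qed
  fix m assume m: "is_outward_normal \<Omega> x m"
  have orth: "\<Phi> (v, D\<gamma> ?y v) \<bullet> m = 0" for v
  proof -
    obtain c where "c 0 = x" "range c \<subseteq> frontier \<Omega>" "(c has_vector_derivative \<Phi> (v, D\<gamma> ?y v)) (at 0)"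
      using tangent_curve[OF x(2) q0] .
    with m show ?thesis unfolding is_outward_normal_def by blast
  qed
  obtain a b where ab: "m = \<Phi> (a, b)" by (metis \<Phi>_\<Psi> surj_pair)
  have "v \<bullet> (a + b *\<^sub>R grad\<gamma> ?y) = 0" for v
    using orth[of v] unfolding ab inner_\<Phi> by (simp add: D\<gamma>_eq inner_add_right inner_commute mult.commute)
  then have "a + b *\<^sub>R grad\<gamma> ?y = 0" by (metis inner_eq_zero_iff)
  then have "a = (- b) *\<^sub>R grad\<gamma> ?y" by (simp add: eq_neg_iff_add_eq_0)
  then have "(a, b) = (- b) *\<^sub>R (grad\<gamma> ?y, - 1)" by simp
  then have m': "m = (- b) *\<^sub>R \<Phi> (grad\<gamma> ?y, - 1)"
    unfolding ab by (metis linear_cmul[OF linear_\<Phi>])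
  then have m'': "m = (- b * area ?y) *\<^sub>R normal ?y"
    using area_pos[of ?y] by (simp add: normal_def)
  have "norm m = 1" using m by (simp add: is_outward_normal_def)
  then have "\<bar>- b * area ?y\<bar> = 1" unfolding m'' by (simp add: norm_normal)
  then consider "- b * area ?y = 1" | "- b * area ?y = - 1" by linarith
  then show "m = normal ?y"
  proof cases
    case 1
    with m'' show ?thesis by simp
  next
    case 2
    with m'' have mn: "m = - normal ?y" by simp
    have "\<forall>\<^sub>F t in at_right 0. x - t *\<^sub>R m \<in> \<Omega>"
      using m by (simp add: is_outward_normal_def eventually_conj_iff)
    with eventually_normal_side(2)[OF x(2) q0] have "\<forall>\<^sub>F t in at_right (0::real). False"
    proof eventually_elim
      case (elim t)
      then show ?case using closure_subset[of \<Omega>] by (auto simp: mn)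
    qed
    then show ?thesis by (simp add: trivial_limit_at_right_real)
  qed
qed

lemma frontier_chart: "x \<in> ball p r \<Longrightarrow> x \<in> frontier \<Omega> \<longleftrightarrow> snd (\<Psi> x) = \<gamma> (fst (\<Psi> x))"
  by (simp add: frontier_iff q_def)

lemma continuous_normal: "continuous_on S (\<lambda>x. normal (fst (\<Psi> x)))"
proof -
  have "continuous_on UNIV normal"
    unfolding normal_def[abs_def] using area_pos
    by (intro continuous_intros continuous_on_compose2[OF continuous_\<Phi>[of UNIV]] continuous_grad\<gamma> continuous_area)
      (auto simp: less_le)
  then show ?thesis
    by (rule continuous_on_compose2) (auto intro!: continuous_intros continuous_\<Psi>)
qed

lemma integrable_frontier_local:
  fixes f :: "real^3 \<Rightarrow> 'b::{banach,second_countable_topology}"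
  assumes f: "continuous_on UNIV f" "\<And>x. x \<notin> ball p r \<Longrightarrow> f x = 0"
  shows "integrable (surface_measure (frontier \<Omega>)) f"
proof -
  have fm: "f \<in> borel_measurable borel" by (rule borel_measurable_continuous_onI[OF f(1)])
  have "integrable lborel (\<lambda>y. area y *\<^sub>R f (G y))"
  proof (rule integrable_continuous_bounded_support)
    show "continuous_on UNIV (\<lambda>y. area y *\<^sub>R f (G y))"
      by (intro continuous_intros continuous_area continuous_on_compose2[OF f(1) continuous_G]) auto
    show "norm y \<le> norm p + r" if "area y *\<^sub>R f (G y) \<noteq> 0" for y
    proof -
      have "G y \<in> ball p r" using f(2)[of "G y"] that by fastforce
      moreover have "norm y \<le> norm (G y)"
        using norm_fst_le[of y "\<gamma> y"] by (simp add: G_def norm_\<Phi>)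
      ultimately show ?thesis
        using norm_triangle_ineq2[of "G y" p] by (simp add: dist_norm norm_minus_commute)
    qed
  qed
  then show ?thesis
    using integrable_surface_measure_graph[OF open_ball frontier_chart fm f(2)] by blast
qed

text \<open>Support in the ball of half the radius makes the derivative vanish outside the chart, so
  \<Omega> may be replaced by the epigraph and its frontier by the graph.\<close>

lemma divergence_local:
  fixes f :: "real^3 \<Rightarrow> complex"
  assumes f: "C1_on UNIV f" and supp: "\<And>x. x \<notin> ball p (r / 2) \<Longrightarrow> f x = 0"
  shows "(\<integral>x. indicator \<Omega> x *\<^sub>R frechet_derivative f (at x) e \<partial>lborel) =
    (LINT x:frontier \<Omega>|surface_measure (frontier \<Omega>). (e \<bullet> outward_normal \<Omega> x) *\<^sub>R f x)"
proof -
  have R: "norm x \<le> norm p + r" if "f x \<noteq> 0" for x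
  proof -
    have "x \<in> ball p (r / 2)" using supp that by blast
    then show ?thesis
      using norm_triangle_ineq2[of x p] r by (simp add: dist_norm norm_minus_commute)
  qed
  have df0: "frechet_derivative f (at x) e = 0" if "x \<notin> ball p r" for x
    by (rule frechet_derivative_eq_0_outside[of "cball p (r / 2)"]) (use supp that r in auto)
  let ?F = "\<lambda>x. (e \<bullet> normal (fst (\<Psi> x))) *\<^sub>R f x"
  have F: "continuous_on UNIV ?F"
    by (intro continuous_intros continuous_normal C1_on_continuous[OF f])
  have F0: "?F x = 0" if "x \<notin> ball p r" for x
    using supp[of x] that r by auto
  have eq: "indicator \<Omega> x *\<^sub>R frechet_derivative f (at x) e = indicator epigraph x *\<^sub>R frechet_derivative f (at x) e" for x
    using df0[of x] chart by (cases "x \<in> ball p r") (auto simp: indicator_def set_eq_iff)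
  have "(\<integral>x. indicator \<Omega> x *\<^sub>R frechet_derivative f (at x) e \<partial>lborel) =
      (\<integral>x. indicator epigraph x *\<^sub>R frechet_derivative f (at x) e \<partial>lborel)"
    unfolding eq ..
  also have "\<dots> = (\<integral>y. area y *\<^sub>R ((e \<bullet> normal y) *\<^sub>R f (G y)) \<partial>lborel)"
    by (rule divergence_epigraph[OF f R])
  also have "\<dots> = integral\<^sup>L (surface_measure (frontier \<Omega>)) ?F"
    using integral_surface_measure_graph[OF open_ball frontier_chart borel_measurable_continuous_onI[OF F] F0]
    by simp
  also have "\<dots> = (\<integral>x. indicator (frontier \<Omega>) x *\<^sub>R ?F x \<partial>surface_measure (frontier \<Omega>))"
  proof (rule integral_cong_AE)
    show "AE x in surface_measure (frontier \<Omega>). ?F x = indicator (frontier \<Omega>) x *\<^sub>R ?F x"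
      using AE_frontier by eventually_elim simp
    have "(\<lambda>x. indicator (frontier \<Omega>) x *\<^sub>R ?F x) \<in> borel_measurable borel"
      by (rule borel_measurable_scaleR[OF borel_measurable_indicator borel_measurable_continuous_onI[OF F]]) simp
    then show "?F \<in> borel_measurable (surface_measure (frontier \<Omega>))"
      "(\<lambda>x. indicator (frontier \<Omega>) x *\<^sub>R ?F x) \<in> borel_measurable (surface_measure (frontier \<Omega>))"
      using borel_measurable_continuous_onI[OF F]
      by (simp_all only: measurable_cong_sets[OF sets_surface_measure refl])
  qed
  also have "\<dots> = (LINT x:frontier \<Omega>|surface_measure (frontier \<Omega>). (e \<bullet> outward_normal \<Omega> x) *\<^sub>R f x)"
    unfolding set_lebesgue_integral_def
  proof (rule Bochner_Integration.integral_cong[OF refl])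
    fix x
    show "indicator (frontier \<Omega>) x *\<^sub>R ?F x = indicator (frontier \<Omega>) x *\<^sub>R ((e \<bullet> outward_normal \<Omega> x) *\<^sub>R f x)"
      using outward_normal_eq[of x] supp[of x] r by (cases "x \<in> ball p r") (auto simp: indicator_def)
  qed
  finally show ?thesis .
qed

text \<open>The inner cone condition of Lipschitz domains.\<close>

lemma inner_cone:
  "\<exists>a. \<exists>\<rho>>0. \<forall>x\<in>\<Omega> \<inter> ball p r. \<forall>z\<in>cball a \<rho>. \<forall>t>0. x + t *\<^sub>R z \<in> ball p r \<longrightarrow> x + t *\<^sub>R z \<in> \<Omega>"
proof -
  define K where "K = ball (fst (\<Psi> p)) r"
  have bK: "fst (\<Psi> x) \<in> K" if "x \<in> ball p r" for x
  proof -
    have "dist (fst (\<Psi> p)) (fst (\<Psi> x)) \<le> dist (\<Psi> p) (\<Psi> x)" by (rule dist_fst_le)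
    also have "\<dots> = dist p x"
      using norm_\<Psi>[of "p - x"] by (simp add: dist_norm linear_diff[OF linear_\<Psi>])
    finally show ?thesis using that by (simp add: K_def)
  qed
  obtain L where L: "L \<ge> 0" "\<And>y. y \<in> K \<Longrightarrow> norm (grad\<gamma> y) \<le> L"
  proof -
    have "bounded (grad\<gamma> ` cball (fst (\<Psi> p)) r)"
      by (intro compact_imp_bounded compact_continuous_image continuous_grad\<gamma>) auto
    then obtain b where b: "\<forall>y\<in>cball (fst (\<Psi> p)) r. norm (grad\<gamma> y) \<le> b"
      unfolding bounded_iff by auto
    show ?thesis
      by (rule that[of "max 0 b"]) (use b in \<open>auto simp: K_def le_max_iff_disj\<close>)
  qed
  have lip: "\<bar>\<gamma> y - \<gamma> y'\<bar> \<le> L * norm (y - y')" if "y \<in> K" "y' \<in> K" for y y'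
  proof -
    have "norm (\<gamma> y - \<gamma> y') \<le> L * norm (y - y')"
    proof (rule differentiable_bound[where S=K and f'=D\<gamma>])
      show "onorm (D\<gamma> z) \<le> L" if "z \<in> K" for z
      proof (rule onorm_le)
        fix h
        have "\<bar>grad\<gamma> z \<bullet> h\<bar> \<le> norm (grad\<gamma> z) * norm h" by (rule Cauchy_Schwarz_ineq2)
        also have "\<dots> \<le> L * norm h" using L(2)[OF that] by (rule mult_right_mono) simp
        finally show "norm (D\<gamma> z h) \<le> L * norm h" by (simp add: D\<gamma>_eq)
      qed
      show "(\<gamma> has_derivative D\<gamma> z) (at z within K)" for z
        by (rule has_derivative_at_withinI[OF \<gamma>_has_derivative])
    qed (use that in \<open>auto simp: K_def\<close>)
    then show ?thesis by simp
  qed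
  \<comment> \<open>Chosen so that \<open>L * \<rho> < 1 - \<rho>\<close>: a direction within \<rho>
    of the vertical rises by at least \<open>1 - \<rho>\<close>, while \<gamma> grows by at most
    \<open>L * \<rho>\<close>.\<close>
  define \<rho> where "\<rho> = 1 / (L + 2)"
  have \<rho>: "\<rho> > 0" "L * \<rho> < 1 - \<rho>" using L(1) by (auto simp: \<rho>_def field_simps)
  show ?thesis
  proof (intro exI[of _ "\<Phi> (0, 1)"] exI[of _ \<rho>] conjI ballI allI impI)
    fix x z and t :: real
    assume x: "x \<in> \<Omega> \<inter> ball p r" and z: "z \<in> cball (\<Phi> (0, 1)) \<rho>" and t: "t > 0" and xz: "x + t *\<^sub>R z \<in> ball p r"
    obtain a b where ab: "\<Psi> z = (a, b)" by (metis surj_pair)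
    have "norm (\<Psi> (z - \<Phi> (0, 1))) \<le> \<rho>"
      using z by (simp add: norm_\<Psi> dist_norm norm_minus_commute)
    then have "norm (a, b - 1) \<le> \<rho>"
      by (simp add: linear_diff[OF linear_\<Psi>] ab)
    then have an: "norm a \<le> \<rho>" "\<bar>b - 1\<bar> \<le> \<rho>"
      using norm_fst_le[of a "b - 1"] norm_snd_le[of "b - 1" a] by auto
    have \<Psi>xz: "\<Psi> (x + t *\<^sub>R z) = (fst (\<Psi> x) + t *\<^sub>R a, snd (\<Psi> x) + t * b)"
      by (simp add: linear_add[OF linear_\<Psi>] linear_cmul[OF linear_\<Psi>] ab prod_eq_iff)
    have "\<gamma> (fst (\<Psi> x) + t *\<^sub>R a) \<le> \<gamma> (fst (\<Psi> x)) + L * norm (t *\<^sub>R a)"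
      using lip[OF bK[OF xz] bK[of x]] x by (simp add: \<Psi>xz)
    also have "L * norm (t *\<^sub>R a) \<le> t * (L * \<rho>)"
      using L(1) t an(1) mult_left_mono[OF an(1), of "L * t"] by (simp add: ac_simps)
    also have "t * (L * \<rho>) < t * b"
      using an(2) \<rho>(2) t by (intro mult_strict_left_mono) linarith+
    finally have "\<gamma> (fst (\<Psi> x) + t *\<^sub>R a) < \<gamma> (fst (\<Psi> x)) + t * b" by simp
    moreover have "\<gamma> (fst (\<Psi> x)) < snd (\<Psi> x)"
      using in_\<Omega>_iff[of x] x by (simp add: q_def)
    ultimately have "q (x + t *\<^sub>R z) > 0"
      by (simp add: q_def \<Psi>xz)
    then show "x + t *\<^sub>R z \<in> \<Omega>" using in_\<Omega>_iff[OF xz] by simp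
  qed (rule \<rho>(1))
qed

lemma inner_\<Phi>_outward_normal:
  assumes "x \<in> frontier \<Omega>" "x \<in> ball p r"
  shows "\<Phi> (0, - 1) \<bullet> outward_normal \<Omega> x > 0"
  using area_pos[of "fst (\<Psi> x)"]
  by (simp add: outward_normal_eq[OF assms] \<Phi>_inner_normal linear_0[OF linear_D\<gamma>])

end

lemma boundary_chart_exists:
  assumes "bounded_C2_domain \<Omega>" "p \<in> frontier \<Omega>"
  shows "\<exists>r T \<gamma>. boundary_chart T \<gamma> \<Omega> p r"
proof -
  from assms obtain T :: "real^3 \<Rightarrow> real^3" and r and \<gamma> :: "real^2 \<Rightarrow> real" where T: "orthogonal_transformation T" and r: "r > 0"
    and \<gamma>: "C2_on UNIV \<gamma>" and eq: "\<Omega> \<inter> ball p r = {x \<in> ball p r. \<gamma> (vector [T x $ 1, T x $ 2]) < T x $ 3}"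
    unfolding bounded_C2_domain_def C2_boundary_def by blast
  have "C1_on UNIV \<gamma>"
    using \<gamma> C1_on_continuous unfolding C2_on_def C1_on_def[of UNIV \<gamma>] by blast
  then interpret graph T \<gamma>
    by unfold_locales (rule T)
  have "epigraph \<inter> ball p r = {x \<in> ball p r. \<gamma> (vector [T x $ 1, T x $ 2]) < T x $ 3}"
    by (auto simp: epigraph_def \<Psi>_def)
  then have "boundary_chart T \<gamma> \<Omega> p r"
    using assms(1) r eq by unfold_locales (auto simp: bounded_C2_domain_def)
  then show ?thesis by blast
qed

lemma borel_measurable_surface_measure: "f \<in> borel_measurable (surface_measure S) \<longleftrightarrow> f \<in> borel_measurable borel"
  by (simp only: measurable_cong_sets[OF sets_surface_measure refl])

section \<open>The divergence theorem on the whole domain\<close>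

locale C2_domain =
  fixes \<Omega> :: "(real^3) set"
  assumes \<Omega>: "bounded_C2_domain \<Omega>"
begin

abbreviation \<sigma> :: "(real^3) measure" where "\<sigma> \<equiv> surface_measure (frontier \<Omega>)"
abbreviation \<nu> :: "real^3 \<Rightarrow> real^3" where "\<nu> \<equiv> outward_normal \<Omega>"

lemma open_\<Omega>: "open \<Omega>" and bounded_\<Omega>: "bounded \<Omega>" and borel_\<Omega>: "\<Omega> \<in> sets borel"
  using \<Omega> by (auto simp: bounded_C2_domain_def)

lemma compact_closure_\<Omega>: "compact (closure \<Omega>)"
  using bounded_\<Omega> by (simp add: compact_eq_bounded_closed bounded_closure)

lemma compact_frontier_\<Omega>: "compact (frontier \<Omega>)"
  using bounded_\<Omega> by (rule compact_frontier_bounded)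

lemma frontier_not_in: "x \<in> frontier \<Omega> \<Longrightarrow> x \<notin> \<Omega>"
  using open_\<Omega> by (simp add: frontier_def interior_open)

lemma closure_cases: "p \<in> closure \<Omega> \<Longrightarrow> p \<in> \<Omega> \<or> p \<in> frontier \<Omega>"
  using open_\<Omega> by (auto simp: frontier_def interior_open)

lemma continuous_outward_normal: "continuous_on (frontier \<Omega>) \<nu>"
  unfolding continuous_on_eq_continuous_within
proof
  fix x assume x: "x \<in> frontier \<Omega>"
  obtain r T \<gamma> where bc: "boundary_chart T \<gamma> \<Omega> x r"
    using boundary_chart_exists[OF \<Omega> x] by blast
  interpret boundary_chart T \<gamma> \<Omega> x r by fact
  have "continuous (at x within frontier \<Omega>) (\<lambda>x. normal (fst (\<Psi> x)))"
    using continuous_normal[of "frontier \<Omega>"] x by (simp add: continuous_on_eq_continuous_within)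
  then show "continuous (at x within frontier \<Omega>) \<nu>"
    by (rule continuous_transform_within[OF _ r x]) (simp add: outward_normal_eq dist_commute)
qed

lemma norm_outward_normal:
  assumes x: "x \<in> frontier \<Omega>"
  shows "norm (\<nu> x) = 1"
proof -
  obtain r T \<gamma> where bc: "boundary_chart T \<gamma> \<Omega> x r"
    using boundary_chart_exists[OF \<Omega> x] by blast
  interpret boundary_chart T \<gamma> \<Omega> x r by fact
  show ?thesis
    using x r by (simp add: outward_normal_eq norm_normal)
qed

lemma normal_measurable: "(\<lambda>x. indicator (frontier \<Omega>) x *\<^sub>R \<nu> x) \<in> borel_measurable borel"
  by (rule borel_measurable_continuous_on_indicator[OF _ continuous_outward_normal]) simp

lemma inner_cone_closure:
  assumes "p \<in> closure \<Omega>"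
  shows "\<exists>r>0. \<exists>a. \<exists>\<rho>>0. \<forall>x\<in>\<Omega> \<inter> ball p r. \<forall>z\<in>cball a \<rho>. \<forall>t>0. x + t *\<^sub>R z \<in> ball p r \<longrightarrow> x + t *\<^sub>R z \<in> \<Omega>"
  using closure_cases[OF assms]
proof
  assume "p \<in> \<Omega>"
  then obtain r where "r > 0" "ball p r \<subseteq> \<Omega>"
    using open_\<Omega> open_contains_ball by blast
  then show ?thesis
    by (intro exI[of _ r] conjI exI[of _ 0] exI[of _ "1::real"]) auto
next
  assume "p \<in> frontier \<Omega>"
  then obtain r T \<gamma> where bc: "boundary_chart T \<gamma> \<Omega> p r"
    using boundary_chart_exists[OF \<Omega>] by blast
  interpret boundary_chart T \<gamma> \<Omega> p r by fact
  show ?thesis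
    using inner_cone r by blast
qed

text \<open>The last conjunct provides a constant direction that is transversal to the boundary on the support
  of \<open>\<psi>\<close>. It is what makes the trace inequality work.\<close>

definition divergence_cutoff :: "(real^3 \<Rightarrow> real) \<Rightarrow> bool" where
  "divergence_cutoff \<psi> \<longleftrightarrow>
    (\<forall>f e. C1_on UNIV f \<longrightarrow>
      (\<integral>x. indicator \<Omega> x *\<^sub>R frechet_derivative (\<lambda>x. complex_of_real (\<psi> x) * f x) (at x) e \<partial>lborel) =
      (LINT x:frontier \<Omega>|\<sigma>. (e \<bullet> \<nu> x) *\<^sub>R (complex_of_real (\<psi> x) * f x))) \<and>
    (\<forall>f :: real^3 \<Rightarrow> complex. continuous_on UNIV f \<longrightarrow> integrable \<sigma> (\<lambda>x. complex_of_real (\<psi> x) * f x)) \<and>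
    (\<exists>d. \<forall>x\<in>frontier \<Omega>. \<psi> x > 0 \<longrightarrow> d \<bullet> \<nu> x > 0)"

text \<open>Both sides vanish because the cutoff has compact support in \<Omega>, and the
  transversality condition is vacuous on the boundary.\<close>

lemma divergence_cutoff_interior:
  assumes c: "ball c r \<subseteq> \<Omega>" "r > 0" and \<psi>: "C1_on UNIV \<psi>" "\<And>x. x \<notin> ball c (r / 2) \<Longrightarrow> \<psi> x = 0"
  shows "divergence_cutoff \<psi>"
  unfolding divergence_cutoff_def
proof (intro conjI allI impI)
  have \<psi>0: "\<psi> x = 0" if "x \<in> frontier \<Omega>" for x
  proof (rule \<psi>(2), rule notI)
    assume "x \<in> ball c (r / 2)"
    then have "x \<in> ball c r" using c(2) by simp
    with c(1) frontier_not_in[OF that] show False by blast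
  qed
  fix f :: "real^3 \<Rightarrow> complex"
  {
    fix e
    assume f: "C1_on UNIV f"
    let ?f = "\<lambda>x. complex_of_real (\<psi> x) * f x"
    have R: "norm x \<le> norm c + r" if "?f x \<noteq> 0" for x
    proof -
      have "x \<in> ball c (r / 2)" using \<psi>(2) that by fastforce
      then show ?thesis
        using norm_triangle_ineq2[of x c] c(2) by (simp add: dist_norm norm_minus_commute)
    qed
    have d0: "frechet_derivative ?f (at x) e = 0" if "x \<notin> \<Omega>" for x
    proof (rule frechet_derivative_eq_0_outside[of "cball c (r / 2)"])
      show "x \<notin> cball c (r / 2)"
      proof
        assume "x \<in> cball c (r / 2)"
        then have "x \<in> ball c r" using c(2) by simp
        with c(1) that show False by blast
      qed
    qed (use \<psi>(2) in auto)
    have "(\<integral>x. indicator \<Omega> x *\<^sub>R frechet_derivative ?f (at x) e \<partial>lborel) = (\<integral>x. frechet_derivative ?f (at x) e \<partial>lborel)"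
      by (rule Bochner_Integration.integral_cong) (use d0 in \<open>auto simp: indicator_def\<close>)
    also have "\<dots> = 0"
      by (rule integral_derivative_eq_0(2)[OF C1_on_mult[OF C1_on_of_real[OF \<psi>(1)] f] R])
    also have "0 = (LINT x:frontier \<Omega>|\<sigma>. (e \<bullet> \<nu> x) *\<^sub>R ?f x)"
      unfolding set_lebesgue_integral_def
      by (rule Bochner_Integration.integral_eq_zero_AE[symmetric]) (use \<psi>0 in \<open>auto simp: indicator_def intro!: AE_I2\<close>)
    finally show "(\<integral>x. indicator \<Omega> x *\<^sub>R frechet_derivative ?f (at x) e \<partial>lborel) =
        (LINT x:frontier \<Omega>|\<sigma>. (e \<bullet> \<nu> x) *\<^sub>R ?f x)" .
  next
    assume f: "continuous_on UNIV f"
    have "integrable \<sigma> (\<lambda>x. complex_of_real (\<psi> x) * f x) \<longleftrightarrow> integrable \<sigma> (\<lambda>x. 0 :: complex)"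
    proof (rule integrable_cong_AE)
      show "(\<lambda>x. complex_of_real (\<psi> x) * f x) \<in> borel_measurable \<sigma>"
        unfolding borel_measurable_surface_measure
        by (intro borel_measurable_continuous_onI continuous_intros f C1_on_continuous[OF \<psi>(1)])
      show "AE x in \<sigma>. complex_of_real (\<psi> x) * f x = 0"
        using AE_frontier by eventually_elim (simp add: \<psi>0)
    qed simp
    then show "integrable \<sigma> (\<lambda>x. complex_of_real (\<psi> x) * f x)" by simp
  }
  show "\<exists>d. \<forall>x\<in>frontier \<Omega>. \<psi> x > 0 \<longrightarrow> d \<bullet> \<nu> x > 0"
    using \<psi>0 by auto
qed

lemma divergence_cutoff_boundary:
  assumes c: "boundary_chart T \<gamma> \<Omega> c r" and \<psi>: "C1_on UNIV \<psi>" "\<And>x. x \<notin> ball c (r / 2) \<Longrightarrow> \<psi> x = 0"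
  shows "divergence_cutoff \<psi>"
proof -
  interpret boundary_chart T \<gamma> \<Omega> c r by fact
  show ?thesis
    unfolding divergence_cutoff_def
  proof (intro conjI allI impI)
    fix f :: "real^3 \<Rightarrow> complex" and e
    assume f: "C1_on UNIV f"
    show "(\<integral>x. indicator \<Omega> x *\<^sub>R frechet_derivative (\<lambda>x. complex_of_real (\<psi> x) * f x) (at x) e \<partial>lborel) =
        (LINT x:frontier \<Omega>|\<sigma>. (e \<bullet> \<nu> x) *\<^sub>R (complex_of_real (\<psi> x) * f x))"
      by (rule divergence_local[OF C1_on_mult[OF C1_on_of_real[OF \<psi>(1)] f]]) (simp add: \<psi>(2))
  next
    fix f :: "real^3 \<Rightarrow> complex"
    assume f: "continuous_on UNIV f"
    show "integrable \<sigma> (\<lambda>x. complex_of_real (\<psi> x) * f x)"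
    proof (rule integrable_frontier_local)
      show "continuous_on UNIV (\<lambda>x. complex_of_real (\<psi> x) * f x)"
        by (intro continuous_intros f C1_on_continuous[OF \<psi>(1)])
      show "complex_of_real (\<psi> x) * f x = 0" if "x \<notin> ball c r" for x
        using \<psi>(2)[of x] that r by simp
    qed
  next
    have "\<Phi> (0, - 1) \<bullet> \<nu> x > 0" if "x \<in> frontier \<Omega>" "\<psi> x > 0" for x
    proof (rule inner_\<Phi>_outward_normal[OF that(1)])
      show "x \<in> ball c r" using \<psi>(2)[of x] that(2) r by fastforce
    qed
    then show "\<exists>d. \<forall>x\<in>frontier \<Omega>. \<psi> x > 0 \<longrightarrow> d \<bullet> \<nu> x > 0" by blast
  qed
qed

lemma partition_exists:
  "\<exists>C \<psi>. finite C \<and> (\<forall>c. C1_on UNIV (\<psi> c)) \<and> (\<forall>c x. 0 \<le> \<psi> c x) \<and>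
    (\<forall>c\<in>C. divergence_cutoff (\<psi> c)) \<and> (\<forall>x\<in>closure \<Omega>. (\<Sum>c\<in>C. \<psi> (c :: real^3) x) = 1)"
proof -
  \<comment> \<open>The radius at a point is fixed before the partition: every C1 cutoff supported
    in the half ball has to be admissible, whichever one the partition produces.\<close>
  define good where "good p r \<longleftrightarrow> r > 0 \<and>
    (\<forall>\<psi>. C1_on UNIV \<psi> \<longrightarrow> (\<forall>x. x \<notin> ball p (r / 2) \<longrightarrow> \<psi> x = 0) \<longrightarrow> divergence_cutoff \<psi>)" for p r
  have "\<exists>r. good p r" if "p \<in> closure \<Omega>" for p
    using closure_cases[OF that]
  proof
    assume "p \<in> \<Omega>"
    then obtain r where r: "r > 0" "ball p r \<subseteq> \<Omega>"
      using open_\<Omega> open_contains_ball by blast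
    then show ?thesis
      unfolding good_def using divergence_cutoff_interior[OF r(2,1)] by blast
  next
    assume "p \<in> frontier \<Omega>"
    then obtain r T \<gamma> where bc: "boundary_chart T \<gamma> \<Omega> p r"
      using boundary_chart_exists[OF \<Omega>] by blast
    then have "r > 0" by (rule boundary_chart.r)
    then show ?thesis
      unfolding good_def using divergence_cutoff_boundary[OF bc] by blast
  qed
  then obtain r where r: "\<And>p. p \<in> closure \<Omega> \<Longrightarrow> good p (r p)" by metis
  then have "\<And>p. p \<in> closure \<Omega> \<Longrightarrow> r p / 2 > 0" by (simp add: good_def)
  with compact_closure_\<Omega>
  obtain C \<psi> where C: "finite C" "C \<subseteq> closure \<Omega>" and \<psi>: "\<And>c. C1_on UNIV (\<psi> c)" "\<And>c x. 0 \<le> \<psi> c x"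
    "\<And>c x. c \<in> C \<Longrightarrow> x \<notin> ball c (r c / 2) \<Longrightarrow> \<psi> c x = (0::real)"
    "\<And>x. x \<in> closure \<Omega> \<Longrightarrow> (\<Sum>c\<in>C. \<psi> c x) = 1"
    by (elim C1_partition_of_unity[of "closure \<Omega>" "\<lambda>c. r c / 2"]) auto
  have "divergence_cutoff (\<psi> c)" if "c \<in> C" for c
  proof -
    have "good c (r c)" using r C(2) that by blast
    then show ?thesis unfolding good_def using \<psi>(1) \<psi>(3)[OF that] by blast
  qed
  with C(1) \<psi> show ?thesis
    by (intro exI[of _ C] exI[of _ \<psi>] conjI allI ballI) auto
qed

lemma integrable_on_\<Omega>:
  fixes f :: "real^3 \<Rightarrow> 'b::{banach,second_countable_topology}"
  assumes "continuous_on UNIV f"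
  shows "integrable lborel (\<lambda>x. indicator \<Omega> x *\<^sub>R f x)"
proof (rule Bochner_Integration.integrable_bound)
  show "integrable lborel (\<lambda>x. indicator (closure \<Omega>) x *\<^sub>R f x)"
    by (intro borel_integrable_compact compact_closure_\<Omega> continuous_on_subset[OF assms]) auto
  show "(\<lambda>x. indicator \<Omega> x *\<^sub>R f x) \<in> borel_measurable lborel"
    using borel_measurable_continuous_onI[OF assms] borel_\<Omega> by measurable
  show "AE x in lborel. norm (indicator \<Omega> x *\<^sub>R f x) \<le> norm (indicator (closure \<Omega>) x *\<^sub>R f x)"
    using closure_subset[of \<Omega>] by (intro AE_I2) (auto simp: indicator_def)
qed

lemma integrable_\<sigma>:
  fixes f :: "real^3 \<Rightarrow> complex"
  assumes "continuous_on UNIV f"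
  shows "integrable \<sigma> f"
proof -
  obtain C \<psi> where C: "finite C" and \<psi>: "\<And>c. C1_on UNIV (\<psi> c)" "\<And>c. c \<in> C \<Longrightarrow> divergence_cutoff (\<psi> c)"
    and \<psi>1: "\<And>x. x \<in> closure \<Omega> \<Longrightarrow> (\<Sum>c\<in>C. \<psi> (c :: real^3) x) = 1"
    using partition_exists by blast
  have int: "integrable \<sigma> (\<lambda>x. \<Sum>c\<in>C. complex_of_real (\<psi> c x) * f x)"
    using \<psi>(2) assms by (intro Bochner_Integration.integrable_sum) (auto simp: divergence_cutoff_def)
  show ?thesis
  proof (rule integrable_cong_AE_imp[OF int])
    show "f \<in> borel_measurable \<sigma>"
      unfolding borel_measurable_surface_measure by (rule borel_measurable_continuous_onI[OF assms])
    show "AE x in \<sigma>. (\<Sum>c\<in>C. complex_of_real (\<psi> c x) * f x) = f x"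
      using AE_frontier
    proof eventually_elim
      case (elim x)
      then have "x \<in> closure \<Omega>" by (simp add: frontier_def)
      from \<psi>1[OF this] show ?case
        by (simp flip: sum_distrib_right of_real_sum)
    qed
  qed
qed

text \<open>The surface measure is a supremum whose finiteness is not evident from its definition;
  integrability of the constant 1, obtained in the charts, supplies it.\<close>

lemma finite_measure_\<sigma>: "finite_measure \<sigma>"
proof -
  have "integrable \<sigma> (\<lambda>x. 1 :: complex)" by (rule integrable_\<sigma>) simp
  then have "(\<integral>\<^sup>+x. 1 \<partial>\<sigma>) < \<infinity>" by (simp add: integrable_iff_bounded)
  then show ?thesis by (intro finite_measureI) simp
qed

lemma set_integrable_\<sigma>:
  fixes f :: "real^3 \<Rightarrow> complex"
  assumes "continuous_on UNIV f"
  shows "set_integrable \<sigma> (frontier \<Omega>) (\<lambda>x. (e \<bullet> \<nu> x) *\<^sub>R f x)"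
  unfolding set_integrable_def
proof (rule Bochner_Integration.integrable_bound[where f="\<lambda>x. norm e *\<^sub>R f x"])
  show "integrable \<sigma> (\<lambda>x. norm e *\<^sub>R f x)"
    using integrable_\<sigma>[OF assms] by simp
  have "(\<lambda>x. (e \<bullet> (indicator (frontier \<Omega>) x *\<^sub>R \<nu> x)) *\<^sub>R f x) \<in> borel_measurable borel"
    by (intro borel_measurable_scaleR borel_measurable_inner normal_measurable borel_measurable_const
        borel_measurable_continuous_onI[OF assms])
  then show "(\<lambda>x. indicator (frontier \<Omega>) x *\<^sub>R ((e \<bullet> \<nu> x) *\<^sub>R f x)) \<in> borel_measurable \<sigma>"
    unfolding borel_measurable_surface_measure by simp
  show "AE x in \<sigma>. norm (indicator (frontier \<Omega>) x *\<^sub>R ((e \<bullet> \<nu> x) *\<^sub>R f x)) \<le> norm (norm e *\<^sub>R f x)"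
  proof (rule AE_I2)
    fix x
    show "norm (indicator (frontier \<Omega>) x *\<^sub>R ((e \<bullet> \<nu> x) *\<^sub>R f x)) \<le> norm (norm e *\<^sub>R f x)"
    proof (cases "x \<in> frontier \<Omega>")
      case True
      then have "\<bar>e \<bullet> \<nu> x\<bar> \<le> norm e"
        using Cauchy_Schwarz_ineq2[of e "\<nu> x"] norm_outward_normal by simp
      then show ?thesis using True by (simp add: mult_right_mono)
    qed simp
  qed
qed

text \<open>The partition of unity reduces the claim to the cutoffs. No derivative of the partition
  survives: the localized functions add up to \<open>f\<close> on the open set \<Omega>, so their
  derivatives add up to that of \<open>f\<close>.\<close>

theorem divergence_theorem:
  fixes f :: "real^3 \<Rightarrow> complex"
  assumes f: "C1_on UNIV f"
  shows "(\<integral>x. indicator \<Omega> x *\<^sub>R frechet_derivative f (at x) e \<partial>lborel) =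
    (LINT x:frontier \<Omega>|\<sigma>. (e \<bullet> \<nu> x) *\<^sub>R f x)"
proof -
  obtain C \<psi> where C: "finite C" and \<psi>: "\<And>c. C1_on UNIV (\<psi> c)" "\<And>c. c \<in> C \<Longrightarrow> divergence_cutoff (\<psi> c)"
    and \<psi>1: "\<And>x. x \<in> closure \<Omega> \<Longrightarrow> (\<Sum>c\<in>C. \<psi> (c :: real^3) x) = 1"
    using partition_exists by blast
  define F where "F c x = complex_of_real (\<psi> c x) * f x" for c x
  have F: "C1_on UNIV (F c)" for c
    unfolding F_def[abs_def] by (rule C1_on_mult[OF C1_on_of_real[OF \<psi>(1)] f])
  have sumF: "(\<Sum>c\<in>C. F c x) = f x" if "x \<in> closure \<Omega>" for x
    using \<psi>1[OF that] by (simp add: F_def flip: sum_distrib_right of_real_sum)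
  have sumD: "frechet_derivative f (at x) e = (\<Sum>c\<in>C. frechet_derivative (F c) (at x) e)" if x: "x \<in> \<Omega>" for x
  proof -
    have "((\<lambda>x. \<Sum>c\<in>C. F c x) has_derivative (\<lambda>h. \<Sum>c\<in>C. frechet_derivative (F c) (at x) h)) (at x)"
      by (intro has_derivative_sum C1_on_has_derivative[OF F] UNIV_I)
    then have "(f has_derivative (\<lambda>h. \<Sum>c\<in>C. frechet_derivative (F c) (at x) h)) (at x)"
      by (rule has_derivative_transform_within_open[OF _ open_\<Omega> x]) (use sumF closure_subset in auto)
    from fun_cong[OF frechet_derivative_at[OF this], of e] show ?thesis by simp
  qed
  have "(\<integral>x. indicator \<Omega> x *\<^sub>R frechet_derivative f (at x) e \<partial>lborel) =
      (\<integral>x. (\<Sum>c\<in>C. indicator \<Omega> x *\<^sub>R frechet_derivative (F c) (at x) e) \<partial>lborel)"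
    by (rule Bochner_Integration.integral_cong) (auto simp: indicator_def sumD)
  also have "\<dots> = (\<Sum>c\<in>C. \<integral>x. indicator \<Omega> x *\<^sub>R frechet_derivative (F c) (at x) e \<partial>lborel)"
    by (rule Bochner_Integration.integral_sum) (rule integrable_on_\<Omega>[OF C1_on_continuous_derivative[OF F]])
  also have "\<dots> = (\<Sum>c\<in>C. LINT x:frontier \<Omega>|\<sigma>. (e \<bullet> \<nu> x) *\<^sub>R F c x)"
    using \<psi>(2) f by (intro sum.cong refl) (simp add: divergence_cutoff_def F_def[abs_def])
  also have "\<dots> = (\<integral>x. (\<Sum>c\<in>C. indicator (frontier \<Omega>) x *\<^sub>R ((e \<bullet> \<nu> x) *\<^sub>R F c x)) \<partial>\<sigma>)"
    unfolding set_lebesgue_integral_def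
    by (rule Bochner_Integration.integral_sum[symmetric])
      (use set_integrable_\<sigma>[OF C1_on_continuous[OF F]] in \<open>simp add: set_integrable_def\<close>)
  also have "\<dots> = (LINT x:frontier \<Omega>|\<sigma>. (e \<bullet> \<nu> x) *\<^sub>R f x)"
    unfolding set_lebesgue_integral_def
  proof (rule Bochner_Integration.integral_cong[OF refl])
    fix x
    show "(\<Sum>c\<in>C. indicator (frontier \<Omega>) x *\<^sub>R ((e \<bullet> \<nu> x) *\<^sub>R F c x)) = indicator (frontier \<Omega>) x *\<^sub>R ((e \<bullet> \<nu> x) *\<^sub>R f x)"
      using sumF[of x] by (cases "x \<in> frontier \<Omega>") (auto simp: frontier_def simp flip: scaleR_sum_right)
  qed
  finally show ?thesis .
qed

end

section \<open>Traces and Green's formula\<close>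

lemma frechet_derivative_eq_sum_partial:
  fixes \<phi> :: "real^3 \<Rightarrow> complex"
  assumes "C1_on UNIV \<phi>"
  shows "frechet_derivative \<phi> (at x) d = (\<Sum>i\<in>UNIV. d $ i *\<^sub>R partial_deriv i \<phi> x)"
proof -
  have lin: "linear (frechet_derivative \<phi> (at x))"
    by (rule has_derivative_linear[OF C1_on_has_derivative[OF assms UNIV_I]])
  have "d = (\<Sum>i\<in>UNIV. d $ i *\<^sub>R axis i 1)"
    using basis_expansion[of d] by (simp add: scalar_mult_eq_scaleR)
  then have "frechet_derivative \<phi> (at x) d = frechet_derivative \<phi> (at x) (\<Sum>i\<in>UNIV. d $ i *\<^sub>R axis i 1)"
    by simp
  also have "\<dots> = (\<Sum>i\<in>UNIV. d $ i *\<^sub>R partial_deriv i \<phi> x)"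
    by (simp add: linear_sum[OF lin] linear_cmul[OF lin] partial_deriv_def)
  finally show ?thesis .
qed

lemma norm_frechet_derivative_le:
  fixes \<phi> :: "real^3 \<Rightarrow> complex"
  assumes "C1_on UNIV \<phi>"
  shows "norm (frechet_derivative \<phi> (at x) d) \<le> 3 * norm d * norm (cgrad \<phi> x)"
proof -
  have "norm (frechet_derivative \<phi> (at x) d) \<le> (\<Sum>i\<in>(UNIV :: 3 set). norm d * norm (cgrad \<phi> x))"
    unfolding frechet_derivative_eq_sum_partial[OF assms]
  proof (rule sum_norm_le)
    fix i :: 3
    have "norm (partial_deriv i \<phi> x) \<le> norm (cgrad \<phi> x)"
      using Finite_Cartesian_Product.norm_nth_le[of "cgrad \<phi> x" i] by (simp add: cgrad_def)
    moreover have "\<bar>d $ i\<bar> \<le> norm d"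
      using Finite_Cartesian_Product.norm_nth_le[of d i] by simp
    ultimately show "norm (d $ i *\<^sub>R partial_deriv i \<phi> x) \<le> norm d * norm (cgrad \<phi> x)"
      by (simp add: mult_mono)
  qed
  then show ?thesis by simp
qed

text \<open>The Riesz-Fischer argument: along a fast subsequence the increments are summable in L1,
  hence pointwise almost everywhere, and Fatou's lemma returns the L2 error of the limit. A
  subsequence suffices, since a trace is defined by some approximating sequence.\<close>

lemma L2_complete:
  fixes f :: "nat \<Rightarrow> 'a \<Rightarrow> complex"
  assumes M: "finite_measure M" and f: "\<And>n. L2_fun M (f n)"
    and cauchy: "\<And>e. e > 0 \<Longrightarrow> \<exists>N. \<forall>m\<ge>N. \<forall>n\<ge>N. (\<integral>\<^sup>+x. ennreal ((norm (f m x - f n x))\<^sup>2) \<partial>M) \<le> ennreal e"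
  obtains r g where "strict_mono r" "L2_fun M g" "L2_tendsto M (\<lambda>n. f (r n)) g"
proof -
  interpret finite_measure M by fact
  have fm [measurable]: "f n \<in> borel_measurable M" for n
    using f by (simp add: L2_fun_def)
  have "\<forall>k. \<exists>N. \<forall>m\<ge>N. \<forall>n\<ge>N. (\<integral>\<^sup>+x. ennreal ((norm (f m x - f n x))\<^sup>2) \<partial>M) \<le> ennreal ((1 / 4) ^ k)"
    using cauchy by simp
  then obtain N where N: "\<And>k m n. m \<ge> N k \<Longrightarrow> n \<ge> N k \<Longrightarrow>
      (\<integral>\<^sup>+x. ennreal ((norm (f m x - f n x))\<^sup>2) \<partial>M) \<le> ennreal ((1 / 4) ^ k)"
    by metis
  \<comment> \<open>The partial sum dominates every \<open>N i\<close> with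
    \<open>i \<le> k\<close>, and the summand \<open>k\<close> makes the indices strictly
    increasing.\<close>
  define r where "r k = (\<Sum>i\<le>k. N i) + k" for k
  have r: "strict_mono r"
    by (rule strict_mono_Suc_iff[THEN iffD2]) (simp add: r_def)
  have rN: "r j \<ge> N k" if "j \<ge> k" for j k
    unfolding r_def using member_le_sum[of k "{..j}" N] that by simp
  define h where "h k x = norm (f (r (Suc k)) x - f (r k) x)" for k x
  have hm [measurable]: "h k \<in> borel_measurable M" for k
    unfolding h_def[abs_def] by measurable
  have h1: "(\<integral>\<^sup>+x. ennreal (h k x) \<partial>M) \<le> ennreal ((1 / 2) ^ k * (measure M (space M) + 1))" for k
  proof -
    \<comment> \<open>The square of the increment has integral at most \<open>(1 / 4) ^ k\<close>;
      the weight \<open>2 ^ k\<close> balances it against the constant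
      \<open>(1 / 2) ^ k\<close>.\<close>
    have "(\<integral>\<^sup>+x. ennreal (h k x) \<partial>M) \<le> (\<integral>\<^sup>+x. ennreal ((1 / 2) ^ k) + ennreal (2 ^ k) * ennreal ((h k x)\<^sup>2) \<partial>M)"
    proof (rule nn_integral_mono)
      fix x
      have "2 * ((1 / 2) ^ k * h k x) \<le> ((1 / 2) ^ k)\<^sup>2 + (h k x)\<^sup>2"
        using sum_squares_bound[of "(1 / 2) ^ k" "h k x"] by (simp add: mult.assoc)
      then have "2 ^ k * (2 * ((1 / 2) ^ k * h k x)) \<le> 2 ^ k * (((1 / 2) ^ k)\<^sup>2 + (h k x)\<^sup>2)"
        by (rule mult_left_mono) simp
      moreover have "2 ^ k * (2 * ((1 / 2) ^ k * h k x)) = 2 * h k x"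
        by (simp add: power_divide)
      moreover have "2 ^ k * (((1 / 2) ^ k)\<^sup>2 + (h k x)\<^sup>2) = (1 / 2) ^ k + 2 ^ k * (h k x)\<^sup>2"
        by (simp add: power_divide power2_eq_square distrib_left)
      moreover have "0 \<le> h k x" by (simp add: h_def)
      ultimately have "h k x \<le> (1 / 2) ^ k + 2 ^ k * (h k x)\<^sup>2" by linarith
      then show "ennreal (h k x) \<le> ennreal ((1 / 2) ^ k) + ennreal (2 ^ k) * ennreal ((h k x)\<^sup>2)"
        by (simp flip: ennreal_plus ennreal_mult add: ennreal_leI)
    qed
    also have "\<dots> = ennreal ((1 / 2) ^ k) * emeasure M (space M) + ennreal (2 ^ k) * (\<integral>\<^sup>+x. ennreal ((h k x)\<^sup>2) \<partial>M)"
      by (simp add: nn_integral_add nn_integral_cmult)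
    also have "\<dots> \<le> ennreal ((1 / 2) ^ k) * ennreal (measure M (space M)) + ennreal (2 ^ k) * ennreal ((1 / 4) ^ k)"
      unfolding emeasure_eq_measure h_def
      by (intro add_left_mono mult_left_mono N rN) auto
    also have "\<dots> = ennreal ((1 / 2) ^ k * measure M (space M) + 2 ^ k * (1 / 4) ^ k)"
      by (simp flip: ennreal_plus ennreal_mult)
    also have "2 ^ k * (1 / 4) ^ k = (1 / 2 :: real) ^ k"
      by (simp flip: power_mult_distrib)
    finally show ?thesis by (simp add: distrib_left)
  qed
  have "(\<integral>\<^sup>+x. (\<Sum>k. ennreal (h k x)) \<partial>M) = (\<Sum>k. \<integral>\<^sup>+x. ennreal (h k x) \<partial>M)"
    by (rule nn_integral_suminf) measurable
  also have "\<dots> \<le> (\<Sum>k. ennreal ((1 / 2) ^ k * (measure M (space M) + 1)))"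
    by (intro suminf_le h1) auto
  also have "\<dots> = ennreal (\<Sum>k. (1 / 2) ^ k * (measure M (space M) + 1))"
    by (intro suminf_ennreal2 summable_mult2 summable_geometric) auto
  finally have "(\<integral>\<^sup>+x. (\<Sum>k. ennreal (h k x)) \<partial>M) < \<infinity>"
    by (rule le_less_trans) simp
  then have "AE x in M. (\<Sum>k. ennreal (h k x)) \<noteq> \<infinity>"
    by (intro nn_integral_noteq_infinite) auto
  then have conv: "AE x in M. convergent (\<lambda>k. f (r k) x)"
  proof eventually_elim
    case (elim x)
    have "summable (\<lambda>k. h k x)"
      by (rule summable_suminf_not_top) (use elim in \<open>auto simp: h_def\<close>)
    then have "summable (\<lambda>k. f (r (Suc k)) x - f (r k) x)"
      unfolding h_def by (rule summable_norm_cancel)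
    then have "convergent (\<lambda>n. \<Sum>k<n. f (r (Suc k)) x - f (r k) x)"
      by (simp add: summable_iff_convergent)
    then have "convergent (\<lambda>n. (\<Sum>k<n. f (r (Suc k)) x - f (r k) x) + f (r 0) x)"
      by (intro convergent_add convergent_const)
    then show ?case
      by (simp add: sum_lessThan_telescope[of "\<lambda>k. f (r k) x"])
  qed
  define g where "g x = lim (\<lambda>k. f (r k) x)" for x
  have gm [measurable]: "g \<in> borel_measurable M"
    unfolding g_def[abs_def] by (rule borel_measurable_lim_metric) measurable
  have err: "(\<integral>\<^sup>+x. ennreal ((norm (f (r k) x - g x))\<^sup>2) \<partial>M) \<le> ennreal ((1 / 4) ^ k)" for k
  proof -
    have "(\<integral>\<^sup>+x. ennreal ((norm (f (r k) x - g x))\<^sup>2) \<partial>M) =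
        (\<integral>\<^sup>+x. liminf (\<lambda>j. ennreal ((norm (f (r k) x - f (r j) x))\<^sup>2)) \<partial>M)"
    proof (rule nn_integral_cong_AE)
      show "AE x in M. ennreal ((norm (f (r k) x - g x))\<^sup>2) = liminf (\<lambda>j. ennreal ((norm (f (r k) x - f (r j) x))\<^sup>2))"
        using conv
      proof eventually_elim
        case (elim x)
        then have "(\<lambda>j. f (r j) x) \<longlonglongrightarrow> g x"
          by (simp add: g_def convergent_LIMSEQ_iff)
        then have "(\<lambda>j. ennreal ((norm (f (r k) x - f (r j) x))\<^sup>2)) \<longlonglongrightarrow> ennreal ((norm (f (r k) x - g x))\<^sup>2)"
          by (intro tendsto_intros)
        from lim_imp_Liminf[OF _ this] show ?case by simp
      qed
    qed
    also have "\<dots> \<le> liminf (\<lambda>j. \<integral>\<^sup>+x. ennreal ((norm (f (r k) x - f (r j) x))\<^sup>2) \<partial>M)"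
      by (rule nn_integral_liminf) measurable
    also have "\<dots> \<le> ennreal ((1 / 4) ^ k)"
    proof (rule Liminf_le)
      show "\<forall>\<^sub>F j in sequentially. (\<integral>\<^sup>+x. ennreal ((norm (f (r k) x - f (r j) x))\<^sup>2) \<partial>M) \<le> ennreal ((1 / 4) ^ k)"
        using eventually_ge_at_top[of k] by eventually_elim (intro N rN, auto)
    qed simp
    finally show ?thesis .
  qed
  have "L2_tendsto M (\<lambda>n. f (r n)) g"
    unfolding L2_tendsto_def
  proof (rule tendsto_sandwich[OF _ _ tendsto_const])
    have "(\<lambda>k. (1 / 4 :: real) ^ k) \<longlonglongrightarrow> 0"
      by (rule LIMSEQ_power_zero) simp
    then show "(\<lambda>k. ennreal ((1 / 4) ^ k)) \<longlonglongrightarrow> 0"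
      using tendsto_ennrealI by fastforce
  qed (use err in \<open>auto intro!: always_eventually\<close>)
  moreover have "L2_fun M g"
  proof -
    have "(\<integral>\<^sup>+x. ennreal ((norm (f (r 0) x - g x))\<^sup>2) \<partial>M) < \<infinity>"
      using err[of 0] by (auto intro: le_less_trans)
    then have "integrable M (\<lambda>x. (norm (f (r 0) x - g x))\<^sup>2)"
      by (intro integrableI_nonneg) auto
    then have "integrable M (\<lambda>x. (norm (f (r 0) x - (f (r 0) x - g x)))\<^sup>2)"
      using f[of "r 0"]
      by (intro integrable_norm_diff_square[of "f (r 0)" M "\<lambda>x. f (r 0) x - g x"]) (simp_all add: L2_fun_def)
    then show ?thesis by (simp add: L2_fun_def)
  qed
  ultimately show ?thesis using that r by blast
qed

lemma L2_tendsto_component: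
  fixes f :: "nat \<Rightarrow> 'a \<Rightarrow> 'b::euclidean_space^'n"
  assumes "L2_tendsto M f g"
  shows "L2_tendsto M (\<lambda>n x. f n x $ i) (\<lambda>x. g x $ i)"
  unfolding L2_tendsto_def
proof (rule tendsto_sandwich[OF _ _ tendsto_const assms[unfolded L2_tendsto_def]])
  show "\<forall>\<^sub>F n in sequentially. (\<integral>\<^sup>+x. ennreal ((norm (f n x $ i - g x $ i))\<^sup>2) \<partial>M) \<le> (\<integral>\<^sup>+x. ennreal ((norm (f n x - g x))\<^sup>2) \<partial>M)"
  proof (intro always_eventually allI nn_integral_mono ennreal_leI power_mono)
    show "norm (f n x $ i - g x $ i) \<le> norm (f n x - g x)" for n x
      using Finite_Cartesian_Product.norm_nth_le[of "f n x - g x" i] by simp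
  qed simp
qed simp

lemma L2_tendsto_subseq:
  assumes "L2_tendsto M f g" "strict_mono r"
  shows "L2_tendsto M (\<lambda>n. f (r n)) g"
  using LIMSEQ_subseq_LIMSEQ[OF assms(1)[unfolded L2_tendsto_def] assms(2)]
  by (simp add: L2_tendsto_def o_def)

lemma L2_tendsto_Cauchy:
  fixes f :: "nat \<Rightarrow> 'a \<Rightarrow> 'b::{banach, second_countable_topology}"
  assumes lim: "L2_tendsto M f g" and m: "\<And>n. f n \<in> borel_measurable M" "g \<in> borel_measurable M" and e: "e > 0"
  shows "\<exists>N. \<forall>m\<ge>N. \<forall>n\<ge>N. (\<integral>\<^sup>+x. ennreal ((norm (f m x - f n x))\<^sup>2) \<partial>M) \<le> ennreal e"
proof -
  note m[measurable]
  let ?E = "\<lambda>n. \<integral>\<^sup>+x. ennreal ((norm (f n x - g x))\<^sup>2) \<partial>M"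
  have "\<forall>\<^sub>F n in sequentially. ?E n < ennreal (e / 4)"
    using e by (intro order_tendstoD(2)[OF lim[unfolded L2_tendsto_def]]) simp
  then obtain N where N: "\<And>n. n \<ge> N \<Longrightarrow> ?E n < ennreal (e / 4)"
    unfolding eventually_sequentially by blast
  have "(\<integral>\<^sup>+x. ennreal ((norm (f m x - f n x))\<^sup>2) \<partial>M) \<le> ennreal e" if "m \<ge> N" "n \<ge> N" for m n
  proof -
    have "(\<integral>\<^sup>+x. ennreal ((norm (f m x - f n x))\<^sup>2) \<partial>M) \<le>
      (\<integral>\<^sup>+x. 2 * (ennreal ((norm (f m x - g x))\<^sup>2) + ennreal ((norm (f n x - g x))\<^sup>2)) \<partial>M)"
    proof (rule nn_integral_mono)
      fix x
      have "(norm (f m x - f n x))\<^sup>2 \<le> 2 * ((norm (f m x - g x))\<^sup>2 + (norm (f n x - g x))\<^sup>2)"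
        using norm_diff_square_le[of "f m x - g x" "f n x - g x"] by simp
      then have "ennreal ((norm (f m x - f n x))\<^sup>2) \<le> ennreal (2 * ((norm (f m x - g x))\<^sup>2 + (norm (f n x - g x))\<^sup>2))"
        by (rule ennreal_leI)
      then show "ennreal ((norm (f m x - f n x))\<^sup>2) \<le> 2 * (ennreal ((norm (f m x - g x))\<^sup>2) + ennreal ((norm (f n x - g x))\<^sup>2))"
        by (simp add: ennreal_mult)
    qed
    also have "\<dots> = 2 * (?E m + ?E n)"
      by (simp add: nn_integral_cmult nn_integral_add)
    also have "\<dots> \<le> 2 * (ennreal (e / 4) + ennreal (e / 4))"
      using N[OF that(1)] N[OF that(2)] by (intro mult_left_mono add_mono) auto
    also have "\<dots> = ennreal e"
    proof -
      have "2 * (ennreal (e / 4) + ennreal (e / 4)) = ennreal 2 * ennreal (e / 4 + e / 4)"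
        using e by (simp add: ennreal_plus[symmetric] del: ennreal_plus)
      also have "\<dots> = ennreal e"
        using e by (subst ennreal_mult[symmetric]) auto
      finally show ?thesis .
    qed
    finally show ?thesis .
  qed
  then show ?thesis by blast
qed

section \<open>The trace inequality and the existence of traces\<close>

context C2_domain
begin

lemma finite_measure_\<Omega>: "finite_measure (lebesgue_on \<Omega>)"
proof
  show "emeasure (lebesgue_on \<Omega>) (space (lebesgue_on \<Omega>)) \<noteq> \<infinity>"
    using borel_\<Omega> emeasure_bounded_finite[OF bounded_\<Omega>]
    by (simp add: space_restrict_space emeasure_restrict_space)
qed

text \<open>The constant must be the same for all \<phi>. Writing the square of the modulus as
  \<open>\<phi> x * cnj (\<phi> x)\<close> keeps it a complex C1 function to which the divergence
  theorem applies.\<close>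

lemma divergence_energy_bound:
  assumes \<psi>: "C1_on UNIV \<psi>"
  shows "\<exists>K\<ge>0. \<forall>\<phi>. C1_on UNIV \<phi> \<longrightarrow>
    (\<forall>x\<in>\<Omega>. norm (frechet_derivative (\<lambda>x. complex_of_real (\<psi> x) * (\<phi> x * cnj (\<phi> x))) (at x) d) \<le>
      K * ((norm (\<phi> x))\<^sup>2 + (norm (cgrad \<phi> x))\<^sup>2))"
proof -
  have "bounded (\<psi> ` closure \<Omega>)" "bounded ((\<lambda>x. frechet_derivative \<psi> (at x) d) ` closure \<Omega>)"
    using C1_on_continuous[OF \<psi>] C1_on_continuous_derivative[OF \<psi>]
    by (auto intro!: compact_imp_bounded compact_continuous_image compact_closure_\<Omega> intro: continuous_on_subset)
  then obtain B1 B2 where B12: "\<forall>x\<in>closure \<Omega>. \<bar>\<psi> x\<bar> \<le> B1" "\<forall>x\<in>closure \<Omega>. \<bar>frechet_derivative \<psi> (at x) d\<bar> \<le> B2"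
    unfolding bounded_iff by auto
  define B where "B = \<bar>B1\<bar> + \<bar>B2\<bar>"
  have B: "B \<ge> 0" "\<And>x. x \<in> \<Omega> \<Longrightarrow> \<bar>\<psi> x\<bar> \<le> B" "\<And>x. x \<in> \<Omega> \<Longrightarrow> \<bar>frechet_derivative \<psi> (at x) d\<bar> \<le> B"
    using B12 closure_subset[of \<Omega>] by (fastforce simp: B_def)+
  \<comment> \<open>One \<open>B\<close> comes from the derivative of \<psi>, the other from that of
    the square of the modulus; 9 is the square of the factor 3 in
    \<open>norm_frechet_derivative_le\<close>.\<close>
  define K where "K = 2 * B + 9 * B * (norm d)\<^sup>2"
  show ?thesis
  proof (intro exI[of _ K] conjI allI impI ballI)
    show "K \<ge> 0" using B(1) by (simp add: K_def)
    fix \<phi> :: "real^3 \<Rightarrow> complex" and x assume \<phi>: "C1_on UNIV \<phi>" and x: "x \<in> \<Omega>"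
    let ?D = "frechet_derivative \<phi> (at x) d" and ?p = "norm (\<phi> x)" and ?g = "norm (cgrad \<phi> x)"
    have dc: "((\<lambda>x. cnj (\<phi> x)) has_derivative (\<lambda>h. cnj (frechet_derivative \<phi> (at x) h))) (at x)"
      by (rule bounded_linear.has_derivative[OF bounded_linear_cnj C1_on_has_derivative[OF \<phi> UNIV_I]])
    have dr: "((\<lambda>x. complex_of_real (\<psi> x)) has_derivative (\<lambda>h. complex_of_real (frechet_derivative \<psi> (at x) h))) (at x)"
      by (rule bounded_linear.has_derivative[OF bounded_linear_of_real C1_on_has_derivative[OF \<psi> UNIV_I]])
    have eq: "frechet_derivative (\<lambda>x. complex_of_real (\<psi> x) * (\<phi> x * cnj (\<phi> x))) (at x) d =
        complex_of_real (\<psi> x) * (\<phi> x * cnj ?D + ?D * cnj (\<phi> x)) +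
        complex_of_real (frechet_derivative \<psi> (at x) d) * (\<phi> x * cnj (\<phi> x))"
      using fun_cong[OF frechet_derivative_at[OF has_derivative_mult[OF dr has_derivative_mult[OF C1_on_has_derivative[OF \<phi> UNIV_I] dc]]], of d]
      by simp
    have "norm (\<phi> x * cnj ?D + ?D * cnj (\<phi> x)) \<le> 2 * (?p * norm ?D)"
      using norm_triangle_ineq[of "\<phi> x * cnj ?D" "?D * cnj (\<phi> x)"] by (simp add: norm_mult mult.commute)
    also have "\<dots> \<le> ?p\<^sup>2 + (norm ?D)\<^sup>2"
      using sum_squares_bound[of ?p "norm ?D"] by (simp add: mult.assoc)
    also have "(norm ?D)\<^sup>2 \<le> (3 * norm d * ?g)\<^sup>2"
      by (intro power_mono norm_frechet_derivative_le[OF \<phi>] norm_ge_zero)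
    finally have 1: "norm (\<phi> x * cnj ?D + ?D * cnj (\<phi> x)) \<le> ?p\<^sup>2 + 9 * (norm d)\<^sup>2 * ?g\<^sup>2"
      by (simp add: power_mult_distrib)
    have "norm (frechet_derivative (\<lambda>x. complex_of_real (\<psi> x) * (\<phi> x * cnj (\<phi> x))) (at x) d) \<le>
        \<bar>\<psi> x\<bar> * norm (\<phi> x * cnj ?D + ?D * cnj (\<phi> x)) + \<bar>frechet_derivative \<psi> (at x) d\<bar> * ?p\<^sup>2"
      unfolding eq by (rule order_trans[OF norm_triangle_ineq]) (simp add: norm_mult power2_eq_square)
    also have "\<dots> \<le> B * (?p\<^sup>2 + 9 * (norm d)\<^sup>2 * ?g\<^sup>2) + B * ?p\<^sup>2"
      using 1 B x by (intro add_mono mult_mono) auto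
    also have "\<dots> = 2 * B * ?p\<^sup>2 + 9 * B * (norm d)\<^sup>2 * ?g\<^sup>2"
      by (simp add: algebra_simps)
    also have "\<dots> \<le> K * ?p\<^sup>2 + K * ?g\<^sup>2"
      using B(1) by (intro add_mono mult_right_mono) (auto simp: K_def)
    finally show "norm (frechet_derivative (\<lambda>x. complex_of_real (\<psi> x) * (\<phi> x * cnj (\<phi> x))) (at x) d) \<le> K * (?p\<^sup>2 + ?g\<^sup>2)"
      by (simp add: distrib_left)
  qed
qed

text \<open>Apply the divergence theorem to \<open>\<psi> |\<phi>|\<^sup>2 d\<close> for each cutoff \<open>\<psi>\<close> and its transversal direction \<open>d\<close>.
  The sum of the boundary integrands dominates a positive multiple of \<open>|\<phi>|\<^sup>2\<close> by compactness.\<close>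

lemma trace_inequality_real:
  "\<exists>K\<ge>0. \<forall>\<phi>. C1_on UNIV \<phi> \<longrightarrow> (\<integral>x. (norm (\<phi> x))\<^sup>2 \<partial>\<sigma>) \<le>
    K * (\<integral>x. indicator \<Omega> x *\<^sub>R ((norm (\<phi> x))\<^sup>2 + (norm (cgrad \<phi> x))\<^sup>2) \<partial>lborel)"
proof -
  obtain C \<psi> where C: "finite C" and \<psi>: "\<And>c. C1_on UNIV (\<psi> c)" "\<And>c. c \<in> C \<Longrightarrow> divergence_cutoff (\<psi> c)"
    and \<psi>0: "\<And>c x. 0 \<le> \<psi> c x" and \<psi>1: "\<And>x. x \<in> closure \<Omega> \<Longrightarrow> (\<Sum>c\<in>C. \<psi> (c :: real^3) x) = 1"
    using partition_exists by blast
  have "\<forall>c\<in>C. \<exists>d. \<forall>x\<in>frontier \<Omega>. \<psi> c x > 0 \<longrightarrow> d \<bullet> \<nu> x > 0"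
    using \<psi>(2) unfolding divergence_cutoff_def by blast
  from bchoice[OF this] obtain d where d: "\<And>c x. c \<in> C \<Longrightarrow> x \<in> frontier \<Omega> \<Longrightarrow> \<psi> c x > 0 \<Longrightarrow> d c \<bullet> \<nu> x > 0"
    by blast
  have "\<forall>c. \<exists>K\<ge>0. \<forall>\<phi>. C1_on UNIV \<phi> \<longrightarrow>
    (\<forall>x\<in>\<Omega>. norm (frechet_derivative (\<lambda>x. complex_of_real (\<psi> c x) * (\<phi> x * cnj (\<phi> x))) (at x) (d c)) \<le>
      K * ((norm (\<phi> x))\<^sup>2 + (norm (cgrad \<phi> x))\<^sup>2))"
    by (intro allI divergence_energy_bound \<psi>(1))
  from choice[OF this] obtain K where K: "\<And>c. K c \<ge> 0"
    "\<And>c \<phi> x. C1_on UNIV \<phi> \<Longrightarrow> x \<in> \<Omega> \<Longrightarrow>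
      norm (frechet_derivative (\<lambda>x. complex_of_real (\<psi> c x) * (\<phi> x * cnj (\<phi> x))) (at x) (d c)) \<le>
      K c * ((norm (\<phi> x))\<^sup>2 + (norm (cgrad \<phi> x))\<^sup>2)"
    by blast
  \<comment> \<open>The combined flux of the directions \<open>d c\<close> through the boundary. No
    summand is negative there, and at each boundary point some cutoff is positive, so
    \<open>N\<close> is positive on the boundary.\<close>
  define N where "N x = (\<Sum>c\<in>C. \<psi> c x * (d c \<bullet> \<nu> x))" for x
  have Npos: "N x > 0" if x: "x \<in> frontier \<Omega>" for x
  proof -
    have nn: "0 \<le> \<psi> c x * (d c \<bullet> \<nu> x)" if "c \<in> C" for c
      using d[OF that x] \<psi>0[of c x] by (cases "\<psi> c x = 0") (auto simp: less_le)
    have "x \<in> closure \<Omega>" using x by (simp add: frontier_def)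
    from \<psi>1[OF this] have "\<exists>c\<in>C. \<psi> c x \<noteq> 0"
      by (metis sum.neutral zero_neq_one)
    then obtain c where "c \<in> C" "\<psi> c x > 0" using \<psi>0[of _ x] by (auto simp: less_le)
    with d[OF this(1) x this(2)] nn C show ?thesis
      unfolding N_def by (intro sum_pos2[where i=c]) auto
  qed
  have Nc: "continuous_on (frontier \<Omega>) N"
    unfolding N_def[abs_def]
    by (intro continuous_intros continuous_outward_normal continuous_on_subset[OF C1_on_continuous[OF \<psi>(1)]]) auto
  obtain m where m: "m > 0" "\<And>x. x \<in> frontier \<Omega> \<Longrightarrow> m \<le> N x"
  proof (cases "frontier \<Omega> = {}")
    case False
    from continuous_attains_inf[OF compact_frontier_\<Omega> False Nc]
    obtain x0 where "x0 \<in> frontier \<Omega>" "\<And>x. x \<in> frontier \<Omega> \<Longrightarrow> N x0 \<le> N x"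
      by blast
    with Npos that[of "N x0"] show ?thesis by auto
  qed (use that[of 1] in auto)
  show ?thesis
  proof (intro exI[of _ "(\<Sum>c\<in>C. K c) / m"] conjI allI impI)
    show "(\<Sum>c\<in>C. K c) / m \<ge> 0" using m K(1) by (simp add: sum_nonneg)
    fix \<phi> :: "real^3 \<Rightarrow> complex" assume \<phi>: "C1_on UNIV \<phi>"
    let ?e = "\<lambda>x. (norm (\<phi> x))\<^sup>2 + (norm (cgrad \<phi> x))\<^sup>2"
    define E where "E = (\<integral>x. indicator \<Omega> x *\<^sub>R ?e x \<partial>lborel)"
    have ec: "continuous_on UNIV ?e"
      by (intro continuous_intros C1_on_continuous[OF \<phi>] cgrad_continuous[OF \<phi>])
    define f where "f x = \<phi> x * cnj (\<phi> x)" for x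
    have f: "C1_on UNIV f"
      unfolding f_def[abs_def] by (intro C1_on_mult \<phi> C1_on_linear_compose[OF bounded_linear_cnj])
    define F where "F c x = complex_of_real (\<psi> c x) * f x" for c x
    have F: "C1_on UNIV (F c)" for c
      unfolding F_def[abs_def] by (rule C1_on_mult[OF C1_on_of_real[OF \<psi>(1)] f])
    let ?A = "\<lambda>c. LINT x:frontier \<Omega>|\<sigma>. (d c \<bullet> \<nu> x) *\<^sub>R F c x"
    have Abound: "norm (?A c) \<le> K c * E" for c
    proof -
      have "?A c = (\<integral>x. indicator \<Omega> x *\<^sub>R frechet_derivative (F c) (at x) (d c) \<partial>lborel)"
        by (rule divergence_theorem[OF F, symmetric])
      also have "norm \<dots> \<le> (\<integral>x. norm (indicator \<Omega> x *\<^sub>R frechet_derivative (F c) (at x) (d c)) \<partial>lborel)"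
        by (rule integral_norm_bound)
      also have "\<dots> \<le> (\<integral>x. K c * (indicator \<Omega> x *\<^sub>R ?e x) \<partial>lborel)"
      proof (rule integral_mono)
        show "integrable lborel (\<lambda>x. norm (indicator \<Omega> x *\<^sub>R frechet_derivative (F c) (at x) (d c)))"
          by (rule integrable_norm[OF integrable_on_\<Omega>[OF C1_on_continuous_derivative[OF F]]])
        show "integrable lborel (\<lambda>x. K c * (indicator \<Omega> x *\<^sub>R ?e x))"
          using integrable_on_\<Omega>[OF ec] by simp
        show "norm (indicator \<Omega> x *\<^sub>R frechet_derivative (F c) (at x) (d c)) \<le> K c * (indicator \<Omega> x *\<^sub>R ?e x)" for x
          using K(2)[OF \<phi>, of x c] by (cases "x \<in> \<Omega>") (simp_all add: F_def[abs_def] f_def)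
      qed
      also have "\<dots> = K c * E" by (simp add: E_def)
      finally show ?thesis .
    qed
    have fn: "f x = complex_of_real ((norm (\<phi> x))\<^sup>2)" for x
      by (simp only: f_def complex_norm_square)
    have sumA: "(\<Sum>c\<in>C. ?A c) = (\<integral>x. complex_of_real (indicator (frontier \<Omega>) x * (N x * (norm (\<phi> x))\<^sup>2)) \<partial>\<sigma>)"
    proof -
      have "(\<Sum>c\<in>C. ?A c) = (\<integral>x. (\<Sum>c\<in>C. indicator (frontier \<Omega>) x *\<^sub>R ((d c \<bullet> \<nu> x) *\<^sub>R F c x)) \<partial>\<sigma>)"
        unfolding set_lebesgue_integral_def
        by (rule Bochner_Integration.integral_sum[symmetric])
          (use set_integrable_\<sigma>[OF C1_on_continuous[OF F]] in \<open>simp add: set_integrable_def\<close>)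
      also have "\<dots> = (\<integral>x. complex_of_real (indicator (frontier \<Omega>) x * (N x * (norm (\<phi> x))\<^sup>2)) \<partial>\<sigma>)"
        by (intro Bochner_Integration.integral_cong refl)
          (simp add: N_def F_def fn sum_distrib_left sum_distrib_right scaleR_conv_of_real ac_simps)
      finally show ?thesis .
    qed
    have Nint: "integrable \<sigma> (\<lambda>x. indicator (frontier \<Omega>) x * (N x * (norm (\<phi> x))\<^sup>2))"
    proof -
      have "integrable \<sigma> (\<lambda>x. Re (\<Sum>c\<in>C. indicator (frontier \<Omega>) x *\<^sub>R ((d c \<bullet> \<nu> x) *\<^sub>R F c x)))"
        using set_integrable_\<sigma>[OF C1_on_continuous[OF F]]
        by (intro integrable_Re Bochner_Integration.integrable_sum) (simp add: set_integrable_def)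
      moreover have "Re (\<Sum>c\<in>C. indicator (frontier \<Omega>) x *\<^sub>R ((d c \<bullet> \<nu> x) *\<^sub>R F c x)) =
          indicator (frontier \<Omega>) x * (N x * (norm (\<phi> x))\<^sup>2)" for x
        by (simp add: N_def F_def fn sum_distrib_left sum_distrib_right ac_simps)
      ultimately show ?thesis by simp
    qed
    have \<phi>int: "integrable \<sigma> (\<lambda>x. (norm (\<phi> x))\<^sup>2)"
      using integrable_Re[OF integrable_\<sigma>[OF C1_on_continuous[OF f]]] by (simp add: fn)
    have "m * (\<integral>x. (norm (\<phi> x))\<^sup>2 \<partial>\<sigma>) = (\<integral>x. m * (norm (\<phi> x))\<^sup>2 \<partial>\<sigma>)"
      by simp
    also have "\<dots> \<le> (\<integral>x. indicator (frontier \<Omega>) x * (N x * (norm (\<phi> x))\<^sup>2) \<partial>\<sigma>)"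
    proof (rule integral_mono_AE[OF _ Nint])
      show "AE x in \<sigma>. m * (norm (\<phi> x))\<^sup>2 \<le> indicator (frontier \<Omega>) x * (N x * (norm (\<phi> x))\<^sup>2)"
        using AE_frontier by eventually_elim (simp add: m mult_right_mono)
    qed (use \<phi>int in simp)
    also have "\<dots> \<le> norm (\<Sum>c\<in>C. ?A c)"
      unfolding sumA integral_complex_of_real by simp
    also have "\<dots> \<le> (\<Sum>c\<in>C. K c * E)"
      by (rule sum_norm_le) (rule Abound)
    also have "\<dots> = (\<Sum>c\<in>C. K c) * E"
      by (rule sum_distrib_right[symmetric])
    finally have "m * (\<integral>x. (norm (\<phi> x))\<^sup>2 \<partial>\<sigma>) \<le> (\<Sum>c\<in>C. K c) * E" .
    then show "(\<integral>x. (norm (\<phi> x))\<^sup>2 \<partial>\<sigma>) \<le> (\<Sum>c\<in>C. K c) / m * (\<integral>x. indicator \<Omega> x *\<^sub>R ?e x \<partial>lborel)"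
      using m(1) unfolding E_def[symmetric] by (simp add: field_simps)
  qed
qed

end

lemma cgrad_diff:
  assumes "C1_on UNIV f" "C1_on UNIV g"
  shows "cgrad (\<lambda>x. f x - g x) x = cgrad f x - cgrad g x"
proof -
  have "((\<lambda>x. f x - g x) has_derivative (\<lambda>h. frechet_derivative f (at x) h - frechet_derivative g (at x) h)) (at x)"
    by (rule has_derivative_diff[OF C1_on_has_derivative[OF assms(1) UNIV_I] C1_on_has_derivative[OF assms(2) UNIV_I]])
  from fun_cong[OF frechet_derivative_at[OF this]] show ?thesis
    by (simp add: cgrad_def partial_deriv_def vec_eq_iff)
qed

context C2_domain
begin

text \<open>In this form the estimate matches the nonnegative integrals in \<open>L2_tendsto\<close>
  and can be applied to differences of approximants.\<close>

lemma trace_inequality: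
  obtains K where "K \<ge> 0" "\<And>\<phi>. C1_on UNIV \<phi> \<Longrightarrow> (\<integral>\<^sup>+x. ennreal ((norm (\<phi> x))\<^sup>2) \<partial>\<sigma>) \<le>
    ennreal K * ((\<integral>\<^sup>+x. ennreal ((norm (\<phi> x))\<^sup>2) \<partial>lebesgue_on \<Omega>) + (\<integral>\<^sup>+x. ennreal ((norm (cgrad \<phi> x))\<^sup>2) \<partial>lebesgue_on \<Omega>))"
proof -
  obtain K where K: "K \<ge> 0" "\<And>\<phi>. C1_on UNIV \<phi> \<Longrightarrow> (\<integral>x. (norm (\<phi> x))\<^sup>2 \<partial>\<sigma>) \<le>
    K * (\<integral>x. indicator \<Omega> x *\<^sub>R ((norm (\<phi> x))\<^sup>2 + (norm (cgrad \<phi> x))\<^sup>2) \<partial>lborel)"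
    using trace_inequality_real by blast
  show ?thesis
  proof (rule that[OF K(1)])
    fix \<phi> :: "real^3 \<Rightarrow> complex" assume \<phi>: "C1_on UNIV \<phi>"
    note c = C1_on_continuous[OF \<phi>] cgrad_continuous[OF \<phi>]
    have "integrable \<sigma> (\<lambda>x. complex_of_real ((norm (\<phi> x))\<^sup>2))"
      by (intro integrable_\<sigma> continuous_intros c)
    then have "integrable \<sigma> (\<lambda>x. (norm (\<phi> x))\<^sup>2)"
      using integrable_Re by fastforce
    then have "(\<integral>\<^sup>+x. ennreal ((norm (\<phi> x))\<^sup>2) \<partial>\<sigma>) = ennreal (\<integral>x. (norm (\<phi> x))\<^sup>2 \<partial>\<sigma>)"
      by (intro nn_integral_eq_integral) auto
    also have "\<dots> \<le> ennreal (K * (\<integral>x. indicator \<Omega> x *\<^sub>R ((norm (\<phi> x))\<^sup>2 + (norm (cgrad \<phi> x))\<^sup>2) \<partial>lborel))"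
      by (rule ennreal_leI[OF K(2)[OF \<phi>]])
    also have "\<dots> = ennreal K * ennreal (\<integral>x. indicator \<Omega> x *\<^sub>R ((norm (\<phi> x))\<^sup>2 + (norm (cgrad \<phi> x))\<^sup>2) \<partial>lborel)"
      using K(1) by (rule ennreal_mult') 
    also have "ennreal (\<integral>x. indicator \<Omega> x *\<^sub>R ((norm (\<phi> x))\<^sup>2 + (norm (cgrad \<phi> x))\<^sup>2) \<partial>lborel) =
        (\<integral>\<^sup>+x. ennreal (indicator \<Omega> x *\<^sub>R ((norm (\<phi> x))\<^sup>2 + (norm (cgrad \<phi> x))\<^sup>2)) \<partial>lborel)"
      by (intro nn_integral_eq_integral[symmetric] integrable_on_\<Omega> continuous_intros c) auto
    also have "\<dots> = (\<integral>\<^sup>+x. (ennreal ((norm (\<phi> x))\<^sup>2) + ennreal ((norm (cgrad \<phi> x))\<^sup>2)) * indicator \<Omega> x \<partial>lborel)"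
      by (intro nn_integral_cong) (simp add: indicator_def ennreal_plus)
    also have "\<dots> = (\<integral>\<^sup>+x. ennreal ((norm (\<phi> x))\<^sup>2) + ennreal ((norm (cgrad \<phi> x))\<^sup>2) \<partial>lebesgue_on \<Omega>)"
      by (rule nn_integral_lebesgue_on_eq_lborel[OF borel_\<Omega>, symmetric])
    also have "\<dots> = (\<integral>\<^sup>+x. ennreal ((norm (\<phi> x))\<^sup>2) \<partial>lebesgue_on \<Omega>) + (\<integral>\<^sup>+x. ennreal ((norm (cgrad \<phi> x))\<^sup>2) \<partial>lebesgue_on \<Omega>)"
      by (rule nn_integral_add)
        (auto intro!: measurable_compose[OF _ measurable_ennreal] borel_measurable_lebesgue_on borel_measurable_continuous_onI continuous_intros c)
    finally show "(\<integral>\<^sup>+x. ennreal ((norm (\<phi> x))\<^sup>2) \<partial>\<sigma>) \<le>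
      ennreal K * ((\<integral>\<^sup>+x. ennreal ((norm (\<phi> x))\<^sup>2) \<partial>lebesgue_on \<Omega>) + (\<integral>\<^sup>+x. ennreal ((norm (cgrad \<phi> x))\<^sup>2) \<partial>lebesgue_on \<Omega>))" .
  qed
qed

lemma L2_fun_\<sigma>:
  fixes \<phi> :: "real^3 \<Rightarrow> complex"
  assumes "continuous_on UNIV \<phi>"
  shows "L2_fun \<sigma> \<phi>"
proof -
  have "integrable \<sigma> (\<lambda>x. complex_of_real ((norm (\<phi> x))\<^sup>2))"
    by (intro integrable_\<sigma> continuous_intros assms)
  then have "integrable \<sigma> (\<lambda>x. (norm (\<phi> x))\<^sup>2)"
    using integrable_Re by fastforce
  then show ?thesis
    unfolding L2_fun_def borel_measurable_surface_measure
    using borel_measurable_continuous_onI[OF assms] by blast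
qed

text \<open>Applied to differences, the trace inequality turns convergence of the approximants and
  their gradients into a Cauchy condition in L2 of the boundary; completeness then yields the
  trace.\<close>

lemma trace_exists:
  assumes u: "u \<in> H1 \<Omega>"
  shows "\<exists>g. is_trace \<Omega> u g"
proof -
  have u2: "L2_fun (lebesgue_on \<Omega>) u" using u by (simp add: H1_def)
  note G = L2_weak_grad[OF u] has_weak_gradient_weak_grad[OF u]
  obtain \<phi> where \<phi>: "\<And>n. C1_on UNIV (\<phi> n)" "L2_tendsto (lebesgue_on \<Omega>) \<phi> u"
    "L2_tendsto (lebesgue_on \<Omega>) (\<lambda>n. cgrad (\<phi> n)) (weak_grad \<Omega> u)"
    using C1_dense_in_H1[OF open_\<Omega> bounded_\<Omega> inner_cone_closure u2 G] by blast
  note c = C1_on_continuous[OF \<phi>(1)] cgrad_continuous[OF \<phi>(1)]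
  have m: "\<phi> n \<in> borel_measurable (lebesgue_on \<Omega>)" "cgrad (\<phi> n) \<in> borel_measurable (lebesgue_on \<Omega>)" for n
    by (intro borel_measurable_lebesgue_on borel_measurable_continuous_onI c)+
  have um: "u \<in> borel_measurable (lebesgue_on \<Omega>)" "weak_grad \<Omega> u \<in> borel_measurable (lebesgue_on \<Omega>)"
    using u2 G by (simp_all add: L2_fun_def)
  obtain K where K: "K \<ge> 0" "\<And>\<phi>. C1_on UNIV \<phi> \<Longrightarrow> (\<integral>\<^sup>+x. ennreal ((norm (\<phi> x))\<^sup>2) \<partial>\<sigma>) \<le>
    ennreal K * ((\<integral>\<^sup>+x. ennreal ((norm (\<phi> x))\<^sup>2) \<partial>lebesgue_on \<Omega>) + (\<integral>\<^sup>+x. ennreal ((norm (cgrad \<phi> x))\<^sup>2) \<partial>lebesgue_on \<Omega>))"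
    using trace_inequality by blast
  obtain r g where rg: "strict_mono r" "L2_fun \<sigma> g" "L2_tendsto \<sigma> (\<lambda>n. \<phi> (r n)) g"
  proof (rule L2_complete[OF finite_measure_\<sigma> L2_fun_\<sigma>[OF c(1)]])
    fix e :: real assume e: "e > 0"
    \<comment> \<open>\<open>K + 1\<close> covers the case \<open>K = 0\<close>; the factor 2
      accounts for the two terms, function and gradient.\<close>
    define e' where "e' = e / (2 * (K + 1))"
    have e': "e' > 0" "K * (e' + e') \<le> e"
    proof -
      show "e' > 0" using e K(1) by (simp add: e'_def)
      have "K * (e' + e') \<le> (K + 1) * (e' + e')"
        using \<open>e' > 0\<close> by (intro mult_right_mono) auto
      also have "\<dots> = e' * (2 * (K + 1))" by (simp add: algebra_simps)
      also have "\<dots> = e" using K(1) by (simp add: e'_def)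
      finally show "K * (e' + e') \<le> e" .
    qed
    obtain N1 where N1: "\<And>m n. m \<ge> N1 \<Longrightarrow> n \<ge> N1 \<Longrightarrow> (\<integral>\<^sup>+x. ennreal ((norm (\<phi> m x - \<phi> n x))\<^sup>2) \<partial>lebesgue_on \<Omega>) \<le> ennreal e'"
      using L2_tendsto_Cauchy[OF \<phi>(2) m(1) um(1) e'(1)] by blast
    obtain N2 where N2: "\<And>m n. m \<ge> N2 \<Longrightarrow> n \<ge> N2 \<Longrightarrow> (\<integral>\<^sup>+x. ennreal ((norm (cgrad (\<phi> m) x - cgrad (\<phi> n) x))\<^sup>2) \<partial>lebesgue_on \<Omega>) \<le> ennreal e'"
      using L2_tendsto_Cauchy[OF \<phi>(3) m(2) um(2) e'(1)] by blast
    have "(\<integral>\<^sup>+x. ennreal ((norm (\<phi> m x - \<phi> n x))\<^sup>2) \<partial>\<sigma>) \<le> ennreal e" if "m \<ge> max N1 N2" "n \<ge> max N1 N2" for m n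
    proof -
      have "(\<integral>\<^sup>+x. ennreal ((norm (\<phi> m x - \<phi> n x))\<^sup>2) \<partial>\<sigma>) \<le>
        ennreal K * ((\<integral>\<^sup>+x. ennreal ((norm (\<phi> m x - \<phi> n x))\<^sup>2) \<partial>lebesgue_on \<Omega>) +
          (\<integral>\<^sup>+x. ennreal ((norm (cgrad (\<phi> m) x - cgrad (\<phi> n) x))\<^sup>2) \<partial>lebesgue_on \<Omega>))"
        using K(2)[OF C1_on_diff[OF \<phi>(1)[of m] \<phi>(1)[of n]]] by (simp add: cgrad_diff[OF \<phi>(1) \<phi>(1)])
      also have "\<dots> \<le> ennreal K * (ennreal e' + ennreal e')"
        using that by (intro mult_left_mono add_mono N1 N2) auto
      also have "\<dots> = ennreal K * ennreal (e' + e')"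
        using e'(1) by (subst ennreal_plus) auto
      also have "\<dots> = ennreal (K * (e' + e'))"
        using e'(1) K(1) by (subst ennreal_mult) auto
      also have "\<dots> \<le> ennreal e" by (rule ennreal_leI[OF e'(2)])
      finally show ?thesis .
    qed
    then show "\<exists>N. \<forall>m\<ge>N. \<forall>n\<ge>N. (\<integral>\<^sup>+x. ennreal ((norm (\<phi> m x - \<phi> n x))\<^sup>2) \<partial>\<sigma>) \<le> ennreal e"
      by (intro exI[of _ "max N1 N2"] allI impI)
  next
    fix r g assume "strict_mono r" "L2_fun \<sigma> g" "L2_tendsto \<sigma> (\<lambda>n. \<phi> (r n)) g"
    then show thesis by (rule that)
  qed
  have "is_trace \<Omega> u g"
    unfolding is_trace_def
    by (intro conjI exI[of _ "\<lambda>n. \<phi> (r n)"] allI rg(2,3) \<phi>(1) L2_tendsto_subseq[OF \<phi>(2) rg(1)]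
        L2_tendsto_subseq[OF \<phi>(3) rg(1)])
  then show ?thesis by blast
qed

lemma is_trace_boundary_trace: "u \<in> H1 \<Omega> \<Longrightarrow> is_trace \<Omega> u (boundary_trace \<Omega> u)"
  unfolding boundary_trace_def by (rule someI_ex[OF trace_exists])

text \<open>The divergence theorem for the field with components
  \<open>\<phi> x * partial_deriv i w x\<close>. The equation for \<open>w\<close> replaces its
  Laplacian, so \<phi> appears with first derivatives only and the formula can pass to limits in
  H1.\<close>

lemma Green_C1:
  assumes \<phi>: "C1_on UNIV \<phi>" and w: "C1_on UNIV w" "\<And>i. C1_on UNIV (partial_deriv i w)"
    and helmholtz: "\<And>x. (\<Sum>i\<in>UNIV. partial_deriv i (partial_deriv i w) x) = - (complex_of_real k)\<^sup>2 * w x"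
  shows "(LINT x|lebesgue_on \<Omega>. (\<Sum>i\<in>UNIV. cgrad \<phi> x $ i * partial_deriv i w x) + \<phi> x * (- (complex_of_real k)\<^sup>2 * w x)) =
    (\<integral>x. \<phi> x * (indicator (frontier \<Omega>) x *\<^sub>R normal_deriv \<Omega> w x) \<partial>\<sigma>)"
proof -
  let ?f = "\<lambda>i x. \<phi> x * partial_deriv i w x"
  have f: "C1_on UNIV (?f i)" for i
    by (rule C1_on_mult[OF \<phi> w(2)])
  have c: "continuous_on UNIV (\<lambda>x. (\<Sum>i\<in>UNIV. cgrad \<phi> x $ i * partial_deriv i w x) + \<phi> x * (- (complex_of_real k)\<^sup>2 * w x))"
    by (intro continuous_intros cgrad_continuous[OF \<phi>] partial_deriv_continuous[OF w(1)] C1_on_continuous[OF \<phi>] C1_on_continuous[OF w(1)])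
  have "(LINT x|lebesgue_on \<Omega>. (\<Sum>i\<in>UNIV. cgrad \<phi> x $ i * partial_deriv i w x) + \<phi> x * (- (complex_of_real k)\<^sup>2 * w x)) =
      (\<integral>x. indicator \<Omega> x *\<^sub>R ((\<Sum>i\<in>UNIV. cgrad \<phi> x $ i * partial_deriv i w x) + \<phi> x * (- (complex_of_real k)\<^sup>2 * w x)) \<partial>lborel)"
    by (rule integral_lebesgue_on_eq_lborel[OF borel_measurable_continuous_onI[OF c] borel_\<Omega>])
  also have "\<dots> = (\<integral>x. (\<Sum>i\<in>UNIV. indicator \<Omega> x *\<^sub>R frechet_derivative (?f i) (at x) (axis i 1)) \<partial>lborel)"
  proof (rule Bochner_Integration.integral_cong[OF refl])
    fix x
    have "(\<Sum>i\<in>UNIV. frechet_derivative (?f i) (at x) (axis i 1)) =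
        (\<Sum>i\<in>UNIV. \<phi> x * partial_deriv i (partial_deriv i w) x + partial_deriv i \<phi> x * partial_deriv i w x)"
      by (simp add: frechet_derivative_mult[OF \<phi> w(2)] flip: partial_deriv_def)
    also have "\<dots> = (\<Sum>i\<in>UNIV. cgrad \<phi> x $ i * partial_deriv i w x) + \<phi> x * (- (complex_of_real k)\<^sup>2 * w x)"
      unfolding sum.distrib sum_distrib_left[symmetric] helmholtz by (simp add: cgrad_def add.commute)
    finally show "indicator \<Omega> x *\<^sub>R ((\<Sum>i\<in>UNIV. cgrad \<phi> x $ i * partial_deriv i w x) + \<phi> x * (- (complex_of_real k)\<^sup>2 * w x)) =
        (\<Sum>i\<in>UNIV. indicator \<Omega> x *\<^sub>R frechet_derivative (?f i) (at x) (axis i 1))"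
      by (simp flip: scaleR_sum_right)
  qed
  also have "\<dots> = (\<Sum>i\<in>UNIV. \<integral>x. indicator \<Omega> x *\<^sub>R frechet_derivative (?f i) (at x) (axis i 1) \<partial>lborel)"
    by (rule Bochner_Integration.integral_sum) (rule integrable_on_\<Omega>[OF C1_on_continuous_derivative[OF f]])
  also have "\<dots> = (\<Sum>i\<in>UNIV. LINT x:frontier \<Omega>|\<sigma>. (axis i 1 \<bullet> \<nu> x) *\<^sub>R ?f i x)"
    by (rule sum.cong[OF refl]) (rule divergence_theorem[OF f])
  also have "\<dots> = (\<integral>x. (\<Sum>i\<in>UNIV. indicator (frontier \<Omega>) x *\<^sub>R ((axis i 1 \<bullet> \<nu> x) *\<^sub>R ?f i x)) \<partial>\<sigma>)"
    unfolding set_lebesgue_integral_def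
    by (rule Bochner_Integration.integral_sum[symmetric])
      (use set_integrable_\<sigma>[OF C1_on_continuous[OF f]] in \<open>simp add: set_integrable_def\<close>)
  also have "\<dots> = (\<integral>x. \<phi> x * (indicator (frontier \<Omega>) x *\<^sub>R normal_deriv \<Omega> w x) \<partial>\<sigma>)"
    by (intro Bochner_Integration.integral_cong refl)
      (simp add: normal_deriv_def cdot_def cgrad_def cvec_def inner_axis' scaleR_sum_right sum_distrib_left scaleR_conv_of_real ac_simps)
  finally show ?thesis .
qed

lemma continuous_bounded_on_\<Omega>:
  fixes b :: "real^3 \<Rightarrow> complex"
  assumes "continuous_on UNIV b"
  shows "\<exists>B. (AE x in lebesgue_on \<Omega>. norm (b x) \<le> B) \<and> (\<forall>x\<in>closure \<Omega>. norm (b x) \<le> B)"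
proof -
  have "bounded (b ` closure \<Omega>)"
    by (intro compact_imp_bounded compact_continuous_image compact_closure_\<Omega> continuous_on_subset[OF assms]) auto
  then obtain B where B: "\<forall>x\<in>closure \<Omega>. norm (b x) \<le> B"
    unfolding bounded_iff by auto
  have "AE x in lebesgue_on \<Omega>. norm (b x) \<le> B"
    using B closure_subset[of \<Omega>] by (intro AE_I2) (auto simp: space_restrict_space)
  with B show ?thesis by blast
qed

lemma integrable_\<Omega>_mult:
  fixes f b :: "real^3 \<Rightarrow> complex"
  assumes "integrable (lebesgue_on \<Omega>) f" "continuous_on UNIV b"
  shows "integrable (lebesgue_on \<Omega>) (\<lambda>x. f x * b x)"
  using continuous_bounded_on_\<Omega>[OF assms(2)]
    integrable_mult_bounded[OF assms(1) borel_measurable_lebesgue_on[OF borel_measurable_continuous_onI[OF assms(2)]]]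
  by blast

text \<open>A single sequence from \<open>is_trace\<close> converges to \<open>u\<close>, its
  gradients to the weak gradient and its boundary values to the trace. All three enter linearly
  against bounded functions, so both sides pass to the limit together.\<close>

theorem Green_H1:
  assumes u: "u \<in> H1 \<Omega>" and w: "C1_on UNIV w" "\<And>i. C1_on UNIV (partial_deriv i w)"
    and helmholtz: "\<And>x. (\<Sum>i\<in>UNIV. partial_deriv i (partial_deriv i w) x) = - (complex_of_real k)\<^sup>2 * w x"
  shows "(LINT x|lebesgue_on \<Omega>. (\<Sum>i\<in>UNIV. weak_grad \<Omega> u x $ i * partial_deriv i w x) + u x * (- (complex_of_real k)\<^sup>2 * w x)) =
    (\<integral>x. boundary_trace \<Omega> u x * (indicator (frontier \<Omega>) x *\<^sub>R normal_deriv \<Omega> w x) \<partial>\<sigma>)"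
proof -
  obtain \<phi> where \<phi>: "\<And>n. C1_on UNIV (\<phi> n)" "L2_tendsto (lebesgue_on \<Omega>) \<phi> u"
      "L2_tendsto (lebesgue_on \<Omega>) (\<lambda>n. cgrad (\<phi> n)) (weak_grad \<Omega> u)" "L2_tendsto \<sigma> \<phi> (boundary_trace \<Omega> u)"
    and tr: "L2_fun \<sigma> (boundary_trace \<Omega> u)"
    using is_trace_boundary_trace[OF u] unfolding is_trace_def by blast
  have u2: "L2_fun (lebesgue_on \<Omega>) u" using u by (simp add: H1_def)
  note G = L2_weak_grad[OF u]
  note fin = finite_measure_\<Omega>
  have ui: "integrable (lebesgue_on \<Omega>) u" by (rule integrable_of_L2_finite[OF fin u2])
  have Gi: "integrable (lebesgue_on \<Omega>) (\<lambda>x. weak_grad \<Omega> u x $ i)" for i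
    by (rule integrable_of_L2_finite[OF fin L2_fun_component[OF G]])
  have \<phi>i: "integrable (lebesgue_on \<Omega>) (\<phi> n)" for n
    by (rule integrable_of_L2_finite[OF fin L2_fun_continuous[OF C1_on_continuous[OF \<phi>(1)] borel_\<Omega> bounded_\<Omega>]])
  have gi: "integrable (lebesgue_on \<Omega>) (\<lambda>x. cgrad (\<phi> n) x $ i)" for n i
    by (rule integrable_of_L2_finite[OF fin L2_fun_component[OF L2_fun_continuous[OF cgrad_continuous[OF \<phi>(1)] borel_\<Omega> bounded_\<Omega>]]])
  have wc: "continuous_on UNIV (partial_deriv i w)" "continuous_on UNIV (\<lambda>x. - (complex_of_real k)\<^sup>2 * w x)" for i
    by (intro continuous_intros partial_deriv_continuous[OF w(1)] C1_on_continuous[OF w(1)])+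
  have lim: "(\<lambda>n. LINT x|lebesgue_on \<Omega>. f n x * b x) \<longlonglongrightarrow> (LINT x|lebesgue_on \<Omega>. g x * b x)"
    if "L2_tendsto (lebesgue_on \<Omega>) f g" "\<And>n. integrable (lebesgue_on \<Omega>) (f n)" "integrable (lebesgue_on \<Omega>) g" "continuous_on UNIV b"
    for f g and b :: "real^3 \<Rightarrow> complex"
    using continuous_bounded_on_\<Omega>[OF that(4)]
      L2_tendsto_integral[OF fin that(1-3) borel_measurable_lebesgue_on[OF borel_measurable_continuous_onI[OF that(4)]]]
    by blast
  have split: "(LINT x|lebesgue_on \<Omega>. (\<Sum>i\<in>UNIV. g x $ i * partial_deriv i w x) + f x * (- (complex_of_real k)\<^sup>2 * w x)) =
      (\<Sum>i\<in>UNIV. LINT x|lebesgue_on \<Omega>. g x $ i * partial_deriv i w x) + (LINT x|lebesgue_on \<Omega>. f x * (- (complex_of_real k)\<^sup>2 * w x))"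
    if "\<And>i. integrable (lebesgue_on \<Omega>) (\<lambda>x. g x $ i)" "integrable (lebesgue_on \<Omega>) f" for g :: "real^3 \<Rightarrow> complex^3" and f
  proof -
    have 1: "integrable (lebesgue_on \<Omega>) (\<lambda>x. g x $ i * partial_deriv i w x)" for i
      by (rule integrable_\<Omega>_mult[OF that(1) wc(1)])
    have 2: "integrable (lebesgue_on \<Omega>) (\<lambda>x. f x * (- (complex_of_real k)\<^sup>2 * w x))"
      by (rule integrable_\<Omega>_mult[OF that(2) wc(2)])
    show ?thesis
      by (subst Bochner_Integration.integral_add[OF Bochner_Integration.integrable_sum[OF 1] 2])
        (simp only: Bochner_Integration.integral_sum[OF 1])
  qed
  have "(\<lambda>n. LINT x|lebesgue_on \<Omega>. (\<Sum>i\<in>UNIV. cgrad (\<phi> n) x $ i * partial_deriv i w x) + \<phi> n x * (- (complex_of_real k)\<^sup>2 * w x))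
      \<longlonglongrightarrow> (LINT x|lebesgue_on \<Omega>. (\<Sum>i\<in>UNIV. weak_grad \<Omega> u x $ i * partial_deriv i w x) + u x * (- (complex_of_real k)\<^sup>2 * w x))"
    unfolding split[OF Gi ui] split[OF gi \<phi>i]
    by (intro tendsto_add tendsto_sum lim L2_tendsto_component \<phi> gi Gi \<phi>i ui wc)
  then have 1: "(\<lambda>n. \<integral>x. \<phi> n x * (indicator (frontier \<Omega>) x *\<^sub>R normal_deriv \<Omega> w x) \<partial>\<sigma>)
      \<longlonglongrightarrow> (LINT x|lebesgue_on \<Omega>. (\<Sum>i\<in>UNIV. weak_grad \<Omega> u x $ i * partial_deriv i w x) + u x * (- (complex_of_real k)\<^sup>2 * w x))"
    unfolding Green_C1[OF \<phi>(1) w helmholtz] .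
  have nc: "continuous_on (frontier \<Omega>) (normal_deriv \<Omega> w)"
    unfolding normal_deriv_def[abs_def] cdot_def cvec_def
    by (simp only: vec_lambda_beta)
      (intro continuous_intros continuous_outward_normal continuous_on_subset[OF cgrad_continuous[OF w(1)]] subset_UNIV)
  then have "bounded (normal_deriv \<Omega> w ` frontier \<Omega>)"
    by (intro compact_imp_bounded compact_continuous_image compact_frontier_\<Omega>)
  then obtain B where B: "\<forall>x\<in>frontier \<Omega>. norm (normal_deriv \<Omega> w x) \<le> B"
    unfolding bounded_iff by auto
  have 2: "(\<lambda>n. \<integral>x. \<phi> n x * (indicator (frontier \<Omega>) x *\<^sub>R normal_deriv \<Omega> w x) \<partial>\<sigma>)
      \<longlonglongrightarrow> (\<integral>x. boundary_trace \<Omega> u x * (indicator (frontier \<Omega>) x *\<^sub>R normal_deriv \<Omega> w x) \<partial>\<sigma>)"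
  proof (rule L2_tendsto_integral[OF finite_measure_\<sigma> \<phi>(4)])
    show "integrable \<sigma> (\<phi> n)" for n
      by (rule integrable_\<sigma>[OF C1_on_continuous[OF \<phi>(1)]])
    show "integrable \<sigma> (boundary_trace \<Omega> u)"
      by (rule integrable_of_L2_finite[OF finite_measure_\<sigma> tr])
    show "(\<lambda>x. indicator (frontier \<Omega>) x *\<^sub>R normal_deriv \<Omega> w x) \<in> borel_measurable \<sigma>"
      unfolding borel_measurable_surface_measure
      by (rule borel_measurable_continuous_on_indicator[OF _ nc]) simp
    show "AE x in \<sigma>. norm (indicator (frontier \<Omega>) x *\<^sub>R normal_deriv \<Omega> w x) \<le> B"
      using AE_frontier by eventually_elim (use B in simp)
  qed
  show ?thesis by (rule LIMSEQ_unique[OF 1 2])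
qed

text \<open>The terms with \<open>u\<close> in the pairing are exactly the volume side of Green's
  formula; they cancel against the boundary integral and leave the source term.\<close>

theorem boundary_form_eq:
  assumes u: "u \<in> H1 \<Omega>" and w: "C1_on UNIV w" "\<And>i. C1_on UNIV (partial_deriv i w)"
    and helmholtz: "\<And>x. (\<Sum>i\<in>UNIV. partial_deriv i (partial_deriv i w) x) = - (complex_of_real k)\<^sup>2 * w x"
    and F: "integrable (lebesgue_on \<Omega>) F"
  shows "boundary_form \<Omega> k F u w = (LINT x|lebesgue_on \<Omega>. F x * w x)"
proof -
  let ?P = "\<lambda>x. (\<Sum>i\<in>UNIV. weak_grad \<Omega> u x $ i * partial_deriv i w x) + u x * (- (complex_of_real k)\<^sup>2 * w x)"
  have u2: "L2_fun (lebesgue_on \<Omega>) u" using u by (simp add: H1_def)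
  have wH: "w \<in> H1 \<Omega>" by (rule C1_in_H1[OF w(1) borel_\<Omega> bounded_\<Omega>])
  have wc: "continuous_on UNIV (partial_deriv i w)" "continuous_on UNIV w" for i
    by (intro partial_deriv_continuous[OF w(1)] C1_on_continuous[OF w(1)])+
  have ui: "integrable (lebesgue_on \<Omega>) u" by (rule integrable_of_L2_finite[OF finite_measure_\<Omega> u2])
  have Gi: "integrable (lebesgue_on \<Omega>) (\<lambda>x. weak_grad \<Omega> u x $ i)" for i
    by (rule integrable_of_L2_finite[OF finite_measure_\<Omega> L2_fun_component[OF L2_weak_grad[OF u]]])
  have Pi: "integrable (lebesgue_on \<Omega>) ?P"
    by (intro Bochner_Integration.integrable_add Bochner_Integration.integrable_sum integrable_\<Omega>_mult Gi ui wc continuous_intros)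
  have Fi: "integrable (lebesgue_on \<Omega>) (\<lambda>x. F x * w x)"
    by (rule integrable_\<Omega>_mult[OF F wc(2)])
  let ?L = "\<lambda>x. weak_grad \<Omega> u x \<cdot>\<^sub>c weak_grad \<Omega> w x - (complex_of_real k)\<^sup>2 * u x * w x + F x * w x"
  have meas: "weak_grad \<Omega> u \<in> borel_measurable (lebesgue_on \<Omega>)" "weak_grad \<Omega> w \<in> borel_measurable (lebesgue_on \<Omega>)"
    "u \<in> borel_measurable (lebesgue_on \<Omega>)" "w \<in> borel_measurable (lebesgue_on \<Omega>)"
    using L2_weak_grad[OF u] L2_weak_grad[OF wH] u2 borel_measurable_lebesgue_on[OF borel_measurable_continuous_onI[OF wc(2)]]
    by (simp_all add: L2_fun_def)
  have "normal_deriv_pairing \<Omega> k F u w = (LINT x|lebesgue_on \<Omega>. ?P x + F x * w x)"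
    unfolding normal_deriv_pairing_def
  proof (rule integral_cong_AE)
    show "AE x in lebesgue_on \<Omega>. ?L x = ?P x + F x * w x"
      using weak_grad_C1[OF w(1) open_\<Omega> bounded_\<Omega>]
      by eventually_elim (simp add: cdot_def cgrad_def mult.assoc mult.left_commute)
    show "(\<lambda>x. ?P x + F x * w x) \<in> borel_measurable (lebesgue_on \<Omega>)"
      by (rule borel_measurable_integrable[OF Bochner_Integration.integrable_add[OF Pi Fi]])
    have comp: "(\<lambda>x. g x $ i) \<in> borel_measurable (lebesgue_on \<Omega>)" if "L2_fun (lebesgue_on \<Omega>) g" for g :: "real^3 \<Rightarrow> complex^3" and i
      using L2_fun_component[OF that] by (simp add: L2_fun_def)
    show "?L \<in> borel_measurable (lebesgue_on \<Omega>)"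
      unfolding cdot_def
      by (intro borel_measurable_add borel_measurable_diff borel_measurable_sum borel_measurable_times comp
          L2_weak_grad u wH meas borel_measurable_const borel_measurable_integrable[OF F])
  qed
  also have "\<dots> = (LINT x|lebesgue_on \<Omega>. ?P x) + (LINT x|lebesgue_on \<Omega>. F x * w x)"
    by (rule Bochner_Integration.integral_add[OF Pi Fi])
  also have "(LINT x|lebesgue_on \<Omega>. ?P x) = (\<integral>x. boundary_trace \<Omega> u x * (indicator (frontier \<Omega>) x *\<^sub>R normal_deriv \<Omega> w x) \<partial>\<sigma>)"
    by (rule Green_H1[OF u w helmholtz])
  also have "\<dots> = (LINT x:frontier \<Omega>|\<sigma>. normal_deriv \<Omega> w x * boundary_trace \<Omega> u x)"
    unfolding set_lebesgue_integral_def
    by (intro Bochner_Integration.integral_cong refl) (simp add: mult.commute)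
  finally show ?thesis
    by (simp add: boundary_form_def)
qed

end

section \<open>Exponential solutions of the Helmholtz equation\<close>

text \<open>Both \<open>cgo\<close> and its derivative with respect to the frequency have this form, which partial
  derivatives preserve.\<close>

definition poly_exp :: "complex \<Rightarrow> complex^3 \<Rightarrow> complex^3 \<Rightarrow> real^3 \<Rightarrow> complex" where
  "poly_exp c \<eta> \<zeta> x = (c + cvec x \<cdot>\<^sub>c \<eta>) * exp (cvec x \<cdot>\<^sub>c \<zeta>)"

lemma cdot_simps:
  "(a + b) \<cdot>\<^sub>c z = a \<cdot>\<^sub>c z + b \<cdot>\<^sub>c z" "z \<cdot>\<^sub>c (a + b) = z \<cdot>\<^sub>c a + z \<cdot>\<^sub>c b"
  "(c *s a) \<cdot>\<^sub>c z = c * (a \<cdot>\<^sub>c z)" "z \<cdot>\<^sub>c (c *s a) = c * (z \<cdot>\<^sub>c a)" "z \<cdot>\<^sub>c 0 = 0"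
  by (simp_all add: cdot_def algebra_simps sum.distrib sum_distrib_left)

lemma cdot_cvec: "cvec a \<cdot>\<^sub>c cvec b = complex_of_real (a \<bullet> b)"
  by (simp add: cdot_def cvec_def inner_vec_def)

lemma bounded_linear_cvec_cdot: "bounded_linear (\<lambda>x. cvec x \<cdot>\<^sub>c \<zeta>)"
proof -
  have "linear (\<lambda>x. cvec x \<cdot>\<^sub>c \<zeta>)"
  proof (rule linearI)
    show "cvec (r *\<^sub>R x) \<cdot>\<^sub>c \<zeta> = r *\<^sub>R (cvec x \<cdot>\<^sub>c \<zeta>)" for r x
      unfolding cdot_def cvec_def scaleR_sum_right by (intro sum.cong) (simp_all add: scaleR_conv_of_real[where 'a=complex])
  qed (simp add: cdot_def cvec_def algebra_simps sum.distrib)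
  then show ?thesis by (simp add: linear_conv_bounded_linear)
qed

lemma cvec_axis_cdot: "cvec (axis i 1) \<cdot>\<^sub>c \<zeta> = \<zeta> $ i"
proof -
  have "cvec (axis i 1) \<cdot>\<^sub>c \<zeta> = (\<Sum>j\<in>UNIV. if j = i then \<zeta> $ j else 0)"
    unfolding cdot_def cvec_def by (intro sum.cong) (auto simp: axis_def)
  then show ?thesis by simp
qed

lemma poly_exp_has_derivative:
  "(poly_exp c \<eta> \<zeta> has_derivative
    (\<lambda>h. (c + cvec x \<cdot>\<^sub>c \<eta>) * (exp (cvec x \<cdot>\<^sub>c \<zeta>) * (cvec h \<cdot>\<^sub>c \<zeta>)) + (cvec h \<cdot>\<^sub>c \<eta>) * exp (cvec x \<cdot>\<^sub>c \<zeta>))) (at x)"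
proof -
  note d = bounded_linear_imp_has_derivative[OF bounded_linear_cvec_cdot]
  have e: "((\<lambda>x. exp (cvec x \<cdot>\<^sub>c \<zeta>)) has_derivative (\<lambda>h. exp (cvec x \<cdot>\<^sub>c \<zeta>) * (cvec h \<cdot>\<^sub>c \<zeta>))) (at x)"
    using has_derivative_compose[OF d DERIV_exp[unfolded has_field_derivative_def]] .
  have l: "((\<lambda>x. c + cvec x \<cdot>\<^sub>c \<eta>) has_derivative (\<lambda>h. cvec h \<cdot>\<^sub>c \<eta>)) (at x)"
    using has_derivative_add[OF has_derivative_const[of c] d] by simp
  show ?thesis
    unfolding poly_exp_def[abs_def] by (rule has_derivative_mult[OF l e])
qed

lemma continuous_poly_exp: "continuous_on S (poly_exp c \<eta> \<zeta>)"
  by (intro continuous_at_imp_continuous_on ballI has_derivative_continuous[OF poly_exp_has_derivative])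

lemma C1_poly_exp: "C1_on UNIV (poly_exp c \<eta> \<zeta>)"
proof (rule C1_onI[OF poly_exp_has_derivative])
  show "continuous_on UNIV (\<lambda>x. (c + cvec x \<cdot>\<^sub>c \<eta>) * (exp (cvec x \<cdot>\<^sub>c \<zeta>) * (cvec i \<cdot>\<^sub>c \<zeta>)) + (cvec i \<cdot>\<^sub>c \<eta>) * exp (cvec x \<cdot>\<^sub>c \<zeta>))" for i
    by (intro continuous_intros linear_continuous_on[OF bounded_linear_cvec_cdot])
qed

lemma partial_deriv_poly_exp:
  "partial_deriv i (poly_exp c \<eta> \<zeta>) = poly_exp (\<eta> $ i + c * \<zeta> $ i) (\<zeta> $ i *s \<eta>) \<zeta>"
proof
  fix x
  show "partial_deriv i (poly_exp c \<eta> \<zeta>) x = poly_exp (\<eta> $ i + c * \<zeta> $ i) (\<zeta> $ i *s \<eta>) \<zeta> x"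
    unfolding partial_deriv_def
    by (subst fun_cong[OF frechet_derivative_at[OF poly_exp_has_derivative, symmetric]])
      (simp add: cvec_axis_cdot poly_exp_def cdot_simps algebra_simps)
qed

text \<open>The second derivatives of the product give
  \<open>\<zeta> \<cdot>\<^sub>c \<zeta>\<close> from the exponential and twice
  \<open>\<eta> \<cdot>\<^sub>c \<zeta>\<close> from the cross terms; the affine factor has no
  second derivative.\<close>

lemma poly_exp_Helmholtz:
  assumes "\<zeta> \<cdot>\<^sub>c \<zeta> = - (complex_of_real k)\<^sup>2" "\<eta> \<cdot>\<^sub>c \<zeta> = 0"
  shows "(\<Sum>i\<in>UNIV. partial_deriv i (partial_deriv i (poly_exp c \<eta> \<zeta>)) x) = - (complex_of_real k)\<^sup>2 * poly_exp c \<eta> \<zeta> x"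
proof -
  let ?e = "exp (cvec x \<cdot>\<^sub>c \<zeta>)"
  have "(\<Sum>i\<in>UNIV. partial_deriv i (partial_deriv i (poly_exp c \<eta> \<zeta>)) x) =
      (\<Sum>i\<in>UNIV. 2 * ?e * (\<eta> $ i * \<zeta> $ i) + (c + cvec x \<cdot>\<^sub>c \<eta>) * ?e * (\<zeta> $ i * \<zeta> $ i))"
    by (intro sum.cong refl) (simp add: partial_deriv_poly_exp poly_exp_def cdot_simps algebra_simps)
  also have "\<dots> = 2 * ?e * (\<eta> \<cdot>\<^sub>c \<zeta>) + (c + cvec x \<cdot>\<^sub>c \<eta>) * ?e * (\<zeta> \<cdot>\<^sub>c \<zeta>)"
    unfolding sum.distrib sum_distrib_left[symmetric] by (simp add: cdot_def)
  finally show ?thesis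
    using assms by (simp add: poly_exp_def)
qed

definition cgo_freq :: "real \<Rightarrow> real^3 \<Rightarrow> real^3 \<Rightarrow> real \<Rightarrow> complex^3" where
  "cgo_freq k \<omega> \<theta> \<tau> = complex_of_real \<tau> *s cvec \<omega> + (\<i> * complex_of_real (sqrt (\<tau>\<^sup>2 + k\<^sup>2))) *s cvec \<theta>"

definition cgo_freq_deriv :: "real \<Rightarrow> real^3 \<Rightarrow> real^3 \<Rightarrow> real \<Rightarrow> complex^3" where
  "cgo_freq_deriv k \<omega> \<theta> \<tau> = cvec \<omega> + (\<i> * complex_of_real (\<tau> / sqrt (\<tau>\<^sup>2 + k\<^sup>2))) *s cvec \<theta>"

lemma cgo_eq_poly_exp: "cgo k \<omega> \<theta> \<tau> = poly_exp 1 0 (cgo_freq k \<omega> \<theta> \<tau>)"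
  by (simp add: fun_eq_iff cgo_def poly_exp_def cgo_freq_def cdot_simps)

lemma cgo_deriv_eq_poly_exp: "cgo_deriv k \<omega> \<theta> \<tau> = poly_exp 0 (cgo_freq_deriv k \<omega> \<theta> \<tau>) (cgo_freq k \<omega> \<theta> \<tau>)"
  by (simp add: fun_eq_iff cgo_deriv_def cgo_def poly_exp_def cgo_freq_def cgo_freq_deriv_def)

text \<open>The bilinear square of the frequency vector is constant in \<tau>, and the second
  identity is half its derivative. Positivity of \<tau> keeps the root away from 0 also when
  \<open>k = 0\<close>.\<close>

lemma cgo_freq_cdot:
  assumes "\<omega> \<bullet> \<omega> = 1" "\<theta> \<bullet> \<theta> = 1" "\<omega> \<bullet> \<theta> = 0" "\<tau> > 0"
  shows "cgo_freq k \<omega> \<theta> \<tau> \<cdot>\<^sub>c cgo_freq k \<omega> \<theta> \<tau> = - (complex_of_real k)\<^sup>2"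
    and "cgo_freq_deriv k \<omega> \<theta> \<tau> \<cdot>\<^sub>c cgo_freq k \<omega> \<theta> \<tau> = 0"
proof -
  define s where "s = sqrt (\<tau>\<^sup>2 + k\<^sup>2)"
  have s: "s > 0" "s\<^sup>2 = \<tau>\<^sup>2 + k\<^sup>2"
    using assms(4) by (simp_all add: s_def add_pos_nonneg)
  note c = cdot_simps cdot_cvec inner_commute[of \<theta> \<omega>] assms(1-3)
  have "cgo_freq k \<omega> \<theta> \<tau> \<cdot>\<^sub>c cgo_freq k \<omega> \<theta> \<tau> = complex_of_real (\<tau>\<^sup>2 - s\<^sup>2)"
    unfolding cgo_freq_def s_def[symmetric] by (simp add: c power2_eq_square algebra_simps)
  then show "cgo_freq k \<omega> \<theta> \<tau> \<cdot>\<^sub>c cgo_freq k \<omega> \<theta> \<tau> = - (complex_of_real k)\<^sup>2"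
    using s(2) by simp
  have "cgo_freq_deriv k \<omega> \<theta> \<tau> \<cdot>\<^sub>c cgo_freq k \<omega> \<theta> \<tau> = complex_of_real (\<tau> - \<tau> / s * s)"
    unfolding cgo_freq_def cgo_freq_deriv_def s_def[symmetric] by (simp add: c)
  then show "cgo_freq_deriv k \<omega> \<theta> \<tau> \<cdot>\<^sub>c cgo_freq k \<omega> \<theta> \<tau> = 0"
    using s(1) by simp
qed

lemma cgo_eq_exp:
  "cgo k \<omega> \<theta> \<tau> x = exp (complex_of_real (\<tau> * (x \<bullet> \<omega>)) + \<i> * complex_of_real (sqrt (\<tau>\<^sup>2 + k\<^sup>2) * (x \<bullet> \<theta>)))"
  by (simp add: cgo_def cdot_simps cdot_cvec mult.assoc)

lemma norm_cgo: "norm (cgo k \<omega> \<theta> \<tau> x) = exp (\<tau> * (x \<bullet> \<omega>))"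
  by (simp add: cgo_eq_exp)

lemma continuous_cgo: "continuous_on S (cgo k \<omega> \<theta> \<tau>)"
  unfolding cgo_eq_poly_exp by (rule continuous_poly_exp)

lemma cgo_deriv_eq:
  "cgo_deriv k \<omega> \<theta> \<tau> x = (complex_of_real (x \<bullet> \<omega>) + \<i> * complex_of_real (\<tau> / sqrt (\<tau>\<^sup>2 + k\<^sup>2)) * complex_of_real (x \<bullet> \<theta>)) * cgo k \<omega> \<theta> \<tau> x"
  by (simp add: cgo_deriv_def cdot_simps cdot_cvec)

section \<open>The constant of a cone\<close>

lemma lborel_integral_affine:
  fixes f :: "'a::euclidean_space \<Rightarrow> 'b::{banach,second_countable_topology}"
  assumes [measurable]: "f \<in> borel_measurable borel" and c: "c > 0"
  shows "integral\<^sup>L lborel f = c ^ DIM('a) *\<^sub>R (\<integral>x. f (t + c *\<^sub>R x) \<partial>lborel)"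
    and "integrable lborel f \<longleftrightarrow> integrable lborel (\<lambda>x. f (t + c *\<^sub>R x))"
proof -
  have eq: "lborel = density (distr lborel borel (\<lambda>x :: 'a. t + c *\<^sub>R x)) (\<lambda>_. ennreal (c ^ DIM('a)))"
    using lborel_affine[of c t] c by simp
  have m: "f \<in> borel_measurable (distr lborel borel (\<lambda>x :: 'a. t + c *\<^sub>R x))"
    "(\<lambda>_. c ^ DIM('a)) \<in> borel_measurable (distr lborel borel (\<lambda>x :: 'a. t + c *\<^sub>R x))" by simp_all
  have a: "(\<lambda>x :: 'a. t + c *\<^sub>R x) \<in> measurable lborel borel" by simp
  have "integral\<^sup>L lborel f = integral\<^sup>L (density (distr lborel borel (\<lambda>x :: 'a. t + c *\<^sub>R x)) (\<lambda>_. ennreal (c ^ DIM('a)))) f"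
    using eq by simp
  also have "\<dots> = (\<integral>x. c ^ DIM('a) *\<^sub>R f x \<partial>distr lborel borel (\<lambda>x :: 'a. t + c *\<^sub>R x))"
    by (rule integral_density[OF m]) (use c in simp)
  also have "\<dots> = (\<integral>x. c ^ DIM('a) *\<^sub>R f (t + c *\<^sub>R x) \<partial>lborel)"
    by (rule integral_distr[OF a]) simp
  finally show "integral\<^sup>L lborel f = c ^ DIM('a) *\<^sub>R (\<integral>x. f (t + c *\<^sub>R x) \<partial>lborel)" by simp
  have "integrable lborel f \<longleftrightarrow> integrable (density (distr lborel borel (\<lambda>x :: 'a. t + c *\<^sub>R x)) (\<lambda>_. ennreal (c ^ DIM('a)))) f"
    using eq by simp
  also have "\<dots> \<longleftrightarrow> integrable (distr lborel borel (\<lambda>x :: 'a. t + c *\<^sub>R x)) (\<lambda>x. c ^ DIM('a) *\<^sub>R f x)"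
    by (rule integrable_density[OF m]) (use c in simp)
  also have "\<dots> \<longleftrightarrow> integrable lborel (\<lambda>x. c ^ DIM('a) *\<^sub>R f (t + c *\<^sub>R x))"
    by (rule integrable_distr_eq[OF a]) simp
  also have "\<dots> \<longleftrightarrow> integrable lborel (\<lambda>x. f (t + c *\<^sub>R x))"
  proof
    assume "integrable lborel (\<lambda>x. c ^ DIM('a) *\<^sub>R f (t + c *\<^sub>R x))"
    from integrable_scaleR_right[OF this, of "inverse (c ^ DIM('a))"]
    show "integrable lborel (\<lambda>x. f (t + c *\<^sub>R x))" using c by simp
  qed (rule integrable_scaleR_right)
  finally show "integrable lborel f \<longleftrightarrow> integrable lborel (\<lambda>x. f (t + c *\<^sub>R x))" .
qed

text \<open>The height factor of the integral over a cone, in which \<open>s\<^sup>2\<close> comes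
  from the area of the slice at height \<open>s\<close>.\<close>

lemma integrable_square_exp: "integrable lborel (\<lambda>s :: real. indicator {0<..} s *\<^sub>R (s\<^sup>2 * exp (- s)))"
proof (rule integrableI_nonneg)
  have "(\<integral>\<^sup>+s. ennreal (s\<^sup>2 * exp (- s)) * indicator {0..} s \<partial>lborel) = ennreal (0 - (- (0\<^sup>2 + 2 * 0 + 2) * exp (- 0)))"
  proof (rule nn_integral_FTC_atLeast)
    show "((\<lambda>s :: real. - (s\<^sup>2 + 2 * s + 2) * exp (- s)) has_real_derivative s\<^sup>2 * exp (- s)) (at s)" for s :: real
      by (auto intro!: derivative_eq_intros simp: algebra_simps power2_eq_square)
    show "((\<lambda>s :: real. - (s\<^sup>2 + 2 * s + 2) * exp (- s)) \<longlongrightarrow> 0) at_top"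
      by real_asymp
  qed auto
  then have "(\<integral>\<^sup>+s. ennreal (s\<^sup>2 * exp (- s)) * indicator {0..} s \<partial>lborel) < \<infinity>"
    by simp
  then show "(\<integral>\<^sup>+s. ennreal (indicator {0<..} s *\<^sub>R (s\<^sup>2 * exp (- s))) \<partial>lborel) < \<infinity>"
    by (rule le_less_trans[rotated]) (auto intro!: nn_integral_mono simp: indicator_def)
qed auto

text \<open>The Laplace transform of the square at the point \<open>z\<close> with real part 1.
  Domination by the real integrand reduces the improper integral to bounded intervals.\<close>

lemma integral_square_exp_complex:
  fixes b :: real
  defines "z \<equiv> 1 - \<i> * complex_of_real b"
  shows "(\<integral>s. indicator {0<..} s *\<^sub>R (complex_of_real (s\<^sup>2) * exp (- complex_of_real s * z)) \<partial>lborel) = 2 / z ^ 3"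
proof -
  have z: "z \<noteq> 0" "Re z = 1" by (simp_all add: z_def complex_eq_iff)
  \<comment> \<open>The antiderivative found by two integrations by parts.\<close>
  define F where "F s = - (complex_of_real (s\<^sup>2) / z + 2 * complex_of_real s / z\<^sup>2 + 2 / z ^ 3) * exp (- complex_of_real s * z)" for s :: real
  let ?f = "\<lambda>s :: real. complex_of_real (s\<^sup>2) * exp (- complex_of_real s * z)"
  have ne: "norm (exp (- complex_of_real s * z)) = exp (- s)" for s
    using z(2) by simp
  have nf: "norm (?f s) = s\<^sup>2 * exp (- s)" for s
    unfolding norm_mult ne by (simp add: norm_power)
  have der: "(F has_vector_derivative ?f s) (at s)" for s
  proof -
    have "((\<lambda>w. - (w\<^sup>2 / z + 2 * w / z\<^sup>2 + 2 / z ^ 3) * exp (- w * z)) has_field_derivative w\<^sup>2 * exp (- w * z)) (at w)" for w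
      using z(1) by (auto intro!: derivative_eq_intros simp: field_simps power2_eq_square power3_eq_cube)
    from has_vector_derivative_real_field[OF this] show ?thesis
      unfolding F_def by simp
  qed
  have lim1: "(\<lambda>n. \<integral>s. indicator {0<..real n} s *\<^sub>R ?f s \<partial>lborel) \<longlonglongrightarrow> (\<integral>s. indicator {0<..} s *\<^sub>R ?f s \<partial>lborel)"
  proof (rule integral_dominated_convergence[OF _ _ integrable_square_exp])
    show "AE s in lborel. (\<lambda>n. indicator {0<..real n} s *\<^sub>R ?f s) \<longlonglongrightarrow> indicator {0<..} s *\<^sub>R ?f s"
    proof (intro AE_I2 tendsto_eventually)
      fix s :: real
      show "\<forall>\<^sub>F n in sequentially. indicator {0<..real n} s *\<^sub>R ?f s = indicator {0<..} s *\<^sub>R ?f s"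
        using eventually_ge_at_top[of "nat \<lceil>s\<rceil>"] by eventually_elim (auto simp: indicator_def nat_ceiling_le_eq)
    qed
    show "AE s in lborel. norm (indicator {0<..real n} s *\<^sub>R ?f s) \<le> indicator {0<..} s *\<^sub>R (s\<^sup>2 * exp (- s))" for n
      unfolding norm_scaleR nf by (intro AE_I2) (simp add: indicator_def)
  qed auto
  have "(\<integral>s. indicator {0<..real n} s *\<^sub>R ?f s \<partial>lborel) = F (real n) - F 0" for n
  proof -
    have "(\<integral>s. indicator {0<..real n} s *\<^sub>R ?f s \<partial>lborel) = (\<integral>s. indicator {0..real n} s *\<^sub>R ?f s \<partial>lborel)"
    proof (rule integral_cong_AE)
      show "AE s in lborel. indicator {0<..real n} s *\<^sub>R ?f s = indicator {0..real n} s *\<^sub>R ?f s"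
        using AE_lborel_singleton[of 0] by eventually_elim (auto simp: indicator_def)
    qed auto
    also have "\<dots> = F (real n) - F 0"
      by (rule integral_FTC_atLeastAtMost[OF _ has_vector_derivative_at_within[OF der]]) (auto intro!: continuous_intros)
    finally show ?thesis .
  qed
  with lim1 have lim2: "(\<lambda>n. F (real n) - F 0) \<longlonglongrightarrow> (\<integral>s. indicator {0<..} s *\<^sub>R ?f s \<partial>lborel)" by simp
  have "(\<lambda>n. F (real n)) \<longlonglongrightarrow> 0"
  proof (rule tendsto_norm_zero_cancel, rule tendsto_sandwich[OF _ _ tendsto_const])
    show "\<forall>\<^sub>F n in sequentially. norm (F (real n)) \<le> ((real n)\<^sup>2 * (1 / norm z) + real n * (2 / (norm z)\<^sup>2) + 2 / norm z ^ 3) * exp (- real n)"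
    proof (intro always_eventually allI)
      fix n
      have "norm (complex_of_real ((real n)\<^sup>2) / z + 2 * complex_of_real (real n) / z\<^sup>2 + 2 / z ^ 3) \<le>
          (real n)\<^sup>2 * (1 / norm z) + real n * (2 / (norm z)\<^sup>2) + 2 / norm z ^ 3"
        by (intro order_trans[OF norm_triangle_ineq add_mono[OF order_trans[OF norm_triangle_ineq]]])
          (simp_all add: norm_divide norm_mult norm_power mult.commute[of 2])
      then show "norm (F (real n)) \<le> ((real n)\<^sup>2 * (1 / norm z) + real n * (2 / (norm z)\<^sup>2) + 2 / norm z ^ 3) * exp (- real n)"
        unfolding F_def norm_mult norm_minus_cancel ne by (rule mult_right_mono) simp
    qed
    show "(\<lambda>n. ((real n)\<^sup>2 * (1 / norm z) + real n * (2 / (norm z)\<^sup>2) + 2 / norm z ^ 3) * exp (- real n)) \<longlonglongrightarrow> 0"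
      by real_asymp
  qed auto
  then have "(\<lambda>n. F (real n) - F 0) \<longlonglongrightarrow> 0 - F 0"
    by (intro tendsto_intros)
  with lim2 have "(\<integral>s. indicator {0<..} s *\<^sub>R ?f s \<partial>lborel) = 0 - F 0"
    by (rule LIMSEQ_unique)
  then show ?thesis by (simp add: F_def)
qed

section \<open>Integrals over infinite cones\<close>

context frame
begin

text \<open>The infinite cone with vertex 0 that meets the plane of height 1 in \<open>B\<close>. It
  is invariant under positive scaling, which the substitution in the asymptotics exploits.\<close>

definition cone :: "(real^2) set \<Rightarrow> (real^3) set" where
  "cone B = {x. 0 < snd (\<Psi> x) \<and> fst (\<Psi> x) /\<^sub>R snd (\<Psi> x) \<in> B}"

lemma \<Phi>_in_cone: "\<Phi> (a, s) \<in> cone B \<longleftrightarrow> 0 < s \<and> a /\<^sub>R s \<in> B"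
  by (simp add: cone_def)

lemma scale_in_cone:
  assumes "c > 0"
  shows "c *\<^sub>R x \<in> cone B \<longleftrightarrow> x \<in> cone B"
proof -
  have "(c *\<^sub>R a) /\<^sub>R (c * s) = a /\<^sub>R s" for a :: "real^2" and s
    using assms by (simp add: field_simps)
  then show ?thesis
    unfolding cone_def mem_Collect_eq linear_cmul[OF linear_\<Psi>] fst_scaleR snd_scaleR real_scaleR_def
    using assms by (simp add: zero_less_mult_iff del: scaleR_scaleR)
qed

lemma open_cone:
  assumes "open B"
  shows "open (cone B)"
proof -
  let ?H = "{x. 0 < snd (\<Psi> x)}"
  have H: "open ?H"
    by (intro open_Collect_less continuous_intros continuous_\<Psi>)
  have "continuous_on ?H (\<lambda>x. fst (\<Psi> x) /\<^sub>R snd (\<Psi> x))"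
    by (intro continuous_intros continuous_\<Psi>) auto
  then have "open ((\<lambda>x. fst (\<Psi> x) /\<^sub>R snd (\<Psi> x)) -` B \<inter> ?H)"
    using H assms continuous_on_open_vimage by blast
  moreover have "(\<lambda>x. fst (\<Psi> x) /\<^sub>R snd (\<Psi> x)) -` B \<inter> ?H = cone B"
    by (auto simp: cone_def)
  ultimately show ?thesis by simp
qed

lemma norm_cone_le:
  assumes B: "\<And>b. b \<in> B \<Longrightarrow> norm b \<le> M" and x: "x \<in> cone B"
  shows "norm x \<le> (M + 1) * snd (\<Psi> x)"
proof -
  have s: "snd (\<Psi> x) > 0" and b: "norm (fst (\<Psi> x) /\<^sub>R snd (\<Psi> x)) \<le> M"
    using x B[of "fst (\<Psi> x) /\<^sub>R snd (\<Psi> x)"] by (simp_all add: cone_def)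
  have "norm (fst (\<Psi> x)) \<le> M * snd (\<Psi> x)"
    using b s by (simp add: field_simps)
  moreover have "norm x \<le> norm (fst (\<Psi> x)) + norm (snd (\<Psi> x))"
    using norm_Pair_le[of "fst (\<Psi> x)" "snd (\<Psi> x)"] norm_\<Psi>[of x] by simp
  ultimately show ?thesis
    using s by (simp add: algebra_simps)
qed

text \<open>Slice by height and substitute \<open>a = s *\<^sub>R b\<close>: the area of a slice
  contributes \<open>s\<^sup>2\<close>, and the remaining integral over heights is the Laplace
  transform with \<open>b \<bullet> e\<close> as frequency. Boundedness of \<open>B\<close> makes
  the double integral absolutely convergent.\<close>

lemma
  fixes e :: "real^2"
  assumes B: "open B" "bounded B"
  defines "f \<equiv> \<lambda>x. indicator (cone B) x *\<^sub>R exp (complex_of_real (- snd (\<Psi> x)) + \<i> * complex_of_real (fst (\<Psi> x) \<bullet> e))"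
  shows integrable_cone: "integrable lborel f"
    and integral_cone: "integral\<^sup>L lborel f = (\<integral>b. indicator B b *\<^sub>R (2 / (1 - \<i> * complex_of_real (b \<bullet> e)) ^ 3) \<partial>lborel)"
proof -
  have Bb [measurable]: "B \<in> sets borel" and Cb [measurable]: "cone B \<in> sets borel"
    using B open_cone by auto
  have Bf: "emeasure lborel B < \<infinity>"
    using emeasure_bounded_finite[OF B(2)] by simp
  have "continuous_on UNIV (\<lambda>x. exp (complex_of_real (- snd (\<Psi> x)) + \<i> * complex_of_real (fst (\<Psi> x) \<bullet> e)))"
    by (intro continuous_intros continuous_\<Psi>)
  note [measurable] = borel_measurable_continuous_onI[OF this]
  have fm [measurable]: "f \<in> borel_measurable borel"
    unfolding f_def by measurable
  \<comment> \<open>The integrand after the substitution, Jacobian included; its modulus is a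
    function of \<open>s\<close> times a function of \<open>b\<close>.\<close>
  define \<phi> where "\<phi> s b = (indicator {0<..} s * indicator B b) *\<^sub>R
    (complex_of_real (s\<^sup>2) * exp (- complex_of_real s * (1 - \<i> * complex_of_real (b \<bullet> e))))" for s and b :: "real^2"
  have \<phi>m: "(\<lambda>(s, b). \<phi> s b) \<in> borel_measurable (lborel \<Otimes>\<^sub>M lborel)"
    unfolding \<phi>_def by measurable
  have n\<phi>: "norm (\<phi> s b) = (indicator {0<..} s *\<^sub>R (s\<^sup>2 * exp (- s))) * indicator B b" for s b
    by (simp add: \<phi>_def norm_mult norm_power indicator_def)
  have iB: "integrable lborel (\<lambda>b. indicator B b :: real)"
    using Bf by simp
  have \<phi>i: "integrable lborel (\<lambda>b. \<phi> s b)" for s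
  proof (rule Bochner_Integration.integrable_bound[of _ "\<lambda>b. (indicator {0<..} s *\<^sub>R (s\<^sup>2 * exp (- s))) * indicator B b"])
    show "integrable lborel (\<lambda>b. (indicator {0<..} s *\<^sub>R (s\<^sup>2 * exp (- s))) * indicator B b)"
      using iB by (rule integrable_mult_right)
    show "\<phi> s \<in> borel_measurable lborel"
      unfolding \<phi>_def[abs_def] by measurable
  qed (simp add: n\<phi>)
  have "integrable lborel (\<lambda>s. \<integral>b. norm (\<phi> s b) \<partial>lborel)"
    unfolding n\<phi> using integrable_mult_left[OF integrable_square_exp] by simp
  then have \<phi>int: "integrable (lborel \<Otimes>\<^sub>M lborel) (\<lambda>(s, b). \<phi> s b)"
    by (intro lborel_pair.Fubini_integrable[OF \<phi>m]) (use \<phi>i in simp_all)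
  define F where "F s a = f (\<Phi> (a, s))" for s a
  have Fm: "(\<lambda>(s, a). F s a) \<in> borel_measurable (lborel \<Otimes>\<^sub>M lborel)"
    unfolding F_def by measurable
  have Fs: "F s a = 0" if "\<not> s > 0" for s a
    using that by (simp add: F_def f_def \<Phi>_in_cone)
  have F\<phi>: "(s\<^sup>2) *\<^sub>R F s (s *\<^sub>R b) = \<phi> s b" if "s > 0" for s b
    using that by (simp add: F_def f_def \<Phi>_in_cone \<phi>_def scaleR_conv_of_real[where 'a=complex] algebra_simps indicator_def)
  have Fsm: "F s \<in> borel_measurable borel" for s
    unfolding F_def[abs_def] by measurable
  have Fi: "integrable lborel (F s)" for s
  proof (cases "s > 0")
    case True
    have "integrable lborel (\<lambda>b. F s (s *\<^sub>R b))"
      using integrable_scaleR_right[OF \<phi>i[of s], of "inverse (s\<^sup>2)"] True by (simp flip: F\<phi>)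
    then show ?thesis
      using lborel_integral_affine(2)[OF Fsm True, of s 0] by simp
  next
    case False
    then have "F s = (\<lambda>_. 0)" by (auto simp: Fs)
    then show ?thesis by simp
  qed
  have F\<phi>I: "(\<integral>a. F s a \<partial>lborel) = (\<integral>b. \<phi> s b \<partial>lborel)" for s
  proof (cases "s > 0")
    case True
    then show ?thesis
      using lborel_integral_affine(1)[OF Fsm True, of s 0] by (simp flip: F\<phi>)
  qed (simp add: Fs \<phi>_def)
  have F\<phi>N: "(\<integral>a. norm (F s a) \<partial>lborel) = (\<integral>b. norm (\<phi> s b) \<partial>lborel)" for s
  proof (cases "s > 0")
    case True
    have "(\<lambda>a. norm (F s a)) \<in> borel_measurable borel"
      using Fsm by measurable
    from lborel_integral_affine(1)[OF this True, of 0] True show ?thesis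
      by (simp flip: F\<phi>)
  qed (simp add: Fs \<phi>_def)
  have Fint: "integrable (lborel \<Otimes>\<^sub>M lborel) (\<lambda>(s, a). F s a)"
    by (intro lborel_pair.Fubini_integrable[OF Fm])
      (use Fi \<open>integrable lborel (\<lambda>s. \<integral>b. norm (\<phi> s b) \<partial>lborel)\<close> in \<open>simp_all add: F\<phi>N\<close>)
  have "integrable (lborel \<Otimes>\<^sub>M lborel) (\<lambda>(a, s). F s a)"
    using lborel_pair.integrable_product_swap[OF Fint] by simp
  then have "integrable lborel (\<lambda>z. f (\<Phi> z))"
    by (simp add: F_def lborel_prod split_def)
  then have "integrable (distr lborel borel \<Phi>) f"
    by (subst integrable_distr_eq) simp_all
  then show fi: "integrable lborel f"
    by (simp add: distr_\<Phi>)
  have "integral\<^sup>L lborel f = (\<integral>z. f (\<Phi> z) \<partial>lborel)"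
    by (rule integral_\<Phi>[OF fi])
  also have "\<dots> = (\<integral>s. \<integral>a. F s a \<partial>lborel \<partial>lborel)"
    unfolding F_def by (rule lborel_prod_iterated(2)[OF integrable_\<Phi>[OF fi]])
  also have "\<dots> = (\<integral>s. \<integral>b. \<phi> s b \<partial>lborel \<partial>lborel)"
    by (simp add: F\<phi>I)
  also have "\<dots> = (\<integral>b. \<integral>s. \<phi> s b \<partial>lborel \<partial>lborel)"
    by (rule lborel_pair.Fubini_integral[OF \<phi>int, symmetric])
  also have "\<dots> = (\<integral>b. indicator B b *\<^sub>R (2 / (1 - \<i> * complex_of_real (b \<bullet> e)) ^ 3) \<partial>lborel)"
  proof (intro Bochner_Integration.integral_cong refl)
    fix b :: "real^2"
    have "(\<integral>s. \<phi> s b \<partial>lborel) = (\<integral>s. indicator B b *\<^sub>R (indicator {0<..} s *\<^sub>R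
        (complex_of_real (s\<^sup>2) * exp (- complex_of_real s * (1 - \<i> * complex_of_real (b \<bullet> e))))) \<partial>lborel)"
      by (simp add: \<phi>_def mult.commute)
    also have "\<dots> = indicator B b *\<^sub>R (2 / (1 - \<i> * complex_of_real (b \<bullet> e)) ^ 3)"
      by (simp only: integral_scaleR_right integral_square_exp_complex)
    finally show "(\<integral>s. \<phi> s b \<partial>lborel) = indicator B b *\<^sub>R (2 / (1 - \<i> * complex_of_real (b \<bullet> e)) ^ 3)" .
  qed
  finally show "integral\<^sup>L lborel f = (\<integral>b. indicator B b *\<^sub>R (2 / (1 - \<i> * complex_of_real (b \<bullet> e)) ^ 3) \<partial>lborel)" .
qed

end

section \<open>The cone at the contact point and its constant\<close>

lemma frame_with_vertical_axis:
  assumes "norm \<omega> = 1"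
  obtains T :: "real^3 \<Rightarrow> real^3" where "orthogonal_transformation T" "\<And>x. T x $ 3 = x \<bullet> \<omega>"
proof -
  obtain f :: "real^3 \<Rightarrow> real^3" where f: "orthogonal_transformation f" "f \<omega> = axis 3 1"
    by (rule orthogonal_transformation_exists_1[OF assms, of "axis 3 1"]) simp_all
  have "f x $ 3 = x \<bullet> \<omega>" for x
  proof -
    have "f x $ 3 = f x \<bullet> f \<omega>"
      by (simp add: f(2) inner_axis)
    then show ?thesis
      using f(1) by (simp add: orthogonal_transformation_def)
  qed
  then show thesis by (rule that[OF f(1)])
qed

text \<open>For \<open>y = x - p\<close> the height \<open>snd (\<Psi> y)\<close> is the depth of
  \<open>x\<close> below \<open>p\<close> in direction \<omega>, so the cone opens towards positive
  heights; \<theta>, being orthogonal to \<omega>, is horizontal.\<close>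

locale cone_point = frame T for T +
  fixes p \<omega> \<theta> :: "real^3" and \<delta> :: real and Q :: "(real^3) set"
  assumes snd_\<Psi>: "snd (\<Psi> x) = - (x \<bullet> \<omega>)" and orth: "\<omega> \<bullet> \<theta> = 0" and \<delta>: "\<delta> > 0"
    and Q: "bounded Q" "openin (top_of_set {x. x \<bullet> \<omega> = p \<bullet> \<omega> - \<delta>}) Q"
begin

text \<open>\<open>Q\<close> lies at depth \<delta>; dividing by \<delta> gives the section at depth
  1, in coordinates of the plane.\<close>

definition base :: "(real^2) set" where "base = {b. p + \<delta> *\<^sub>R \<Phi> (b, 1) \<in> Q}"

definition e :: "real^2" where "e = fst (\<Psi> \<theta>)"

definition K :: "(real^3) set" where "K = cone base"

text \<open>The limit of the rescaled indicator for a density equal to 1 at the vertex; it turns out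
  to be the constant of the cone.\<close>

definition cone_limit :: complex where
  "cone_limit = (\<integral>y. indicator K y *\<^sub>R exp (complex_of_real (y \<bullet> \<omega>) + \<i> * complex_of_real (y \<bullet> \<theta>)) \<partial>lborel)"

lemma \<Phi>_inner_\<omega>: "\<Phi> (a, s) \<bullet> \<omega> = - s"
  using snd_\<Psi>[of "\<Phi> (a, s)"] by simp

lemma inner_\<theta>: "x \<bullet> \<theta> = fst (\<Psi> x) \<bullet> e"
  using inner_\<Psi>[of x \<theta>] snd_\<Psi>[of \<theta>] orth by (simp add: inner_prod_def e_def inner_commute)

lemma open_base: "open base"
proof -
  obtain U where U: "open U" "Q = {x. x \<bullet> \<omega> = p \<bullet> \<omega> - \<delta>} \<inter> U"
    using Q(2) by (auto simp: openin_open)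
  have "p + \<delta> *\<^sub>R \<Phi> (b, 1) \<in> Q \<longleftrightarrow> p + \<delta> *\<^sub>R \<Phi> (b, 1) \<in> U" for b
    by (subst U(2)) (simp add: inner_add_left \<Phi>_inner_\<omega>)
  then have "base = (\<lambda>b. p + \<delta> *\<^sub>R \<Phi> (b, 1)) -` U"
    by (simp add: base_def vimage_def)
  moreover have "open ((\<lambda>b. p + \<delta> *\<^sub>R \<Phi> (b, 1)) -` U)"
    by (intro open_vimage U(1) continuous_intros continuous_on_compose2[OF continuous_\<Phi>[of UNIV]]) auto
  ultimately show ?thesis by simp
qed

lemma bounded_base: "bounded base"
proof -
  obtain M where M: "\<And>z. z \<in> Q \<Longrightarrow> norm z \<le> M"
    using Q(1) by (auto simp: bounded_iff)
  have "norm b \<le> (M + norm p) / \<delta>" if "b \<in> base" for b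
  proof -
    have "\<delta> * norm b \<le> \<delta> * norm (\<Phi> (b, 1))"
      using \<delta> norm_fst_le[of b "1 :: real"] by (simp add: norm_\<Phi>)
    also have "\<dots> = norm ((p + \<delta> *\<^sub>R \<Phi> (b, 1)) - p)"
      using \<delta> by simp
    also have "\<dots> \<le> M + norm p"
      using norm_triangle_ineq4[of "p + \<delta> *\<^sub>R \<Phi> (b, 1)" p] M that by (force simp: base_def)
    finally show ?thesis
      using \<delta> by (simp add: field_simps)
  qed
  then show ?thesis by (auto simp: bounded_iff)
qed

lemma open_K: "open K"
  unfolding K_def by (rule open_cone[OF open_base])

lemma K_depth: "x \<in> K \<Longrightarrow> x \<bullet> \<omega> < 0"
  using snd_\<Psi>[of x] by (simp add: K_def cone_def)

text \<open>Boundedness of \<open>Q\<close> bounds the opening of the cone, so depth controls the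
  distance from the vertex, and truncation by depth localizes near \<open>p\<close>.\<close>

lemma norm_K_le:
  obtains L where "L > 0" "\<And>x. x \<in> K \<Longrightarrow> norm x \<le> L * - (x \<bullet> \<omega>)"
proof -
  obtain M where M: "M > 0" "\<And>b. b \<in> base \<Longrightarrow> norm b \<le> M"
    using bounded_base by (auto simp: bounded_pos)
  show thesis
  proof (rule that)
    show "M + 1 > 0" using M by simp
    show "norm x \<le> (M + 1) * - (x \<bullet> \<omega>)" if "x \<in> K" for x
      using norm_cone_le[OF M(2), of base x] that by (simp add: K_def snd_\<Psi>)
  qed
qed

text \<open>With the factor \<open>s / \<delta>\<close> the parameter \<open>s\<close> is the depth
  of the point, so the given finite cone is the infinite cone at \<open>p\<close> cut off at depth
  \<delta>.\<close>

lemma cone_set_eq: "x \<in> cone_set p \<delta> Q \<longleftrightarrow> x - p \<in> K \<and> - ((x - p) \<bullet> \<omega>) < \<delta>"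
proof
  assume "x \<in> cone_set p \<delta> Q"
  then obtain s z where s: "0 < s" "s < \<delta>" and z: "z \<in> Q" and x: "x = p + (s / \<delta>) *\<^sub>R (z - p)"
    by (auto simp: cone_set_def)
  have "z \<bullet> \<omega> = p \<bullet> \<omega> - \<delta>"
    using openin_imp_subset[OF Q(2)] z by auto
  then have "snd (\<Psi> (z - p)) = \<delta>"
    by (simp add: snd_\<Psi> inner_diff_left)
  then have zp: "\<Phi> (fst (\<Psi> (z - p)), \<delta>) = z - p"
    using \<Phi>_\<Psi>[of "z - p"] by (metis prod.collapse)
  have "\<delta> *\<^sub>R \<Phi> (fst (\<Psi> (z - p)) /\<^sub>R \<delta>, 1) = \<Phi> (fst (\<Psi> (z - p)), \<delta>)"
    using \<delta> by (simp flip: \<Phi>_simps)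
  then have "fst (\<Psi> (z - p)) /\<^sub>R \<delta> \<in> base"
    using z by (simp add: base_def zp)
  then have "z - p \<in> K"
    using \<delta> \<Phi>_in_cone[of "fst (\<Psi> (z - p))" \<delta> base] by (simp add: K_def zp)
  then show "x - p \<in> K \<and> - ((x - p) \<bullet> \<omega>) < \<delta>"
    using s \<delta> scale_in_cone[of "s / \<delta>" "z - p" base] \<open>z \<bullet> \<omega> = _\<close> by (simp add: x K_def inner_diff_left)
next
  assume x: "x - p \<in> K \<and> - ((x - p) \<bullet> \<omega>) < \<delta>"
  define s where "s = - ((x - p) \<bullet> \<omega>)"
  have s: "0 < s" "s < \<delta>" "snd (\<Psi> (x - p)) = s"
    using x K_depth[of "x - p"] by (simp_all add: s_def snd_\<Psi>)
  define b where "b = fst (\<Psi> (x - p)) /\<^sub>R s"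
  have "b \<in> base"
    using x s by (simp add: K_def cone_def b_def)
  then have z: "p + \<delta> *\<^sub>R \<Phi> (b, 1) \<in> Q" by (simp add: base_def)
  have "x - p = s *\<^sub>R \<Phi> (b, 1)"
  proof -
    have "\<Psi> (x - p) = (s *\<^sub>R b, s)"
      using s by (simp add: prod_eq_iff b_def)
    then have "x - p = \<Phi> (s *\<^sub>R b, s)"
      using \<Phi>_\<Psi>[of "x - p"] by simp
    then show ?thesis by (simp flip: \<Phi>_simps)
  qed
  then have "x = p + (s / \<delta>) *\<^sub>R ((p + \<delta> *\<^sub>R \<Phi> (b, 1)) - p)"
    using \<delta> by (simp add: algebra_simps)
  with s z show "x \<in> cone_set p \<delta> Q"
    unfolding cone_set_def
    by (intro UN_I[of s] CollectI exI[of _ "p + \<delta> *\<^sub>R \<Phi> (b, 1)"]) simp_all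
qed

lemma
  shows integrable_K: "integrable lborel (\<lambda>y. indicator K y *\<^sub>R exp (y \<bullet> \<omega>))"
    and cone_limit_eq: "cone_limit = (\<integral>b. indicator base b *\<^sub>R (2 / (1 - \<i> * complex_of_real (b \<bullet> e)) ^ 3) \<partial>lborel)"
proof -
  have eq: "complex_of_real (y \<bullet> \<omega>) + \<i> * complex_of_real (y \<bullet> \<theta>) =
      complex_of_real (- snd (\<Psi> y)) + \<i> * complex_of_real (fst (\<Psi> y) \<bullet> e)" for y
    by (simp add: snd_\<Psi> inner_\<theta>)
  have "integrable lborel (\<lambda>y. norm (indicator K y *\<^sub>R exp (complex_of_real (- snd (\<Psi> y)) + \<i> * complex_of_real (fst (\<Psi> y) \<bullet> e))))"
    unfolding K_def by (intro integrable_norm integrable_cone open_base bounded_base)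
  then show "integrable lborel (\<lambda>y. indicator K y *\<^sub>R exp (y \<bullet> \<omega>))"
    by (simp add: snd_\<Psi>)
  show "cone_limit = (\<integral>b. indicator base b *\<^sub>R (2 / (1 - \<i> * complex_of_real (b \<bullet> e)) ^ 3) \<partial>lborel)"
    unfolding cone_limit_def eq unfolding K_def by (rule integral_cone[OF open_base bounded_base])
qed

text \<open>The slice lies in a plane, the graph of a constant with area factor 1. Scaling by
  \<open>s\<close> contributes \<open>s\<^sup>2\<close> from the area and \<open>1 / s ^ 3\<close>
  from the integrand, which the factor \<open>s\<close> in front balances; the factor 2 is the one
  in the Laplace transform.\<close>

lemma cone_slice_integral_eq:
  assumes s: "0 < s" "s < \<delta>"
  shows "cone_slice_integral p \<omega> \<delta> Q \<theta> s = cone_limit"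
proof -
  define c where "c = snd (\<Psi> p) + s"
  interpret graph T "\<lambda>_. c"
    by unfold_locales (rule C1_on_const)
  have area: "area y = 1" for y
    by (simp add: area_def grad\<gamma>_def norm_vec_square sum_2)
  define S where "S = {x. x \<bullet> \<omega> = p \<bullet> \<omega> - s}"
  have S: "x \<in> S \<longleftrightarrow> snd (\<Psi> x) = c" for x
    by (auto simp: S_def c_def snd_\<Psi>)
  define A where "A = cone_set p \<delta> Q \<inter> S"
  have "closed S"
    unfolding S_def by (intro closed_Collect_eq continuous_intros)
  moreover have "open (cone_set p \<delta> Q)"
  proof -
    have "cone_set p \<delta> Q = (\<lambda>x. x - p) -` K \<inter> {x. - ((x - p) \<bullet> \<omega>) < \<delta>}"
      using cone_set_eq by auto
    then show ?thesis
      by (auto intro!: open_Int open_vimage open_K open_Collect_less continuous_intros)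
  qed
  ultimately have Ab [measurable]: "A \<in> sets borel"
    by (auto simp: A_def)
  define q where "q z = (1 / (complex_of_real s - \<i> * complex_of_real ((z - p) \<bullet> \<theta>)) ^ 3)" for z
  define f where "f z = indicator A z *\<^sub>R q z" for z
  have f: "f \<in> borel_measurable borel"
    unfolding f_def q_def by measurable
  have G: "G (fst (\<Psi> p) + s *\<^sub>R b) = p + \<Phi> (s *\<^sub>R b, s)" for b
  proof -
    have "\<Psi> (G (fst (\<Psi> p) + s *\<^sub>R b)) = \<Psi> (p + \<Phi> (s *\<^sub>R b, s))"
      by (simp add: linear_add[OF linear_\<Psi>] prod_eq_iff) (simp add: c_def)
    then show ?thesis by (metis \<Phi>_\<Psi>)
  qed
  have fG: "f (p + \<Phi> (s *\<^sub>R b, s)) = indicator base b *\<^sub>R (1 / (s ^ 3 *\<^sub>R (1 - \<i> * complex_of_real (b \<bullet> e)) ^ 3))" for b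
  proof -
    have "p + \<Phi> (s *\<^sub>R b, s) \<in> A \<longleftrightarrow> b \<in> base"
      using s by (simp add: A_def S_def cone_set_eq \<Phi>_inner_\<omega> K_def \<Phi>_in_cone inner_add_left)
    moreover have "q (p + \<Phi> (s *\<^sub>R b, s)) = 1 / (s ^ 3 *\<^sub>R (1 - \<i> * complex_of_real (b \<bullet> e)) ^ 3)"
    proof -
      have "complex_of_real s - \<i> * complex_of_real ((p + \<Phi> (s *\<^sub>R b, s) - p) \<bullet> \<theta>) = s *\<^sub>R (1 - \<i> * complex_of_real (b \<bullet> e))"
        by (simp add: inner_\<theta> scaleR_conv_of_real[where 'a=complex] algebra_simps)
      then show ?thesis
        by (simp only: q_def scaleR_power)
    qed
    ultimately show ?thesis
      by (simp add: f_def indicator_def)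
  qed
  have fGm: "(\<lambda>y. f (G y)) \<in> borel_measurable borel"
    using f by measurable
  have "(LINT z:A|surface_measure S. q z) = integral\<^sup>L (surface_measure S) f"
    by (simp add: set_lebesgue_integral_def f_def[abs_def])
  also have "\<dots> = (\<integral>y. area y *\<^sub>R f (G y) \<partial>lborel)"
    by (rule integral_surface_measure_graph[of UNIV]) (use S f in simp_all)
  also have "\<dots> = (\<integral>y. f (G y) \<partial>lborel)"
    by (simp add: area)
  also have "\<dots> = s\<^sup>2 *\<^sub>R (\<integral>b. f (G (fst (\<Psi> p) + s *\<^sub>R b)) \<partial>lborel)"
    using lborel_integral_affine(1)[OF fGm s(1), of "fst (\<Psi> p)"] by simp
  finally have "cone_slice_integral p \<omega> \<delta> Q \<theta> s = 2 * complex_of_real s * (s\<^sup>2 *\<^sub>R (\<integral>b. f (G (fst (\<Psi> p) + s *\<^sub>R b)) \<partial>lborel))"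
    by (simp add: cone_slice_integral_def A_def S_def q_def)
  also have "\<dots> = (\<integral>b. (2 * complex_of_real s * complex_of_real (s\<^sup>2)) * f (G (fst (\<Psi> p) + s *\<^sub>R b)) \<partial>lborel)"
    by (simp add: scaleR_conv_of_real[where 'a=complex])
  also have "\<dots> = cone_limit"
    unfolding cone_limit_eq G fG
    using s by (intro Bochner_Integration.integral_cong refl)
      (simp add: indicator_def scaleR_conv_of_real[where 'a=complex] power2_eq_square power3_eq_cube)
  finally show ?thesis .
qed

lemma cone_const_eq: "cone_const p \<omega> \<delta> Q \<theta> = cone_limit"
  unfolding cone_const_def
proof (rule the_equality)
  show "\<forall>s\<in>{0<..<\<delta>}. cone_slice_integral p \<omega> \<delta> Q \<theta> s = cone_limit"
    using cone_slice_integral_eq by simp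
  fix c assume "\<forall>s\<in>{0<..<\<delta>}. cone_slice_integral p \<omega> \<delta> Q \<theta> s = c"
  moreover have "\<delta> / 2 \<in> {0<..<\<delta>}" using \<delta> by simp
  ultimately show "c = cone_limit"
    using cone_slice_integral_eq[of "\<delta> / 2"] \<delta> by auto
qed

end

section \<open>Asymptotics of the indicator functions\<close>

lemma cgo_divide_cgo:
  "cgo k \<omega> \<theta> \<tau> x / cgo k \<omega> \<theta> \<tau> p =
    exp (complex_of_real (\<tau> * ((x - p) \<bullet> \<omega>)) + \<i> * complex_of_real (sqrt (\<tau>\<^sup>2 + k\<^sup>2) * ((x - p) \<bullet> \<theta>)))"
  unfolding cgo_eq_exp exp_diff[symmetric] by (simp add: inner_diff_left algebra_simps)

lemma sqrt_div_tendsto_1: "((\<lambda>\<tau> :: real. sqrt (\<tau>\<^sup>2 + k\<^sup>2) / \<tau>) \<longlongrightarrow> 1) at_top"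
  by real_asymp

text \<open>The density is arbitrary because the result is needed for the source and for the source
  times a linear function. Its value at \<open>p\<close> comes out as a factor since
  \<open>p + (1 / \<tau>) *\<^sub>R y\<close> tends to \<open>p\<close> for fixed
  \<open>y\<close>.\<close>

lemma (in cone_point) cgo_integral_asymptotics:
  fixes g \<rho>' :: "real^3 \<Rightarrow> complex" and D :: "(real^3) set"
  assumes g: "integrable lborel g" "\<And>x. x \<notin> D \<Longrightarrow> g x = 0"
    and D: "\<And>x. x \<in> D \<Longrightarrow> x \<bullet> \<omega> < p \<bullet> \<omega>"
      "D \<inter> {x. p \<bullet> \<omega> - \<delta> < x \<bullet> \<omega> \<and> x \<bullet> \<omega> < p \<bullet> \<omega>} = cone_set p \<delta> Q"
    and \<rho>': "\<eta> > 0" "continuous_on (cball p \<eta>) \<rho>'" "AE x in lborel. x \<in> ball p \<eta> \<inter> D \<longrightarrow> g x = \<rho>' x"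
  shows "((\<lambda>\<tau>. \<tau> ^ 3 *\<^sub>R ((\<integral>x. g x * cgo k \<omega> \<theta> \<tau> x \<partial>lborel) / cgo k \<omega> \<theta> \<tau> p)) \<longlongrightarrow> \<rho>' p * cone_limit) at_top"
proof -
  define v where "v \<tau> y = exp (complex_of_real (\<tau> * (y \<bullet> \<omega>)) + \<i> * complex_of_real (sqrt (\<tau>\<^sup>2 + k\<^sup>2) * (y \<bullet> \<theta>)))"
    for \<tau> and y :: "real^3"
  have nv: "norm (v \<tau> y) = exp (\<tau> * (y \<bullet> \<omega>))" for \<tau> y
    by (simp add: v_def)
  have vm [measurable]: "v \<tau> \<in> borel_measurable borel" for \<tau>
    unfolding v_def[abs_def] by (intro borel_measurable_continuous_onI continuous_intros)
  obtain L where L: "L > 0" "\<And>x. x \<in> K \<Longrightarrow> norm x \<le> L * - (x \<bullet> \<omega>)"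
    by (rule norm_K_le) blast
  \<comment> \<open>A tip of depth \<open>d\<close> lies within the given finite cone and, as
    distance is at most \<open>L\<close> times depth, inside the ball where \<open>\<rho>'\<close>
    represents the density.\<close>
  define d where "d = min \<delta> (\<eta> / L)"
  have d: "d > 0" "d \<le> \<delta>" "d \<le> \<eta> / L"
    using \<delta> \<rho>'(1) L(1) by (auto simp: d_def)
  define N where "N = {x. x - p \<in> K \<and> - ((x - p) \<bullet> \<omega>) < d}"
  have "N = (\<lambda>x. x - p) -` K \<inter> {x. - ((x - p) \<bullet> \<omega>) < d}"
    by (auto simp: N_def)
  then have "open N"
    by (auto intro!: open_Int open_vimage open_K open_Collect_less continuous_intros)
  then have Nb [measurable]: "N \<in> sets borel" by simp
  have ND: "x \<in> ball p \<eta> \<inter> D" if "x \<in> N" for x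
  proof -
    have "x \<in> cone_set p \<delta> Q"
      using that d(2) by (simp add: N_def cone_set_eq)
    moreover have "norm (x - p) \<le> L * - ((x - p) \<bullet> \<omega>)"
      using that L(2) by (simp add: N_def)
    moreover have "L * - ((x - p) \<bullet> \<omega>) < L * d"
      using that L(1) by (intro mult_strict_left_mono) (simp_all add: N_def)
    moreover have "L * d \<le> \<eta>"
      using d(3) L(1) by (simp add: field_simps)
    ultimately show ?thesis
      using D(2) by (auto simp: dist_norm norm_minus_commute)
  qed
  \<comment> \<open>A point of \<open>D\<close> less than \<open>d\<close> below \<open>p\<close>
    belongs to the finite cone by the assumption on \<open>D\<close>, hence to the tip.\<close>
  have far: "(x - p) \<bullet> \<omega> \<le> - d" if "x \<in> D" "x \<notin> N" for x
  proof (rule ccontr)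
    assume *: "\<not> (x - p) \<bullet> \<omega> \<le> - d"
    then have "p \<bullet> \<omega> - \<delta> < x \<bullet> \<omega>"
      using d(2) by (simp add: inner_diff_left)
    then have "x \<in> cone_set p \<delta> Q"
      using that(1) D by blast
    then have "x \<in> N"
      using * by (simp add: N_def cone_set_eq)
    with that(2) show False by simp
  qed
  define f where "f x = indicator N x *\<^sub>R \<rho>' x" for x
  have "continuous_on N \<rho>'"
    using ND by (intro continuous_on_subset[OF \<rho>'(2)]) (force intro: less_imp_le)
  then have fm [measurable]: "f \<in> borel_measurable borel"
    unfolding f_def[abs_def] by (rule borel_measurable_continuous_on_indicator[OF Nb])
  obtain M where M: "M > 0" "\<And>x. x \<in> cball p \<eta> \<Longrightarrow> norm (\<rho>' x) \<le> M"
    using compact_imp_bounded[OF compact_continuous_image[OF \<rho>'(2)]] by (auto simp: bounded_pos)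
  define g1 where "g1 x = indicator (- N) x *\<^sub>R g x" for x
  have g1: "integrable lborel g1"
    unfolding g1_def by (rule integrable_indicator_scaleR[OF g(1)]) simp
  note [measurable] = borel_measurable_integrable[OF g(1)] borel_measurable_integrable[OF g1]
  have gv: "integrable lborel (\<lambda>x. g x * v \<tau> (x - p))" if "\<tau> \<ge> 0" for \<tau>
  proof (rule Bochner_Integration.integrable_bound[OF g(1)])
    show "(\<lambda>x. g x * v \<tau> (x - p)) \<in> borel_measurable lborel"
      by measurable
  next
    show "AE x in lborel. norm (g x * v \<tau> (x - p)) \<le> norm (g x)"
    proof (rule AE_I2)
    fix x
    show "norm (g x * v \<tau> (x - p)) \<le> norm (g x)"
    proof (cases "x \<in> D")
      case True
      then have "\<tau> * ((x - p) \<bullet> \<omega>) \<le> 0"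
        using that D(1)[of x] by (simp add: mult_nonneg_nonpos inner_diff_left)
      then show ?thesis
        unfolding norm_mult nv by (intro mult_left_le) auto
    qed (simp add: g(2))
  qed
  qed
  have g1v_le: "norm (g1 x * v \<tau> (x - p)) \<le> exp (- \<tau> * d) * norm (g x)" if "\<tau> \<ge> 0" for x \<tau>
  proof (cases "x \<in> D - N")
    case True
    then have "\<tau> * ((x - p) \<bullet> \<omega>) \<le> \<tau> * - d"
      using that far[of x] by (intro mult_left_mono) auto
    then show ?thesis
      using True by (simp add: norm_mult nv g1_def mult.commute[of _ "norm (g x)"] mult_left_mono)
  qed (auto simp: g1_def g(2))
  have g1v: "integrable lborel (\<lambda>x. g1 x * v \<tau> (x - p))" if "\<tau> \<ge> 0" for \<tau>
    by (rule Bochner_Integration.integrable_bound[OF integrable_mult_right[OF integrable_norm[OF g(1)], of "exp (- \<tau> * d)"]])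
      (use g1v_le[OF that] in auto)
  have far_lim: "((\<lambda>\<tau>. \<tau> ^ 3 *\<^sub>R (\<integral>x. g1 x * v \<tau> (x - p) \<partial>lborel)) \<longlongrightarrow> 0) at_top"
  proof (rule Lim_null_comparison)
    let ?C = "\<integral>x. norm (g x) \<partial>lborel"
    show "\<forall>\<^sub>F \<tau> in at_top. norm (\<tau> ^ 3 *\<^sub>R (\<integral>x. g1 x * v \<tau> (x - p) \<partial>lborel)) \<le> \<tau> ^ 3 * exp (- \<tau> * d) * ?C"
      using eventually_ge_at_top[of 0]
    proof eventually_elim
      case (elim \<tau>)
      have "norm (\<integral>x. g1 x * v \<tau> (x - p) \<partial>lborel) \<le> (\<integral>x. norm (g1 x * v \<tau> (x - p)) \<partial>lborel)"
        by (rule integral_norm_bound)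
      also have "\<dots> \<le> (\<integral>x. exp (- \<tau> * d) * norm (g x) \<partial>lborel)"
        using g1v[OF elim] g1v_le[OF elim] g(1) by (intro integral_mono) auto
      finally have "norm (\<integral>x. g1 x * v \<tau> (x - p) \<partial>lborel) \<le> exp (- \<tau> * d) * ?C" by simp
      then show ?case
        using elim by (simp add: mult.assoc mult_left_mono)
    qed
    have "((\<lambda>\<tau>. \<tau> ^ 3 * exp (- \<tau> * d)) \<longlongrightarrow> 0) at_top"
      using d(1) by real_asymp
    then show "((\<lambda>\<tau>. \<tau> ^ 3 * exp (- \<tau> * d) * ?C) \<longlongrightarrow> 0) at_top"
      by (rule tendsto_mult_left_zero)
  qed
  have near_eq: "\<tau> ^ 3 *\<^sub>R (\<integral>x. f x * v \<tau> (x - p) \<partial>lborel) =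
      (\<integral>y. f (p + (1 / \<tau>) *\<^sub>R y) * v \<tau> ((1 / \<tau>) *\<^sub>R y) \<partial>lborel)" if "\<tau> > 0" for \<tau>
    using that by (subst lborel_integral_affine(1)[of _ "1 / \<tau>" p]) (simp_all add: power_divide)
  have near_lim: "((\<lambda>\<tau>. \<integral>y. f (p + (1 / \<tau>) *\<^sub>R y) * v \<tau> ((1 / \<tau>) *\<^sub>R y) \<partial>lborel) \<longlongrightarrow>
      (\<integral>y. \<rho>' p * (indicator K y *\<^sub>R exp (complex_of_real (y \<bullet> \<omega>) + \<i> * complex_of_real (y \<bullet> \<theta>))) \<partial>lborel)) at_top"
  \<comment> \<open>The majorant is free of \<tau>: rescaling cancels \<tau> in the real part of the
    exponent, and \<open>y\<close> stays in \<open>K\<close> by scale invariance.\<close>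
  proof (rule integral_dominated_convergence_at_top[where w = "\<lambda>y. M * (indicator K y *\<^sub>R exp (y \<bullet> \<omega>))"])
    have [measurable]: "K \<in> sets borel" using open_K by simp
    show "(\<lambda>y. \<rho>' p * (indicator K y *\<^sub>R exp (complex_of_real (y \<bullet> \<omega>) + \<i> * complex_of_real (y \<bullet> \<theta>)))) \<in> borel_measurable lborel"
      by measurable
    show "(\<lambda>y. f (p + (1 / \<tau>) *\<^sub>R y) * v \<tau> ((1 / \<tau>) *\<^sub>R y)) \<in> borel_measurable lborel" for \<tau>
      by measurable
    show "integrable lborel (\<lambda>y. M * (indicator K y *\<^sub>R exp (y \<bullet> \<omega>)))"
      by (intro integrable_mult_right integrable_K)
    show "\<forall>\<^sub>F \<tau> in at_top. AE y in lborel. norm (f (p + (1 / \<tau>) *\<^sub>R y) * v \<tau> ((1 / \<tau>) *\<^sub>R y)) \<le> M * (indicator K y *\<^sub>R exp (y \<bullet> \<omega>))"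
      using eventually_gt_at_top[of 0]
    proof (eventually_elim, intro AE_I2)
      fix \<tau> :: real and y :: "real^3" assume \<tau>: "0 < \<tau>"
      show "norm (f (p + (1 / \<tau>) *\<^sub>R y) * v \<tau> ((1 / \<tau>) *\<^sub>R y)) \<le> M * (indicator K y *\<^sub>R exp (y \<bullet> \<omega>))"
      proof (cases "p + (1 / \<tau>) *\<^sub>R y \<in> N")
        case True
        then have "y \<in> K"
          using scale_in_cone[of "1 / \<tau>" y base] \<tau> by (simp add: N_def K_def)
        moreover have "norm (\<rho>' (p + (1 / \<tau>) *\<^sub>R y)) \<le> M"
          using ND[OF True] by (intro M) auto
        ultimately show ?thesis
          using True \<tau> by (simp add: f_def norm_mult nv)
      qed (use M(1) in \<open>simp add: f_def\<close>)
    qed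
    show "AE y in lborel. ((\<lambda>\<tau>. f (p + (1 / \<tau>) *\<^sub>R y) * v \<tau> ((1 / \<tau>) *\<^sub>R y)) \<longlongrightarrow>
        \<rho>' p * (indicator K y *\<^sub>R exp (complex_of_real (y \<bullet> \<omega>) + \<i> * complex_of_real (y \<bullet> \<theta>)))) at_top"
    proof (intro AE_I2)
      fix y :: "real^3"
      have t0: "((\<lambda>\<tau> :: real. 1 / \<tau>) \<longlongrightarrow> 0) at_top"
        by real_asymp
      show "((\<lambda>\<tau>. f (p + (1 / \<tau>) *\<^sub>R y) * v \<tau> ((1 / \<tau>) *\<^sub>R y)) \<longlongrightarrow>
        \<rho>' p * (indicator K y *\<^sub>R exp (complex_of_real (y \<bullet> \<omega>) + \<i> * complex_of_real (y \<bullet> \<theta>)))) at_top"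
      proof (cases "y \<in> K")
        case True
        have "continuous (at p) \<rho>'"
          by (rule continuous_on_interior[OF \<rho>'(2)]) (use \<rho>'(1) in simp)
        moreover have "((\<lambda>\<tau>. p + (1 / \<tau>) *\<^sub>R y) \<longlongrightarrow> p + 0 *\<^sub>R y) at_top"
          by (intro tendsto_intros t0)
        ultimately have "((\<lambda>\<tau>. \<rho>' (p + (1 / \<tau>) *\<^sub>R y)) \<longlongrightarrow> \<rho>' p) at_top"
          using isCont_tendsto_compose[of p \<rho>'] by simp
        moreover have "((\<lambda>\<tau>. exp (complex_of_real (y \<bullet> \<omega>) + \<i> * complex_of_real (sqrt (\<tau>\<^sup>2 + k\<^sup>2) / \<tau> * (y \<bullet> \<theta>)))) \<longlongrightarrow>
            exp (complex_of_real (y \<bullet> \<omega>) + \<i> * complex_of_real (1 * (y \<bullet> \<theta>)))) at_top"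
          by (intro tendsto_intros sqrt_div_tendsto_1)
        ultimately have "((\<lambda>\<tau>. \<rho>' (p + (1 / \<tau>) *\<^sub>R y) * exp (complex_of_real (y \<bullet> \<omega>) + \<i> * complex_of_real (sqrt (\<tau>\<^sup>2 + k\<^sup>2) / \<tau> * (y \<bullet> \<theta>)))) \<longlongrightarrow>
            \<rho>' p * exp (complex_of_real (y \<bullet> \<omega>) + \<i> * complex_of_real (1 * (y \<bullet> \<theta>)))) at_top"
          by (rule tendsto_mult)
        moreover have "\<forall>\<^sub>F \<tau> in at_top. \<rho>' (p + (1 / \<tau>) *\<^sub>R y) * exp (complex_of_real (y \<bullet> \<omega>) + \<i> * complex_of_real (sqrt (\<tau>\<^sup>2 + k\<^sup>2) / \<tau> * (y \<bullet> \<theta>))) =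
            f (p + (1 / \<tau>) *\<^sub>R y) * v \<tau> ((1 / \<tau>) *\<^sub>R y)"
          \<comment> \<open>For fixed \<open>y\<close> in the cone, the rescaled point has depth
            below \<open>d\<close>, hence lies in the tip, once \<tau> exceeds this bound.\<close>
          using eventually_gt_at_top[of 0] eventually_gt_at_top[of "- (y \<bullet> \<omega>) / d"]
        proof eventually_elim
          case (elim \<tau>)
          then have "- (y \<bullet> \<omega>) / \<tau> < d"
            using d(1) by (simp add: field_simps)
          moreover have "(1 / \<tau>) *\<^sub>R y \<in> K"
            using scale_in_cone[of "1 / \<tau>" y base] elim True by (simp add: K_def)
          ultimately have "p + (1 / \<tau>) *\<^sub>R y \<in> N"
            by (simp add: N_def)
          then show ?case
            using elim by (simp add: f_def v_def)
        qed
        ultimately show ?thesis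
          using True by (simp add: Lim_transform_eventually)
      next
        case False
        have "\<forall>\<^sub>F \<tau> in at_top. f (p + (1 / \<tau>) *\<^sub>R y) * v \<tau> ((1 / \<tau>) *\<^sub>R y) = 0"
          using eventually_gt_at_top[of 0]
        proof eventually_elim
          case (elim \<tau>)
          then have "p + (1 / \<tau>) *\<^sub>R y \<notin> N"
            using scale_in_cone[of "1 / \<tau>" y base] False by (simp add: N_def K_def)
          then show ?case by (simp add: f_def)
        qed
        then show ?thesis
          using False by (simp add: tendsto_eventually)
      qed
    qed
  qed
  have split: "\<tau> ^ 3 *\<^sub>R ((\<integral>x. g x * cgo k \<omega> \<theta> \<tau> x \<partial>lborel) / cgo k \<omega> \<theta> \<tau> p) =
      (\<integral>y. f (p + (1 / \<tau>) *\<^sub>R y) * v \<tau> ((1 / \<tau>) *\<^sub>R y) \<partial>lborel) + \<tau> ^ 3 *\<^sub>R (\<integral>x. g1 x * v \<tau> (x - p) \<partial>lborel)"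
    if "\<tau> > 0" for \<tau>
  proof -
    have "(\<integral>x. g x * cgo k \<omega> \<theta> \<tau> x \<partial>lborel) / cgo k \<omega> \<theta> \<tau> p = (\<integral>x. g x * cgo k \<omega> \<theta> \<tau> x / cgo k \<omega> \<theta> \<tau> p \<partial>lborel)"
      by simp
    also have "\<dots> = (\<integral>x. (g x * v \<tau> (x - p) - g1 x * v \<tau> (x - p)) + g1 x * v \<tau> (x - p) \<partial>lborel)"
      by (intro Bochner_Integration.integral_cong refl) (simp only: v_def cgo_divide_cgo[symmetric] diff_add_cancel times_divide_eq_right)
    also have "\<dots> = (\<integral>x. g x * v \<tau> (x - p) - g1 x * v \<tau> (x - p) \<partial>lborel) + (\<integral>x. g1 x * v \<tau> (x - p) \<partial>lborel)"
      using gv[of \<tau>] g1v[of \<tau>] that by (intro Bochner_Integration.integral_add Bochner_Integration.integrable_diff) simp_all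
    also have "(\<integral>x. g x * v \<tau> (x - p) - g1 x * v \<tau> (x - p) \<partial>lborel) = (\<integral>x. f x * v \<tau> (x - p) \<partial>lborel)"
    proof (rule integral_cong_AE)
      show "AE x in lborel. g x * v \<tau> (x - p) - g1 x * v \<tau> (x - p) = f x * v \<tau> (x - p)"
        using \<rho>'(3)
      proof eventually_elim
        case (elim x)
        show ?case
          using elim ND[of x] by (cases "x \<in> N") (simp_all add: f_def g1_def)
      qed
    qed measurable
    finally show ?thesis
      by (simp only: scaleR_add_right near_eq[OF that])
  qed
  have "((\<lambda>\<tau>. (\<integral>y. f (p + (1 / \<tau>) *\<^sub>R y) * v \<tau> ((1 / \<tau>) *\<^sub>R y) \<partial>lborel) + \<tau> ^ 3 *\<^sub>R (\<integral>x. g1 x * v \<tau> (x - p) \<partial>lborel)) \<longlongrightarrow>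
      \<rho>' p * cone_limit + 0) at_top"
    using near_lim[unfolded integral_mult_right_zero] by (intro tendsto_add far_lim) (simp only: cone_limit_def)
  moreover have "\<forall>\<^sub>F \<tau> in at_top.
      (\<integral>y. f (p + (1 / \<tau>) *\<^sub>R y) * v \<tau> ((1 / \<tau>) *\<^sub>R y) \<partial>lborel) + \<tau> ^ 3 *\<^sub>R (\<integral>x. g1 x * v \<tau> (x - p) \<partial>lborel) =
      \<tau> ^ 3 *\<^sub>R ((\<integral>x. g x * cgo k \<omega> \<theta> \<tau> x \<partial>lborel) / cgo k \<omega> \<theta> \<tau> p)"
    using eventually_gt_at_top[of 0] by eventually_elim (simp only: split)
  ultimately show ?thesis
    by (simp only: add_0_right Lim_transform_eventually)
qed

section \<open>From the source term to the limit formulas\<close>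

lemma source_representative:
  assumes D: "D \<in> sets borel" "D \<subseteq> \<Omega>" and \<Omega>: "\<Omega> \<in> sets borel"
    and \<rho>: "\<rho> \<in> borel_measurable (lebesgue_on D)" and g: "borel_representative D \<rho> g"
  shows "AE x in lborel. source \<rho> D x = g x"
    and "integrable (lebesgue_on \<Omega>) (source \<rho> D)"
    and "w \<in> borel_measurable borel \<Longrightarrow> (LINT x|lebesgue_on \<Omega>. source \<rho> D x * w x) = (\<integral>x. g x * w x \<partial>lborel)"
proof -
  have D': "D \<inter> space lebesgue \<in> sets lebesgue" and \<Omega>': "\<Omega> \<inter> space lebesgue \<in> sets lebesgue"
    using D \<Omega> by auto
  have g0: "g \<in> borel_measurable borel" "\<And>x. x \<notin> D \<Longrightarrow> g x = 0" "integrable lborel g"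
    and ae: "AE x in lebesgue_on D. \<rho> x = g x"
    using g by (auto simp: borel_representative_def)
  have "AE x in lebesgue. x \<in> D \<longrightarrow> \<rho> x = g x"
    using ae AE_restrict_space_iff[OF D'] by simp
  then have AE: "AE x in lebesgue. source \<rho> D x = g x"
    by eventually_elim (simp add: source_def g0)
  then show "AE x in lborel. source \<rho> D x = g x"
    by (simp add: AE_completion_iff)
  have sm: "source \<rho> D \<in> borel_measurable lebesgue"
    unfolding source_def[abs_def] using \<rho> D by (subst borel_measurable_if) auto
  have gm: "g \<in> borel_measurable lebesgue"
    using g0(1) by (simp add: measurable_completion)
  have "integrable lebesgue g"
    using g0 by (simp add: integrable_completion)
  then have "integrable lebesgue (source \<rho> D)"
    using integrable_cong_AE[OF sm gm AE] by simp
  moreover have "(\<lambda>x. indicator \<Omega> x *\<^sub>R source \<rho> D x) = source \<rho> D"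
    using D(2) by (auto simp: source_def fun_eq_iff indicator_def)
  ultimately show "integrable (lebesgue_on \<Omega>) (source \<rho> D)"
    by (simp add: integrable_restrict_space[OF \<Omega>'])
  assume w: "w \<in> borel_measurable borel"
  then have wm: "w \<in> borel_measurable lebesgue"
    by (simp add: measurable_completion)
  have "(LINT x|lebesgue_on \<Omega>. source \<rho> D x * w x) = (\<integral>x. indicator \<Omega> x *\<^sub>R (source \<rho> D x * w x) \<partial>lebesgue)"
    by (rule integral_restrict_space[OF \<Omega>'])
  also have "\<dots> = (\<integral>x. g x * w x \<partial>lebesgue)"
  proof (rule integral_cong_AE)
    show "AE x in lebesgue. indicator \<Omega> x *\<^sub>R (source \<rho> D x * w x) = g x * w x"
      using AE
    proof eventually_elim
      case (elim x)
      then show ?case using D(2) g0(2)[of x] by (auto simp: indicator_def)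
    qed
  qed (use sm gm wm \<Omega> in \<open>auto intro!: borel_measurable_times borel_measurable_scaleR borel_measurable_indicator\<close>)
  also have "\<dots> = (\<integral>x. g x * w x \<partial>lborel)"
    using g0(1) w by (intro integral_completion) simp
  finally show "(LINT x|lebesgue_on \<Omega>. source \<rho> D x * w x) = (\<integral>x. g x * w x \<partial>lborel)" .
qed

lemma continuous_on_Holder:
  fixes f :: "'a::real_normed_vector \<Rightarrow> 'b::real_normed_vector"
  assumes "\<alpha> > 0" "\<And>x y. x \<in> S \<Longrightarrow> y \<in> S \<Longrightarrow> norm (f x - f y) \<le> C * norm (x - y) powr \<alpha>"
  shows "continuous_on S f"
  unfolding continuous_on_def
proof
  fix x assume x: "x \<in> S"
  have "((\<lambda>y. norm (y - x)) \<longlongrightarrow> 0) (at x within S)"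
    by (intro tendsto_eq_intros) auto
  then have "((\<lambda>y. norm (y - x) powr \<alpha>) \<longlongrightarrow> 0) (at x within S)"
    using assms(1) by (intro tendsto_zero_powrI tendsto_const) auto
  then have "((\<lambda>y. C * norm (y - x) powr \<alpha>) \<longlongrightarrow> 0) (at x within S)"
    by (rule tendsto_mult_right_zero)
  moreover have "\<forall>\<^sub>F y in at x within S. norm (f y - f x) \<le> C * norm (y - x) powr \<alpha>"
    using assms(2) x by (auto simp: eventually_at_filter)
  ultimately have "((\<lambda>y. f y - f x) \<longlongrightarrow> 0) (at x within S)"
    by (rule Lim_null_comparison[rotated])
  then show "(f \<longlongrightarrow> f x) (at x within S)"
    by (rule LIM_zero_cancel)
qed

text \<open>The modulus of \<open>I\<close> behaves like
  \<open>norm L * exp (\<tau> * h) / \<tau> ^ 3\<close>. The power disappears from the logarithm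
  divided by \<tau> and cancels in the quotient, but it decides the case \<open>t = h\<close>, where
  the exponentials cancel.\<close>

lemma limits_of_exponential_asymptotics:
  fixes I I' W :: "real \<Rightarrow> complex" and h :: real
  assumes W: "\<And>\<tau>. cmod (W \<tau>) = exp (\<tau> * h)" and L: "L \<noteq> 0"
    and I: "((\<lambda>\<tau>. \<tau> ^ 3 *\<^sub>R (I \<tau> / W \<tau>)) \<longlongrightarrow> L) at_top"
    and I': "((\<lambda>\<tau>. \<tau> ^ 3 *\<^sub>R (I' \<tau> / W \<tau>)) \<longlongrightarrow> L * c) at_top"
  shows "\<exists>\<tau>0>0. \<forall>\<tau>\<ge>\<tau>0. cmod (I \<tau>) > 0"
    and "((\<lambda>\<tau>. ln (cmod (I \<tau>)) / \<tau>) \<longlongrightarrow> h) at_top"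
    and "((\<lambda>\<tau>. I' \<tau> / I \<tau>) \<longlongrightarrow> c) at_top"
    and "t \<ge> h \<Longrightarrow> ((\<lambda>\<tau>. exp (- \<tau> * t) * cmod (I \<tau>)) \<longlongrightarrow> 0) at_top"
    and "t < h \<Longrightarrow> filterlim (\<lambda>\<tau>. exp (- \<tau> * t) * cmod (I \<tau>)) at_top at_top"
proof -
  define a where "a \<tau> = norm (\<tau> ^ 3 *\<^sub>R (I \<tau> / W \<tau>))" for \<tau>
  have W0: "W \<tau> \<noteq> 0" for \<tau>
    using W[of \<tau>] by auto
  have a: "(a \<longlongrightarrow> norm L) at_top"
    unfolding a_def by (rule tendsto_norm[OF I])
  have Ia: "cmod (I \<tau>) = exp (\<tau> * h) / \<tau> ^ 3 * a \<tau>" if "\<tau> > 0" for \<tau>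
    using that by (simp add: a_def norm_divide W)
  have ev: "\<forall>\<^sub>F \<tau> in at_top. \<tau> > 0 \<and> I \<tau> \<noteq> 0"
    using eventually_gt_at_top[of 0] tendsto_imp_eventually_ne[OF I L]
    by eventually_elim auto
  then obtain N where N: "\<And>\<tau>. \<tau> \<ge> N \<Longrightarrow> \<tau> > 0 \<and> I \<tau> \<noteq> 0"
    by (auto simp: eventually_at_top_linorder)
  show "\<exists>\<tau>0>0. \<forall>\<tau>\<ge>\<tau>0. cmod (I \<tau>) > 0"
    using N by (intro exI[of _ "max N 1"]) auto
  have "((\<lambda>\<tau>. ln (a \<tau>)) \<longlongrightarrow> ln (norm L)) at_top"
    using a L by (intro tendsto_ln) auto
  moreover have "((\<lambda>\<tau> :: real. 1 / \<tau>) \<longlongrightarrow> 0) at_top" "((\<lambda>\<tau> :: real. ln \<tau> / \<tau>) \<longlongrightarrow> 0) at_top"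
    by real_asymp+
  ultimately have "((\<lambda>\<tau>. h - 3 * (ln \<tau> / \<tau>) + ln (a \<tau>) * (1 / \<tau>)) \<longlongrightarrow> h - 3 * 0 + ln (norm L) * 0) at_top"
    by (intro tendsto_add tendsto_diff tendsto_mult tendsto_const)
  then have "((\<lambda>\<tau>. h - 3 * (ln \<tau> / \<tau>) + ln (a \<tau>) * (1 / \<tau>)) \<longlongrightarrow> h) at_top" by simp
  moreover have "\<forall>\<^sub>F \<tau> in at_top. h - 3 * (ln \<tau> / \<tau>) + ln (a \<tau>) * (1 / \<tau>) = ln (cmod (I \<tau>)) / \<tau>"
    using ev
  proof eventually_elim
    case (elim \<tau>)
    then have "a \<tau> > 0" using W0 by (simp add: a_def)
    then have "ln (cmod (I \<tau>)) = \<tau> * h - 3 * ln \<tau> + ln (a \<tau>)"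
      using elim by (simp add: Ia ln_mult ln_div ln_realpow)
    then show ?case
      using elim by (simp add: field_simps)
  qed
  ultimately show "((\<lambda>\<tau>. ln (cmod (I \<tau>)) / \<tau>) \<longlongrightarrow> h) at_top"
    by (rule Lim_transform_eventually)
  have "((\<lambda>\<tau>. \<tau> ^ 3 *\<^sub>R (I' \<tau> / W \<tau>) / (\<tau> ^ 3 *\<^sub>R (I \<tau> / W \<tau>))) \<longlongrightarrow> L * c / L) at_top"
    by (intro tendsto_divide I I' L)
  then have "((\<lambda>\<tau>. \<tau> ^ 3 *\<^sub>R (I' \<tau> / W \<tau>) / (\<tau> ^ 3 *\<^sub>R (I \<tau> / W \<tau>))) \<longlongrightarrow> c) at_top"
    using L by simp
  moreover have "\<forall>\<^sub>F \<tau> in at_top. \<tau> ^ 3 *\<^sub>R (I' \<tau> / W \<tau>) / (\<tau> ^ 3 *\<^sub>R (I \<tau> / W \<tau>)) = I' \<tau> / I \<tau>"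
    using ev by eventually_elim (use W0 in \<open>simp add: scaleR_conv_of_real field_simps\<close>)
  ultimately show "((\<lambda>\<tau>. I' \<tau> / I \<tau>) \<longlongrightarrow> c) at_top"
    by (rule Lim_transform_eventually)
  have eq: "\<forall>\<^sub>F \<tau> in at_top. a \<tau> * (exp (\<tau> * (h - t)) / \<tau> ^ 3) = exp (- \<tau> * t) * cmod (I \<tau>)"
    using eventually_gt_at_top[of 0]
    by eventually_elim (simp add: Ia right_diff_distrib exp_diff exp_minus field_simps)
  show "((\<lambda>\<tau>. exp (- \<tau> * t) * cmod (I \<tau>)) \<longlongrightarrow> 0) at_top" if "t \<ge> h"
  proof -
    have "((\<lambda>\<tau>. exp (\<tau> * (h - t)) / \<tau> ^ 3) \<longlongrightarrow> 0) at_top"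
    proof (cases "t = h")
      case True
      have "((\<lambda>\<tau> :: real. 1 / \<tau> ^ 3) \<longlongrightarrow> 0) at_top" by real_asymp
      then show ?thesis using True by simp
    next
      case False
      then have "h - t < 0" using that by simp
      then show ?thesis by real_asymp
    qed
    from tendsto_mult[OF a this] show ?thesis
      by (intro Lim_transform_eventually[OF _ eq]) simp
  qed
  show "filterlim (\<lambda>\<tau>. exp (- \<tau> * t) * cmod (I \<tau>)) at_top at_top" if "t < h"
  proof -
    have "h - t > 0" using that by simp
    then have "filterlim (\<lambda>\<tau>. exp (\<tau> * (h - t)) / \<tau> ^ 3) at_top at_top"
      by real_asymp
    from filterlim_tendsto_pos_mult_at_top[OF a _ this] L
    have "filterlim (\<lambda>\<tau>. a \<tau> * (exp (\<tau> * (h - t)) / \<tau> ^ 3)) at_top at_top" by simp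
    then show ?thesis
      using filterlim_cong[OF refl refl eq] by simp
  qed
qed


theorem theorem1p2:
  fixes \<Omega> D Q :: "(real^3) set" and k \<delta> :: real
    and \<rho> u :: "real^3 \<Rightarrow> complex" and \<omega> \<theta> :: "real^3"
  defines "h \<equiv> support_fun D \<omega>" and "p \<equiv> contact_point D \<omega>"
    and "I \<equiv> indicator_I \<Omega> k (source \<rho> D) u \<omega> \<theta>"
    and "I' \<equiv> indicator_I' \<Omega> k (source \<rho> D) u \<omega> \<theta>"
  assumes "bounded_C2_domain \<Omega>" and "k \<ge> 0"
    and "open D" and "D \<noteq> {}" and "closure D \<subseteq> \<Omega>"
    and "L2_fun (lebesgue_on D) \<rho>"
    and "weak_solution \<Omega> k (source \<rho> D) u"
    and "\<omega> \<in> sphere 0 1" and "regular_direction D \<omega>"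
    and "conical_singularity D \<omega> \<delta> Q"
    and "active_at \<rho> D p"
    and "\<theta> \<in> orth_dirs \<omega>" and "cone_const p \<omega> \<delta> Q \<theta> \<noteq> 0"
  shows "(\<exists>\<tau>0>0. \<forall>\<tau>\<ge>\<tau>0. cmod (I \<tau>) > 0) \<and>
    ((\<lambda>\<tau>. ln (cmod (I \<tau>)) / \<tau>) \<longlongrightarrow> h) at_top \<and>
    ((\<lambda>\<tau>. I' \<tau> / I \<tau>) \<longlongrightarrow> complex_of_real h + \<i> * complex_of_real (p \<bullet> \<theta>)) at_top \<and>
    (\<forall>t. (t \<ge> h \<longrightarrow> ((\<lambda>\<tau>. exp (- \<tau> * t) * cmod (I \<tau>)) \<longlongrightarrow> 0) at_top) \<and>
         (t < h \<longrightarrow> filterlim (\<lambda>\<tau>. exp (- \<tau> * t) * cmod (I \<tau>)) at_top at_top))"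
proof -
  interpret C2_domain \<Omega> by unfold_locales fact
  have \<omega>: "norm \<omega> = 1" and \<theta>: "norm \<theta> = 1" "\<omega> \<bullet> \<theta> = 0"
    using \<open>\<omega> \<in> sphere 0 1\<close> \<open>\<theta> \<in> orth_dirs \<omega>\<close> by (simp_all add: orth_dirs_def)
  have D: "open D" "D \<subseteq> \<Omega>"
    using \<open>open D\<close> \<open>closure D \<subseteq> \<Omega>\<close> closure_subset[of D] by auto
  have "bounded D"
    by (rule bounded_subset[OF bounded_\<Omega> D(2)])
  obtain R where R: "R > 0" "\<And>x. x \<in> D \<Longrightarrow> norm x \<le> R"
    using \<open>bounded D\<close> by (auto simp: bounded_pos)
  have pc: "p \<in> closure D \<and> p \<bullet> \<omega> = h"
    unfolding p_def h_def contact_point_def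
    by (rule theI') (use \<open>regular_direction D \<omega>\<close> in \<open>simp only: regular_direction_def\<close>)
  then have ph: "p \<bullet> \<omega> = h" by simp
  \<comment> \<open>A point of the open set \<open>D\<close> can be moved a little in direction
    \<omega> within \<open>D\<close>, so the supremum is not attained in \<open>D\<close>.\<close>
  have Dh: "x \<bullet> \<omega> < p \<bullet> \<omega>" if x: "x \<in> D" for x
  proof -
    have "y \<bullet> \<omega> \<le> h" if "y \<in> D" for y
    proof -
      have "y' \<bullet> \<omega> \<le> R" if "y' \<in> D" for y'
        using norm_cauchy_schwarz[of y' \<omega>] \<omega> R(2)[OF that] by simp
      then have "bdd_above ((\<lambda>x. x \<bullet> \<omega>) ` D)" by (auto simp: bdd_above_def)
      then show ?thesis
        unfolding h_def support_fun_def using that by (rule cSUP_upper[rotated])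
    qed
    moreover obtain \<epsilon> where \<epsilon>: "\<epsilon> > 0" "cball x \<epsilon> \<subseteq> D"
      using D(1) x open_contains_cball by blast
    then have "x + \<epsilon> *\<^sub>R \<omega> \<in> D"
      using \<omega> by (auto simp: dist_norm)
    ultimately have "(x + \<epsilon> *\<^sub>R \<omega>) \<bullet> \<omega> \<le> h" by blast
    then show ?thesis
      using \<epsilon>(1) \<omega> ph by (simp add: inner_add_left norm_eq_1)
  qed
  have \<delta>: "\<delta> > 0" "bounded Q" "openin (top_of_set {x. x \<bullet> \<omega> = p \<bullet> \<omega> - \<delta>}) Q"
    and DQ: "D \<inter> {x. p \<bullet> \<omega> - \<delta> < x \<bullet> \<omega> \<and> x \<bullet> \<omega> < p \<bullet> \<omega>} = cone_set p \<delta> Q"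
    using \<open>conical_singularity D \<omega> \<delta> Q\<close>
    unfolding conical_singularity_def h_def[symmetric] p_def[symmetric] ph by blast+
  \<comment> \<open>The sign turns the third coordinate into depth with respect to \<omega>, as
    \<open>cone_point\<close> requires.\<close>
  obtain T :: "real^3 \<Rightarrow> real^3" where T': "orthogonal_transformation T" "\<And>x. T x $ 3 = x \<bullet> (- \<omega>)"
    using frame_with_vertical_axis[of "- \<omega>"] \<omega> by auto
  interpret frame T by unfold_locales (rule T')
  interpret cone_point T p \<omega> \<theta> \<delta> Q
    by unfold_locales (use \<theta> \<delta> in \<open>simp_all add: \<Psi>_def T'(2)\<close>)
  obtain \<eta> \<alpha> C \<rho>' where \<eta>: "\<eta> > 0" "\<alpha> > 0"
    and hold: "\<And>x y. x \<in> cball p \<eta> \<Longrightarrow> y \<in> cball p \<eta> \<Longrightarrow> norm (\<rho>' x - \<rho>' y) \<le> C * norm (x - y) powr \<alpha>"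
    and \<rho>'eq: "AE x in lebesgue. x \<in> ball p \<eta> \<inter> D \<longrightarrow> \<rho> x = \<rho>' x" and \<rho>'p: "\<rho>' p \<noteq> 0"
    using \<open>active_at \<rho> D p\<close> unfolding active_at_def by blast
  have \<rho>'c: "continuous_on (cball p \<eta>) \<rho>'"
    by (rule continuous_on_Holder[OF \<eta>(2) hold])
  obtain g where g: "borel_representative D \<rho> g"
    using borel_representative_exists[of D \<rho>] D \<open>bounded D\<close> \<open>L2_fun (lebesgue_on D) \<rho>\<close> by auto
  have g0: "g \<in> borel_measurable borel" "\<And>x. x \<notin> D \<Longrightarrow> g x = 0" "integrable lborel g"
    using g by (auto simp: borel_representative_def)
  note src = source_representative[OF borel_open[OF D(1)] D(2) borel_\<Omega> _ g]
  have \<rho>m: "\<rho> \<in> borel_measurable (lebesgue_on D)"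
    using \<open>L2_fun (lebesgue_on D) \<rho>\<close> by (simp add: L2_fun_def)
  have g\<rho>': "AE x in lborel. x \<in> ball p \<eta> \<inter> D \<longrightarrow> g x = \<rho>' x"
    using src(1)[OF \<rho>m] \<rho>'eq[unfolded AE_completion_iff] by eventually_elim (auto simp: source_def)
  have uH: "u \<in> H1 \<Omega>"
    using \<open>weak_solution \<Omega> k (source \<rho> D) u\<close> by (simp add: weak_solution_def)
  \<comment> \<open>Stated for general \<open>poly_exp\<close> functions, it covers both the
    exponential and its derivative in \<tau>.\<close>
  have form: "boundary_form \<Omega> k (source \<rho> D) u (poly_exp c \<eta> \<zeta>) = (\<integral>x. g x * poly_exp c \<eta> \<zeta> x \<partial>lborel)"
    if "\<zeta> \<cdot>\<^sub>c \<zeta> = - (complex_of_real k)\<^sup>2" "\<eta> \<cdot>\<^sub>c \<zeta> = 0" for c \<eta> \<zeta>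
  proof -
    have "boundary_form \<Omega> k (source \<rho> D) u (poly_exp c \<eta> \<zeta>) = (LINT x|lebesgue_on \<Omega>. source \<rho> D x * poly_exp c \<eta> \<zeta> x)"
      by (rule boundary_form_eq[OF uH C1_poly_exp _ poly_exp_Helmholtz[OF that] src(2)[OF \<rho>m]])
        (simp add: partial_deriv_poly_exp C1_poly_exp)
    also have "\<dots> = (\<integral>x. g x * poly_exp c \<eta> \<zeta> x \<partial>lborel)"
      by (intro src(3)[OF \<rho>m] borel_measurable_continuous_onI continuous_poly_exp)
    finally show ?thesis .
  qed
  have freq: "cgo_freq k \<omega> \<theta> \<tau> \<cdot>\<^sub>c cgo_freq k \<omega> \<theta> \<tau> = - (complex_of_real k)\<^sup>2"
    "cgo_freq_deriv k \<omega> \<theta> \<tau> \<cdot>\<^sub>c cgo_freq k \<omega> \<theta> \<tau> = 0" if "\<tau> > 0" for \<tau>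
    using cgo_freq_cdot[of \<omega> \<theta> \<tau> k] \<omega> \<theta> that by (simp_all add: norm_eq_1)
  have I: "I \<tau> = (\<integral>x. g x * cgo k \<omega> \<theta> \<tau> x \<partial>lborel)" if "\<tau> > 0" for \<tau>
    unfolding I_def indicator_I_def cgo_eq_poly_exp
    by (rule form) (use freq[OF that] in \<open>simp_all add: cdot_def\<close>)
  have gi: "integrable lborel (\<lambda>x. g x * complex_of_real (x \<bullet> a))" for a
  proof (rule Bochner_Integration.integrable_bound)
    show "integrable lborel (\<lambda>x. R * norm a * norm (g x))"
      using g0(3) by simp
    show "AE x in lborel. norm (g x * complex_of_real (x \<bullet> a)) \<le> norm (R * norm a * norm (g x))"
    proof (intro AE_I2)
      fix x
      show "norm (g x * complex_of_real (x \<bullet> a)) \<le> norm (R * norm a * norm (g x))"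
      proof (cases "x \<in> D")
        case True
        have "\<bar>x \<bullet> a\<bar> \<le> R * norm a"
          using Cauchy_Schwarz_ineq2[of x a] mult_right_mono[OF R(2)[OF True], of "norm a"] by simp
        then show ?thesis
          using R(1) mult_right_mono[of "\<bar>x \<bullet> a\<bar>" "R * norm a" "norm (g x)"] by (simp add: norm_mult mult.commute)
      qed (simp add: g0)
    qed
  qed (use g0 in measurable)
  have giv: "integrable lborel (\<lambda>x. g x * complex_of_real (x \<bullet> a) * cgo k \<omega> \<theta> \<tau> x)" if "\<tau> > 0" for a \<tau>
  proof (rule Bochner_Integration.integrable_bound)
    show "integrable lborel (\<lambda>x. exp (\<tau> * h) * norm (g x * complex_of_real (x \<bullet> a)))"
      using gi by simp
    have "(\<lambda>x. cgo k \<omega> \<theta> \<tau> x) \<in> borel_measurable borel"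
      by (intro borel_measurable_continuous_onI continuous_cgo)
    then show "(\<lambda>x. g x * complex_of_real (x \<bullet> a) * cgo k \<omega> \<theta> \<tau> x) \<in> borel_measurable lborel"
      using g0(1) by simp
    show "AE x in lborel. norm (g x * complex_of_real (x \<bullet> a) * cgo k \<omega> \<theta> \<tau> x) \<le> norm (exp (\<tau> * h) * norm (g x * complex_of_real (x \<bullet> a)))"
    proof (intro AE_I2)
      fix x
      show "norm (g x * complex_of_real (x \<bullet> a) * cgo k \<omega> \<theta> \<tau> x) \<le> norm (exp (\<tau> * h) * norm (g x * complex_of_real (x \<bullet> a)))"
      proof (cases "x \<in> D")
        case True
        then have "exp (\<tau> * (x \<bullet> \<omega>)) \<le> exp (\<tau> * h)"
          using Dh[OF True] that ph by simp
        from mult_left_mono[OF this norm_ge_zero[of "g x * complex_of_real (x \<bullet> a)"]] show ?thesis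
          by (simp add: norm_mult norm_cgo mult_ac)
      qed (simp add: g0)
    qed
  qed
  have I': "I' \<tau> = (\<integral>x. g x * complex_of_real (x \<bullet> \<omega>) * cgo k \<omega> \<theta> \<tau> x \<partial>lborel) +
      \<i> * complex_of_real (\<tau> / sqrt (\<tau>\<^sup>2 + k\<^sup>2)) * (\<integral>x. g x * complex_of_real (x \<bullet> \<theta>) * cgo k \<omega> \<theta> \<tau> x \<partial>lborel)" if "\<tau> > 0" for \<tau>
  proof -
    let ?c = "\<i> * complex_of_real (\<tau> / sqrt (\<tau>\<^sup>2 + k\<^sup>2))"
    have "I' \<tau> = (\<integral>x. g x * cgo_deriv k \<omega> \<theta> \<tau> x \<partial>lborel)"
      unfolding I'_def indicator_I'_def cgo_deriv_eq_poly_exp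
      by (rule form) (use freq[OF that] in simp_all)
    also have "\<dots> = (\<integral>x. g x * complex_of_real (x \<bullet> \<omega>) * cgo k \<omega> \<theta> \<tau> x + ?c * (g x * complex_of_real (x \<bullet> \<theta>) * cgo k \<omega> \<theta> \<tau> x) \<partial>lborel)"
      by (intro Bochner_Integration.integral_cong refl) (simp only: cgo_deriv_eq ring_distribs mult_ac)
    also have "\<dots> = (\<integral>x. g x * complex_of_real (x \<bullet> \<omega>) * cgo k \<omega> \<theta> \<tau> x \<partial>lborel) +
        (\<integral>x. ?c * (g x * complex_of_real (x \<bullet> \<theta>) * cgo k \<omega> \<theta> \<tau> x) \<partial>lborel)"
      by (intro Bochner_Integration.integral_add integrable_mult_right giv that)
    finally show ?thesis by (simp only: integral_mult_right_zero)
  qed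
  let ?c = "complex_of_real h + \<i> * complex_of_real (p \<bullet> \<theta>)"
  \<comment> \<open>The density \<open>g x * (x \<bullet> a)\<close> is represented near
    \<open>p\<close> by \<open>\<rho>' x * (x \<bullet> a)\<close>, whose value at the contact point
    produces the factor \<open>p \<bullet> a\<close>.\<close>
  have lim: "((\<lambda>\<tau>. \<tau> ^ 3 *\<^sub>R ((\<integral>x. g x * complex_of_real (x \<bullet> a) * cgo k \<omega> \<theta> \<tau> x \<partial>lborel) / cgo k \<omega> \<theta> \<tau> p)) \<longlongrightarrow>
      (\<rho>' p * complex_of_real (p \<bullet> a)) * cone_limit) at_top" for a
  proof (rule cgo_integral_asymptotics[OF gi _ _ DQ \<eta>(1)])
    show "continuous_on (cball p \<eta>) (\<lambda>x. \<rho>' x * complex_of_real (x \<bullet> a))"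
      by (intro continuous_intros \<rho>'c)
    show "AE x in lborel. x \<in> ball p \<eta> \<inter> D \<longrightarrow> g x * complex_of_real (x \<bullet> a) = \<rho>' x * complex_of_real (x \<bullet> a)"
      using g\<rho>' by eventually_elim simp
  qed (simp_all add: g0 Dh)
  have limI: "((\<lambda>\<tau>. \<tau> ^ 3 *\<^sub>R (I \<tau> / cgo k \<omega> \<theta> \<tau> p)) \<longlongrightarrow> \<rho>' p * cone_limit) at_top"
  proof (rule Lim_transform_eventually[OF cgo_integral_asymptotics[OF g0(3,2) Dh DQ \<eta>(1) \<rho>'c g\<rho>']])
    show "\<forall>\<^sub>F \<tau> in at_top. \<tau> ^ 3 *\<^sub>R ((\<integral>x. g x * cgo k \<omega> \<theta> \<tau> x \<partial>lborel) / cgo k \<omega> \<theta> \<tau> p) = \<tau> ^ 3 *\<^sub>R (I \<tau> / cgo k \<omega> \<theta> \<tau> p)"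
      using eventually_gt_at_top[of 0] by eventually_elim (simp add: I)
  qed
  have limI': "((\<lambda>\<tau>. \<tau> ^ 3 *\<^sub>R (I' \<tau> / cgo k \<omega> \<theta> \<tau> p)) \<longlongrightarrow> \<rho>' p * cone_limit * ?c) at_top"
  proof -
    let ?J = "\<lambda>a \<tau>. \<tau> ^ 3 *\<^sub>R ((\<integral>x. g x * complex_of_real (x \<bullet> a) * cgo k \<omega> \<theta> \<tau> x \<partial>lborel) / cgo k \<omega> \<theta> \<tau> p)"
    \<comment> \<open>The coefficient of the \<theta>-part in \<open>I'\<close>; because it tends to
      1, the limits for \<open>a = \<omega>\<close> and \<open>a = \<theta>\<close> combine to the
      factor \<open>?c\<close>.\<close>
    have "((\<lambda>\<tau> :: real. \<tau> / sqrt (\<tau>\<^sup>2 + k\<^sup>2)) \<longlongrightarrow> 1) at_top"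
      by real_asymp
    then have "((\<lambda>\<tau>. ?J \<omega> \<tau> + \<i> * complex_of_real (\<tau> / sqrt (\<tau>\<^sup>2 + k\<^sup>2)) * ?J \<theta> \<tau>) \<longlongrightarrow>
        (\<rho>' p * complex_of_real (p \<bullet> \<omega>)) * cone_limit + \<i> * complex_of_real 1 * ((\<rho>' p * complex_of_real (p \<bullet> \<theta>)) * cone_limit)) at_top"
      by (intro tendsto_add tendsto_mult tendsto_const tendsto_of_real lim)
    moreover have "(\<rho>' p * complex_of_real (p \<bullet> \<omega>)) * cone_limit + \<i> * complex_of_real 1 * ((\<rho>' p * complex_of_real (p \<bullet> \<theta>)) * cone_limit) = \<rho>' p * cone_limit * ?c"
      by (simp add: ph algebra_simps)
    moreover have "\<forall>\<^sub>F \<tau> in at_top. ?J \<omega> \<tau> + \<i> * complex_of_real (\<tau> / sqrt (\<tau>\<^sup>2 + k\<^sup>2)) * ?J \<theta> \<tau> = \<tau> ^ 3 *\<^sub>R (I' \<tau> / cgo k \<omega> \<theta> \<tau> p)"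
      using eventually_gt_at_top[of 0] by eventually_elim (simp only: I' add_divide_distrib scaleR_add_right mult_scaleR_right times_divide_eq_right)
    ultimately show ?thesis
      by (simp only: Lim_transform_eventually)
  qed
  \<comment> \<open>Here the nonzero value of the density at \<open>p\<close> and the choice of
    \<theta> enter, as the leading coefficient of both indicator asymptotics.\<close>
  have "\<rho>' p * cone_limit \<noteq> 0"
    using \<rho>'p \<open>cone_const p \<omega> \<delta> Q \<theta> \<noteq> 0\<close> by (simp add: cone_const_eq)
  note conclusions = limits_of_exponential_asymptotics[OF _ this limI limI', of h]
  have "cmod (cgo k \<omega> \<theta> \<tau> p) = exp (\<tau> * h)" for \<tau>
    by (simp add: norm_cgo ph)
  then show ?thesis
    using conclusions by blast
qed

end
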